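(* Let $g',g$ be given by $$g'=\exp\Bigl(\sum_{j=1}^{N}b_j\phi(p_j)\phi(q_j)+\sum_{j=1}^{M}c_j\phi(p'_j)\hat\phi(q'_j)\Bigr),$$ $$g=\exp\Bigl(\sum_{j=1}^{N}b_j\bigl(\psi^{(1)}(p_j)\psi^{(1)\ast}(-q_j)-\psi^{(1)}(q_j)\psi^{(1)\ast}(-p_j)\bigr)+\sum_{j=1}^{M}c_j\bigl(\psi^{(1)}(p'_j)\psi^{(2)\ast}(-q'_j)-\psi^{(2)}(q'_j)\psi^{(1)\ast}(-p'_j)\bigr)\Bigr),$$ whose parameters satisfy, with $A(p)=\prod_{k=2}^{n-1}(1-p/a_k)$, the reduction condition $$p_j^2A(p_j)A(-p_j)=q_j^2A(q_j)A(-q_j),\qquad {p'_j}^2A(p'_j)A(-p'_j)={q'_j}^2\quad\text{for all }j.$$ Let $h'$ be obtained from $g'$ by replacing $b_j,c_j$ with $b'_j=-\frac{q_jA(q_j)}{p_jA(-p_j)}b_j$, $c'_j=-\frac{p'_jA(p'_j)}{q'_j}c_j$. Put $$X_j=F_{1,1}(x^X_j;g)\quad(1\le j\le n-2,\ X=S,W,N,E),$$ $$\tau^J_j=\begin{cases} f_j(x^J_1;g') & j=0,1 \\ F_{1,1}(x^J_j;g) & 2\le j\le n-2 \\ f_{n-j}(x^J_1;h') & j=n-1,n \end{cases}\qquad(J=1,2,3,4),$$ $$\tau^0_j=\begin{cases} F_{0,1}(x^0_1;g)+(-1)^j i\,F_{0,1;1}(x^0_1;g) & j=0,1 \\ F_{1,1}(x^0_{j-1};g)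 & 2\le j\le n-2 \\ F_{0,0}(x^0_{n-2};\omega(g))+\frac{(-1)^{n-j}i\,a_{n-1}}{KL}F_{-1,1;1}(x^0_{n-2};\omega(g)) & j=n-1,n. \end{cases}$$ Then these functions solve the $D^{(1)}_n$ bilinear equations $\langle J,i\rangle$ ($1\le J\le4$, $0\le i\le n$) with (setting $a_1=0$) $$\lambda_i=L-a_i,\ \bar\lambda_i=L+a_i,\ \kappa_i=K-a_i,\ \bar\kappa_i=K+a_i\ (1\le i\le n-1),\quad\lambda_n=\kappa_n=1,\quad\alpha=K-L,\ \beta=K+L.$$
   Context: Fix $n\ge3$. **Bilinear equations.** For parameters $\lambda=(\lambda_1,\dots,\lambda_n,\bar\lambda_{n-1},\dots,\bar\lambda_1)$, $\kappa=(\kappa_1,\dots,\kappa_n,\bar\kappa_{n-1},\dots,\bar\kappa_1)$, $\alpha,\beta$ and variables $S_i,W_i,N_i,E_i$ ($1\le i\le n-2$), $\tau^J_i$ ($0\le J\le4$, $0\le i\le n$) the $D^{(1)}_n$ bilinear equations are: $\langle1,0\rangle$: $\bar\kappa_1N_1\tau^4_1-\bar\lambda_1E_1\tau^2_1=\alpha\tau^0_0\tau^1_0$; $\langle1,1\rangle$: $\kappa_1N_1\tau^4_0-\lambda_1E_1\tau^2_0=\alpha\tau^0_1\tau^1_1$; $\langle1,i\rangle$ ($2\le i\le n-2$): $\kappa_iE_{i-1}N_i-\lambda_iN_{i-1}E_i=\alpha\tau^0_i\tau^1_i$; $\langle1,n-1\rangle$: $\kappa_{n-1}\kappa_nE_{n-2}\tau^2_n-\lambda_{n-1}\lambda_nN_{n-2}\tau^4_n=\alpha\tau^0_{n-1}\tau^1_n$;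 $\langle1,n\rangle$: $\kappa_{n-1}E_{n-2}\tau^2_{n-1}-\lambda_{n-1}N_{n-2}\tau^4_{n-1}=\alpha\tau^0_n\tau^1_{n-1}$; $\langle2,0\rangle$: $\kappa_1N_1\tau^3_1+\bar\lambda_1W_1\tau^1_1=\beta\tau^0_0\tau^2_0$; $\langle2,1\rangle$: $\bar\kappa_1N_1\tau^3_0+\lambda_1W_1\tau^1_0=\beta\tau^0_1\tau^2_1$; $\langle2,i\rangle$ ($2\le i\le n-2$): $\bar\kappa_iW_{i-1}N_i+\lambda_iN_{i-1}W_i=\beta\tau^0_i\tau^2_i$; $\langle2,n-1\rangle$: $\kappa_n\bar\kappa_{n-1}W_{n-2}\tau^1_{n-1}+\lambda_{n-1}N_{n-2}\tau^3_{n-1}=\beta\tau^0_{n-1}\tau^2_{n-1}$; $\langle2,n\rangle$: $\bar\kappa_{n-1}W_{n-2}\tau^1_n+\lambda_{n-1}\lambda_nN_{n-2}\tau^3_n=\beta\tau^0_n\tau^2_n$; $\langle3,0\rangle$: $\kappa_1S_1\tau^2_1-\lambda_1W_1\tau^4_1=\alpha\tau^0_0\tau^3_0$; $\langle3,1\rangle$: $\bar\kappa_1S_1\tau^2_0-\bar\lambda_1W_1\tau^4_0=\alpha\tau^0_1\tau^3_1$; $\langle3,i\rangle$ ($2\le i\le n-2$): $\bar\kappa_iW_{i-1}S_i-\bar\lambda_iS_{i-1}W_i=\alpha\tau^0_i\tau^3_i$; $\langle3,n-1\rangle$: $\bar\kappa_{n-1}W_{n-2}\tau^4_n-\bar\lambda_{n-1}S_{n-2}\tau^2_n=\alpha\tau^0_{n-1}\tau^3_n$;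 $\langle3,n\rangle$: $\kappa_n\bar\kappa_{n-1}W_{n-2}\tau^4_{n-1}-\lambda_n\bar\lambda_{n-1}S_{n-2}\tau^2_{n-1}=\alpha\tau^0_n\tau^3_{n-1}$; $\langle4,0\rangle$: $\bar\kappa_1S_1\tau^1_1+\lambda_1E_1\tau^3_1=\beta\tau^0_0\tau^4_0$; $\langle4,1\rangle$: $\kappa_1S_1\tau^1_0+\bar\lambda_1E_1\tau^3_0=\beta\tau^0_1\tau^4_1$; $\langle4,i\rangle$ ($2\le i\le n-2$): $\kappa_iE_{i-1}S_i+\bar\lambda_iS_{i-1}E_i=\beta\tau^0_i\tau^4_i$; $\langle4,n-1\rangle$: $\kappa_{n-1}E_{n-2}\tau^3_{n-1}+\lambda_n\bar\lambda_{n-1}S_{n-2}\tau^1_{n-1}=\beta\tau^0_{n-1}\tau^4_{n-1}$; $\langle4,n\rangle$: $\kappa_{n-1}\kappa_nE_{n-2}\tau^3_n+\bar\lambda_{n-1}S_{n-2}\tau^1_n=\beta\tau^0_n\tau^4_n$. **Times.** A time is a sequence $x=(x_1,x_2,\dots)$; $\tilde x=(x_1,-x_2,x_3,-x_4,\dots)$; $x$ is odd if $x=\tilde x$. $\xi(x,p)=\sum_{j\ge1}x_jp^j$; $\varepsilon(a)=(a,a^2/2,a^3/3,\dots)$, $\tilde\varepsilon(a)=\widetilde{\varepsilon(a)}=-\varepsilon(-a)$; exponentials are read accordingly, $e^{\xi(\varepsilon(a^{-1}),p)}=(1-p/a)^{-1}$. Let $L,K,a_2,a_3,\dots$ be nonzero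 parameters. Times $x^J$, $J\in\{0,1,2,3,4,N,S,W,E\}$, satisfy: $x^1$ is an arbitrary odd time and $x^W-x^3=x^0-x^S=x^E-x^4=\tilde\varepsilon(L^{-1})$; $x^2-x^W=x^N-x^0=x^1-x^E=\varepsilon(L^{-1})$; $x^N-x^2=x^0-x^W=x^S-x^3=\tilde\varepsilon(K^{-1})$; $x^1-x^N=x^E-x^0=x^4-x^S=\varepsilon(K^{-1})$. Put $x^J_i=x^J+z_i$, $z_1=0$, $z_i=-\sum_{k=2}^i\varepsilon(a_k^{-1})$ ($i\ge2$). **Fermions.** Single component: $\psi_j,\psi_j^\ast$ ($j\in\mathbb Z$), $[\psi_j,\psi^\ast_k]_+=\delta_{jk}$, other anticommutators $0$; vacuum: $\psi_j|\mathrm{vac}\rangle=0$, $\langle\mathrm{vac}|\psi_j^\ast=0$ ($j<0$), $\psi_j^\ast|\mathrm{vac}\rangle=0$, $\langle\mathrm{vac}|\psi_j=0$ ($j\ge0$), $\langle\mathrm{vac}|\mathrm{vac}\rangle=1$. $|l\rangle=\Psi_l|\mathrm{vac}\rangle$, $\langle l|=\langle\mathrm{vac}|\Psi_l^\ast$, where $\Psi_l=\psi_{l-1}\cdots\psi_0$ ($l>0$), $1$ ($l=0$), $\psi^\ast_l\cdots\psi^\ast_{-1}$ ($l<0$), and $\Psi^\ast_l=\psi^\ast_0\cdots\psi^\ast_{l-1}$ ($l>0$), $1$, $\psi_{-1}\cdots\psi_l$ ($l<0$). Neutral fermions: $\phi_j=(\psi_j+(-1)^j\psi^\ast_{-j})/\sqrt2$,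 $\hat\phi_j=i(\psi_j-(-1)^j\psi^\ast_{-j})/\sqrt2$, $\phi(p)=\sum_j\phi_jp^j$, $\hat\phi(p)=\sum_j\hat\phi_jp^j$. For odd $x,y$: $H'(x,y)=\frac12\sum_{l\ \mathrm{odd}\ge1}\sum_{m\in\mathbb Z}(-1)^{m+1}(x_l\phi_m\phi_{-m-l}+y_l\hat\phi_m\hat\phi_{-m-l})$. Two component: $\psi^{(\alpha)}_j,\psi^{(\alpha)\ast}_j$ ($\alpha=1,2$), mutually anticommuting copies with the same vacuum conditions; $\psi^{(\alpha)}(p)=\sum_j\psi^{(\alpha)}_jp^j$, $\psi^{(\alpha)\ast}(p)=\sum_j\psi^{(\alpha)\ast}_jp^{-j}$; $H(x,y)=\sum_{l\ge1}\sum_j(x_l\psi^{(1)}_j\psi^{(1)\ast}_{j+l}+y_l\psi^{(2)}_j\psi^{(2)\ast}_{j+l})$; $\langle l_1,l_2|=\langle\mathrm{vac}|\Psi^{(1)\ast}_{l_1}\Psi^{(2)\ast}_{l_2}$, $|l_2,l_1\rangle=\Psi^{(2)}_{l_2}\Psi^{(1)}_{l_1}|\mathrm{vac}\rangle$. $\omega$ is the automorphism $\psi^{(\alpha)}_j\mapsto\psi^{(\alpha)}_{j-1}$, $\psi^{(\alpha)\ast}_j\mapsto\psi^{(\alpha)\ast}_{j-1}$. **Vacuum expectation values.** With a fixed odd $y$ suppressed in the notation, $f_l(x;g')=\langle l|e^{H'(x,y)}g'|l\rangle$ ($x$ odd), $F_{l_1,l_2;l}(x;g)=\langle l_1,l_2|e^{H(x,y)}g|l_2-l,l_1+l\rangle$,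 $F_{l_1,l_2}=F_{l_1,l_2;0}$. They are evaluated by Wick's theorem, pairings being read as rational functions of the parameters $p_j,q_j,p_j',q_j'$, which are assumed such that all expressions are defined. *)

theory Defs
  imports "HOL-Analysis.Analysis" "HOL-Library.Function_Algebras"
begin

section \<open>The bilinear equations\<close>

definition D1_bilinear ::
  "nat \<Rightarrow> (nat \<Rightarrow> complex) \<Rightarrow> (nat \<Rightarrow> complex) \<Rightarrow> (nat \<Rightarrow> complex) \<Rightarrow> (nat \<Rightarrow> complex) \<Rightarrow>
   complex \<Rightarrow> complex \<Rightarrow>
   (nat \<Rightarrow> complex) \<Rightarrow> (nat \<Rightarrow> complex) \<Rightarrow> (nat \<Rightarrow> complex) \<Rightarrow> (nat \<Rightarrow> complex) \<Rightarrow>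
   (nat \<Rightarrow> nat \<Rightarrow> complex) \<Rightarrow> bool" where
  "D1_bilinear n lam lamb kap kapb \<alpha> \<beta> S W N E \<tau> \<longleftrightarrow>
    kapb 1 * N 1 * \<tau> 4 1 - lamb 1 * E 1 * \<tau> 2 1 = \<alpha> * \<tau> 0 0 * \<tau> 1 0 \<and>
    kap 1 * N 1 * \<tau> 4 0 - lam 1 * E 1 * \<tau> 2 0 = \<alpha> * \<tau> 0 1 * \<tau> 1 1 \<and>
    (\<forall>i\<in>{2..n-2}. kap i * E (i-1) * N i - lam i * N (i-1) * E i = \<alpha> * \<tau> 0 i * \<tau> 1 i) \<and>
    kap (n-1) * kap n * E (n-2) * \<tau> 2 n - lam (n-1) * lam n * N (n-2) * \<tau> 4 n
      = \<alpha> * \<tau> 0 (n-1) * \<tau> 1 n \<and>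
    kap (n-1) * E (n-2) * \<tau> 2 (n-1) - lam (n-1) * N (n-2) * \<tau> 4 (n-1)
      = \<alpha> * \<tau> 0 n * \<tau> 1 (n-1) \<and>

    kap 1 * N 1 * \<tau> 3 1 + lamb 1 * W 1 * \<tau> 1 1 = \<beta> * \<tau> 0 0 * \<tau> 2 0 \<and>
    kapb 1 * N 1 * \<tau> 3 0 + lam 1 * W 1 * \<tau> 1 0 = \<beta> * \<tau> 0 1 * \<tau> 2 1 \<and>
    (\<forall>i\<in>{2..n-2}. kapb i * W (i-1) * N i + lam i * N (i-1) * W i = \<beta> * \<tau> 0 i * \<tau> 2 i) \<and>
    kap n * kapb (n-1) * W (n-2) * \<tau> 1 (n-1) + lam (n-1) * N (n-2) * \<tau> 3 (n-1)
      = \<beta> * \<tau> 0 (n-1) * \<tau> 2 (n-1) \<and>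
    kapb (n-1) * W (n-2) * \<tau> 1 n + lam (n-1) * lam n * N (n-2) * \<tau> 3 n
      = \<beta> * \<tau> 0 n * \<tau> 2 n \<and>

    kap 1 * S 1 * \<tau> 2 1 - lam 1 * W 1 * \<tau> 4 1 = \<alpha> * \<tau> 0 0 * \<tau> 3 0 \<and>
    kapb 1 * S 1 * \<tau> 2 0 - lamb 1 * W 1 * \<tau> 4 0 = \<alpha> * \<tau> 0 1 * \<tau> 3 1 \<and>
    (\<forall>i\<in>{2..n-2}. kapb i * W (i-1) * S i - lamb i * S (i-1) * W i = \<alpha> * \<tau> 0 i * \<tau> 3 i) \<and>
    kapb (n-1) * W (n-2) * \<tau> 4 n - lamb (n-1) * S (n-2) * \<tau> 2 n
      = \<alpha> * \<tau> 0 (n-1) * \<tau> 3 n \<and>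
    kap n * kapb (n-1) * W (n-2) * \<tau> 4 (n-1) - lam n * lamb (n-1) * S (n-2) * \<tau> 2 (n-1)
      = \<alpha> * \<tau> 0 n * \<tau> 3 (n-1) \<and>

    kapb 1 * S 1 * \<tau> 1 1 + lam 1 * E 1 * \<tau> 3 1 = \<beta> * \<tau> 0 0 * \<tau> 4 0 \<and>
    kap 1 * S 1 * \<tau> 1 0 + lamb 1 * E 1 * \<tau> 3 0 = \<beta> * \<tau> 0 1 * \<tau> 4 1 \<and>
    (\<forall>i\<in>{2..n-2}. kap i * E (i-1) * S i + lamb i * S (i-1) * E i = \<beta> * \<tau> 0 i * \<tau> 4 i) \<and>
    kap (n-1) * E (n-2) * \<tau> 3 (n-1) + lam n * lamb (n-1) * S (n-2) * \<tau> 1 (n-1)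
      = \<beta> * \<tau> 0 (n-1) * \<tau> 4 (n-1) \<and>
    kap (n-1) * kap n * E (n-2) * \<tau> 3 n + lamb (n-1) * S (n-2) * \<tau> 1 n
      = \<beta> * \<tau> 0 n * \<tau> 4 n"


section \<open>Times\<close>

text \<open>A time \<open>(x\<^sub>1, x\<^sub>2, \<dots>)\<close> is a function on \<^typ>\<open>nat\<close> whose entry at index 0 plays no role.
  Addition and negation of times are pointwise.\<close>

type_synonym time = "nat \<Rightarrow> complex"

definition tilde :: "time \<Rightarrow> time" where
  "tilde x = (\<lambda>l. (-1) ^ (l + 1) * x l)"

definition odd_time :: "time \<Rightarrow> bool" where
  "odd_time x \<longleftrightarrow> x = tilde x"

definition eps :: "complex \<Rightarrow> time" where
  "eps a = (\<lambda>l. a ^ l / of_nat l)"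

definition teps :: "complex \<Rightarrow> time" where
  "teps a = tilde (eps a)"

lemma teps_altdef: "teps a = - eps (- a)"
  by (auto simp: fun_eq_iff teps_def tilde_def eps_def power_minus')

text \<open>\<open>shifted a x i\<close> is \<open>x + z\<^sub>i\<close> with \<open>z\<^sub>i = - (\<epsilon>(1/a\<^sub>2) + \<dots> + \<epsilon>(1/a\<^sub>i))\<close> and \<open>z\<^sub>1 = 0\<close>.\<close>

definition shifted :: "(nat \<Rightarrow> complex) \<Rightarrow> time \<Rightarrow> nat \<Rightarrow> time" where
  "shifted a x i = x + - (\<Sum>k=2..i. eps (inverse (a k)))"

text \<open>The power series \<open>exp (x\<^sub>1 p + x\<^sub>2 p\<^sup>2 + \<dots>)\<close> in \<open>p\<close>. It is defined at a number \<open>u\<close> if it becomes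
  absolutely convergent at \<open>u\<close> after multiplication by a polynomial not vanishing at \<open>u\<close>.
  This allows ordinary convergence and also times such as \<^term>\<open>eps (inverse a)\<close>, whose exponential is
  \<open>1 / (1 - p/a)\<close> for all \<open>p \<noteq> a\<close>.\<close>

definition exp_xi :: "time \<Rightarrow> complex fps" where
  "exp_xi x = fps_compose (fps_exp 1) (Abs_fps (\<lambda>l. if l = 0 then 0 else x l))"

definition exp_xi_defined :: "time \<Rightarrow> complex \<Rightarrow> bool" where
  "exp_xi_defined x u \<longleftrightarrow>
     (\<exists>D :: complex poly. poly D u \<noteq> 0 \<and>
        summable (\<lambda>m. norm (fps_nth (fps_of_poly D * exp_xi x) m * u ^ m)))"


section \<open>Fermions and Fock space\<close>

text \<open>\<open>Psi c j\<close> and \<open>PsiStar c j\<close> stand for the fermions of component \<open>c\<close>. All components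
  anticommute. Components 1 and 2 form the two-component system; component 0 is the
  single-component system (the two systems are never mixed).\<close>

datatype mode = Psi nat int | PsiStar nat int

text \<open>Fock space as an exterior algebra: the basis is given by the finite sets \<open>D\<close> of modes whose
  occupation differs from that of the vacuum, and a vector is its coefficient function. The sign
  of a basis vector refers to the lexicographic order of the modes.\<close>

type_synonym fock = "(nat \<times> int) set \<Rightarrow> complex"

definition vac :: fock where
  "vac D = (if D = {} then 1 else 0)"

definition mode_less :: "nat \<times> int \<Rightarrow> nat \<times> int \<Rightarrow> bool" where
  "mode_less k m \<longleftrightarrow> fst k < fst m \<or> fst k = fst m \<and> snd k < snd m"

definition mode_sign :: "nat \<times> int \<Rightarrow> (nat \<times> int) set \<Rightarrow> complex" where
  "mode_sign m D = (-1) ^ card {k \<in> D. mode_less k m}"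

definition excite :: "nat \<times> int \<Rightarrow> fock \<Rightarrow> fock" where
  "excite m v D = (if m \<in> D then mode_sign m D * v (D - {m}) else 0)"

definition relax :: "nat \<times> int \<Rightarrow> fock \<Rightarrow> fock" where
  "relax m v D = (if m \<notin> D then mode_sign m D * v (insert m D) else 0)"

fun op :: "mode \<Rightarrow> fock \<Rightarrow> fock" where
  "op (Psi c j) = (if j \<ge> 0 then excite (c, j) else relax (c, j))"
| "op (PsiStar c j) = (if j \<ge> 0 then relax (c, j) else excite (c, j))"

text \<open>The anticommutation relations and the vacuum conditions. The dual vacuum is \<open>v \<mapsto> v {}\<close>.\<close>

fun bracket :: "mode \<Rightarrow> mode \<Rightarrow> complex" where
  "bracket (Psi c j) (PsiStar d k) = (if c = d \<and> j = k then 1 else 0)"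
| "bracket (PsiStar d k) (Psi c j) = (if c = d \<and> j = k then 1 else 0)"
| "bracket _ _ = 0"

lemma mode_less_total: "m \<noteq> k \<Longrightarrow> mode_less k m \<longleftrightarrow> \<not> mode_less m k"
  by (cases m; cases k) (auto simp: mode_less_def)

lemma mode_sign_insert:
  assumes "finite D" "k \<notin> D"
  shows "mode_sign m (insert k D) = (if mode_less k m then - mode_sign m D else mode_sign m D)"
proof (cases "mode_less k m")
  case True
  then have "{l \<in> insert k D. mode_less l m} = insert k {l \<in> D. mode_less l m}"
    by blast
  then show ?thesis
    using True assms by (simp add: mode_sign_def)
next
  case False
  then have "{l \<in> insert k D. mode_less l m} = {l \<in> D. mode_less l m}"
    by blast
  then show ?thesis
    using False by (simp add: mode_sign_def)
qed

lemma mode_sign_remove: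
  assumes "finite D" "k \<in> D"
  shows "mode_sign m (D - {k}) = (if mode_less k m then - mode_sign m D else mode_sign m D)"
  using mode_sign_insert[of "D - {k}" k m] assms by (simp add: insert_absorb)

lemma mode_sign_square: "mode_sign m D * (mode_sign m D * z) = z"
proof -
  have "mode_sign m D * mode_sign m D = 1"
    by (simp add: mode_sign_def flip: power_mult_distrib)
  then show ?thesis
    by (simp flip: mult.assoc)
qed

lemma excite_excite:
  assumes "finite D"
  shows "excite m (excite k v) D + excite k (excite m v) D = 0"
proof (cases "m \<noteq> k \<and> m \<in> D \<and> k \<in> D")
  case True
  then have "D - {m} - {k} = D - {k} - {m}"
    by blast
  then show ?thesis
    using True assms mode_less_total[of m k] by (auto simp: excite_def mode_sign_remove)
qed (auto simp: excite_def)

lemma relax_relax: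
  assumes "finite D"
  shows "relax m (relax k v) D + relax k (relax m v) D = 0"
proof (cases "m \<noteq> k \<and> m \<notin> D \<and> k \<notin> D")
  case True
  then show ?thesis
    using assms mode_less_total[of m k] by (auto simp: relax_def mode_sign_insert insert_commute)
qed (auto simp: relax_def)

lemma excite_relax:
  assumes "finite D"
  shows "excite m (relax k v) D + relax k (excite m v) D = (if m = k then v D else 0)"
proof (cases "m = k")
  case True
  have "\<not> mode_less k k"
    by (simp add: mode_less_def)
  with True show ?thesis
    using assms
    by (cases "k \<in> D")
      (simp_all add: excite_def relax_def mode_sign_insert mode_sign_remove mode_sign_square
        insert_absorb)
next
  case False
  show ?thesis
  proof (cases "m \<in> D \<and> k \<notin> D")
    case True
    then have "insert k (D - {m}) = insert k D - {m}"
      using False by blast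
    then show ?thesis
      using True False assms mode_less_total[of m k]
      by (simp add: excite_def relax_def mode_sign_insert mode_sign_remove)
  qed (use False in \<open>auto simp: excite_def relax_def\<close>)
qed

lemma op_anticommute:
  assumes "finite D"
  shows "op a (op b v) D + op b (op a v) D = bracket a b * v D"
proof -
  have relax_excite: "relax k (excite m v) D + excite m (relax k v) D = (if m = k then v D else 0)"
    for m k
    using excite_relax[OF assms, of m k] by (simp add: add.commute)
  show ?thesis
    using assms
    by (cases a; cases b) (simp_all add: excite_excite relax_relax excite_relax relax_excite)
qed

lemma vac_conditions:
  "j < 0 \<Longrightarrow> op (Psi c j) vac = (\<lambda>_. 0)"
  "j \<ge> 0 \<Longrightarrow> op (PsiStar c j) vac = (\<lambda>_. 0)"
  "j < 0 \<Longrightarrow> op (PsiStar c j) v {} = 0"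
  "j \<ge> 0 \<Longrightarrow> op (Psi c j) v {} = 0"
  "vac {} = 1"
  by (auto simp: fun_eq_iff vac_def excite_def relax_def)

text \<open>Linear combinations of modes are kept as lists so that \<open>omega\<close> can act on the modes.\<close>

type_synonym lin = "(complex \<times> mode) list"

definition lop :: "lin \<Rightarrow> fock \<Rightarrow> fock" where
  "lop A v D = (\<Sum>(z, m)\<leftarrow>A. z * op m v D)"

fun omega_mode :: "mode \<Rightarrow> mode" where
  "omega_mode (Psi c j) = Psi c (j - 1)"
| "omega_mode (PsiStar c j) = PsiStar c (j - 1)"

definition omega_lin :: "lin \<Rightarrow> lin" where
  "omega_lin = map (\<lambda>(z, m). (z, omega_mode m))"

definition phi_mode :: "int \<Rightarrow> lin" where
  "phi_mode j = [(1 / complex_of_real (sqrt 2), Psi 0 j),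
                 ((-1) powi j / complex_of_real (sqrt 2), PsiStar 0 (-j))]"

definition phihat_mode :: "int \<Rightarrow> lin" where
  "phihat_mode j = [(\<i> / complex_of_real (sqrt 2), Psi 0 j),
                    (- \<i> * (-1) powi j / complex_of_real (sqrt 2), PsiStar 0 (-j))]"

text \<open>The lists of factors of \<open>\<Psi>\<^sub>l\<close> and \<open>\<Psi>\<^sub>l\<^sup>*\<close> for component \<open>c\<close>.\<close>

definition Psis :: "nat \<Rightarrow> int \<Rightarrow> mode list" where
  "Psis c l = (if l > 0 then map (Psi c) (rev [0..l-1]) else map (PsiStar c) [l..-1])"

definition PsiStars :: "nat \<Rightarrow> int \<Rightarrow> mode list" where
  "PsiStars c l = (if l > 0 then map (PsiStar c) [0..l-1] else map (Psi c) (rev [l..-1]))"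

text \<open>The infinite sums have only finitely many nonzero terms on vectors of finite support, on
  which both Hamiltonians are locally nilpotent; all vectors below are of this kind.\<close>

definition Ham1 :: "time \<Rightarrow> time \<Rightarrow> fock \<Rightarrow> fock" where
  "Ham1 x y v D = 1/2 * (\<Sum>\<^sub>\<infinity>(l, m)\<in>{l. odd l} \<times> UNIV. (-1) powi (m + 1) *
      (x l * lop (phi_mode m) (lop (phi_mode (- m - int l)) v) D
       + y l * lop (phihat_mode m) (lop (phihat_mode (- m - int l)) v) D))"

definition Ham2 :: "time \<Rightarrow> time \<Rightarrow> fock \<Rightarrow> fock" where
  "Ham2 x y v D = (\<Sum>\<^sub>\<infinity>(l, j)\<in>{1..} \<times> UNIV.
      x l * op (Psi 1 j) (op (PsiStar 1 (j + int l)) v) D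
      + y l * op (Psi 2 j) (op (PsiStar 2 (j + int l)) v) D)"

definition op_exp :: "(fock \<Rightarrow> fock) \<Rightarrow> fock \<Rightarrow> fock" where
  "op_exp H v D = (\<Sum>k. (H ^^ k) v D / fact k)"


section \<open>Rational reading of pairings\<close>

text \<open>A formal Laurent series in two variables, infinite in all directions, is read as a function
  by clearing denominators: if multiplication by a Laurent polynomial \<open>D\<close> with \<open>D(u,v) \<noteq> 0\<close> turns \<open>G\<close>
  into a series which converges absolutely at \<open>(u,v)\<close> to \<open>s\<close>, then \<open>G(u,v) = s / D(u,v)\<close>. This value is
  independent of \<open>D\<close> (lemma \<open>has_reading_unique\<close>).
  For a series expanding a rational function it is the value of that function, inside or outside the
  domain of expansion; for absolutely convergent series it is the sum.\<close>

type_synonym laurent2 = "int \<times> int \<Rightarrow> complex"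

definition lmult :: "laurent2 \<Rightarrow> laurent2 \<Rightarrow> laurent2" where
  "lmult D G = (\<lambda>d. \<Sum>e | D e \<noteq> 0. D e * G (d - e))"

definition lterm :: "laurent2 \<Rightarrow> complex \<Rightarrow> complex \<Rightarrow> int \<times> int \<Rightarrow> complex" where
  "lterm G u v = (\<lambda>(m, n). G (m, n) * u powi m * v powi n)"

definition has_reading :: "laurent2 \<Rightarrow> complex \<Rightarrow> complex \<Rightarrow> complex \<Rightarrow> bool" where
  "has_reading G u v r \<longleftrightarrow>
     (\<exists>D. finite {d. D d \<noteq> 0} \<and> infsum (lterm D u v) UNIV \<noteq> 0 \<and>
        (\<lambda>d. norm (lterm (lmult D G) u v d)) summable_on UNIV \<and>
        r = infsum (lterm (lmult D G) u v) UNIV / infsum (lterm D u v) UNIV)"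

lemma lmult_commute:
  "lmult D (lmult D' G) = lmult D' (lmult D G)"
proof
  fix d
  have "lmult D (lmult D' G) d =
      (\<Sum>e | D e \<noteq> 0. \<Sum>e' | D' e' \<noteq> 0. D e * (D' e' * G (d - e - e')))"
    by (simp add: lmult_def sum_distrib_left)
  also have "\<dots> = (\<Sum>e' | D' e' \<noteq> 0. \<Sum>e | D e \<noteq> 0. D e * (D' e' * G (d - e - e')))"
    by (rule sum.swap)
  also have "\<dots> = lmult D' (lmult D G) d"
    by (simp add: lmult_def sum_distrib_left mult.left_commute diff_diff_eq add.commute)
  finally show "lmult D (lmult D' G) d = lmult D' (lmult D G) d" .
qed

lemma infsum_lmult:
  assumes D: "finite {d. D d \<noteq> 0}" and uv: "u \<noteq> 0" "v \<noteq> 0"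
    and C: "(\<lambda>d. norm (lterm C u v d)) summable_on UNIV"
  shows "infsum (lterm (lmult D C) u v) UNIV = infsum (lterm D u v) UNIV * infsum (lterm C u v) UNIV"
proof -
  let ?S = "{d. D d \<noteq> 0}"
  have lterm_add: "lterm (lmult D C) u v d = (\<Sum>e\<in>?S. lterm D u v e * lterm C u v (d - e))" for d
    using uv by (cases d)
      (auto simp: lterm_def lmult_def sum_distrib_right power_int_diff intro!: sum.cong)
  have "lterm C u v summable_on UNIV"
    using C by (rule abs_summable_summable)
  then have sum_C: "(lterm C u v has_sum infsum (lterm C u v) UNIV) UNIV"
    by simp
  have "((\<lambda>d. lterm C u v (d - e)) has_sum infsum (lterm C u v) UNIV) UNIV" for e
  proof -
    have "bij (\<lambda>d :: int \<times> int. d - e)"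
      by (rule bij_betw_byWitness[where f' = "\<lambda>d. d + e"]) auto
    then show ?thesis
      using sum_C by (simp add: has_sum_reindex_bij_betw[of "\<lambda>d. d - e" UNIV UNIV])
  qed
  then have shift: "((\<lambda>d. lterm D u v e * lterm C u v (d - e)) has_sum
      lterm D u v e * infsum (lterm C u v) UNIV) UNIV" for e
    by (rule has_sum_cmult_right)
  have "((\<lambda>d. \<Sum>e\<in>T. lterm D u v e * lterm C u v (d - e)) has_sum
      (\<Sum>e\<in>T. lterm D u v e * infsum (lterm C u v) UNIV)) UNIV" if "finite T" for T
    using that by induction (auto intro!: has_sum_add shift)
  from this[OF D] have "((\<lambda>d. \<Sum>e\<in>?S. lterm D u v e * lterm C u v (d - e)) has_sum
      (\<Sum>e\<in>?S. lterm D u v e * infsum (lterm C u v) UNIV)) UNIV" .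
  moreover have "infsum (lterm D u v) UNIV = (\<Sum>e\<in>?S. lterm D u v e)"
    using D by (subst infsum_cong_neutral[where T = ?S and g = "lterm D u v"])
      (auto simp: lterm_def)
  ultimately show ?thesis
    by (simp add: lterm_add[abs_def] infsumI sum_distrib_right)
qed

lemma has_reading_unique:
  assumes "has_reading G u v r" "has_reading G u v s" "u \<noteq> 0" "v \<noteq> 0"
  shows "r = s"
proof -
  obtain D where D: "finite {d. D d \<noteq> 0}" "infsum (lterm D u v) UNIV \<noteq> 0"
      "(\<lambda>d. norm (lterm (lmult D G) u v d)) summable_on UNIV"
      "r = infsum (lterm (lmult D G) u v) UNIV / infsum (lterm D u v) UNIV"
    using assms(1) unfolding has_reading_def by blast
  obtain D' where D': "finite {d. D' d \<noteq> 0}" "infsum (lterm D' u v) UNIV \<noteq> 0"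
      "(\<lambda>d. norm (lterm (lmult D' G) u v d)) summable_on UNIV"
      "s = infsum (lterm (lmult D' G) u v) UNIV / infsum (lterm D' u v) UNIV"
    using assms(2) unfolding has_reading_def by blast
  have "infsum (lterm D' u v) UNIV * infsum (lterm (lmult D G) u v) UNIV =
        infsum (lterm D u v) UNIV * infsum (lterm (lmult D' G) u v) UNIV"
    using infsum_lmult[of D' u v "lmult D G"] infsum_lmult[of D u v "lmult D' G"] D D' assms(3,4)
    by (simp add: lmult_commute[of D' D])
  then have "infsum (lterm D' u v) UNIV * (r * infsum (lterm D u v) UNIV) =
      infsum (lterm D u v) UNIV * (s * infsum (lterm D' u v) UNIV)"
    using D D' by simp
  then show ?thesis
    using D(2) D'(2) by simp
qed

definition reading :: "laurent2 \<Rightarrow> complex \<Rightarrow> complex \<Rightarrow> complex" where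
  "reading G u v = (THE r. has_reading G u v r)"


section \<open>Vacuum expectation values\<close>

text \<open>A pair \<open>(A, u)\<close> stands for the field \<open>\<Sum>j. A j * u ^ j\<close>.\<close>

type_synonym field = "(int \<Rightarrow> lin) \<times> complex"

definition mode_field :: "mode \<Rightarrow> field" where
  "mode_field m = ((\<lambda>j. if j = 0 then [(1, m)] else []), 1)"

definition phi :: "complex \<Rightarrow> field" where
  "phi u = (phi_mode, u)"

definition phihat :: "complex \<Rightarrow> field" where
  "phihat u = (phihat_mode, u)"

definition psi :: "nat \<Rightarrow> complex \<Rightarrow> field" where
  "psi c u = ((\<lambda>j. [(1, Psi c j)]), u)"

definition psistar :: "nat \<Rightarrow> complex \<Rightarrow> field" where
  "psistar c u = ((\<lambda>j. [(1, PsiStar c (-j))]), u)"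

text \<open>Pairings in the presence of \<open>eH = exp H\<close>; the tags \<open>Inl\<close>, \<open>Inr\<close> mark factors standing to the
  left and to the right of \<open>eH\<close>.\<close>

fun pairing :: "(fock \<Rightarrow> fock) \<Rightarrow> field + field \<Rightarrow> field + field \<Rightarrow> complex" where
  "pairing eH (Inl (A, u)) (Inl (B, v)) = reading (\<lambda>(j, k). lop (A j) (lop (B k) (eH vac)) {}) u v"
| "pairing eH (Inl (A, u)) (Inr (B, v)) = reading (\<lambda>(j, k). lop (A j) (eH (lop (B k) vac)) {}) u v"
| "pairing eH (Inr (A, u)) (Inr (B, v)) = reading (\<lambda>(j, k). eH (lop (A j) (lop (B k) vac)) {}) u v"
| "pairing eH (Inr _) (Inl _) = undefined"

text \<open>Wick's theorem.\<close>

fun wick :: "('a \<Rightarrow> 'a \<Rightarrow> complex) \<Rightarrow> 'a list \<Rightarrow> complex" where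
  "wick P [] = 1"
| "wick P (w # ws) =
     (\<Sum>i<length ws. (-1) ^ i * P w (ws ! i) * wick P (take i ws @ drop (Suc i) ws))"

text \<open>A list of triples \<open>(z, A, B)\<close> stands for the exponential of the sum of all \<open>z A B\<close>, and \<open>vev\<close>
  expands this exponential: the product over a list of indices \<open>is\<close> of length \<open>k\<close> is one of the terms
  of the \<open>k\<close>-th power of that sum.\<close>

type_synonym gexp = "(complex \<times> field \<times> field) list"

definition vev :: "(fock \<Rightarrow> fock) \<Rightarrow> mode list \<Rightarrow> gexp \<Rightarrow> mode list \<Rightarrow> complex" where
  "vev eH us g ws =
     (\<Sum>k. (\<Sum>is | set is \<subseteq> {..<length g} \<and> length is = k.
         (\<Prod>i\<leftarrow>is. fst (g ! i)) *
         wick (pairing eH)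
           (map Inl (map mode_field us) @
            map Inr (concat (map (\<lambda>i. case g ! i of (z, A, B) \<Rightarrow> [A, B]) is) @ map mode_field ws)))
       / fact k)"

definition omega :: "gexp \<Rightarrow> gexp" where
  "omega = map (\<lambda>(z, (A, u), (B, v)). (z, (\<lambda>j. omega_lin (A j), u), (\<lambda>j. omega_lin (B j), v)))"

definition f_vev :: "time \<Rightarrow> int \<Rightarrow> time \<Rightarrow> gexp \<Rightarrow> complex" where
  "f_vev y l x g' = vev (op_exp (Ham1 x y)) (PsiStars 0 l) g' (Psis 0 l)"

definition F_vev :: "time \<Rightarrow> int \<Rightarrow> int \<Rightarrow> int \<Rightarrow> time \<Rightarrow> gexp \<Rightarrow> complex" where
  "F_vev y l1 l2 l x g =
     vev (op_exp (Ham2 x y)) (PsiStars 1 l1 @ PsiStars 2 l2) g (Psis 2 (l2 - l) @ Psis 1 (l1 + l))"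

definition g_neutral ::
  "nat \<Rightarrow> nat \<Rightarrow> (nat \<Rightarrow> complex) \<Rightarrow> (nat \<Rightarrow> complex) \<Rightarrow> (nat \<Rightarrow> complex) \<Rightarrow> (nat \<Rightarrow> complex) \<Rightarrow>
   (nat \<Rightarrow> complex) \<Rightarrow> (nat \<Rightarrow> complex) \<Rightarrow> gexp" where
  "g_neutral N M b c p q p' q' =
     map (\<lambda>j. (b j, phi (p j), phi (q j))) [1..<N+1] @
     map (\<lambda>j. (c j, phi (p' j), phihat (q' j))) [1..<M+1]"

definition g_charged ::
  "nat \<Rightarrow> nat \<Rightarrow> (nat \<Rightarrow> complex) \<Rightarrow> (nat \<Rightarrow> complex) \<Rightarrow> (nat \<Rightarrow> complex) \<Rightarrow> (nat \<Rightarrow> complex) \<Rightarrow>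
   (nat \<Rightarrow> complex) \<Rightarrow> (nat \<Rightarrow> complex) \<Rightarrow> gexp" where
  "g_charged N M b c p q p' q' =
     concat (map (\<lambda>j. [(b j, psi 1 (p j), psistar 1 (- q j)),
                       (- b j, psi 1 (q j), psistar 1 (- p j))]) [1..<N+1]) @
     concat (map (\<lambda>j. [(c j, psi 1 (p' j), psistar 2 (- q' j)),
                       (- c j, psi 2 (q' j), psistar 1 (- p' j))]) [1..<M+1])"

definition A_poly :: "nat \<Rightarrow> (nat \<Rightarrow> complex) \<Rightarrow> complex \<Rightarrow> complex" where
  "A_poly n a p = (\<Prod>k=2..n-1. 1 - p / a k)"

end

theory Submission
  imports Defs
begin

text \<open>By Wick's theorem the neutral expectation values are sums of Pfaffians and the charged ones sums of
  determinants, both running over the insertions chosen from the exponent. The charged exponent is the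
  doubled neutral one, so for an antisymmetric kernel the charged sum is the square of the neutral sum.

  All times are referred to one base time. A shift multiplies the kernels by factors
  \<open>(1 - p/K)\<close>, \<open>(1 + p/K)\<close>, \<open>(1 - p/L)\<close>, \<open>(1 + p/L)\<close>, and every kernel that occurs differs from a
  common one by a kernel of small rank. Dressing by the insertions (possible for generic weights, which
  suffices since both sides are polynomial in the weights) then reduces each equation to an identity
  between values of one bilinear form: a Hirota-Miwa relation for \<open>2 \<le> i \<le> n - 2\<close>, and a relation between
  a Pfaffian sum and its square at both ends. The equations \<open>\<langle>J, i\<rangle>\<close> for \<open>J = 2, 3, 4\<close> are \<open>\<langle>1, i\<rangle>\<close> with
  other signs of \<open>K\<close> and \<open>L\<close>.

  At \<open>i = n - 1, n\<close> the reduction condition says that a gauge transformation of the charged fermions turns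
  \<open>g\<close> into the double of \<open>h'\<close>. It is singular if some \<open>p\<^sub>j\<close> or \<open>q\<^sub>j\<close> equals \<open>a\<^sub>n\<^sub>-\<^sub>1\<close>; this case
  follows by moving that point slightly and passing to the limit.\<close>

section \<open>Contractions and Wick sums\<close>

fun contract :: "('a \<Rightarrow> complex) \<Rightarrow> ('a list \<Rightarrow> complex) \<Rightarrow> 'a list \<Rightarrow> complex" where
  "contract \<alpha> T [] = 0"
| "contract \<alpha> T (w # ws) = \<alpha> w * T ws - contract \<alpha> (\<lambda>l. T (w # l)) ws"

lemma contract_altdef:
  "contract \<alpha> T ws = (\<Sum>i<length ws. (-1) ^ i * \<alpha> (ws ! i) * T (take i ws @ drop (Suc i) ws))"
proof (induction ws arbitrary: T)
  case (Cons w ws)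
  have "(\<Sum>i<length (w # ws). (-1) ^ i * \<alpha> ((w # ws) ! i) * T (take i (w # ws) @ drop (Suc i) (w # ws)))
      = \<alpha> w * T ws - (\<Sum>i<length ws. (-1) ^ i * \<alpha> (ws ! i) * T (w # take i ws @ drop (Suc i) ws))"
    by (simp only: length_Cons sum.lessThan_Suc_shift) (simp add: sum_negf)
  with Cons show ?case
    by simp
qed simp

lemma wick_Cons: "wick P (w # ws) = contract (P w) (wick P) ws"
  by (simp add: contract_altdef)

declare wick.simps(2) [simp del]

lemma wick_singleton [simp]: "wick P [a] = 0"
  and wick_pair [simp]: "wick P [a, b] = P a b"
  by (simp_all add: wick_Cons)

lemma contract_cong_length:
  assumes "\<And>l. set l \<subseteq> set ws \<Longrightarrow> Suc (length l) = length ws \<Longrightarrow> T l = T' l"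
    and "\<And>w. w \<in> set ws \<Longrightarrow> \<alpha> w = \<alpha>' w"
  shows "contract \<alpha> T ws = contract \<alpha>' T' ws"
  using assms
proof (induction ws arbitrary: T T')
  case (Cons w ws)
  have "contract \<alpha> (\<lambda>l. T (w # l)) ws = contract \<alpha>' (\<lambda>l. T' (w # l)) ws"
    by (intro Cons.IH Cons.prems) auto
  moreover have "T ws = T' ws"
    by (intro Cons.prems) auto
  ultimately show ?case
    using Cons.prems(2) by simp
qed simp

lemma contract_add:
  "contract \<alpha> (\<lambda>l. T l + T' l) ws = contract \<alpha> T ws + contract \<alpha> T' ws"
  by (induction ws arbitrary: T T') (auto simp: algebra_simps)

lemma contract_scale:
  "contract \<alpha> (\<lambda>l. c * T l) ws = c * contract \<alpha> T ws"
  by (induction ws arbitrary: T) (auto simp: algebra_simps)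

lemma contract_diff:
  "contract \<alpha> (\<lambda>l. T l - T' l) ws = contract \<alpha> T ws - contract \<alpha> T' ws"
  by (induction ws arbitrary: T T') (auto simp: algebra_simps)

lemma contract_form_add:
  "contract (\<lambda>x. \<alpha> x + \<beta> x) T ws = contract \<alpha> T ws + contract \<beta> T ws"
  by (induction ws arbitrary: T) (auto simp: algebra_simps)

lemma contract_form_diff:
  "contract (\<lambda>x. \<alpha> x - \<beta> x) T ws = contract \<alpha> T ws - contract \<beta> T ws"
  by (induction ws arbitrary: T) (auto simp: algebra_simps)

lemma contract_form_scale:
  "contract (\<lambda>x. c * \<alpha> x) T ws = c * contract \<alpha> T ws"
  by (induction ws arbitrary: T) (auto simp: algebra_simps)

lemma contract_zero [simp]: "contract \<alpha> (\<lambda>_. 0) ws = 0"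
  by (induction ws) auto

lemma contract_anticommute:
  "contract \<alpha> (contract \<beta> T) ws = - contract \<beta> (contract \<alpha> T) ws"
  by (induction ws arbitrary: T) (auto simp: contract_diff contract_scale)

lemma contract_contract: "contract \<alpha> (contract \<alpha> T) ws = 0"
  using contract_anticommute[of \<alpha> \<alpha> T ws] by simp

lemma wick_Cons_Cons:
  "wick P (a # b # ws) = P a b * wick P ws - contract (P a) (contract (P b) (wick P)) ws"
proof -
  have "(\<lambda>l. wick P (b # l)) = contract (P b) (wick P)"
    by (auto simp: wick_Cons)
  then show ?thesis
    by (simp add: wick_Cons[of P a])
qed

lemma wick_cong:
  assumes "\<And>u v. u \<in> set ws \<Longrightarrow> v \<in> set ws \<Longrightarrow> P u v = Q u v"
  shows "wick P ws = wick Q ws"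
  using assms
proof (induction "length ws" arbitrary: ws rule: less_induct)
  case less
  show ?case
  proof (cases ws)
    case (Cons w us)
    then show ?thesis
      using less by (auto simp: wick_Cons intro!: contract_cong_length less)
  qed simp
qed

lemma wick_map: "wick P (map f ws) = wick (\<lambda>u v. P (f u) (f v)) ws"
proof (induction "length ws" arbitrary: ws rule: less_induct)
  case less
  have map: "contract \<alpha> T (map f us) = contract (\<lambda>x. \<alpha> (f x)) (\<lambda>l. T (map f l)) us" for \<alpha> T us
    by (induction us arbitrary: T) auto
  show ?case
  proof (cases ws)
    case (Cons w us)
    then show ?thesis
      using less by (auto simp: wick_Cons map intro!: contract_cong_length)
  qed simp
qed

lemma wick_rank_two:
  "wick (\<lambda>u v. P u v + z * (\<alpha> u * \<beta> v - \<beta> u * \<alpha> v)) ws =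
   wick P ws + z * contract \<alpha> (contract \<beta> (wick P)) ws"
proof (induction "length ws" arbitrary: ws rule: less_induct)
  case less
  let ?Q = "\<lambda>u v. P u v + z * (\<alpha> u * \<beta> v - \<beta> u * \<alpha> v)"
  let ?T = "wick P"
  show ?case
  proof (cases ws)
    case (Cons w us)
    have IH: "contract \<gamma> (wick ?Q) us = contract \<gamma> (\<lambda>l. ?T l + z * contract \<alpha> (contract \<beta> ?T) l) us" for \<gamma>
      using less Cons by (intro contract_cong_length) auto
    have "?Q w = (\<lambda>v. P w v + z * (\<alpha> w * \<beta> v - \<beta> w * \<alpha> v))"
      by auto
    then have "wick ?Q (w # us) = contract (P w) (wick ?Q) us +
        z * (\<alpha> w * contract \<beta> (wick ?Q) us - \<beta> w * contract \<alpha> (wick ?Q) us)"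
      by (simp add: wick_Cons contract_form_add contract_form_diff contract_form_scale)
    also have "contract \<alpha> (wick ?Q) us = contract \<alpha> ?T us"
      by (simp add: IH contract_add contract_scale contract_contract)
    also have "contract \<beta> (wick ?Q) us = contract \<beta> ?T us"
    proof -
      have "contract \<beta> (contract \<alpha> (contract \<beta> ?T)) us = - contract \<alpha> (contract \<beta> (contract \<beta> ?T)) us"
        by (rule contract_anticommute)
      also have "contract \<beta> (contract \<beta> ?T) = (\<lambda>_. 0)"
        by (auto simp: contract_contract)
      finally show ?thesis
        by (simp add: IH contract_add contract_scale)
    qed
    also have "contract (P w) (wick ?Q) us = wick P (w # us) + z * contract (P w) (contract \<alpha>
        (contract \<beta> ?T)) us"
      by (simp add: IH contract_add contract_scale wick_Cons)
    also have "contract (P w) (contract \<alpha> (contract \<beta> ?T)) us = contract \<alpha> (contract \<beta> (contract (P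
        w) ?T)) us"
    proof -
      have "contract (P w) (contract \<beta> ?T) = (\<lambda>l. - contract \<beta> (contract (P w) ?T) l)"
        using contract_anticommute by blast
      then show ?thesis
        using contract_scale[of \<alpha> "- 1" "contract \<beta> (contract (P w) ?T)" us]
        by (simp add: contract_anticommute[of "P w"])
    qed
    also have "wick P (w # us) + z * contract \<alpha> (contract \<beta> (contract (P w) ?T)) us +
        z * (\<alpha> w * contract \<beta> ?T us - \<beta> w * contract \<alpha> ?T us) =
        wick P (w # us) + z * contract \<alpha> (contract \<beta> ?T) (w # us)"
    proof -
      have "(\<lambda>l. ?T (w # l)) = contract (P w) ?T"
        by (auto simp: wick_Cons)
      then show ?thesis
        by (simp add: contract_diff contract_scale algebra_simps)
    qed
    finally show ?thesis
      using Cons by simp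
  qed simp
qed

lemma wick_insert_pair:
  assumes "1 + z * P a b \<noteq> 0"
  shows "wick P ws + z * wick P (a # b # ws) =
    (1 + z * P a b) * wick (\<lambda>u v. P u v - z * (P a u * P b v - P b u * P a v) / (1 + z * P a b)) ws"
proof -
  have "(\<lambda>u v. P u v - z * (P a u * P b v - P b u * P a v) / (1 + z * P a b)) =
        (\<lambda>u v. P u v + - z / (1 + z * P a b) * (P a u * P b v - P b u * P a v))"
    by auto
  then have "wick (\<lambda>u v. P u v - z * (P a u * P b v - P b u * P a v) / (1 + z * P a b)) ws =
      wick P ws + - z / (1 + z * P a b) * contract (P a) (contract (P b) (wick P)) ws"
    by (simp only: wick_rank_two)
  then show ?thesis
    using assms by (simp add: wick_Cons_Cons) (simp add: field_simps)
qed

lemma wick_rank_two_insert: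
  assumes "P a b = 0"
  shows "wick (\<lambda>u v. P u v + z * (P a u * P b v - P b u * P a v)) ws =
    wick P ws - z * wick P (a # b # ws)"
  using assms by (simp add: wick_rank_two wick_Cons_Cons)

lemma wick_scale: "wick (\<lambda>a b. w a * w b * P a b) ws = prod_list (map w ws) * wick P ws"
proof (induction "length ws" arbitrary: ws rule: less_induct)
  case less
  have scale: "contract (\<lambda>x. w x * \<alpha> x) (\<lambda>l. prod_list (map w l) * T l) us =
      prod_list (map w us) * contract \<alpha> T us" for \<alpha> T us
  proof (induction us arbitrary: T)
    case (Cons u us)
    have "contract (\<lambda>x. w x * \<alpha> x) (\<lambda>l. prod_list (map w (u # l)) * T (u # l)) us =
        contract (\<lambda>x. w x * \<alpha> x) (\<lambda>l. w u * (prod_list (map w l) * T (u # l))) us"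
      by (simp add: mult.assoc)
    also have "\<dots> = w u * (prod_list (map w us) * contract \<alpha> (\<lambda>l. T (u # l)) us)"
      by (simp add: contract_scale Cons)
    finally show ?case
      by (simp add: algebra_simps)
  qed simp
  show ?case
  proof (cases ws)
    case (Cons a us)
    have "wick (\<lambda>a b. w a * w b * P a b) (a # us) =
        contract (\<lambda>b. w a * (w b * P a b)) (\<lambda>l. prod_list (map w l) * wick P l) us"
      unfolding wick_Cons using less Cons by (intro contract_cong_length) (auto simp: mult_ac)
    also have "\<dots> = w a * (prod_list (map w us) * contract (P a) (wick P) us)"
      by (simp only: contract_form_scale scale)
    finally show ?thesis
      by (simp add: Cons wick_Cons)
  qed simp
qed

definition antisymmetric :: "('a \<Rightarrow> 'a \<Rightarrow> complex) \<Rightarrow> bool" where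
  "antisymmetric P \<longleftrightarrow> (\<forall>u v. P u v = - P v u)"

lemma antisymmetricD: "antisymmetric P \<Longrightarrow> P u v = - P v u"
  unfolding antisymmetric_def by blast

lemma antisymmetric_diag: "antisymmetric P \<Longrightarrow> P u u = 0"
proof -
  assume "antisymmetric P"
  then have "P u u = - P u u"
    by (rule antisymmetricD)
  then have "P u u + P u u = - P u u + P u u"
    by (rule arg_cong)
  then show ?thesis
    by simp
qed

definition alternating :: "('a list \<Rightarrow> complex) \<Rightarrow> bool" where
  "alternating T \<longleftrightarrow> (\<forall>us a b ws. T (us @ a # b # ws) = - T (us @ b # a # ws))"

lemma alternatingD: "alternating T \<Longrightarrow> T (us @ a # b # ws) = - T (us @ b # a # ws)"
  unfolding alternating_def by blast

lemma contract_swap: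
  assumes "\<And>us a b ws. Suc (length us + length ws + 2) \<le> N \<Longrightarrow> T (us @ a # b # ws) = - T (us @ b # a # ws)"
    and "length us + length ws + 2 \<le> N"
  shows "contract \<alpha> T (us @ a # b # ws) = - contract \<alpha> T (us @ b # a # ws)"
  using assms
proof (induction us arbitrary: T N)
  case Nil
  have "contract \<alpha> (\<lambda>l. T (a # b # l)) ws = contract \<alpha> (\<lambda>l. - 1 * T (b # a # l)) ws"
    using Nil(2) by (intro contract_cong_length) (auto simp: Nil(1)[of "[]" _ a b, simplified])
  also have "\<dots> = - 1 * contract \<alpha> (\<lambda>l. T (b # a # l)) ws"
    by (rule contract_scale)
  finally show ?case
    by simp
next
  case (Cons u us)
  have "contract \<alpha> (\<lambda>l. T (u # l)) (us @ a # b # ws) = - contract \<alpha> (\<lambda>l. T (u # l)) (us @ b # a # ws)"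
  proof (rule Cons.IH[of "N - 1"])
    fix us' ws' :: "'a list" and a b
    assume "Suc (length us' + length ws' + 2) \<le> N - 1"
    then show "T (u # us' @ a # b # ws') = - T (u # us' @ b # a # ws')"
      using Cons.prems(1)[of "u # us'" ws' a b] by simp
  qed (use Cons.prems(2) in simp)
  moreover have "T (us @ a # b # ws) = - T (us @ b # a # ws)"
    by (rule Cons.prems(1)) (use Cons.prems(2) in simp)
  ultimately show ?case
    by simp
qed

lemma alternating_wick:
  assumes "antisymmetric P"
  shows "alternating (wick P)"
  unfolding alternating_def
proof (intro allI)
  fix us a b ws
  show "wick P (us @ a # b # ws) = - wick P (us @ b # a # ws)"
  proof (induction "length us + length ws" arbitrary: us a b ws rule: less_induct)
    case less
    show ?case
    proof (cases us)
      case Nil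
      then show ?thesis
        unfolding Nil append_Nil wick_Cons_Cons antisymmetricD[OF assms, of a b]
          contract_anticommute[of "P a" "P b"]
        by simp
    next
      case (Cons u us')
      have "contract (P u) (wick P) (us' @ a # b # ws) = - contract (P u) (wick P) (us' @ b # a # ws)"
        by (rule contract_swap[where N = "length us' + length ws + 2"])
          (rule less.hyps, simp_all add: Cons)
      then show ?thesis
        by (simp add: Cons wick_Cons)
    qed
  qed
qed

section \<open>Exponentials of pairs\<close>

fun pair_exp :: "(complex \<times> 'a \<times> 'a) list \<Rightarrow> ('a list \<Rightarrow> complex) \<Rightarrow> 'a list \<Rightarrow> complex" where
  "pair_exp [] T ws = T ws"
| "pair_exp ((z, a, b) # g) T ws = pair_exp g T ws + z * pair_exp g T (a # b # ws)"

lemma pair_exp_diff_scale: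
  "pair_exp g (\<lambda>l. T l - c * T' l) ws = pair_exp g T ws - c * pair_exp g T' ws"
  by (induction g T ws arbitrary: T' rule: pair_exp.induct) (simp_all add: right_diff_distrib
      distrib_left mult.left_commute)

lemma pair_exp_map:
  "pair_exp (map (\<lambda>(z, a, b). (z, f a, f b)) g) T (map f ws) = pair_exp g (\<lambda>l. T (map f l)) ws"
proof (induction g arbitrary: ws)
  case (Cons c g)
  show ?case
    using Cons[of ws] Cons[of "fst (snd c) # snd (snd c) # ws"] by (cases c) simp
qed simp

lemma alternating_pair_exp: "alternating T \<Longrightarrow> alternating (pair_exp g T)"
proof (induction g)
  case Nil
  have "pair_exp [] T = T"
    by (simp add: fun_eq_iff)
  with Nil show ?case
    by (simp only:)
next
  case (Cons c g)
  obtain z a b where c: "c = (z, a, b)"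
    by (cases c)
  have alt: "alternating (pair_exp g T)"
    using Cons by simp
  show ?case
    unfolding alternating_def c pair_exp.simps
  proof (intro allI)
    fix us x y ws
    show "pair_exp g T (us @ x # y # ws) + z * pair_exp g T (a # b # us @ x # y # ws) =
        - (pair_exp g T (us @ y # x # ws) + z * pair_exp g T (a # b # us @ y # x # ws))"
      unfolding alternatingD[OF alt, of us x y ws]
        alternatingD[OF alt, of "a # b # us" x y ws, unfolded append_Cons] by simp
  qed
qed

lemma alternating_repeat: 
  assumes "alternating T"
  shows "T (us @ a # a # ws) = 0"
proof -
  have "T (us @ a # a # ws) + T (us @ a # a # ws) = - T (us @ a # a # ws) + T (us @ a # a # ws)"
    using alternatingD[OF assms] by (rule arg_cong)
  then show ?thesis
    by simp
qed

lemma alternating_swap_pairs: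
  assumes "alternating T"
  shows "T (a # b # c # d # ws) = T (c # d # a # b # ws)"
proof -
  note D = alternatingD[OF assms]
  have "T (a # b # c # d # ws) = - T (a # c # b # d # ws)"
    using D[of "[a]" b c "d # ws"] by simp
  also have "\<dots> = T (c # a # b # d # ws)"
    using D[of "[]" a c "b # d # ws"] by simp
  also have "\<dots> = - T (c # a # d # b # ws)"
    using D[of "[c, a]" b d ws] by simp
  also have "\<dots> = T (c # d # a # b # ws)"
    using D[of "[c]" a d "b # ws"] by simp
  finally show ?thesis .
qed

lemma pair_exp_insert:
  assumes "alternating T"
  shows "pair_exp g (\<lambda>l. T (a # b # l)) ws = pair_exp g T (a # b # ws)"
proof (induction g arbitrary: ws)
  case (Cons c g)
  obtain z x y where c: "c = (z, x, y)"
    by (cases c)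
  show ?case
    by (simp add: c Cons alternating_swap_pairs[OF alternating_pair_exp[OF assms], where a =
        a and b = b and c = x and d = y])
qed simp

definition pair_sum :: "(complex \<times> 'a \<times> 'a) list \<Rightarrow> ('a list \<Rightarrow> complex) \<Rightarrow> 'a list \<Rightarrow> complex" where
  "pair_sum g T ws = (\<Sum>i<length g. case g ! i of (z, a, b) \<Rightarrow> z * T (a # b # ws))"

lemma pair_sum_Nil: "pair_sum [] T = (\<lambda>_. 0)"
  by (auto simp: pair_sum_def)

lemma pair_sum_Cons:
  "pair_sum ((z, a, b) # g) T = (\<lambda>ws. pair_sum g T ws + z * T (a # b # ws))"
  unfolding pair_sum_def length_Cons sum.lessThan_Suc_shift by (simp add: fun_eq_iff)

lemma pair_sum_linear:
  "pair_sum g (\<lambda>l. T l + c * T' l) = (\<lambda>l. pair_sum g T l + c * pair_sum g T' l)"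
  by (induction g) (auto simp: pair_sum_Nil pair_sum_Cons fun_eq_iff algebra_simps)

lemma pair_sum_insert:
  assumes "alternating T"
  shows "pair_sum g (\<lambda>l. z * T (a # b # l)) = (\<lambda>l. z * pair_sum g T (a # b # l))"
proof (induction g)
  case (Cons c g)
  obtain z' x y where c: "c = (z', x, y)"
    by (cases c)
  show ?case
    by (simp add: c pair_sum_Cons Cons fun_eq_iff alternating_swap_pairs[OF assms, where a =
        a and b = b and c = x and d = y] algebra_simps)
qed (simp add: pair_sum_Nil)

lemma alternating_pair_sum:
  assumes "alternating T"
  shows "alternating (pair_sum g T)"
proof (induction g)
  case (Cons c g)
  obtain z a b where c: "c = (z, a, b)"
    by (cases c)
  show ?case
    unfolding alternating_def c pair_sum_Cons
  proof (intro allI)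
    fix us x y ws
    show "pair_sum g T (us @ x # y # ws) + z * T (a # b # us @ x # y # ws) =
        - (pair_sum g T (us @ y # x # ws) + z * T (a # b # us @ y # x # ws))"
      unfolding alternatingD[OF Cons, of us x y ws]
        alternatingD[OF assms, of "a # b # us" x y ws, unfolded append_Cons] by simp
  qed
qed (simp add: pair_sum_Nil alternating_def)

lemma alternating_pair_sum_pow:
  "alternating T \<Longrightarrow> alternating ((pair_sum g ^^ k) T)"
  by (induction k) (auto intro: alternating_pair_sum)

text \<open>Inserting a fixed pair commutes with \<^const>\<open>pair_sum\<close> and squares to zero, so the binomial
  expansion stops after the second term.\<close>

lemma pair_sum_Cons_pow:
  assumes "alternating T"
  shows "(pair_sum ((z, a, b) # g) ^^ k) T =
    (\<lambda>ws. (pair_sum g ^^ k) T ws + of_nat k * (z * (pair_sum g ^^ (k - 1)) T (a # b # ws)))"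
proof (induction k)
  case (Suc k)
  let ?X = "\<lambda>k. (pair_sum g ^^ k) T"
  note alt = alternating_pair_sum_pow[OF assms, of _ g]
  have aabb: "?X j (a # b # a # b # ws) = 0" for j ws
    using alternating_repeat[OF alt[of j], of "[a]" b "a # ws"]
      alternatingD[OF alt[of j], of "[a]" b a "b # ws"] alternating_repeat[OF alt[of j], of "[]"
          a "b # b # ws"]
    by simp
  have "pair_sum g (\<lambda>ws. ?X k ws + of_nat k * (z * ?X (k - 1) (a # b # ws))) ws =
      ?X (Suc k) ws + of_nat k * (z * ?X k (a # b # ws))" for ws
  proof (cases k)
    case (Suc j)
    then show ?thesis
      by (simp add: pair_sum_linear pair_sum_insert[OF alt])
  qed simp
  then have step: "pair_sum g (\<lambda>ws. ?X k ws + of_nat k * (z * ?X (k - 1) (a # b # ws))) =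
      (\<lambda>ws. ?X (Suc k) ws + of_nat k * (z * ?X k (a # b # ws)))"
    by blast
  have "(pair_sum ((z, a, b) # g) ^^ Suc k) T = pair_sum ((z, a, b) # g)
      (\<lambda>ws. ?X k ws + of_nat k * (z * ?X (k - 1) (a # b # ws)))"
    by (simp only: funpow.simps comp_def Suc)
  then show ?case
    unfolding pair_sum_Cons step by (simp add: aabb fun_eq_iff algebra_simps)
qed simp

lemma pair_sum_pow_eq_zero:
  assumes "alternating T" "k > length g"
  shows "(pair_sum g ^^ k) T = (\<lambda>_. 0)"
  using assms(2)
proof (induction g arbitrary: k)
  case Nil
  then show ?case
    by (cases k) (auto simp: pair_sum_Nil)
next
  case (Cons c g)
  obtain z a b where c: "c = (z, a, b)"
    by (cases c)
  have "length g < k" "length g < k - 1"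
    using Cons.prems by auto
  then show ?case
    unfolding c pair_sum_Cons_pow[OF assms(1)] by (simp add: Cons.IH)
qed

lemma pair_exp_eq_sum:
  assumes "alternating T"
  shows "pair_exp g T ws = (\<Sum>k\<le>length g. (pair_sum g ^^ k) T ws / fact k)"
proof (induction g arbitrary: ws)
  case (Cons c g)
  obtain z a b where c: "c = (z, a, b)"
    by (cases c)
  have zero: "(pair_sum g ^^ Suc (length g)) T l = 0" for l
    using pair_sum_pow_eq_zero[OF assms, of g "Suc (length g)"] by simp
  have coeff: "of_nat (Suc k) * (z * Y) / fact (Suc k) = z * (Y / fact k)" for k and Y :: complex
    using of_nat_0_neq[of k, where 'a = complex]
    by (simp only: fact_Suc of_nat_mult) (simp add: field_simps del: of_nat_Suc)
  have "(\<Sum>k\<le>length (c # g). (pair_sum (c # g) ^^ k) T ws / fact k) =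
      (\<Sum>k\<le>Suc (length g). (pair_sum g ^^ k) T ws / fact k) +
      (\<Sum>k\<le>Suc (length g). of_nat k * (z * (pair_sum g ^^ (k - 1)) T (a # b # ws)) / fact k)"
    unfolding c pair_sum_Cons_pow[OF assms] by (simp add: add_divide_distrib sum.distrib)
  also have "(\<Sum>k\<le>Suc (length g). (pair_sum g ^^ k) T ws / fact k) = pair_exp g T ws"
    unfolding Cons by (simp only: sum.atMost_Suc zero) simp
  also have "(\<Sum>k\<le>Suc (length g). of_nat k * (z * (pair_sum g ^^ (k - 1)) T (a # b # ws)) / fact k) =
      z * pair_exp g T (a # b # ws)"
    unfolding Cons sum.atMost_Suc_shift sum_distrib_left
    by (simp only: coeff diff_Suc_1) simp
  finally show ?case
    by (simp add: c)
qed simp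

lemma pair_sum_pow_eq_sum_lists:
  "(pair_sum g ^^ k) T ws = (\<Sum>is | set is \<subseteq> {..<length g} \<and> length is = k.
     (\<Prod>i\<leftarrow>is. fst (g ! i)) * T (concat (map (\<lambda>i. case g ! i of (z, a, b) \<Rightarrow> [a, b]) is) @ ws))"
proof (induction k arbitrary: T)
  case 0
  have "{is. set is \<subseteq> {..<length g} \<and> length is = 0} = {[]}"
    by auto
  then show ?case
    by simp
next
  case (Suc k)
  let ?A = "{..<length g}"
  let ?pr = "\<lambda>i. case g ! i of (z, a, b) \<Rightarrow> [a, b]"
  have inj: "inj_on (\<lambda>(xs, n). n # xs) ({is. set is \<subseteq> ?A \<and> length is = k} \<times> ?A)"
    by (auto simp: inj_on_def)
  have "(pair_sum g ^^ Suc k) T ws = (pair_sum g ^^ k) (pair_sum g T) ws"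
    by (simp only: funpow_Suc_right comp_def)
  also have "\<dots> = (\<Sum>is | set is \<subseteq> ?A \<and> length is = k. \<Sum>i\<in>?A.
      (\<Prod>i\<leftarrow>i # is. fst (g ! i)) * T (concat (map ?pr (i # is)) @ ws))"
    unfolding Suc by (auto simp: pair_sum_def sum_distrib_left split: prod.split intro!: sum.cong)
  also have "\<dots> = (\<Sum>is | set is \<subseteq> ?A \<and> length is = Suc k.
      (\<Prod>i\<leftarrow>is. fst (g ! i)) * T (concat (map ?pr is) @ ws))"
    unfolding lists_length_Suc_eq sum.cartesian_product
    by (subst sum.reindex[OF inj]) (auto simp: comp_def case_prod_unfold)
  finally have *: "(pair_sum g ^^ Suc k) T ws = (\<Sum>is | set is \<subseteq> ?A \<and> length is = Suc k.
      (\<Prod>i\<leftarrow>is. fst (g ! i)) * T (concat (map ?pr is) @ ws))" .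
  show ?case
    by (rule *)
qed

section \<open>Pfaffian and determinant sums\<close>

fun pf_dress :: "(complex \<times> 'a \<times> 'a) list \<Rightarrow> ('a \<Rightarrow> 'a \<Rightarrow> complex) \<Rightarrow> 'a \<Rightarrow> 'a \<Rightarrow> complex" where
  "pf_dress [] Q = Q"
| "pf_dress ((z, a, b) # g) Q = (\<lambda>u v. pf_dress g Q u v -
     z * (pf_dress g Q a u * pf_dress g Q b v - pf_dress g Q b u * pf_dress g Q a v) /
       (1 + z * pf_dress g Q a b))"

fun pf_value :: "(complex \<times> 'a \<times> 'a) list \<Rightarrow> ('a \<Rightarrow> 'a \<Rightarrow> complex) \<Rightarrow> complex" where
  "pf_value [] Q = 1"
| "pf_value ((z, a, b) # g) Q = pf_value g Q * (1 + z * pf_dress g Q a b)"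

fun pf_good :: "(complex \<times> 'a \<times> 'a) list \<Rightarrow> ('a \<Rightarrow> 'a \<Rightarrow> complex) \<Rightarrow> bool" where
  "pf_good [] Q \<longleftrightarrow> True"
| "pf_good ((z, a, b) # g) Q \<longleftrightarrow> pf_good g Q \<and> 1 + z * pf_dress g Q a b \<noteq> 0"

lemma pair_exp_wick:
  "pf_good g Q \<Longrightarrow> pair_exp g (wick Q) ws = pf_value g Q * wick (pf_dress g Q) ws"
proof (induction g arbitrary: ws)
  case (Cons c g)
  obtain z a b where c: "c = (z, a, b)"
    by (cases c)
  let ?Q = "pf_dress g Q"
  have good: "pf_good g Q" "1 + z * ?Q a b \<noteq> 0"
    using Cons.prems c by auto
  have "pair_exp (c # g) (wick Q) ws = pf_value g Q * (wick ?Q ws + z * wick ?Q (a # b # ws))"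
    by (simp add: c Cons.IH[OF good(1)] algebra_simps)
  then show ?case
    by (simp only: wick_insert_pair[where P = "?Q", OF good(2)]) (simp add: c)
qed simp

lemma antisymmetric_pf_dress:
  "antisymmetric Q \<Longrightarrow> antisymmetric (pf_dress g Q)"
proof (induction g)
  case (Cons c g)
  obtain z a b where c: "c = (z, a, b)"
    by (cases c)
  show ?case
    unfolding antisymmetric_def c pf_dress.simps
  proof (intro allI)
    fix u v
    have "pf_dress g Q u v = - pf_dress g Q v u"
      using antisymmetricD[OF Cons.IH[OF Cons.prems]] .
    then show "pf_dress g Q u v - z * (pf_dress g Q a u * pf_dress g Q b v - pf_dress g Q b u *
        pf_dress g Q a v) /
          (1 + z * pf_dress g Q a b) =
        - (pf_dress g Q v u - z * (pf_dress g Q a v * pf_dress g Q b u - pf_dress g Q b v * pf_dress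
            g Q a u) /
          (1 + z * pf_dress g Q a b))"
      by (simp add: algebra_simps diff_divide_distrib)
  qed
qed simp

definition scale_exp :: "complex \<Rightarrow> (complex \<times> 'a \<times> 'a) list \<Rightarrow> (complex \<times> 'a \<times> 'a) list" where
  "scale_exp r = map (\<lambda>(z, a, b). (r * z, a, b))"

lemma scale_exp_Nil [simp]: "scale_exp r [] = []"
  and scale_exp_Cons [simp]: "scale_exp r ((z, a, b) # g) = (r * z, a, b) # scale_exp r g"
  by (simp_all add: scale_exp_def)

lemma scale_exp_one [simp]: "scale_exp 1 g = g"
  by (induction g) auto

lemma pair_exp_scale_poly:
  "\<exists>q. (\<forall>r. pair_exp (scale_exp r g) T ws = poly q r) \<and> poly q 0 = T ws"
proof (induction g arbitrary: ws)
  case Nil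
  show ?case
    by (intro exI[of _ "[:T ws:]"]) simp
next
  case (Cons c g)
  obtain z a b where c: "c = (z, a, b)"
    by (cases c)
  obtain q1 where q1: "\<forall>r. pair_exp (scale_exp r g) T ws = poly q1 r" "poly q1 0 = T ws"
    using Cons by blast
  obtain q2 where q2: "\<forall>r. pair_exp (scale_exp r g) T (a # b # ws) = poly q2 r"
    using Cons by blast
  show ?case
    by (intro exI[of _ "q1 + [:0, z:] * q2"]) (simp add: c q1 q2)
qed

lemma finite_not_pf_good: "finite {r. \<not> pf_good (scale_exp r g) Q}"
proof (induction g)
  case (Cons c g)
  obtain z a b where c: "c = (z, a, b)"
    by (cases c)
  obtain q where q: "\<forall>r. pair_exp (scale_exp r (c # g)) (wick Q) [] = poly q r" "poly q 0 = 1"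
    using pair_exp_scale_poly[of "c # g" "wick Q" "[]"] by auto
  have "\<not> pf_good (scale_exp r g) Q \<or> poly q r = 0" if "\<not> pf_good (scale_exp r (c # g)) Q" for r
  proof (cases "pf_good (scale_exp r g) Q")
    case True
    then have "pair_exp (scale_exp r (c # g)) (wick Q) [] =
        pf_value (scale_exp r g) Q * (1 + r * z * pf_dress (scale_exp r g) Q a b)"
      by (simp add: c pair_exp_wick algebra_simps)
    moreover have "1 + r * z * pf_dress (scale_exp r g) Q a b = 0"
      using that True c by auto
    ultimately show ?thesis
      using q(1) by simp
  qed simp
  then have "{r. \<not> pf_good (scale_exp r (c # g)) Q} \<subseteq> {r. \<not> pf_good (scale_exp r g) Q} \<union> {r. poly q r = 0}"
    by blast
  moreover have "q \<noteq> 0"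
    using q(2) by auto
  ultimately show ?case
    using Cons poly_roots_finite finite_subset by blast
qed simp

text \<open>Rows and columns are adjoined to a kernel by treating arbitrary vectors as additional symbols.\<close>

datatype 'i extended = I 'i | V "'i \<Rightarrow> complex"

fun extend :: "('i \<Rightarrow> 'i \<Rightarrow> complex) \<Rightarrow> 'i extended \<Rightarrow> 'i extended \<Rightarrow> complex" where
  "extend M (I s) (I t) = M s t"
| "extend M (V \<alpha>) (I t) = \<alpha> t"
| "extend M (I s) (V \<alpha>) = - \<alpha> s"
| "extend M (V _) (V _) = 0"

datatype 'e charged = Cr 'e | An 'e

fun charge :: "('e \<Rightarrow> 'e \<Rightarrow> complex) \<Rightarrow> 'e charged \<Rightarrow> 'e charged \<Rightarrow> complex" where
  "charge R (Cr s) (An t) = R s t"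
| "charge R (An t) (Cr s) = - R s t"
| "charge R _ _ = 0"

lemma antisymmetric_charge: "antisymmetric (charge R)"
  unfolding antisymmetric_def
proof (intro allI)
  show "charge R u v = - charge R v u" for u v
    by (cases u; cases v) auto
qed

lemma antisymmetric_ext: 
  assumes "antisymmetric P"
  shows "antisymmetric (extend P)"
  unfolding antisymmetric_def
proof (intro allI)
  show "extend P u v = - extend P v u" for u v
    by (cases u; cases v) (auto intro: antisymmetricD[OF assms])
qed

definition charge_exp :: "(complex \<times> 'e \<times> 'e) list \<Rightarrow> (complex \<times> 'e charged \<times> 'e charged) list" where
  "charge_exp = map (\<lambda>(z, s, t). (z, Cr s, An t))"

definition ext_exp :: "(complex \<times> 'i \<times> 'i) list \<Rightarrow> (complex \<times> 'i extended \<times> 'i extended) list" where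
  "ext_exp = map (\<lambda>(z, s, t). (z, I s, I t))"

fun double_exp :: "(complex \<times> 'e \<times> 'e) list \<Rightarrow> (complex \<times> 'e \<times> 'e) list" where
  "double_exp [] = []"
| "double_exp ((z, a, b) # g) = (z, a, b) # (- z, b, a) # double_exp g"

definition pf_sum :: "(complex \<times> 'i \<times> 'i) list \<Rightarrow> ('i \<Rightarrow> 'i \<Rightarrow> complex) \<Rightarrow> complex" where
  "pf_sum g P = pair_exp g (wick P) []"

definition det_sum :: "(complex \<times> 'i \<times> 'i) list \<Rightarrow> ('i \<Rightarrow> 'i \<Rightarrow> complex) \<Rightarrow> complex" where
  "det_sum g M = pair_exp (charge_exp g) (wick (charge M)) []"

fun ch_dress :: "(complex \<times> 'e \<times> 'e) list \<Rightarrow> ('e \<Rightarrow> 'e \<Rightarrow> complex) \<Rightarrow> 'e \<Rightarrow> 'e \<Rightarrow> complex" where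
  "ch_dress [] R = R"
| "ch_dress ((z, a, b) # g) R = (\<lambda>s t. ch_dress g R s t -
     z * ch_dress g R a t * ch_dress g R s b / (1 + z * ch_dress g R a b))"

lemma pf_dress_charge: "pf_dress (charge_exp g) (charge R) = charge (ch_dress g R)"
proof (induction g)
  case (Cons c g)
  obtain z a b where c: "c = (z, a, b)"
    by (cases c)
  have "pf_dress (charge_exp (c # g)) (charge R) u v = charge (ch_dress (c # g) R) u v" for u v
    using Cons by (cases u; cases v) (simp_all add: c charge_exp_def)
  then show ?case
    by (simp add: fun_eq_iff)
qed (simp add: charge_exp_def)

lemma double_exp_dress:
  assumes "antisymmetric Q" "pf_good g Q"
  shows "ch_dress (double_exp g) Q = pf_dress g Q \<and>
    pf_good (charge_exp (double_exp g)) (charge Q) \<and>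
    pf_value (charge_exp (double_exp g)) (charge Q) = (pf_value g Q)\<^sup>2"
  using assms(2)
proof (induction g)
  case (Cons c g)
  obtain z a b where c: "c = (z, a, b)"
    by (cases c)
  define R where "R = pf_dress g Q"
  have alt: "antisymmetric R"
    unfolding R_def using assms(1) by (rule antisymmetric_pf_dress)
  have good: "pf_good g Q" "1 + z * R a b \<noteq> 0"
    using Cons.prems c by (auto simp: R_def)
  note IH = Cons.IH[OF good(1)]
  have IH1: "ch_dress (double_exp g) Q = R"
    using IH R_def by blast
  have diag: "R a a = 0" "R b b = 0"
    using antisymmetric_diag[OF alt] by auto
  have ba: "R b a = - R a b"
    using alt by (rule antisymmetricD)
  define R1 where "R1 = ch_dress ((- z, b, a) # double_exp g) Q"
  have R1: "R1 s t = R s t + z * R b t * R s a / (1 + z * R a b)" for s t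
    by (simp add: R1_def IH1 ba)
  have R1ab: "R1 a b = R a b" "R1 a t = R a t" "R1 s b = R s b" for s t
    by (simp_all add: R1 diag)
  have 1: "ch_dress (double_exp (c # g)) Q = (\<lambda>s t. R1 s t - z * R1 a t * R1 s b / (1 + z * R1 a b))"
    by (simp add: c R1_def)
  have "ch_dress (double_exp (c # g)) Q s t = pf_dress (c # g) Q s t" for s t
  proof -
    have "R s a = - R a s" "R s b = - R b s"
      using alt by (rule antisymmetricD)+
    then show ?thesis
      using good(2) unfolding 1 R1ab unfolding R1 by (simp add: c flip: R_def) (simp add:
          algebra_simps add_divide_distrib diff_divide_distrib)
  qed
  moreover have list: "charge_exp (double_exp (c # g)) =
      (z, Cr a, An b) # (- z, Cr b, An a) # charge_exp (double_exp g)"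
    by (simp add: c charge_exp_def)
  have d1: "pf_dress (charge_exp (double_exp g)) (charge Q) = charge R"
    by (simp only: pf_dress_charge IH1)
  have d2: "pf_dress ((- z, Cr b, An a) # charge_exp (double_exp g)) (charge Q) = charge R1"
    using pf_dress_charge[of "(- z, b, a) # double_exp g" Q] by (simp add: charge_exp_def R1_def)
  have "pf_good (charge_exp (double_exp (c # g))) (charge Q)"
    using IH good(2) unfolding list pf_good.simps d1 d2 charge.simps R1ab ba by simp
  moreover have "pf_value (c # g) Q = pf_value g Q * (1 + z * R a b)"
    by (simp add: c R_def)
  then have "pf_value (charge_exp (double_exp (c # g))) (charge Q) = (pf_value (c # g) Q)\<^sup>2"
    using IH unfolding list pf_value.simps d1 d2 charge.simps R1ab ba
    by (simp add: power2_eq_square)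
  ultimately show ?case
    by blast
qed (simp add: charge_exp_def)

lemma pf_dress_linear:
  assumes "\<And>u. Q u v = c * Q u v1 + d * Q u v2"
  shows "pf_dress g Q u v = c * pf_dress g Q u v1 + d * pf_dress g Q u v2"
proof (induction g arbitrary: u)
  case (Cons e g)
  obtain z a b where e: "e = (z, a, b)"
    by (cases e)
  show ?case
    unfolding e pf_dress.simps Cons[of u] Cons[of a] Cons[of b]
    by (simp add: field_simps add_divide_distrib diff_divide_distrib)
qed (simp add: assms)

lemma ch_dress_linear_right:
  assumes "\<And>u. Q u v = c * Q u v1 + d * Q u v2"
  shows "ch_dress g Q u v = c * ch_dress g Q u v1 + d * ch_dress g Q u v2"
proof (induction g arbitrary: u)
  case (Cons e g)
  obtain z a b where e: "e = (z, a, b)"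
    by (cases e)
  show ?case
    unfolding e ch_dress.simps Cons[of u] Cons[of a]
    by (simp add: field_simps add_divide_distrib diff_divide_distrib)
qed (simp add: assms)

lemma ch_dress_linear_left:
  assumes "\<And>v. Q u v = c * Q u1 v + d * Q u2 v"
  shows "ch_dress g Q u v = c * ch_dress g Q u1 v + d * ch_dress g Q u2 v"
proof (induction g arbitrary: v)
  case (Cons e g)
  obtain z a b where e: "e = (z, a, b)"
    by (cases e)
  show ?case
    unfolding e ch_dress.simps Cons[of v] Cons[of b]
    by (simp add: field_simps add_divide_distrib diff_divide_distrib)
qed (simp add: assms)

lemma pf_sum_ext: "pf_sum g P = pair_exp (ext_exp g) (wick (extend P)) []"
proof -
  have "wick P l = wick (extend P) (map I l)" for l
    by (simp add: wick_map)
  then have "wick P = (\<lambda>l. wick (extend P) (map I l))"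
    by (rule ext)
  then have "pf_sum g P = pair_exp g (\<lambda>l. wick (extend P) (map I l)) []"
    by (simp only: pf_sum_def)
  then show ?thesis
    using pair_exp_map[where f = I and g = g and T = "wick (extend P)" and ws =
        "[]"] by (simp add: ext_exp_def)
qed

lemma det_sum_ext: "det_sum g M = pair_exp (charge_exp (ext_exp g)) (wick (charge (extend M))) []"
proof -
  let ?f = "map_charged I"
  have "charge M u v = charge (extend M) (?f u) (?f v)" for u v
    by (cases u; cases v) auto
  then have "wick (charge M) l = wick (charge (extend M)) (map ?f l)" for l
    unfolding wick_map by presburger
  then have "wick (charge M) = (\<lambda>l. wick (charge (extend M)) (map ?f l))"
    by (rule ext)
  then have "det_sum g M = pair_exp (charge_exp g) (\<lambda>l. wick (charge (extend M)) (map ?f l)) []"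
    by (simp only: det_sum_def)
  moreover have "map (\<lambda>(z, a, b). (z, ?f a, ?f b)) (charge_exp g) = charge_exp (ext_exp g)"
    by (auto simp: charge_exp_def ext_exp_def)
  ultimately show ?thesis
    using pair_exp_map[where f = ?f and g = "charge_exp g" and T = "wick (charge (extend M))"
        and ws = "[]"] by simp
qed

lemma wick_ext_rank_two:
  "wick (extend (\<lambda>u v. P u v + (\<alpha> u * \<beta> v - \<beta> u * \<alpha> v))) ws =
   wick (extend P) ws - 1 * wick (extend P) (V \<alpha> # V \<beta> # ws)"
proof -
  have "extend (\<lambda>u v. P u v + (\<alpha> u * \<beta> v - \<beta> u * \<alpha> v)) u v =
      extend P u v + 1 * (extend P (V \<alpha>) u * extend P (V \<beta>) v - extend P (V \<beta>) u * extend P (V \<alpha>)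
          v)" for u v
    by (cases u; cases v) auto
  then have "extend (\<lambda>u v. P u v + (\<alpha> u * \<beta> v - \<beta> u * \<alpha> v)) =
      (\<lambda>u v. extend P u v + 1 * (extend P (V \<alpha>) u * extend P (V \<beta>) v - extend P (V \<beta>) u * extend P
          (V \<alpha>) v))"
    by blast
  then show ?thesis
    by (simp only: wick_rank_two_insert[of "extend P" "V \<alpha>" "V \<beta>" 1, OF extend.simps(4)])
qed

lemma wick_charge_rank_one:
  "wick (charge (extend (\<lambda>s t. M s t + \<alpha> s * \<beta> t))) ws =
   wick (charge (extend M)) ws - 1 * wick (charge (extend M)) (An (V \<alpha>) # Cr (V \<beta>) # ws)"
proof -
  let ?C = "charge (extend M)"
  have "extend (\<lambda>s t. M s t + \<alpha> s * \<beta> t) u v = extend M u v - extend M u (V \<alpha>) * extend M (V \<beta>) v" for u v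
    by (cases u; cases v) auto
  then have "charge (extend (\<lambda>s t. M s t + \<alpha> s * \<beta> t)) u v =
      ?C u v + 1 * (?C (An (V \<alpha>)) u * ?C (Cr (V \<beta>)) v - ?C (Cr (V \<beta>)) u * ?C (An (V \<alpha>)) v)" for u v
    by (cases u; cases v) auto
  then have "charge (extend (\<lambda>s t. M s t + \<alpha> s * \<beta> t)) =
      (\<lambda>u v. ?C u v + 1 * (?C (An (V \<alpha>)) u * ?C (Cr (V \<beta>)) v - ?C (Cr (V \<beta>)) u * ?C (An (V \<alpha>)) v))"
    by blast
  moreover have "?C (An (V \<alpha>)) (Cr (V \<beta>)) = 0"
    by simp
  ultimately show ?thesis
    by (simp only: wick_rank_two_insert)
qed

definition bilinear_form :: "(('i \<Rightarrow> complex) \<Rightarrow> ('i \<Rightarrow> complex) \<Rightarrow> complex) \<Rightarrow> bool" where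
  "bilinear_form \<rho> \<longleftrightarrow>
     (\<forall>c d \<alpha> \<alpha>' \<beta>. \<rho> (\<lambda>s. c * \<alpha> s + d * \<alpha>' s) \<beta> = c * \<rho> \<alpha> \<beta> + d * \<rho> \<alpha>' \<beta>) \<and>
     (\<forall>c d \<alpha> \<beta> \<beta>'. \<rho> \<alpha> (\<lambda>s. c * \<beta> s + d * \<beta>' s) = c * \<rho> \<alpha> \<beta> + d * \<rho> \<alpha> \<beta>')"

definition det_form where
  "det_form g M \<zeta> \<rho> \<longleftrightarrow>
     (\<forall>\<alpha> \<beta>. det_sum g (\<lambda>s t. M s t + \<alpha> s * \<beta> t) = \<zeta> * (1 + \<rho> \<alpha> \<beta>)) \<and>
     (\<forall>\<alpha> \<beta> \<alpha>' \<beta>'. det_sum g (\<lambda>s t. M s t + \<alpha> s * \<beta> t + \<alpha>' s * \<beta>' t) =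
        \<zeta> * ((1 + \<rho> \<alpha> \<beta>) * (1 + \<rho> \<alpha>' \<beta>') - \<rho> \<alpha> \<beta>' * \<rho> \<alpha>' \<beta>))"

lemma det_form_dress:
  assumes "pf_good (charge_exp (ext_exp g)) (charge (extend M))"
  shows "det_form g M (pf_value (charge_exp (ext_exp g)) (charge (extend M)))
     (\<lambda>\<alpha> \<beta>. ch_dress (ext_exp g) (extend M) (V \<beta>) (V \<alpha>))"
  unfolding det_form_def
proof (intro conjI allI)
  let ?C = "charge (extend M)" and ?g = "charge_exp (ext_exp g)"
  let ?R = "ch_dress (ext_exp g) (extend M)" and ?Z = "pf_value (charge_exp (ext_exp g)) (charge
      (extend M))"
  note insert = pair_exp_insert[OF alternating_wick[OF antisymmetric_charge]]
  have val: "pair_exp ?g (wick ?C) ws = ?Z * wick (charge ?R) ws" for ws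
    using pair_exp_wick[OF assms] by (simp add: pf_dress_charge)
  fix \<alpha> \<beta> \<alpha>' \<beta>'
  have 1: "pair_exp ?g (wick (charge (extend (\<lambda>s t. M s t + \<alpha> s * \<beta> t)))) ws =
      ?Z * (wick (charge ?R) ws - wick (charge ?R) (An (V \<alpha>) # Cr (V \<beta>) # ws))" for ws
    unfolding wick_charge_rank_one pair_exp_diff_scale insert val by (simp add: algebra_simps)
  show "det_sum g (\<lambda>s t. M s t + \<alpha> s * \<beta> t) = ?Z * (1 + ?R (V \<beta>) (V \<alpha>))"
    by (simp add: det_sum_ext 1)
  show "det_sum g (\<lambda>s t. M s t + \<alpha> s * \<beta> t + \<alpha>' s * \<beta>' t) =
        ?Z * ((1 + ?R (V \<beta>) (V \<alpha>)) * (1 + ?R (V \<beta>') (V \<alpha>')) - ?R (V \<beta>') (V \<alpha>) * ?R (V \<beta>) (V \<alpha>'))"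
    unfolding det_sum_ext wick_charge_rank_one[of "\<lambda>s t. M s t + \<alpha> s * \<beta> t"]
      pair_exp_diff_scale insert 1
    by (simp add: wick_Cons_Cons algebra_simps)
qed

lemma charged_det_form:
  assumes "pf_good (charge_exp (ext_exp g)) (charge (extend M))"
  shows "\<exists>\<zeta> \<rho>. bilinear_form \<rho> \<and> det_form g M \<zeta> \<rho>"
proof (intro exI conjI)
  show "det_form g M (pf_value (charge_exp (ext_exp g)) (charge (extend M)))
     (\<lambda>\<alpha> \<beta>. ch_dress (ext_exp g) (extend M) (V \<beta>) (V \<alpha>))"
    using assms by (rule det_form_dress)
  show "bilinear_form (\<lambda>\<alpha> \<beta>. ch_dress (ext_exp g) (extend M) (V \<beta>) (V \<alpha>))"
    unfolding bilinear_form_def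
  proof (intro conjI allI)
    fix c d :: complex and \<alpha> \<alpha>' \<beta> :: "'a \<Rightarrow> complex"
    have "extend M u (V (\<lambda>s. c * \<alpha> s + d * \<alpha>' s)) = c * extend M u (V \<alpha>) + d * extend M u (V \<alpha>')" for u
      by (cases u) auto
    then show "ch_dress (ext_exp g) (extend M) (V \<beta>) (V (\<lambda>s. c * \<alpha> s + d * \<alpha>' s)) =
        c * ch_dress (ext_exp g) (extend M) (V \<beta>) (V \<alpha>) + d * ch_dress (ext_exp g) (extend M) (V \<beta>) (V \<alpha>')"
      by (rule ch_dress_linear_right)
  next
    fix c d :: complex and \<alpha> \<beta> \<beta>' :: "'a \<Rightarrow> complex"
    have "extend M (V (\<lambda>s. c * \<beta> s + d * \<beta>' s)) u = c * extend M (V \<beta>) u + d * extend M (V \<beta>') u" for u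
      by (cases u) auto
    then show "ch_dress (ext_exp g) (extend M) (V (\<lambda>s. c * \<beta> s + d * \<beta>' s)) (V \<alpha>) =
        c * ch_dress (ext_exp g) (extend M) (V \<beta>) (V \<alpha>) + d * ch_dress (ext_exp g) (extend M) (V \<beta>') (V \<alpha>)"
      by (rule ch_dress_linear_left)
  qed
qed

lemma ext_exp_double: "ext_exp (double_exp g) = double_exp (ext_exp g)"
  by (induction g rule: double_exp.induct) (auto simp: ext_exp_def)

lemma neutral_det_form:
  assumes P: "antisymmetric P" and good: "pf_good (ext_exp g) (extend P)"
  shows "\<exists>\<zeta> \<rho>. bilinear_form \<rho> \<and> (\<forall>\<alpha> \<beta>. \<rho> \<alpha> \<beta> = - \<rho> \<beta> \<alpha>) \<and>
    (\<forall>\<alpha> \<beta>. pf_sum g (\<lambda>s t. P s t + (\<alpha> s * \<beta> t - \<beta> s * \<alpha> t)) = \<zeta> * (1 + \<rho> \<alpha> \<beta>)) \<and>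
    det_form (double_exp g) P (\<zeta>\<^sup>2) \<rho>"
proof -
  let ?Q = "pf_dress (ext_exp g) (extend P)" and ?\<zeta> = "pf_value (ext_exp g) (extend P)"
  let ?\<rho> = "\<lambda>\<alpha> \<beta>. ?Q (V \<beta>) (V \<alpha>)"
  have extP: "antisymmetric (extend P)"
    using P by (rule antisymmetric_ext)
  have Q: "?Q u v = - ?Q v u" for u v
    using antisymmetric_pf_dress[OF extP] by (rule antisymmetricD)
  note double = double_exp_dress[OF extP good]
  have lin: "?Q u (V (\<lambda>s. c * \<alpha> s + d * \<alpha>' s)) = c * ?Q u (V \<alpha>) + d * ?Q u (V \<alpha>')" for u c d \<alpha> \<alpha>'
  proof (rule pf_dress_linear)
    show "extend P u (V (\<lambda>s. c * \<alpha> s + d * \<alpha>' s)) = c * extend P u (V \<alpha>) + d * extend P u (V \<alpha>')" for u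
      by (cases u) auto
  qed
  have "bilinear_form ?\<rho>"
    unfolding bilinear_form_def
  proof (intro conjI allI)
    fix c d :: complex and \<alpha> \<alpha>' \<beta> :: "'a \<Rightarrow> complex"
    show "?Q (V \<beta>) (V (\<lambda>s. c * \<alpha> s + d * \<alpha>' s)) = c * ?Q (V \<beta>) (V \<alpha>) + d * ?Q (V \<beta>) (V \<alpha>')"
      by (rule lin)
    show "?Q (V (\<lambda>s. c * \<alpha> s + d * \<alpha>' s)) (V \<beta>) = c * ?Q (V \<alpha>) (V \<beta>) + d * ?Q (V \<alpha>') (V \<beta>)"
      unfolding Q[of _ "V \<beta>"] lin by (simp add: algebra_simps)
  qed
  moreover have "\<forall>\<alpha> \<beta>. ?\<rho> \<alpha> \<beta> = - ?\<rho> \<beta> \<alpha>"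
    by (intro allI Q)
  moreover have "pf_sum g (\<lambda>s t. P s t + (\<alpha> s * \<beta> t - \<beta> s * \<alpha> t)) = ?\<zeta> * (1 + ?\<rho> \<alpha> \<beta>)" for \<alpha> \<beta>
    unfolding pf_sum_ext wick_ext_rank_two pair_exp_diff_scale
      pair_exp_insert[OF alternating_wick[OF extP]] pair_exp_wick[OF good] Q[of "V \<beta>" "V \<alpha>"]
    by (simp add: algebra_simps)
  moreover have "det_form (double_exp g) P (?\<zeta>\<^sup>2) ?\<rho>"
  proof -
    have "det_form (double_exp g) P (pf_value (charge_exp (ext_exp (double_exp g))) (charge (extend P)))
        (\<lambda>\<alpha> \<beta>. ch_dress (ext_exp (double_exp g)) (extend P) (V \<beta>) (V \<alpha>))"
      using double by (intro det_form_dress) (simp add: ext_exp_double)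
    then show ?thesis
      using double by (simp add: ext_exp_double)
  qed
  ultimately show ?thesis
    by blast
qed

section \<open>Bilinear identities\<close>

definition syms :: "(complex \<times> 'i \<times> 'i) list \<Rightarrow> 'i set" where
  "syms g = (\<Union>(z, s, t)\<in>set g. {s, t})"

lemma syms_Nil [simp]: "syms [] = {}"
  and syms_Cons [simp]: "syms ((z, s, t) # g) = {s, t} \<union> syms g"
  by (auto simp: syms_def)

lemma syms_scale_exp [simp]: "syms (scale_exp r g) = syms g"
  by (auto simp: syms_def scale_exp_def)

lemma syms_double_exp [simp]: "syms (double_exp g) = syms g"
  by (induction g rule: double_exp.induct) auto

lemma double_exp_scale: "double_exp (scale_exp r g) = scale_exp r (double_exp g)"
  by (induction g rule: double_exp.induct) auto

lemma pair_exp_cong: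
  assumes "\<And>l. set l \<subseteq> syms g \<union> set ws \<Longrightarrow> T l = T' l"
  shows "pair_exp g T ws = pair_exp g T' ws"
  using assms
proof (induction g arbitrary: ws)
  case (Cons c g)
  obtain z a b where c: "c = (z, a, b)"
    by (cases c)
  have "pair_exp g T ws = pair_exp g T' ws"
    by (rule Cons.IH, rule Cons.prems) (auto simp: c)
  moreover have "pair_exp g T (a # b # ws) = pair_exp g T' (a # b # ws)"
    by (rule Cons.IH, rule Cons.prems) (auto simp: c)
  ultimately show ?case
    by (simp add: c)
qed simp

lemma pf_sum_cong:
  assumes "\<And>s t. s \<in> syms g \<Longrightarrow> t \<in> syms g \<Longrightarrow> P s t = Q s t"
  shows "pf_sum g P = pf_sum g Q"
  unfolding pf_sum_def using assms by (intro pair_exp_cong wick_cong) auto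

lemma det_sum_cong:
  assumes "\<And>s t. s \<in> syms g \<Longrightarrow> t \<in> syms g \<Longrightarrow> M s t = M' s t"
  shows "det_sum g M = det_sum g M'"
  unfolding det_sum_def
proof (intro pair_exp_cong wick_cong)
  fix l u v
  assume l: "set l \<subseteq> syms (charge_exp g) \<union> set []" and uv: "u \<in> set l" "v \<in> set l"
  have *: "s \<in> syms g" if "Cr s \<in> syms (charge_exp g) \<or> An s \<in> syms (charge_exp g)" for s
    using that by (auto simp: syms_def charge_exp_def)
  show "charge M u v = charge M' u v"
    using l uv * by (cases u; cases v) (auto intro!: assms)
qed

definition polynomial_fun :: "(complex \<Rightarrow> complex) \<Rightarrow> bool" where
  "polynomial_fun X \<longleftrightarrow> (\<exists>q. \<forall>r. X r = poly q r)"

lemma polynomial_fun_const: "polynomial_fun (\<lambda>_. c)"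
  unfolding polynomial_fun_def by (intro exI[of _ "[:c:]"]) simp

lemma polynomial_fun_mult:
  "polynomial_fun X \<Longrightarrow> polynomial_fun Y \<Longrightarrow> polynomial_fun (\<lambda>r. X r * Y r)"
  unfolding polynomial_fun_def by (metis poly_mult)

lemma polynomial_fun_diff:
  "polynomial_fun X \<Longrightarrow> polynomial_fun Y \<Longrightarrow> polynomial_fun (\<lambda>r. X r - Y r)"
  unfolding polynomial_fun_def by (metis poly_diff)

lemma polynomial_fun_pf_sum: "polynomial_fun (\<lambda>r. pf_sum (scale_exp r g) P)"
  unfolding polynomial_fun_def pf_sum_def using pair_exp_scale_poly by blast

lemma polynomial_fun_det_sum: "polynomial_fun (\<lambda>r. det_sum (scale_exp r g) M)"
proof -
  have "charge_exp (scale_exp r g) = scale_exp r (charge_exp g)" for r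
    by (auto simp: charge_exp_def scale_exp_def)
  then show ?thesis
    unfolding polynomial_fun_def det_sum_def using pair_exp_scale_poly by metis
qed

lemmas polynomial_fun_intros = polynomial_fun_const polynomial_fun_mult polynomial_fun_diff
  polynomial_fun_pf_sum polynomial_fun_det_sum

lemma polynomial_fun_eqI:
  assumes "polynomial_fun X" "polynomial_fun Y" "finite {r. X r \<noteq> Y r}"
  shows "X 1 = Y 1"
proof -
  obtain p q where p: "\<And>r. X r = poly p r" and q: "\<And>r. Y r = poly q r"
    using assms unfolding polynomial_fun_def by blast
  have "p - q = 0"
  proof (rule ccontr)
    assume "p - q \<noteq> 0"
    then have "finite {r. poly (p - q) r = 0}"
      by (rule poly_roots_finite)
    moreover have "{r. poly (p - q) r = 0} \<union> {r. X r \<noteq> Y r} = UNIV"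
      using p q by auto
    ultimately show False
      using assms(3) infinite_UNIV_char_0[where 'a = complex] by (metis finite_UnI)
  qed
  then show ?thesis
    using p q by simp
qed

lemma neutral_generic:
  assumes "polynomial_fun X" "polynomial_fun Y" "antisymmetric P"
    and "\<And>r. pf_good (ext_exp (scale_exp r g)) (extend P) \<Longrightarrow> X r = Y r"
  shows "X 1 = Y 1"
proof (rule polynomial_fun_eqI[OF assms(1,2)])
  have "ext_exp (scale_exp r g) = scale_exp r (ext_exp g)" for r
    by (auto simp: ext_exp_def scale_exp_def)
  then have "{r. X r \<noteq> Y r} \<subseteq> {r. \<not> pf_good (scale_exp r (ext_exp g)) (extend P)}"
    using assms(4) by auto
  then show "finite {r. X r \<noteq> Y r}"
    using finite_not_pf_good finite_subset by blast
qed

lemma charged_generic: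
  assumes "polynomial_fun X" "polynomial_fun Y"
    and "\<And>r. pf_good (charge_exp (ext_exp (scale_exp r g))) (charge (extend M)) \<Longrightarrow> X r = Y r"
  shows "X 1 = Y 1"
proof (rule polynomial_fun_eqI[OF assms(1,2)])
  have "charge_exp (ext_exp (scale_exp r g)) = scale_exp r (charge_exp (ext_exp g))" for r
    by (auto simp: ext_exp_def scale_exp_def charge_exp_def)
  then have "{r. X r \<noteq> Y r} \<subseteq> {r. \<not> pf_good (scale_exp r (charge_exp (ext_exp g))) (charge (extend M))}"
    using assms(3) by auto
  then show "finite {r. X r \<noteq> Y r}"
    using finite_not_pf_good finite_subset by blast
qed

lemma bilinear_formD:
  assumes "bilinear_form \<rho>"
  shows "\<rho> (\<lambda>s. c * \<alpha> s + d * \<alpha>' s) \<beta> = c * \<rho> \<alpha> \<beta> + d * \<rho> \<alpha>' \<beta>"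
    and "\<rho> \<alpha> (\<lambda>s. c * \<beta> s + d * \<beta>' s) = c * \<rho> \<alpha> \<beta> + d * \<rho> \<alpha> \<beta>'"
  using assms unfolding bilinear_form_def by blast+

lemma det_formD:
  assumes "det_form g M \<zeta> \<rho>"
  shows "det_sum g (\<lambda>s t. M s t + \<alpha> s * \<beta> t) = \<zeta> * (1 + \<rho> \<alpha> \<beta>)"
    and "det_sum g (\<lambda>s t. M s t + \<alpha> s * \<beta> t + \<alpha>' s * \<beta>' t) =
      \<zeta> * ((1 + \<rho> \<alpha> \<beta>) * (1 + \<rho> \<alpha>' \<beta>') - \<rho> \<alpha> \<beta>' * \<rho> \<alpha>' \<beta>)"
  using assms unfolding det_form_def by blast+

lemma bilinear_form_comb3:
  assumes "bilinear_form \<rho>"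
  shows "\<rho> \<alpha> (\<lambda>s. c * \<beta> s + d * \<beta>' s + e * \<beta>'' s) = c * \<rho> \<alpha> \<beta> + d * \<rho> \<alpha> \<beta>' + e * \<rho> \<alpha> \<beta>''"
  using bilinear_formD(2)[OF assms, of \<alpha> 1 "\<lambda>s. c * \<beta> s + d * \<beta>' s" e \<beta>'']
    bilinear_formD(2)[OF assms, of \<alpha> c \<beta> d \<beta>'] by simp

definition twist :: "('i \<Rightarrow> bool) \<Rightarrow> ('i \<Rightarrow> complex) \<Rightarrow> ('i \<Rightarrow> complex) \<Rightarrow> 'i \<Rightarrow> complex" where
  "twist c1 r e s = (if c1 s then r s * e s else e s)"

definition pf_kernel :: "('i \<Rightarrow> bool) \<Rightarrow> ('i \<Rightarrow> complex) \<Rightarrow> complex \<Rightarrow> ('i \<Rightarrow> complex) \<Rightarrow> 'i \<Rightarrow> 'i \<Rightarrow> complex" where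
  "pf_kernel c1 v w e s t = e s * e t *
     (if c1 s = c1 t then (v s - v t) / (v s + v t) / 2 else if c1 s then w / 2 else - w / 2)"

definition kernel_11 :: "('i \<Rightarrow> bool) \<Rightarrow> ('i \<Rightarrow> complex) \<Rightarrow> ('i \<Rightarrow> complex) \<Rightarrow> ('i \<Rightarrow> complex) \<Rightarrow> 'i \<Rightarrow> 'i \<Rightarrow>
    complex" where
  "kernel_11 c1 v X Y s t = (if c1 s = c1 t then v s / (v s + v t) * X s * Y t else 0)"

definition kernel_00 :: "('i \<Rightarrow> bool) \<Rightarrow> ('i \<Rightarrow> complex) \<Rightarrow> ('i \<Rightarrow> complex) \<Rightarrow> ('i \<Rightarrow> complex) \<Rightarrow> 'i \<Rightarrow> 'i \<Rightarrow>
    complex" where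
  "kernel_00 c1 v X Y s t = (if c1 s = c1 t then - v t / (v s + v t) * X s * Y t else 0)"

lemma hirota_miwa_det_sum:
  fixes \<kappa> \<nu> \<mu> :: complex and X Y :: "'i \<Rightarrow> complex"
  assumes nz: "\<And>s t. s \<in> syms g \<Longrightarrow> t \<in> syms g \<Longrightarrow> c1 s = c1 t \<Longrightarrow> v s + v t \<noteq> 0"
  defines "d \<equiv> \<lambda>\<kappa> s. 1 - \<kappa> * v s" and "u \<equiv> \<lambda>\<kappa> s. 1 + \<kappa> * v s"
  defines "F \<equiv> \<lambda>r q. det_sum g (kernel_11 c1 v (twist c1 r X) (twist c1 q Y))"
  shows "\<nu> * (\<mu> - \<kappa>) * F (d \<nu>) (\<lambda>s. u \<kappa> s * u \<mu> s) * F (\<lambda>s. d \<kappa> s * d \<mu> s) (u \<nu>)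
       - \<kappa> * (\<mu> - \<nu>) * F (d \<kappa>) (\<lambda>s. u \<nu> s * u \<mu> s) * F (\<lambda>s. d \<nu> s * d \<mu> s) (u \<kappa>)
       = \<mu> * (\<nu> - \<kappa>) * F (\<lambda>s. d \<kappa> s * d \<nu> s) (u \<mu>) * F (d \<mu>) (\<lambda>s. u \<kappa> s * u \<nu> s)"
proof -
  define M where "M = kernel_11 c1 v X (twist c1 (\<lambda>s. u \<kappa> s * u \<nu> s * u \<mu> s) Y)"
  define a1 a2 where "a1 = (\<lambda>s. if c1 s then v s * X s else 0)" and "a2 = (\<lambda>s. if c1 s then (v s)\<^sup>2
      * X s else 0)"
  define w where "w = (\<lambda>j s. if c1 s then v s ^ j * Y s else 0)"
  define G where "G r h q = det_sum (scale_exp r g) (kernel_11 c1 v (twist c1 h X) (twist c1 q Y))"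
      for r h q
  define lhs where "lhs r = \<nu> * (\<mu> - \<kappa>) * G r (d \<nu>) (\<lambda>s. u \<kappa> s * u \<mu> s) * G r (\<lambda>s. d \<kappa> s * d \<mu> s) (u \<nu>)
       - \<kappa> * (\<mu> - \<nu>) * G r (d \<kappa>) (\<lambda>s. u \<nu> s * u \<mu> s) * G r (\<lambda>s. d \<nu> s * d \<mu> s) (u \<kappa>)" for r
  define rhs where "rhs r = \<mu> * (\<nu> - \<kappa>) * G r (\<lambda>s. d \<kappa> s * d \<nu> s) (u \<mu>) * G r (d \<mu>) (\<lambda>s. u \<kappa> s * u \<nu>
      s)" for r
  have "lhs r = rhs r" if good: "pf_good (charge_exp (ext_exp (scale_exp r g))) (charge (extend M))" for r
  proof -
    obtain \<zeta> \<rho> where bil: "bilinear_form \<rho>" and det: "det_form (scale_exp r g) M \<zeta> \<rho>"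
      using charged_det_form[OF good] by blast
    have one: "G r (d k) (\<lambda>s. u l s * u m s) = \<zeta> * (1 - k * (\<rho> a1 (w 0) + (l + m) * \<rho> a1 (w 1) +
        l * m * \<rho> a1 (w 2)))"
      if "(k, l, m) \<in> {(\<kappa>, \<nu>, \<mu>), (\<nu>, \<kappa>, \<mu>), (\<mu>, \<kappa>, \<nu>)}" for k l m
    proof -
      have "G r (d k) (\<lambda>s. u l s * u m s) = det_sum (scale_exp r g)
          (\<lambda>s t. M s t + a1 s * (- k * w 0 t + - (k * (l + m)) * w 1 t + - (k * l * m) * w 2 t))"
        unfolding G_def
      proof (rule det_sum_cong)
        fix s t assume "s \<in> syms (scale_exp r g)" "t \<in> syms (scale_exp r g)"
        then have "v s + v t \<noteq> 0" if "c1 s = c1 t"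
          using nz that by simp
        then show "kernel_11 c1 v (twist c1 (d k) X) (twist c1 (\<lambda>s. u l s * u m s) Y) s t =
            M s t + a1 s * (- k * w 0 t + - (k * (l + m)) * w 1 t + - (k * l * m) * w 2 t)"
          using that unfolding M_def kernel_11_def twist_def a1_def w_def d_def u_def
          by (auto simp: field_simps power2_eq_square)
      qed
      then show ?thesis
        unfolding det_formD(1)[OF det] bilinear_form_comb3[OF bil] by algebra
    qed
    have two: "G r (\<lambda>s. d k s * d l s) (u m) = \<zeta> *
        ((1 + k * l * (\<rho> a2 (w 0) + m * \<rho> a2 (w 1))) *
         (1 - ((k + l) * \<rho> a1 (w 0) + (k * l + (k + l) * m) * \<rho> a1 (w 1) + k * l * m * \<rho> a1 (w 2))) +
         ((k + l) * \<rho> a2 (w 0) + (k * l + (k + l) * m) * \<rho> a2 (w 1) + k * l * m * \<rho> a2 (w 2)) *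
         (k * l * (\<rho> a1 (w 0) + m * \<rho> a1 (w 1))))"
      if "(k, l, m) \<in> {(\<kappa>, \<nu>, \<mu>), (\<kappa>, \<mu>, \<nu>), (\<nu>, \<mu>, \<kappa>)}" for k l m
    proof -
      have "G r (\<lambda>s. d k s * d l s) (u m) = det_sum (scale_exp r g)
          (\<lambda>s t. M s t + a2 s * (k * l * w 0 t + k * l * m * w 1 t) +
             a1 s * (- (k + l) * w 0 t + - (k * l + (k + l) * m) * w 1 t + - (k * l * m) * w 2 t))"
        unfolding G_def
      proof (rule det_sum_cong)
        fix s t assume "s \<in> syms (scale_exp r g)" "t \<in> syms (scale_exp r g)"
        then have "v s + v t \<noteq> 0" if "c1 s = c1 t"
          using nz that by simp
        then show "kernel_11 c1 v (twist c1 (\<lambda>s. d k s * d l s) X) (twist c1 (u m) Y) s t =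
            M s t + a2 s * (k * l * w 0 t + k * l * m * w 1 t) +
             a1 s * (- (k + l) * w 0 t + - (k * l + (k + l) * m) * w 1 t + - (k * l * m) * w 2 t)"
          using that unfolding M_def kernel_11_def twist_def a1_def a2_def w_def d_def u_def
          by (auto simp: field_simps power2_eq_square)
      qed
      then show ?thesis
        unfolding det_formD(2)[OF det] bilinear_form_comb3[OF bil] bilinear_formD(2)[OF bil] by algebra
    qed
    have "lhs r = rhs r"
      unfolding lhs_def rhs_def one[of \<kappa> \<nu> \<mu>, simplified] one[of \<nu> \<kappa> \<mu>, simplified]
        one[of \<mu> \<kappa> \<nu>, simplified] two[of \<kappa> \<nu> \<mu>, simplified]
        two[of \<kappa> \<mu> \<nu>, simplified] two[of \<nu> \<mu> \<kappa>, simplified]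
      by algebra
    then show ?thesis .
  qed
  moreover have "polynomial_fun lhs" "polynomial_fun rhs"
    unfolding lhs_def rhs_def G_def by (intro polynomial_fun_intros)+
  ultimately have "lhs 1 = rhs 1"
    by (intro charged_generic[of lhs rhs g M])
  then show ?thesis
    unfolding lhs_def rhs_def F_def G_def by simp
qed

lemma antisymmetric_pf_kernel: "antisymmetric (pf_kernel c1 v w e)"
  unfolding antisymmetric_def
proof (intro allI)
  fix s t
  have "(v s - v t) / (v s + v t) = - ((v t - v s) / (v t + v s))"
    by (simp add: add.commute minus_divide_left)
  then show "pf_kernel c1 v w e s t = - pf_kernel c1 v w e t s"
    by (auto simp: pf_kernel_def)
qed

lemma same_component_kernels:
  assumes "c1 s = c1 t"
  shows "pf_kernel c1 v w e s t = e s * e t * (v s - v t) / (v s + v t) / 2"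
    and "kernel_11 c1 v X Y s t = 2 * v s * X s * Y t / (v s + v t) / 2"
    and "kernel_00 c1 v X Y s t = - 2 * v t * X s * Y t / (v s + v t) / 2"
proof -
  have half: "2 * x / D / 2 = x / D" for x D :: complex
    by simp
  show "pf_kernel c1 v w e s t = e s * e t * (v s - v t) / (v s + v t) / 2"
    using assms by (simp add: pf_kernel_def)
  show "kernel_11 c1 v X Y s t = 2 * v s * X s * Y t / (v s + v t) / 2"
    "kernel_00 c1 v X Y s t = - 2 * v t * X s * Y t / (v s + v t) / 2"
    using half[of "v s * X s * Y t"] half[of "- v t * X s * Y t"] assms
    by (simp_all only: kernel_11_def kernel_00_def refl if_True times_divide_eq_left mult.assoc
        mult_minus_left mult_minus_right)
qed

lemma half_fraction_eqI:
  fixes D :: complex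
  assumes "D \<noteq> 0" "x = y + 2 * z * D"
  shows "x / D / 2 = y / D / 2 + z"
  using assms by (simp add: add_divide_distrib)

lemma half_fraction_add_eqI:
  fixes D :: complex
  assumes "D \<noteq> 0" "x = y + 2 * (z - q) * D"
  shows "x / D / 2 + q = y / D / 2 + z"
  using half_fraction_eqI[OF assms] by simp

lemma bilinear_form_comb4:
  assumes "bilinear_form \<rho>"
  shows "\<rho> \<alpha> (\<lambda>s. c * \<beta> s + d * \<beta>' s + e * \<gamma> s + f * \<gamma>' s) =
    c * \<rho> \<alpha> \<beta> + d * \<rho> \<alpha> \<beta>' + e * \<rho> \<alpha> \<gamma> + f * \<rho> \<alpha> \<gamma>'"
  using bilinear_formD(2)[OF assms, of \<alpha> 1 "\<lambda>s. c * \<beta> s + d * \<beta>' s + e * \<gamma> s" f \<gamma>']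
    bilinear_form_comb3[OF assms, of \<alpha> c \<beta> d \<beta>' e \<gamma>] by simp

lemma first_bilinear_pf_sum:
  fixes \<kappa> \<nu> w :: complex and y :: "'i \<Rightarrow> complex"
  assumes nz: "\<And>s t. s \<in> syms g \<Longrightarrow> t \<in> syms g \<Longrightarrow> c1 s = c1 t \<Longrightarrow> v s + v t \<noteq> 0"
    and w: "w * w = - 1"
  defines "d \<equiv> \<lambda>\<kappa> s. 1 - \<kappa> * v s" and "u \<equiv> \<lambda>\<kappa> s. 1 + \<kappa> * v s"
  defines "f \<equiv> \<lambda>w r. pf_sum g (pf_kernel c1 v w (twist c1 r y))"
    and "F \<equiv> \<lambda>r q. det_sum (double_exp g) (kernel_11 c1 v (twist c1 r y) (twist c1 q y))"
    and "F0 \<equiv> \<lambda>w r. det_sum (double_exp g) (\<lambda>s t. kernel_00 c1 v (twist c1 r y) y s t +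
        (if c1 s then 0 else y s) * (if c1 t then w * y t else y t))"
  shows "\<nu> * F (\<lambda>s. u \<kappa> s * u \<nu> s * d \<kappa> s) (u \<nu>) * f (- w) (\<lambda>s. u \<kappa> s * d \<nu> s)
       - \<kappa> * F (\<lambda>s. u \<kappa> s * u \<nu> s * d \<nu> s) (u \<kappa>) * f (- w) (\<lambda>s. d \<kappa> s * u \<nu> s)
       = (\<nu> - \<kappa>) * F0 w (\<lambda>s. u \<kappa> s * u \<nu> s * d \<kappa> s * d \<nu> s) * f w (\<lambda>s. u \<kappa> s * u \<nu> s)"
proof -
  define e where "e = twist c1 (\<lambda>s. u \<kappa> s * u \<nu> s) y"
  define P where "P = pf_kernel c1 v (- w) e"
  define r0 r1 r2 where "r0 = (\<lambda>s. if c1 s then y s else 0)"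
    and "r1 = (\<lambda>s. if c1 s then v s * y s else 0)" and "r2 = (\<lambda>s. if c1 s then (v s)\<^sup>2 * y s else 0)"
  define m where "m = (\<lambda>s. if c1 s then e s else - w * y s)"
  define a where "a = (\<lambda>s. if c1 s then v s * e s else 0)"
  note defs = e_def r0_def r1_def r2_def m_def a_def d_def u_def twist_def
  have nz': "v s + v t \<noteq> 0" if "s \<in> syms (scale_exp r g)" "t \<in> syms (scale_exp r g)" "c1 s = c1 t" for r s t
    using nz that by simp
  have ww: "w * w = - 1" "w * (w * x) = - x" for x
    using w by (simp_all flip: mult.assoc)
  define G where "G r h q = det_sum (double_exp (scale_exp r g)) (kernel_11 c1 v (twist c1 h y)
      (twist c1 q y))" for r h q
  define G0 where "G0 r w h = det_sum (double_exp (scale_exp r g)) (\<lambda>s t. kernel_00 c1 v (twist c1 h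
      y) y s t +
        (if c1 s then 0 else y s) * (if c1 t then w * y t else y t))" for r w h
  define p where "p r w h = pf_sum (scale_exp r g) (pf_kernel c1 v w (twist c1 h y))" for r w h
  define lhs where "lhs r = \<nu> * G r (\<lambda>s. u \<kappa> s * u \<nu> s * d \<kappa> s) (u \<nu>) * p r (- w) (\<lambda>s. u \<kappa> s * d \<nu> s)
       - \<kappa> * G r (\<lambda>s. u \<kappa> s * u \<nu> s * d \<nu> s) (u \<kappa>) * p r (- w) (\<lambda>s. d \<kappa> s * u \<nu> s)" for r
  define rhs where "rhs r = (\<nu> - \<kappa>) * G0 r w (\<lambda>s. u \<kappa> s * u \<nu> s * d \<kappa> s * d \<nu> s) * p r w (\<lambda>s. u \<kappa> s
      * u \<nu> s)" for r
  have antiP: "antisymmetric P"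
    unfolding P_def by (rule antisymmetric_pf_kernel)
  have "lhs r = rhs r" if good: "pf_good (ext_exp (scale_exp r g)) (extend P)" for r
  proof -
    obtain \<zeta> \<rho> where bil: "bilinear_form \<rho>" and anti: "\<And>\<alpha> \<beta>. \<rho> \<alpha> \<beta> = - \<rho> \<beta> \<alpha>"
      and pf: "\<And>\<alpha> \<beta>. pf_sum (scale_exp r g) (\<lambda>s t. P s t + (\<alpha> s * \<beta> t - \<beta> s * \<alpha> t)) = \<zeta> * (1 + \<rho> \<alpha> \<beta>)"
      and det: "det_form (double_exp (scale_exp r g)) P (\<zeta>\<^sup>2) \<rho>"
      using neutral_det_form[OF antiP good] by blast
    have mm: "\<rho> m m = 0"
      using antisymmetric_diag[of \<rho> m] anti unfolding antisymmetric_def by blast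
    have shifted: "p r (- w) h = \<zeta> * (1 + k * \<rho> m r1 + \<nu> * \<kappa> * \<rho> m r2)"
      if "h = (\<lambda>s. u \<kappa> s * d \<nu> s) \<and> k = \<nu> \<or> h = (\<lambda>s. d \<kappa> s * u \<nu> s) \<and> k = \<kappa>" for h k
    proof -
      have "p r (- w) h = pf_sum (scale_exp r g) (\<lambda>s t. P s t +
          (m s * (k * r1 t + \<nu> * \<kappa> * r2 t) - (k * r1 s + \<nu> * \<kappa> * r2 s) * m t))"
        unfolding p_def
      proof (rule pf_sum_cong)
        fix s t assume "s \<in> syms (scale_exp r g)" "t \<in> syms (scale_exp r g)"
        note nz'' = nz'[OF this]
        show "pf_kernel c1 v (- w) (twist c1 h y) s t = P s t +
          (m s * (k * r1 t + \<nu> * \<kappa> * r2 t) - (k * r1 s + \<nu> * \<kappa> * r2 s) * m t)"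
        proof (cases "c1 s = c1 t")
          case True
          show ?thesis
            unfolding P_def same_component_kernels[of c1, OF True] add.assoc
            by (rule half_fraction_eqI[OF nz''[OF True]])
              (use True that in \<open>elim disjE conjE; cases "c1 s"; simp add: defs ww field_simps
                  power2_eq_square\<close>)
        next
          case False
          then show ?thesis
            using that unfolding P_def pf_kernel_def
            by - (elim disjE conjE; cases "c1 s"; simp add: defs ww field_simps power2_eq_square)
        qed
      qed
      then show ?thesis
        unfolding pf bilinear_formD(2)[OF bil] by simp
    qed
    have "p r w (\<lambda>s. u \<kappa> s * u \<nu> s) = pf_sum (scale_exp r g) (\<lambda>s t. P s t +
        (m s * (1 * r0 t + (\<kappa> + \<nu>) * r1 t + \<kappa> * \<nu> * r2 t) - (1 * r0 s + (\<kappa> + \<nu>) * r1 s +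
            \<kappa> * \<nu> * r2 s) * m t))"
      unfolding p_def
    proof (rule pf_sum_cong)
      fix s t assume "s \<in> syms (scale_exp r g)" "t \<in> syms (scale_exp r g)"
      note nz'' = nz'[OF this]
      show "pf_kernel c1 v w (twist c1 (\<lambda>s. u \<kappa> s * u \<nu> s) y) s t = P s t +
        (m s * (1 * r0 t + (\<kappa> + \<nu>) * r1 t + \<kappa> * \<nu> * r2 t) - (1 * r0 s + (\<kappa> + \<nu>) * r1 s +
            \<kappa> * \<nu> * r2 s) * m t)"
      proof (cases "c1 s = c1 t")
        case True
        show ?thesis
          unfolding P_def same_component_kernels[of c1, OF True] add.assoc
          by (rule half_fraction_eqI[OF nz''[OF True]])
            (use True in \<open>cases "c1 s"; simp add: defs ww field_simps power2_eq_square\<close>)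
      next
        case False
        then show ?thesis
          unfolding P_def pf_kernel_def
          by (cases "c1 s"; simp add: defs ww field_simps power2_eq_square)
      qed
    qed
    then have p1: "p r w (\<lambda>s. u \<kappa> s * u \<nu> s) = \<zeta> * (1 + (\<rho> m r0 + (\<kappa> + \<nu>) * \<rho> m r1 + \<kappa> * \<nu> * \<rho> m r2))"
      unfolding pf bilinear_form_comb3[OF bil] by simp
    have G: "G r (\<lambda>s. u \<kappa> s * u \<nu> s * d k s) (u l) = \<zeta>\<^sup>2 * ((1 + (\<rho> m r0 + (\<kappa> + \<nu>) * \<rho> m r1 +
        \<kappa> * \<nu> * \<rho> m r2)) *
          (1 - k * \<rho> a r0 - k * l * \<rho> a r1) + (k * \<rho> m r0 + k * l * \<rho> m r1) *
          (\<rho> a r0 + (\<kappa> + \<nu>) * \<rho> a r1 + \<kappa> * \<nu> * \<rho> a r2 - \<rho> a m / 2))"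
      if "k = \<kappa> \<and> l = \<nu> \<or> k = \<nu> \<and> l = \<kappa>" for k l
    proof -
      have "G r (\<lambda>s. u \<kappa> s * u \<nu> s * d k s) (u l) = det_sum (double_exp (scale_exp r g)) (\<lambda>s t. P s t +
          m s * (1 * r0 t + (\<kappa> + \<nu>) * r1 t + \<kappa> * \<nu> * r2 t + (- 1 / 2) * m t) + a s * (- k * r0 t + -
              (k * l) * r1 t))"
        unfolding G_def
      proof (rule det_sum_cong)
        fix s t assume "s \<in> syms (double_exp (scale_exp r g))" "t \<in> syms (double_exp (scale_exp r g))"
        then have nz'': "v s + v t \<noteq> 0" if "c1 s = c1 t"
          using nz' that by simp
        show "kernel_11 c1 v (twist c1 (\<lambda>s. u \<kappa> s * u \<nu> s * d k s) y) (twist c1 (u l) y) s t = P s t +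
          m s * (1 * r0 t + (\<kappa> + \<nu>) * r1 t + \<kappa> * \<nu> * r2 t + (- 1 / 2) * m t) + a s * (- k * r0 t + -
              (k * l) * r1 t)"
        proof (cases "c1 s = c1 t")
          case True
          show ?thesis
            unfolding P_def same_component_kernels[of c1, OF True] add.assoc
            by (rule half_fraction_eqI[OF nz''[OF True]])
              (use True that in \<open>elim disjE conjE; cases "c1 s"; simp add: defs ww field_simps
                  power2_eq_square\<close>)
        next
          case False
          then show ?thesis
            using that unfolding P_def pf_kernel_def kernel_11_def
            by - (elim disjE conjE; cases "c1 s"; simp add: defs ww field_simps power2_eq_square)
        qed
      qed
      then show ?thesis
        unfolding det_formD(2)[OF det] bilinear_form_comb4[OF bil] bilinear_formD(2)[OF bil] mm by algebra
    qed
    have "G0 r w (\<lambda>s. u \<kappa> s * u \<nu> s * d \<kappa> s * d \<nu> s) = det_sum (double_exp (scale_exp r g)) (\<lambda>s t. P s t +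
          m s * ((\<kappa> + \<nu>) * r1 t + \<kappa> * \<nu> * r2 t + (- 1 / 2) * m t) + a s * (- (\<kappa> * \<nu>) * r1 t + 0 * r2 t))"
      unfolding G0_def
    proof (rule det_sum_cong)
      fix s t assume "s \<in> syms (double_exp (scale_exp r g))" "t \<in> syms (double_exp (scale_exp r g))"
      then have nz'': "v s + v t \<noteq> 0" if "c1 s = c1 t"
        using nz' that by simp
      show "kernel_00 c1 v (twist c1 (\<lambda>s. u \<kappa> s * u \<nu> s * d \<kappa> s * d \<nu> s) y) y s t +
          (if c1 s then 0 else y s) * (if c1 t then w * y t else y t) = P s t +
          m s * ((\<kappa> + \<nu>) * r1 t + \<kappa> * \<nu> * r2 t + (- 1 / 2) * m t) + a s * (- (\<kappa> * \<nu>) * r1 t + 0 * r2 t)"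
      proof (cases "c1 s = c1 t")
        case True
        show ?thesis
          unfolding P_def same_component_kernels[of c1, OF True] add.assoc
          by (rule half_fraction_add_eqI[OF nz''[OF True]])
            (use True in \<open>cases "c1 s"; simp add: defs ww field_simps power2_eq_square\<close>)
      next
        case False
        then show ?thesis
          unfolding P_def pf_kernel_def kernel_00_def
          by (cases "c1 s"; simp add: defs ww field_simps power2_eq_square)
      qed
    qed
    then have T: "G0 r w (\<lambda>s. u \<kappa> s * u \<nu> s * d \<kappa> s * d \<nu> s) =
        \<zeta>\<^sup>2 * ((1 + (\<kappa> + \<nu>) * \<rho> m r1 + \<kappa> * \<nu> * \<rho> m r2) * (1 - \<kappa> * \<nu> * \<rho> a r1) +
          \<kappa> * \<nu> * \<rho> m r1 * ((\<kappa> + \<nu>) * \<rho> a r1 + \<kappa> * \<nu> * \<rho> a r2 - \<rho> a m / 2))"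
      unfolding det_formD(2)[OF det] bilinear_form_comb3[OF bil] bilinear_formD(2)[OF bil] mm by algebra
    show ?thesis
      unfolding lhs_def rhs_def p1 T G[of \<kappa> \<nu>, simplified] G[of \<nu> \<kappa>, simplified]
        shifted[of "\<lambda>s. u \<kappa> s * d \<nu> s" \<nu>, simplified] shifted[of "\<lambda>s. d \<kappa> s * u \<nu> s" \<kappa>, simplified]
      by algebra
  qed
  moreover have "polynomial_fun lhs" "polynomial_fun rhs"
    unfolding lhs_def rhs_def G_def G0_def p_def double_exp_scale by (intro polynomial_fun_intros)+
  ultimately have "lhs 1 = rhs 1"
    by (intro neutral_generic[of lhs rhs P g] antiP)
  then show ?thesis
    unfolding lhs_def rhs_def f_def F_def F0_def G_def G0_def p_def by simp
qed

lemma last_bilinear_generic: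
  fixes \<kappa> \<nu> \<mu> w :: complex and y :: "'i \<Rightarrow> complex"
  assumes nz: "\<And>s t. s \<in> syms g \<Longrightarrow> t \<in> syms g \<Longrightarrow> c1 s = c1 t \<Longrightarrow> v s + v t \<noteq> 0"
    and w: "w * w = - 1" and \<mu>: "\<mu> \<noteq> 0"
    and nz\<mu>: "\<And>s. s \<in> syms g \<Longrightarrow> c1 s \<Longrightarrow> 1 - \<mu> * v s \<noteq> 0"
  defines "d \<equiv> \<lambda>\<kappa> s. 1 - \<kappa> * v s" and "u \<equiv> \<lambda>\<kappa> s. 1 + \<kappa> * v s"
  defines "f \<equiv> \<lambda>r. pf_sum g (pf_kernel c1 v w (twist c1 r y))"
    and "F \<equiv> \<lambda>r q. det_sum (double_exp g)
        (kernel_00 c1 v (twist c1 (\<lambda>s. r s / d \<mu> s) y) (twist c1 (\<lambda>s. q s * u \<mu> s) y))"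
    and "F0 \<equiv> \<lambda>r. det_sum (double_exp g)
        (\<lambda>s t. kernel_00 c1 v (twist c1 (\<lambda>s. r s / d \<mu> s) y) (twist c1 (u \<mu>) y) s t +
          (if c1 s then 0 else y s) * (if c1 t then w * (\<kappa> * \<nu> / \<mu>) * v t * u \<mu> t * y t else 0))"
  shows "\<nu> * (\<mu> - \<kappa>) * F (\<lambda>s. u \<kappa> s * u \<nu> s * d \<nu> s) (u \<kappa>) * f (\<lambda>s. d \<kappa> s * u \<nu> s)
       - \<kappa> * (\<mu> - \<nu>) * F (\<lambda>s. u \<kappa> s * u \<nu> s * d \<kappa> s) (u \<nu>) * f (\<lambda>s. u \<kappa> s * d \<nu> s)
       = \<mu> * (\<nu> - \<kappa>) * F0 (\<lambda>s. u \<kappa> s * u \<nu> s * d \<kappa> s * d \<nu> s) * f (\<lambda>s. u \<kappa> s * u \<nu> s)"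
proof -
  define e where "e = twist c1 (\<lambda>s. u \<kappa> s * u \<nu> s) y"
  define P where "P = pf_kernel c1 v (- w) e"
  define r0 r1 r2 where "r0 = (\<lambda>s. if c1 s then y s else 0)"
    and "r1 = (\<lambda>s. if c1 s then v s * y s else 0)" and "r2 = (\<lambda>s. if c1 s then (v s)\<^sup>2 * y s else 0)"
  define m where "m = (\<lambda>s. if c1 s then e s else w * y s)"
  define a where "a = (\<lambda>s. if c1 s then e s / d \<mu> s else 0)"
  note defs = r0_def r1_def r2_def m_def twist_def
  have nz': "v s + v t \<noteq> 0" if "s \<in> syms (scale_exp r g)" "t \<in> syms (scale_exp r g)" "c1 s = c1 t" for r s t
    using nz that by simp
  have ww: "w * w = - 1" "w * (w * x) = - x" for x
    using w by (simp_all flip: mult.assoc)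
  have left: "e s = d \<mu> s * a s" "twist c1 (\<lambda>s. u \<kappa> s * u \<nu> s / d \<mu> s) y s = a s"
    "twist c1 (\<lambda>s. u \<kappa> s * u \<nu> s * h s / d \<mu> s) y s = h s * a s"
    if "s \<in> syms g" "c1 s" for s h
    using nz\<mu>[OF that] that(2) by (simp_all add: a_def e_def twist_def d_def)
  have right: "e t = (if c1 t then u \<kappa> t * u \<nu> t * y t else y t)" for t
    by (simp add: e_def twist_def)
  define G where "G r h q = det_sum (double_exp (scale_exp r g))
        (kernel_00 c1 v (twist c1 (\<lambda>s. h s / d \<mu> s) y) (twist c1 (\<lambda>s. q s * u \<mu> s) y))" for r h q
  define G0 where "G0 r h = det_sum (double_exp (scale_exp r g))
        (\<lambda>s t. kernel_00 c1 v (twist c1 (\<lambda>s. h s / d \<mu> s) y) (twist c1 (u \<mu>) y) s t +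
          (if c1 s then 0 else y s) * (if c1 t then w * (\<kappa> * \<nu> / \<mu>) * v t * u \<mu> t * y t else 0))" for r h
  define p where "p r h = pf_sum (scale_exp r g) (pf_kernel c1 v w (twist c1 h y))" for r h
  define lhs where "lhs r = \<nu> * (\<mu> - \<kappa>) * G r (\<lambda>s. u \<kappa> s * u \<nu> s * d \<nu> s) (u \<kappa>) * p r (\<lambda>s. d \<kappa> s * u \<nu> s)
       - \<kappa> * (\<mu> - \<nu>) * G r (\<lambda>s. u \<kappa> s * u \<nu> s * d \<kappa> s) (u \<nu>) * p r (\<lambda>s. u \<kappa> s * d \<nu> s)" for r
  define rhs where "rhs r = \<mu> * (\<nu> - \<kappa>) * G0 r (\<lambda>s. u \<kappa> s * u \<nu> s * (d \<kappa> s * d \<nu> s)) * p r (\<lambda>s. u \<kappa>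
      s * u \<nu> s)" for r
  have antiP: "antisymmetric P"
    unfolding P_def by (rule antisymmetric_pf_kernel)
  have "lhs r = rhs r" if good: "pf_good (ext_exp (scale_exp r g)) (extend P)" for r
  proof -
    obtain \<zeta> \<rho> where bil: "bilinear_form \<rho>" and anti: "\<And>\<alpha> \<beta>. \<rho> \<alpha> \<beta> = - \<rho> \<beta> \<alpha>"
      and pf: "\<And>\<alpha> \<beta>. pf_sum (scale_exp r g) (\<lambda>s t. P s t + (\<alpha> s * \<beta> t - \<beta> s * \<alpha> t)) = \<zeta> * (1 + \<rho> \<alpha> \<beta>)"
      and det: "det_form (double_exp (scale_exp r g)) P (\<zeta>\<^sup>2) \<rho>"
      using neutral_det_form[OF antiP good] by blast
    have mm: "\<rho> m m = 0"
      using antisymmetric_diag[of \<rho> m] anti unfolding antisymmetric_def by blast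
    have shifted: "p r h = \<zeta> * (1 - \<rho> m r0 - k * \<rho> m r1)"
      if "h = (\<lambda>s. u \<kappa> s * d \<nu> s) \<and> k = \<kappa> \<or> h = (\<lambda>s. d \<kappa> s * u \<nu> s) \<and> k = \<nu>" for h k
    proof -
      have "p r h = pf_sum (scale_exp r g) (\<lambda>s t. P s t +
          (m s * (- 1 * r0 t + - k * r1 t) - (- 1 * r0 s + - k * r1 s) * m t))"
        unfolding p_def
      proof (rule pf_sum_cong)
        fix s t assume "s \<in> syms (scale_exp r g)" "t \<in> syms (scale_exp r g)"
        note nz'' = nz'[OF this]
        show "pf_kernel c1 v w (twist c1 h y) s t = P s t +
          (m s * (- 1 * r0 t + - k * r1 t) - (- 1 * r0 s + - k * r1 s) * m t)"
        proof (cases "c1 s = c1 t")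
          case True
          show ?thesis
            unfolding P_def same_component_kernels[of c1, OF True] add.assoc
            by (rule half_fraction_eqI[OF nz''[OF True]])
              (use True that in \<open>elim disjE conjE; cases "c1 s"; simp add: right defs d_def u_def ww
                  field_simps power2_eq_square\<close>)
        next
          case False
          then show ?thesis
            using that unfolding P_def pf_kernel_def
            by - (elim disjE conjE; cases "c1 s"; simp add: right defs d_def u_def ww field_simps
                power2_eq_square)
        qed
      qed
      then show ?thesis
        unfolding pf bilinear_formD(2)[OF bil] by simp
    qed
    have "p r (\<lambda>s. u \<kappa> s * u \<nu> s) = pf_sum (scale_exp r g) (\<lambda>s t. P s t +
        (m s * (- 1 * r0 t + - (\<kappa> + \<nu>) * r1 t + - (\<kappa> * \<nu>) * r2 t) -
         (- 1 * r0 s + - (\<kappa> + \<nu>) * r1 s + - (\<kappa> * \<nu>) * r2 s) * m t))"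
      unfolding p_def
    proof (rule pf_sum_cong)
      fix s t assume "s \<in> syms (scale_exp r g)" "t \<in> syms (scale_exp r g)"
      note nz'' = nz'[OF this]
      show "pf_kernel c1 v w (twist c1 (\<lambda>s. u \<kappa> s * u \<nu> s) y) s t = P s t +
        (m s * (- 1 * r0 t + - (\<kappa> + \<nu>) * r1 t + - (\<kappa> * \<nu>) * r2 t) -
         (- 1 * r0 s + - (\<kappa> + \<nu>) * r1 s + - (\<kappa> * \<nu>) * r2 s) * m t)"
      proof (cases "c1 s = c1 t")
        case True
        show ?thesis
          unfolding P_def same_component_kernels[of c1, OF True] add.assoc
          by (rule half_fraction_eqI[OF nz''[OF True]])
            (use True in \<open>cases "c1 s"; simp add: right defs d_def u_def ww field_simps power2_eq_square\<close>)
      next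
        case False
        then show ?thesis
          unfolding P_def pf_kernel_def
          by (cases "c1 s"; simp add: right defs d_def u_def ww field_simps power2_eq_square)
      qed
    qed
    then have p1: "p r (\<lambda>s. u \<kappa> s * u \<nu> s) = \<zeta> * (1 - (\<rho> m r0 + (\<kappa> + \<nu>) * \<rho> m r1 + \<kappa> * \<nu> * \<rho> m r2))"
      unfolding pf bilinear_form_comb3[OF bil] by (simp add: algebra_simps)
    have G: "G r (\<lambda>s. u \<kappa> s * u \<nu> s * d k s) (u l) = \<zeta>\<^sup>2 * ((1 - (\<rho> m r0 + (\<kappa> + \<nu>) * \<rho> m r1 +
        \<kappa> * \<nu> * \<rho> m r2)) *
          (1 - (\<mu> - k) * (\<rho> a r1 + l * \<rho> a r2)) + (\<mu> - k) * (\<rho> m r1 + l * \<rho> m r2) *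
          (\<rho> a m / 2 - (\<rho> a r0 + (\<kappa> + \<nu>) * \<rho> a r1 + \<kappa> * \<nu> * \<rho> a r2)))"
      if "k = \<kappa> \<and> l = \<nu> \<or> k = \<nu> \<and> l = \<kappa>" for k l
    proof -
      have "G r (\<lambda>s. u \<kappa> s * u \<nu> s * d k s) (u l) = det_sum (double_exp (scale_exp r g)) (\<lambda>s t. P s t +
          m s * (- 1 * r0 t + - (\<kappa> + \<nu>) * r1 t + - (\<kappa> * \<nu>) * r2 t + (1 / 2) * m t) +
          a s * (- (\<mu> - k) * r1 t + - ((\<mu> - k) * l) * r2 t))"
        unfolding G_def
      proof (rule det_sum_cong)
        fix s t assume st: "s \<in> syms (double_exp (scale_exp r g))" "t \<in> syms (double_exp (scale_exp r g))"
        then have nz'': "v s + v t \<noteq> 0" if "c1 s = c1 t"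
          using nz' that by simp
        have s: "s \<in> syms g"
          using st by simp
        show "kernel_00 c1 v (twist c1 (\<lambda>s. u \<kappa> s * u \<nu> s * d k s / d \<mu> s) y) (twist c1 (\<lambda>s. u l s *
            u \<mu> s) y) s t = P s t +
          m s * (- 1 * r0 t + - (\<kappa> + \<nu>) * r1 t + - (\<kappa> * \<nu>) * r2 t + (1 / 2) * m t) +
          a s * (- (\<mu> - k) * r1 t + - ((\<mu> - k) * l) * r2 t)"
        proof (cases "c1 s")
          case s1: True
          note l = left[OF s s1]
          show ?thesis
          proof (cases "c1 t")
            case True
            then have st: "c1 s = c1 t"
              using s1 by simp
            show ?thesis
              unfolding P_def same_component_kernels[of c1, OF st] add.assoc l
              by (rule half_fraction_eqI[OF nz''[OF st]])
                (use True s1 that in \<open>elim disjE conjE; simp add: l right[of t] defs d_def u_def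
                    field_simps power2_eq_square\<close>)
          next
            case False
            then show ?thesis
              using s1 by (simp add: P_def pf_kernel_def kernel_00_def defs right[of t])
          qed
        next
          case False
          then have "a s = 0" "e s = y s" "m s = w * y s" "twist c1 h y s = y s" for h
            by (simp_all add: a_def e_def twist_def m_def)
          note s2 = this
          show ?thesis
          proof (cases "c1 t")
            case True
            with False show ?thesis
              unfolding s2 by (simp add: P_def pf_kernel_def kernel_00_def defs s2 right[of t] u_def
                  field_simps power2_eq_square)
          next
            case t: False
            then have st: "c1 s = c1 t"
              using False by simp
            show ?thesis
              unfolding P_def same_component_kernels[of c1, OF st] add.assoc s2
              by (rule half_fraction_eqI[OF nz''[OF st]])
                (use t False in \<open>simp add: right[of t] defs ww field_simps\<close>)
          qed
        qed
      qed
      then show ?thesis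
        unfolding det_formD(2)[OF det] bilinear_form_comb4[OF bil] bilinear_formD(2)[OF bil] mm
        by (simp add: algebra_simps)
    qed
    have "G0 r (\<lambda>s. u \<kappa> s * u \<nu> s * (d \<kappa> s * d \<nu> s)) = det_sum (double_exp (scale_exp r g)) (\<lambda>s t. P s t +
          m s * (- 1 * r0 t + (\<kappa> * \<nu> / \<mu> - (\<kappa> + \<nu>)) * r1 t + (1 / 2) * m t) +
          a s * (- (\<mu> - \<kappa> - \<nu> + \<kappa> * \<nu> / \<mu>) * r1 t + 0 * r2 t))"
      unfolding G0_def
    proof (rule det_sum_cong)
      fix s t assume st: "s \<in> syms (double_exp (scale_exp r g))" "t \<in> syms (double_exp (scale_exp r g))"
      then have nz'': "v s + v t \<noteq> 0" if "c1 s = c1 t"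
        using nz' that by simp
      have s: "s \<in> syms g"
        using st by simp
      show "kernel_00 c1 v (twist c1 (\<lambda>s. u \<kappa> s * u \<nu> s * (d \<kappa> s * d \<nu> s) / d \<mu> s) y) (twist c1 (u
          \<mu>) y) s t +
          (if c1 s then 0 else y s) * (if c1 t then w * (\<kappa> * \<nu> / \<mu>) * v t * u \<mu> t * y t else 0) = P s t +
          m s * (- 1 * r0 t + (\<kappa> * \<nu> / \<mu> - (\<kappa> + \<nu>)) * r1 t + (1 / 2) * m t) +
          a s * (- (\<mu> - \<kappa> - \<nu> + \<kappa> * \<nu> / \<mu>) * r1 t + 0 * r2 t)"
      proof (cases "c1 s")
        case s1: True
        note l = left[OF s s1]
        show ?thesis
        proof (cases "c1 t")
          case True
          then have st: "c1 s = c1 t"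
            using s1 by simp
          show ?thesis
            unfolding P_def same_component_kernels[of c1, OF st] add.assoc l
            by (rule half_fraction_add_eqI[OF nz''[OF st]])
              (use True s1 \<mu> in \<open>simp add: l right[of t] defs d_def u_def field_simps power2_eq_square\<close>)
        next
          case False
          then show ?thesis
            using s1 by (simp add: P_def pf_kernel_def kernel_00_def defs right[of t])
        qed
      next
        case False
        then have "a s = 0" "e s = y s" "m s = w * y s" "twist c1 h y s = y s" for h
          by (simp_all add: a_def e_def twist_def m_def)
        note s2 = this
        show ?thesis
        proof (cases "c1 t")
          case True
          with False \<mu> show ?thesis
            unfolding s2 by (simp add: P_def pf_kernel_def kernel_00_def defs s2 right[of t] u_def
                field_simps power2_eq_square)
        next
          case t: False
          then have st: "c1 s = c1 t"
            using False by simp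
          show ?thesis
            unfolding P_def same_component_kernels[of c1, OF st] add.assoc s2
            by (rule half_fraction_add_eqI[OF nz''[OF st]])
              (use t False in \<open>simp add: right[of t] defs ww field_simps\<close>)
        qed
      qed
    qed
    then have T: "G0 r (\<lambda>s. u \<kappa> s * u \<nu> s * (d \<kappa> s * d \<nu> s)) =
        \<zeta>\<^sup>2 * ((1 - \<rho> m r0 + (\<kappa> * \<nu> / \<mu> - (\<kappa> + \<nu>)) * \<rho> m r1) * (1 - (\<mu> - \<kappa> - \<nu> + \<kappa> * \<nu> / \<mu>) * \<rho> a r1) +
          (\<mu> - \<kappa> - \<nu> + \<kappa> * \<nu> / \<mu>) * \<rho> m r1 *
          (\<rho> a m / 2 - \<rho> a r0 + (\<kappa> * \<nu> / \<mu> - (\<kappa> + \<nu>)) * \<rho> a r1))"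
      unfolding det_formD(2)[OF det] bilinear_form_comb3[OF bil] bilinear_formD(2)[OF bil] mm
      by (simp add: algebra_simps)
    have "\<mu> * G0 r (\<lambda>s. u \<kappa> s * u \<nu> s * (d \<kappa> s * d \<nu> s)) = \<zeta>\<^sup>2 *
        (\<mu> * (1 - \<rho> m r0 - \<mu> * \<rho> m r1) - (\<mu> - \<kappa>) * (\<mu> - \<nu>) * (1 - \<rho> m r0 - \<mu> * \<rho> m r1) * \<rho> a r1 +
         (\<mu> - \<kappa>) * (\<mu> - \<nu>) * \<rho> m r1 * (1 + \<rho> a m / 2 - \<rho> a r0 - \<mu> * \<rho> a r1))"
      unfolding T using \<mu> by (simp add: field_simps power2_eq_square)
    note T' = this
    have rhs': "rhs r = (\<nu> - \<kappa>) * (\<mu> * G0 r (\<lambda>s. u \<kappa> s * u \<nu> s * (d \<kappa> s * d \<nu> s))) * p r (\<lambda>s. u \<kappa> s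
        * u \<nu> s)"
      by (simp add: rhs_def)
    define b where "b = \<rho> a m / 2"
    show ?thesis
      unfolding lhs_def rhs' T' p1 G[of \<kappa> \<nu>, simplified] G[of \<nu> \<kappa>, simplified]
        shifted[of "\<lambda>s. u \<kappa> s * d \<nu> s" \<kappa>, simplified] shifted[of "\<lambda>s. d \<kappa> s * u \<nu> s" \<nu>, simplified]
        b_def[symmetric]
      by algebra
  qed
  moreover have "polynomial_fun lhs" "polynomial_fun rhs"
    unfolding lhs_def rhs_def G_def G0_def p_def double_exp_scale by (intro polynomial_fun_intros)+
  ultimately have "lhs 1 = rhs 1"
    by (intro neutral_generic[of lhs rhs P g] antiP)
  then show ?thesis
    unfolding lhs_def rhs_def f_def F_def F0_def G_def G0_def p_def by (simp add: mult.assoc)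
qed

section \<open>Operators on Fock space\<close>

definition fin_supp :: "fock \<Rightarrow> bool" where
  "fin_supp v \<longleftrightarrow> finite {D. v D \<noteq> 0} \<and> (\<forall>D. v D \<noteq> 0 \<longrightarrow> finite D)"

fun mode_label :: "mode \<Rightarrow> nat \<times> int" where
  "mode_label (Psi c j) = (c, j)"
| "mode_label (PsiStar c j) = (c, j)"

fun annihilator :: "mode \<Rightarrow> bool" where
  "annihilator (Psi c j) \<longleftrightarrow> j < 0"
| "annihilator (PsiStar c j) \<longleftrightarrow> j \<ge> 0"

abbreviation flip :: "'a \<Rightarrow> 'a set \<Rightarrow> 'a set" where
  "flip m D \<equiv> sym_diff D {m}"

lemma flip_flip [simp]: "flip m (flip m D) = D"
  by auto

lemma sym_diff_flip_flip:
  assumes "x \<noteq> y"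
  shows "sym_diff D (flip y (flip x D)) = {x, y}"
proof (rule set_eqI)
  show "z \<in> sym_diff D (flip y (flip x D)) \<longleftrightarrow> z \<in> {x, y}" for z
    using assms by (cases "z = x"; cases "z = y"; cases "z \<in> D") simp_all
qed

lemma op_eq_flip: "\<exists>z. \<forall>v. op a v D = z * v (flip (mode_label a) D)"
proof -
  have "\<exists>z. \<forall>v. excite m v D = z * v (flip m D)" for m
  proof (cases "m \<in> D")
    case True
    then have "flip m D = D - {m}"
      by blast
    then show ?thesis
      using True by (auto simp: excite_def)
  qed (auto simp: excite_def intro: exI[of _ 0])
  moreover have "\<exists>z. \<forall>v. relax m v D = z * v (flip m D)" for m
  proof (cases "m \<in> D")
    case False
    then have "flip m D = insert m D"
      by blast
    then show ?thesis
      using False by (auto simp: relax_def)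
  qed (auto simp: relax_def intro: exI[of _ 0])
  ultimately show ?thesis
    by (cases a) auto
qed

lemma op_nonzeroD: "op a v D \<noteq> 0 \<Longrightarrow> v (flip (mode_label a) D) \<noteq> 0"
  using op_eq_flip[of a D] by auto

lemma fin_supp_op:
  assumes "fin_supp v"
  shows "fin_supp (op a v)"
proof -
  have "{D. op a v D \<noteq> 0} \<subseteq> flip (mode_label a) ` {D. v D \<noteq> 0}"
  proof
    fix D assume "D \<in> {D. op a v D \<noteq> 0}"
    then have "flip (mode_label a) D \<in> {D. v D \<noteq> 0}"
      using op_nonzeroD by simp
    then show "D \<in> flip (mode_label a) ` {D. v D \<noteq> 0}"
      by (rule image_eqI[rotated]) (rule flip_flip[symmetric])
  qed
  moreover have "finite D" if "op a v D \<noteq> 0" for D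
  proof -
    have "finite (flip (mode_label a) D)"
      using op_nonzeroD[OF that] assms unfolding fin_supp_def by blast
    then have "finite (insert (mode_label a) (flip (mode_label a) D))"
      by simp
    moreover have "D \<subseteq> insert (mode_label a) (flip (mode_label a) D)"
      by blast
    ultimately show ?thesis
      by (rule finite_subset[rotated])
  qed
  ultimately show ?thesis
    using assms unfolding fin_supp_def by (meson finite_imageI finite_subset)
qed

lemma op_linear: "op a (\<lambda>D. x * v D + y * w D) D = x * op a v D + y * op a w D"
  using op_eq_flip[of a D] by (auto simp: algebra_simps)

lemma op_zero [simp]: "op a (\<lambda>_. 0) = (\<lambda>_. 0)"
proof
  show "op a (\<lambda>_. 0) D = 0" for D
    using op_eq_flip[of a D] by auto
qed

lemma op_linear': "op a (\<lambda>D. x * v D + w D) D = x * op a v D + op a w D"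
  using op_linear[of a x v 1 w D] by simp

lemma fin_supp_zero: "fin_supp (\<lambda>_. 0)"
  by (simp add: fin_supp_def)

lemma fin_supp_vac: "fin_supp vac"
  by (auto simp: fin_supp_def vac_def)

lemma fin_supp_linear:
  assumes "fin_supp v" "fin_supp w"
  shows "fin_supp (\<lambda>D. x * v D + y * w D)"
proof -
  have "{D. x * v D + y * w D \<noteq> 0} \<subseteq> {D. v D \<noteq> 0} \<union> {D. w D \<noteq> 0}"
    by auto
  then show ?thesis
    using assms unfolding fin_supp_def by (auto intro: finite_subset)
qed

lemma fin_supp_scale: "fin_supp v \<Longrightarrow> fin_supp (\<lambda>D. x * v D)"
  using fin_supp_linear[of v v x 0] by simp

lemma fin_supp_add: "fin_supp v \<Longrightarrow> fin_supp w \<Longrightarrow> fin_supp (\<lambda>D. v D + w D)"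
  using fin_supp_linear[of v w 1 1] by simp

lemma fin_supp_sum: "(\<And>i. i \<in> A \<Longrightarrow> fin_supp (v i)) \<Longrightarrow> fin_supp (\<lambda>D. \<Sum>i\<in>A. v i D)"
  by (induction A rule: infinite_finite_induct) (auto simp: fin_supp_zero intro: fin_supp_add)

lemma lop_Nil [simp]: "lop [] v = (\<lambda>_. 0)"
  and lop_Cons: "lop ((z, m) # A) v D = z * op m v D + lop A v D"
  by (simp_all add: lop_def fun_eq_iff)

lemma lop_single: "lop [(1, m)] v = op m v"
  by (auto simp: fun_eq_iff lop_Cons)

lemma fin_supp_lop: "fin_supp v \<Longrightarrow> fin_supp (lop A v)"
proof (induction A)
  case (Cons c A)
  obtain z m where c: "c = (z, m)"
    by (cases c)
  have "lop (c # A) v = (\<lambda>D. z * op m v D + lop A v D)"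
    by (simp add: c lop_Cons fun_eq_iff)
  then show ?case
    using Cons by (simp add: fin_supp_add fin_supp_scale fin_supp_op)
qed (simp add: fin_supp_zero)

lemma lop_linear: "lop A (\<lambda>D. x * v D + y * w D) D = x * lop A v D + y * lop A w D"
  by (induction A) (auto simp: lop_Cons op_linear algebra_simps)

lemma lop_zero [simp]: "lop A (\<lambda>_. 0) = (\<lambda>_. 0)"
  by (induction A) (auto simp: lop_Cons fun_eq_iff)

lemma lop_scale: "lop A (\<lambda>D. x * v D) D = x * lop A v D"
  using lop_linear[of A x v 0 v D] by simp

lemma lop_sum: "lop A (\<lambda>D. \<Sum>i\<in>S. c i * v i D) D = (\<Sum>i\<in>S. c i * lop A (v i) D)"
proof (induction S rule: infinite_finite_induct)
  case (insert i S)
  then show ?case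
    using lop_linear[of A "c i" "v i" 1 "\<lambda>D. \<Sum>i\<in>S. c i * v i D" D] by simp
qed auto

lemma op_anticommute':
  assumes "fin_supp v"
  shows "op a (op b v) D + op b (op a v) D = bracket a b * v D"
proof (cases "finite D")
  case False
  then show ?thesis
    using fin_supp_op[OF fin_supp_op[OF assms]] assms unfolding fin_supp_def by (metis add_0
        mult_zero_right)
qed (rule op_anticommute)

definition lin_bracket :: "lin \<Rightarrow> lin \<Rightarrow> complex" where
  "lin_bracket A B = (\<Sum>(z, a)\<leftarrow>A. \<Sum>(w, b)\<leftarrow>B. z * w * bracket a b)"

lemma lin_bracket_Nil [simp]: "lin_bracket [] B = 0" "lin_bracket A [] = 0"
  by (simp_all add: lin_bracket_def case_prod_unfold)

lemma lin_bracket_Cons: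
  "lin_bracket ((z, a) # A) B = (\<Sum>(w, b)\<leftarrow>B. z * w * bracket a b) + lin_bracket A B"
  by (simp add: lin_bracket_def)

lemma op_lop_anticommute:
  assumes "fin_supp v"
  shows "z * op a (lop B v) D + lop B (\<lambda>D. z * op a v D) D = (\<Sum>(w, b)\<leftarrow>B. z * w * bracket a b) * v D"
proof (induction B)
  case (Cons c B)
  obtain w b where c: "c = (w, b)"
    by (cases c)
  have "lop (c # B) v = (\<lambda>D. w * op b v D + lop B v D)"
    by (simp add: c lop_Cons fun_eq_iff)
  then have "op a (lop (c # B) v) D = w * op a (op b v) D + op a (lop B v) D"
    by (simp add: op_linear')
  moreover have "op b (\<lambda>D. z * op a v D) D = z * op b (op a v) D"
    using op_linear[of b z "op a v" 0 "op a v" D] by simp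
  then have "lop (c # B) (\<lambda>D. z * op a v D) D = w * (z * op b (op a v) D) + lop B (\<lambda>D. z * op a v D) D"
    by (simp add: c lop_Cons)
  moreover have "op a (op b v) D = bracket a b * v D - op b (op a v) D"
    using op_anticommute'[OF assms, of a b D] by (simp add: algebra_simps)
  ultimately have "z * op a (lop (c # B) v) D + lop (c # B) (\<lambda>D. z * op a v D) D =
      z * w * bracket a b * v D + (z * op a (lop B v) D + lop B (\<lambda>D. z * op a v D) D)"
    by (simp only:) (simp add: algebra_simps)
  then show ?case
    unfolding Cons by (simp add: c algebra_simps)
qed simp

lemma lop_anticommute:
  assumes "fin_supp v"
  shows "lop A (lop B v) D + lop B (lop A v) D = lin_bracket A B * v D"
proof (induction A)
  case (Cons c A)
  obtain z a where c: "c = (z, a)"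
    by (cases c)
  have "lop (c # A) v = (\<lambda>D. 1 * (z * op a v D) + 1 * lop A v D)"
    by (simp add: c lop_Cons fun_eq_iff)
  then have B: "lop B (lop (c # A) v) D = lop B (\<lambda>D. z * op a v D) D + lop B (lop A v) D"
    by (simp only: lop_linear) simp
  have "lop (c # A) (lop B v) D = z * op a (lop B v) D + lop A (lop B v) D"
    by (simp add: c lop_Cons)
  then have "lop (c # A) (lop B v) D + lop B (lop (c # A) v) D =
      (z * op a (lop B v) D + lop B (\<lambda>D. z * op a v D) D) + (lop A (lop B v) D + lop B (lop A v) D)"
    unfolding B by simp
  then show ?case
    unfolding Cons op_lop_anticommute[OF assms, of z a B D]
    by (simp add: c lin_bracket_Cons algebra_simps)
qed simp

lemma op_creator_at_empty: "\<not> annihilator a \<Longrightarrow> op a v {} = 0"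
  by (cases a) (auto simp: excite_def)

lemma op_annihilator_vac: "annihilator a \<Longrightarrow> op a vac = (\<lambda>_. 0)"
  by (cases a) (simp_all only: vac_conditions annihilator.simps)

lemma op_op_vac: "op a (op b vac) {} = (if annihilator a then bracket a b else 0)"
proof (cases "annihilator a")
  case True
  then show ?thesis
    using op_anticommute'[OF fin_supp_vac, of a b "{}"]
    by (simp add: op_annihilator_vac vac_conditions)
qed (simp add: op_creator_at_empty)

lemma lop_lop_vac:
  "lop A (lop B vac) {} = (\<Sum>(z, a)\<leftarrow>A. \<Sum>(w, b)\<leftarrow>B. if annihilator a then z * w * bracket a b else 0)"
proof -
  have *: "op a (lop B vac) {} = (\<Sum>(w, b)\<leftarrow>B. if annihilator a then w * bracket a b else 0)" for a
  proof (induction B)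
    case (Cons c B)
    obtain w b where c: "c = (w, b)"
      by (cases c)
    have "lop (c # B) vac = (\<lambda>D. w * op b vac D + lop B vac D)"
      by (simp add: c lop_Cons fun_eq_iff)
    then have "op a (lop (c # B) vac) {} = w * op a (op b vac) {} + op a (lop B vac) {}"
      by (simp add: op_linear')
    then show ?case
      using Cons by (simp add: c op_op_vac)
  qed simp
  have **: "z * (\<Sum>(w, b)\<leftarrow>B. if annihilator a then w * bracket a b else 0) =
      (\<Sum>(w, b)\<leftarrow>B. if annihilator a then z * w * bracket a b else 0)" for z a
    by (induction B) (auto simp: algebra_simps)
  show ?thesis
    by (induction A) (auto simp: lop_Cons * **)
qed

definition quadratic :: "('t \<Rightarrow> complex) \<Rightarrow> ('t \<Rightarrow> lin) \<Rightarrow> ('t \<Rightarrow> lin) \<Rightarrow> 't set \<Rightarrow> fock \<Rightarrow> fock" where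
  "quadratic \<kappa> A B T v D = (\<Sum>\<^sub>\<infinity>t\<in>T. \<kappa> t * lop (A t) (lop (B t) v) D)"

definition locally_finite :: "('t \<Rightarrow> lin) \<Rightarrow> ('t \<Rightarrow> lin) \<Rightarrow> 't set \<Rightarrow> bool" where
  "locally_finite A B T \<longleftrightarrow> (\<forall>v D. fin_supp v \<longrightarrow> finite {t\<in>T. lop (A t) (lop (B t) v) D \<noteq> 0})"

lemma finite_support_summable:
  fixes f :: "'t \<Rightarrow> complex"
  assumes "finite {t\<in>T. f t \<noteq> 0}"
  shows "f summable_on T"
  using assms by (rule finite_nonzero_values_imp_summable_on)

lemma locally_finite_summable:
  assumes "locally_finite A B T" "fin_supp v"
  shows "(\<lambda>t. \<kappa> t * lop (A t) (lop (B t) v) D) summable_on T"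
proof (rule finite_support_summable)
  show "finite {t\<in>T. \<kappa> t * lop (A t) (lop (B t) v) D \<noteq> 0}"
    using assms unfolding locally_finite_def
    by (auto intro: finite_subset[of _ "{t\<in>T. lop (A t) (lop (B t) v) D \<noteq> 0}"])
qed

lemma quadratic_linear:
  assumes "locally_finite A B T" "fin_supp v" "fin_supp w"
  shows "quadratic \<kappa> A B T (\<lambda>D. x * v D + y * w D) D = x * quadratic \<kappa> A B T v D + y * quadratic \<kappa> A
      B T w D"
proof -
  have "lop (B t) (\<lambda>D. x * v D + y * w D) = (\<lambda>D. x * lop (B t) v D + y * lop (B t) w D)" for t
    by (auto simp: lop_linear)
  then have "quadratic \<kappa> A B T (\<lambda>D. x * v D + y * w D) D =
      (\<Sum>\<^sub>\<infinity>t\<in>T. x * (\<kappa> t * lop (A t) (lop (B t) v) D) + y * (\<kappa> t * lop (A t) (lop (B t) w) D))"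
    unfolding quadratic_def by (simp add: lop_linear algebra_simps)
  also have "\<dots> = (\<Sum>\<^sub>\<infinity>t\<in>T. x * (\<kappa> t * lop (A t) (lop (B t) v) D)) +
      (\<Sum>\<^sub>\<infinity>t\<in>T. y * (\<kappa> t * lop (A t) (lop (B t) w) D))"
    using assms by (intro infsum_add summable_on_cmult_right locally_finite_summable)
  finally show ?thesis
    by (simp add: quadratic_def infsum_cmult_right')
qed

lemma lop_infsum:
  assumes "\<And>D. (\<lambda>t. f t D) summable_on T"
  shows "lop C (\<lambda>D. \<Sum>\<^sub>\<infinity>t\<in>T. f t D) D = (\<Sum>\<^sub>\<infinity>t\<in>T. lop C (f t) D) \<and> (\<lambda>t. lop C (f t) D) summable_on T"
proof (induction C)
  case (Cons c C)
  obtain z m where c: "c = (z, m)"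
    by (cases c)
  obtain z' where z': "\<And>v. op m v D = z' * v (flip (mode_label m) D)"
    using op_eq_flip[of m D] by auto
  have "(\<lambda>t. z * op m (f t) D) summable_on T"
    unfolding z' using assms by (intro summable_on_cmult_right)
  moreover have "z * op m (\<lambda>D. \<Sum>\<^sub>\<infinity>t\<in>T. f t D) D = (\<Sum>\<^sub>\<infinity>t\<in>T. z * op m (f t) D)"
    unfolding z' by (simp add: infsum_cmult_right')
  ultimately show ?case
    using Cons by (simp add: c lop_Cons infsum_add summable_on_add)
qed simp

lemma quadratic_commute:
  assumes fin: "locally_finite A B T" and v: "fin_supp v"
  shows "quadratic \<kappa> A B T (lop C v) D = lop C (quadratic \<kappa> A B T v) D +
    (\<Sum>\<^sub>\<infinity>t\<in>T. \<kappa> t * (lin_bracket (B t) C * lop (A t) v D - lin_bracket (A t) C * lop (B t) v D))"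
proof -
  let ?R = "\<lambda>t. \<kappa> t * (lin_bracket (B t) C * lop (A t) v D - lin_bracket (A t) C * lop (B t) v D)"
  have step: "\<kappa> t * lop (A t) (lop (B t) (lop C v)) D = lop C (\<lambda>D. \<kappa> t * lop (A t) (lop (B t) v) D)
      D + ?R t" for t
  proof -
    have "lop (B t) (lop C v) = (\<lambda>D. lin_bracket (B t) C * v D + - 1 * lop C (lop (B t) v) D)"
      using lop_anticommute[OF v, of "B t" C] by (simp add: fun_eq_iff algebra_simps)
    then have "lop (A t) (lop (B t) (lop C v)) D = lin_bracket (B t) C * lop (A t) v D -
        lop (A t) (lop C (lop (B t) v)) D"
      by (simp only: lop_linear) simp
    also have "lop (A t) (lop C (lop (B t) v)) D = lin_bracket (A t) C * lop (B t) v D -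
        lop C (lop (A t) (lop (B t) v)) D"
      using lop_anticommute[OF fin_supp_lop[OF v], of "A t" C "B t" D] by (simp add: algebra_simps)
    finally have "lop (A t) (lop (B t) (lop C v)) D = lin_bracket (B t) C * lop (A t) v D -
        (lin_bracket (A t) C * lop (B t) v D - lop C (lop (A t) (lop (B t) v)) D)" .
    then show ?thesis
      unfolding lop_scale by (simp only:) (simp add: algebra_simps)
  qed
  have sum1: "(\<lambda>t. \<kappa> t * lop (A t) (lop (B t) v) D) summable_on T" for D
    using fin v by (rule locally_finite_summable)
  have sum2: "(\<lambda>t. \<kappa> t * lop (A t) (lop (B t) (lop C v)) D) summable_on T"
    using fin fin_supp_lop[OF v] by (rule locally_finite_summable)
  note C = lop_infsum[of "\<lambda>t D. \<kappa> t * lop (A t) (lop (B t) v) D" T C D, OF sum1]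
  have "?R summable_on T"
    using summable_on_add[OF sum2 summable_on_uminus[THEN iffD2, OF C[THEN conjunct2]]] unfolding
        step by simp
  then have "quadratic \<kappa> A B T (lop C v) D =
      (\<Sum>\<^sub>\<infinity>t\<in>T. lop C (\<lambda>D. \<kappa> t * lop (A t) (lop (B t) v) D) D) + infsum ?R T"
    unfolding quadratic_def step using C by (intro infsum_add) auto
  moreover have "quadratic \<kappa> A B T v = (\<lambda>D. \<Sum>\<^sub>\<infinity>t\<in>T. \<kappa> t * lop (A t) (lop (B t) v) D)"
    by (auto simp: quadratic_def)
  ultimately show ?thesis
    using C by simp
qed

lemma locally_finiteI:
  assumes A: "\<And>t. t \<in> T \<Longrightarrow> snd ` set (A t) \<subseteq> {m. mode_label m \<in> L (p t)}"
    and B: "\<And>t. t \<in> T \<Longrightarrow> snd ` set (B t) \<subseteq> {m. mode_label m \<in> L (q t)}"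
    and disj: "\<And>t. t \<in> T \<Longrightarrow> L (p t) \<inter> L (q t) = {}"
    and fin: "\<And>F. finite F \<Longrightarrow> finite {i. L i \<inter> F \<noteq> {}}"
    and inj: "inj_on (\<lambda>t. (p t, q t)) T"
  shows "locally_finite A B T"
  unfolding locally_finite_def
proof (intro allI impI)
  fix v D assume v: "fin_supp v"
  define F where "F = (\<Union>S\<in>{S. v S \<noteq> 0}. if finite (sym_diff D S) then sym_diff D S else {})"
  have "finite F"
    unfolding F_def using v by (auto simp: fin_supp_def)
  have lopD: "\<exists>m\<in>snd ` set C. op m w D' \<noteq> 0" if "lop C w D' \<noteq> 0" for C w D'
    using that by (induction C) (auto simp: lop_Cons)
  have "(\<lambda>t. (p t, q t)) ` {t\<in>T. lop (A t) (lop (B t) v) D \<noteq> 0} \<subseteq> {i. L i \<inter> F \<noteq> {}} \<times> {i. L i \<inter> F \<noteq> {}}"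
  proof (rule image_subsetI)
    fix t assume "t \<in> {t\<in>T. lop (A t) (lop (B t) v) D \<noteq> 0}"
    then have t: "t \<in> T" and nz: "lop (A t) (lop (B t) v) D \<noteq> 0"
      by auto
    obtain a where a: "a \<in> snd ` set (A t)" "op a (lop (B t) v) D \<noteq> 0"
      using lopD[OF nz] by blast
    have "lop (B t) v (flip (mode_label a) D) \<noteq> 0"
      using op_nonzeroD[OF a(2)] .
    then obtain b where b: "b \<in> snd ` set (B t)" "op b v (flip (mode_label a) D) \<noteq> 0"
      using lopD by blast
    have S: "v (flip (mode_label b) (flip (mode_label a) D)) \<noteq> 0"
      using op_nonzeroD[OF b(2)] .
    have ab: "mode_label a \<in> L (p t)" "mode_label b \<in> L (q t)"
      using A[OF t] B[OF t] a b by auto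
    then have "mode_label a \<noteq> mode_label b"
      using disj[OF t] by auto
    then have eq: "sym_diff D (flip (mode_label b) (flip (mode_label a) D)) = {mode_label a, mode_label b}"
      by (rule sym_diff_flip_flip)
    let ?S = "flip (mode_label b) (flip (mode_label a) D)"
    have "(if finite (sym_diff D ?S) then sym_diff D ?S else {}) \<subseteq> F"
      unfolding F_def by (rule UN_upper) (simp only: mem_Collect_eq S not_False_eq_True)
    then have "{mode_label a, mode_label b} \<subseteq> F"
      unfolding eq by simp
    then show "(p t, q t) \<in> {i. L i \<inter> F \<noteq> {}} \<times> {i. L i \<inter> F \<noteq> {}}"
      using ab by auto
  qed
  then have "finite ((\<lambda>t. (p t, q t)) ` {t\<in>T. lop (A t) (lop (B t) v) D \<noteq> 0})"
    using fin[OF \<open>finite F\<close>] by (meson finite_SigmaI finite_subset)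
  then show "finite {t\<in>T. lop (A t) (lop (B t) v) D \<noteq> 0}"
    by (rule finite_imageD) (rule inj_on_subset[OF inj], auto)
qed

section \<open>Time evolution of two-field states\<close>

definition shifts :: "(fock \<Rightarrow> fock) \<Rightarrow> (int \<Rightarrow> lin) \<Rightarrow> time \<Rightarrow> bool" where
  "shifts H A X \<longleftrightarrow> (\<forall>v j D. fin_supp v \<longrightarrow>
     H (lop (A j) v) D = lop (A j) (H v) D + (\<Sum>\<^sub>\<infinity>l\<in>{1..}. X l * lop (A (j - int l)) v D))"

definition hamiltonian :: "(fock \<Rightarrow> fock) \<Rightarrow> bool" where
  "hamiltonian H \<longleftrightarrow> H vac = (\<lambda>_. 0) \<and>
     (\<forall>v w x y. fin_supp v \<longrightarrow> fin_supp w \<longrightarrow>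
        H (\<lambda>D. x * v D + y * w D) = (\<lambda>D. x * H v D + y * H w D))"

definition xi :: "time \<Rightarrow> complex fps" where
  "xi x = Abs_fps (\<lambda>l. if l = 0 then 0 else x l)"

lemma exp_xi_altdef: "exp_xi x = fps_compose (fps_exp 1) (xi x)"
  by (simp add: exp_xi_def xi_def)

lemma hamiltonianD:
  assumes "hamiltonian H" "fin_supp v" "fin_supp w"
  shows "H (\<lambda>D. x * v D + y * w D) = (\<lambda>D. x * H v D + y * H w D)"
  using assms unfolding hamiltonian_def by blast

lemma hamiltonian_zero: "hamiltonian H \<Longrightarrow> H (\<lambda>_. 0) = (\<lambda>_. 0)"
  using hamiltonianD[OF _ fin_supp_zero fin_supp_zero, of H 0 0] by simp

lemma hamiltonian_sum:
  assumes "hamiltonian H" "\<And>i. i \<in> S \<Longrightarrow> fin_supp (v i)"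
  shows "H (\<lambda>D. \<Sum>i\<in>S. c i * v i D) = (\<lambda>D. \<Sum>i\<in>S. c i * H (v i) D)"
  using assms(2)
proof (induction S rule: infinite_finite_induct)
  case (insert i S)
  have "H (\<lambda>D. c i * v i D + 1 * (\<Sum>i\<in>S. c i * v i D)) =
      (\<lambda>D. c i * H (v i) D + 1 * H (\<lambda>D. \<Sum>i\<in>S. c i * v i D) D)"
    using insert.prems by (intro hamiltonianD[OF assms(1)] fin_supp_sum fin_supp_scale) auto
  then show ?case
    using insert by simp
qed (auto simp: hamiltonian_zero[OF assms(1)])

lemma convolution_sum:
  fixes c e g :: "nat \<Rightarrow> complex"
  assumes "\<And>m. m > n \<Longrightarrow> g m = 0"
  shows "(\<Sum>a\<le>n. \<Sum>l\<le>n. c a * e l * g (a + l)) = (\<Sum>m\<le>n. (\<Sum>a\<le>m. c a * e (m - a)) * g m)"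
proof -
  have nz: "m \<le> n" if "g m \<noteq> 0" for m
    using assms that not_le by blast
  have "(\<Sum>a\<le>n. \<Sum>l\<le>n. c a * e l * g (a + l)) = (\<Sum>(a, l)\<in>{..n} \<times> {..n}. c a * e l * g (a + l))"
    by (simp add: sum.cartesian_product)
  also have "\<dots> = (\<Sum>(a, l)\<in>{(a, l). a + l \<le> n}. c a * e l * g (a + l))"
    using nz by (intro sum.mono_neutral_right) auto
  also have "\<dots> = (\<Sum>m\<le>n. \<Sum>a\<le>m. c a * e (m - a) * g (a + (m - a)))"
    by (rule sum.triangle_reindex_eq)
  also have "\<dots> = (\<Sum>m\<le>n. (\<Sum>a\<le>m. c a * e (m - a)) * g m)"
    by (simp add: sum_distrib_right)
  finally show ?thesis .
qed

lemma infsum_truncate: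
  fixes f :: "nat \<Rightarrow> complex"
  assumes "\<And>l. l > n \<Longrightarrow> f l = 0"
  shows "(\<Sum>\<^sub>\<infinity>l\<in>{1..}. f l) = (\<Sum>l\<le>n. if l = 0 then 0 else f l)"
proof -
  have "(\<Sum>\<^sub>\<infinity>l\<in>{1..}. f l) = (\<Sum>\<^sub>\<infinity>l\<in>{..n}. if l = 0 then 0 else f l)"
    using assms by (intro infsum_cong_neutral) auto
  then show ?thesis
    by simp
qed

lemma xi_power_nth_zero: "a < i \<Longrightarrow> fps_nth (xi x ^ i) a = 0"
proof -
  assume "a < i"
  have "fps_nth (xi x) 0 = 0"
    by (simp add: xi_def)
  then show ?thesis
    using \<open>a < i\<close> by (simp add: startsby_zero_power_prefix)
qed

lemma exp_xi_nth: "a \<le> n \<Longrightarrow> fps_nth (exp_xi x) a = (\<Sum>i\<le>n. fps_nth (xi x ^ i) a / fact i)"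
proof -
  assume a: "a \<le> n"
  have "fps_nth (exp_xi x) a = (\<Sum>i=0..a. fps_nth (xi x ^ i) a / fact i)"
    by (simp add: exp_xi_altdef fps_compose_nth)
  also have "\<dots> = (\<Sum>i\<le>n. fps_nth (xi x ^ i) a / fact i)"
    using a by (intro sum.mono_neutral_left) (auto simp: xi_power_nth_zero)
  finally show ?thesis .
qed

lemma sum_rotate: "(\<Sum>i\<in>S. \<Sum>j\<in>T. \<Sum>a\<in>R. g i j a) = (\<Sum>a\<in>R. \<Sum>i\<in>S. \<Sum>j\<in>T. g i j a)"
proof -
  have "(\<Sum>i\<in>S. \<Sum>j\<in>T. \<Sum>a\<in>R. g i j a) = (\<Sum>i\<in>S. \<Sum>a\<in>R. \<Sum>j\<in>T. g i j a)"
    by (intro sum.cong refl sum.swap)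
  also have "\<dots> = (\<Sum>a\<in>R. \<Sum>i\<in>S. \<Sum>j\<in>T. g i j a)"
    by (rule sum.swap)
  finally show ?thesis .
qed

locale field_states =
  fixes H :: "fock \<Rightarrow> fock" and X Y :: time and state :: "int \<Rightarrow> int \<Rightarrow> fock"
  assumes ham: "hamiltonian H" and fin_supp_state: "fin_supp (state j k)"
    and neg: "j + k < 0 \<Longrightarrow> state j k = (\<lambda>_. 0)"
    and H_state: "j + k \<le> int n \<Longrightarrow> H (state j k) D = (\<Sum>l\<le>n. fps_nth (xi X) l * state (j - int l) k D) +
      (\<Sum>l\<le>n. fps_nth (xi Y) l * state j (k - int l) D)"
begin

definition mixed :: "int \<Rightarrow> int \<Rightarrow> nat \<Rightarrow> nat \<Rightarrow> nat \<Rightarrow> fock" where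
  "mixed j k n i i' D = (\<Sum>a\<le>n. \<Sum>b\<le>n. fps_nth (xi X ^ i) a * fps_nth (xi Y ^ i') b * state (j -
      int a) (k - int b) D)"

lemma fin_supp_mixed: "fin_supp (mixed j k n i i')"
  unfolding mixed_def by (intro fin_supp_sum fin_supp_scale fin_supp_state)

lemma H_mixed:
  assumes "j + k \<le> int n"
  shows "H (mixed j k n i i') D = mixed j k n (Suc i) i' D + mixed j k n i (Suc i') D"
proof -
  have "mixed j k n i i' = (\<lambda>D. \<Sum>p\<in>{..n} \<times> {..n}. fps_nth (xi X ^ i) (fst p) * fps_nth (xi Y ^ i') (snd p) *
      state (j - int (fst p)) (k - int (snd p)) D)"
    by (simp add: mixed_def sum.cartesian_product case_prod_unfold fun_eq_iff)
  then have "H (mixed j k n i i') D = (\<Sum>p\<in>{..n} \<times> {..n}. fps_nth (xi X ^ i) (fst p) * fps_nth (xi Y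
      ^ i') (snd p) *
      H (state (j - int (fst p)) (k - int (snd p))) D)"
    by (simp only: hamiltonian_sum[OF ham fin_supp_state])
  also have "\<dots> = (\<Sum>a\<le>n. \<Sum>b\<le>n. fps_nth (xi X ^ i) a * fps_nth (xi Y ^ i') b * H (state (j -
      int a) (k - int b)) D)"
    by (simp add: sum.cartesian_product case_prod_unfold)
  also have "\<dots> = (\<Sum>a\<le>n. \<Sum>b\<le>n. fps_nth (xi X ^ i) a * fps_nth (xi Y ^ i') b *
      ((\<Sum>l\<le>n. fps_nth (xi X) l * state (j - int (a + l)) (k - int b) D) +
       (\<Sum>l\<le>n. fps_nth (xi Y) l * state (j - int a) (k - int (b + l)) D)))"
  proof -
    have "H (state (j - int a) (k - int b)) D =
      (\<Sum>l\<le>n. fps_nth (xi X) l * state (j - int (a + l)) (k - int b) D) +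
       (\<Sum>l\<le>n. fps_nth (xi Y) l * state (j - int a) (k - int (b + l)) D)" for a b
      using H_state[of "j - int a" "k - int b" n D] assms by (simp add: diff_diff_eq)
    then show ?thesis
      by (simp only:)
  qed
  also have "\<dots> = (\<Sum>b\<le>n. fps_nth (xi Y ^ i') b * (\<Sum>a\<le>n. \<Sum>l\<le>n. fps_nth (xi X ^ i) a * fps_nth (xi X) l
      * state (j - int (a + l)) (k - int b) D))
     + (\<Sum>a\<le>n. fps_nth (xi X ^ i) a * (\<Sum>b\<le>n. \<Sum>l\<le>n. fps_nth (xi Y ^ i') b * fps_nth (xi Y) l * state
         (j - int a) (k - int (b + l)) D))"
  proof -
    have "(\<Sum>a\<le>n. \<Sum>b\<le>n. fps_nth (xi X ^ i) a * fps_nth (xi Y ^ i') b * (\<Sum>l\<le>n. fps_nth (xi X) l *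
        state (j - int (a + l)) (k - int b) D)) =
        (\<Sum>b\<le>n. fps_nth (xi Y ^ i') b * (\<Sum>a\<le>n. \<Sum>l\<le>n. fps_nth (xi X ^ i) a * fps_nth (xi X) l * state
            (j - int (a + l)) (k - int b) D))"
      by (subst sum.swap) (simp add: sum_distrib_left mult_ac)
    moreover have "(\<Sum>a\<le>n. \<Sum>b\<le>n. fps_nth (xi X ^ i) a * fps_nth (xi Y ^ i') b * (\<Sum>l\<le>n. fps_nth (xi Y)
        l * state (j - int a) (k - int (b + l)) D)) =
        (\<Sum>a\<le>n. fps_nth (xi X ^ i) a * (\<Sum>b\<le>n. \<Sum>l\<le>n. fps_nth (xi Y ^ i') b * fps_nth (xi Y) l * state
            (j - int a) (k - int (b + l)) D))"
      by (simp add: sum_distrib_left mult_ac)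
    ultimately show ?thesis
      by (simp only: distrib_left sum.distrib)
  qed
  also have "(\<Sum>b\<le>n. fps_nth (xi Y ^ i') b * (\<Sum>a\<le>n. \<Sum>l\<le>n. fps_nth (xi X ^ i) a * fps_nth (xi X) l *
      state (j - int (a + l)) (k - int b) D)) =
      mixed j k n (Suc i) i' D"
  proof -
    have "(\<Sum>a\<le>n. \<Sum>l\<le>n. fps_nth (xi X ^ i) a * fps_nth (xi X) l * state (j - int (a + l)) (k - int b) D) =
        (\<Sum>m\<le>n. fps_nth (xi X ^ Suc i) m * state (j - int m) (k - int b) D)" for b
    proof (subst convolution_sum[where g = "\<lambda>m. state (j - int m) (k - int b) D"])
      show "state (j - int m) (k - int b) D = 0" if "m > n" for m
        using that assms by (simp add: neg)
    qed (simp add: fps_mult_nth power_Suc2 atLeast0AtMost del: power_Suc)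
    then show ?thesis
      unfolding mixed_def by (subst sum.swap) (simp add: sum_distrib_left mult_ac del: power_Suc)
  qed
  also have "(\<Sum>a\<le>n. fps_nth (xi X ^ i) a * (\<Sum>b\<le>n. \<Sum>l\<le>n. fps_nth (xi Y ^ i') b * fps_nth (xi Y) l *
      state (j - int a) (k - int (b + l)) D)) =
      mixed j k n i (Suc i') D"
  proof -
    have "(\<Sum>b\<le>n. \<Sum>l\<le>n. fps_nth (xi Y ^ i') b * fps_nth (xi Y) l * state (j - int a) (k - int (b + l)) D) =
        (\<Sum>m\<le>n. fps_nth (xi Y ^ Suc i') m * state (j - int a) (k - int m) D)" for a
    proof (subst convolution_sum[where g = "\<lambda>m. state (j - int a) (k - int m) D"])
      show "state (j - int a) (k - int m) D = 0" if "m > n" for m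
        using that assms by (simp add: neg)
    qed (simp add: fps_mult_nth power_Suc2 atLeast0AtMost del: power_Suc)
    then show ?thesis
      unfolding mixed_def by (simp add: sum_distrib_left mult_ac del: power_Suc)
  qed
  finally show ?thesis .
qed

lemma mixed_zero: "i > n \<or> i' > n \<Longrightarrow> mixed j k n i i' D = 0"
  unfolding mixed_def by (intro sum.neutral ballI) (auto simp: xi_power_nth_zero)

text \<open>\<open>H\<close> raises one of the two exponents of \<open>mixed\<close>, so by Pascal's rule it maps \<open>graded j k n m\<close> to
  \<open>m + 1\<close> times the next piece: these are the terms of the exponential series.\<close>

definition graded :: "int \<Rightarrow> int \<Rightarrow> nat \<Rightarrow> nat \<Rightarrow> fock" where
  "graded j k n m D = (\<Sum>i\<le>m. inverse (fact i * fact (m - i)) * mixed j k n i (m - i) D)"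

lemma H_graded:
  assumes "j + k \<le> int n"
  shows "H (graded j k n m) D = of_nat (Suc m) * graded j k n (Suc m) D"
proof -
  let ?W = "\<lambda>i i'. inverse (fact i * fact i') * mixed j k n i i' D"
  have W1: "inverse (fact i * fact i') * mixed j k n (Suc i) i' D = of_nat (Suc i) * ?W (Suc i) i'"
    and W2: "inverse (fact i * fact i') * mixed j k n i (Suc i') D = of_nat (Suc i') * ?W i (Suc
        i')" for i i'
    using of_nat_0_neq[of i, where 'a = complex] of_nat_0_neq[of i', where 'a = complex]
    by (simp_all add: fact_Suc field_simps del: of_nat_Suc)
  have "H (graded j k n m) D = (\<Sum>i\<le>m. inverse (fact i * fact (m - i)) * H (mixed j k n i (m - i)) D)"
    unfolding graded_def by (simp add: hamiltonian_sum[OF ham fin_supp_mixed])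
  also have "\<dots> = (\<Sum>i\<le>m. of_nat (Suc i) * ?W (Suc i) (m - i) + of_nat (Suc (m - i)) * ?W i (Suc (m - i)))"
    unfolding H_mixed[OF assms] distrib_left W1 W2 ..
  also have "\<dots> = (\<Sum>i\<le>Suc m. of_nat i * ?W i (Suc m - i)) + (\<Sum>i\<le>Suc m. of_nat (Suc m - i) * ?W i (Suc
      m - i))"
  proof -
    have "(\<Sum>i\<le>Suc m. of_nat i * ?W i (Suc m - i)) = (\<Sum>i\<le>m. of_nat (Suc i) * ?W (Suc i) (m - i))"
      unfolding sum.atMost_Suc_shift by simp
    moreover have "(\<Sum>i\<le>Suc m. of_nat (Suc m - i) * ?W i (Suc m - i)) = (\<Sum>i\<le>m. of_nat (Suc (m -
        i)) * ?W i (Suc (m - i)))"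
      unfolding sum.atMost_Suc diff_self_eq_0 of_nat_0 mult_zero_left add_0_right
      by (intro sum.cong refl) (simp only: Suc_diff_le atMost_iff)
    ultimately show ?thesis
      by (simp only: sum.distrib)
  qed
  also have "\<dots> = (\<Sum>i\<le>Suc m. of_nat (Suc m) * ?W i (Suc m - i))"
    unfolding sum.distrib[symmetric] distrib_right[symmetric] of_nat_add[symmetric]
    by (intro sum.cong refl) simp
  finally show ?thesis
    unfolding graded_def sum_distrib_left .
qed

lemma fin_supp_graded: "fin_supp (graded j k n m)"
  unfolding graded_def by (intro fin_supp_sum fin_supp_scale fin_supp_mixed)

lemma H_pow_state:
  assumes "j + k \<le> int n"
  shows "(H ^^ m) (state j k) = (\<lambda>D. fact m * graded j k n m D)"
proof (induction m)
  case 0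
  have "graded j k n 0 D = state j k D" for D
  proof -
    have "mixed j k n 0 0 D = (\<Sum>a\<le>n. \<Sum>b\<le>n. if b = 0 then if a = 0 then state j k D else 0 else 0)"
      unfolding mixed_def by (intro sum.cong) auto
    then show ?thesis
      by (simp add: graded_def)
  qed
  then show ?case
    by simp
next
  case (Suc m)
  have "H (\<lambda>D. fact m * graded j k n m D) = (\<lambda>D. fact m * H (graded j k n m) D)"
    using hamiltonian_sum[OF ham, of "{()}" "\<lambda>_. graded j k n m" "\<lambda>_. fact m"] fin_supp_graded by simp
  then show ?case
    by (simp add: Suc H_graded[OF assms] fun_eq_iff del: of_nat_Suc)
qed

lemma op_exp_state:
  "op_exp H (state j k) D = (\<Sum>a\<le>nat (j + k). \<Sum>b\<le>nat (j + k).
     fps_nth (exp_xi X) a * fps_nth (exp_xi Y) b * state (j - int a) (k - int b) D)"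
proof -
  define n where "n = nat (j + k)"
  have n: "j + k \<le> int n"
    by (simp add: n_def)
  let ?W = "\<lambda>i i'. inverse (fact i * fact i') * mixed j k n i i' D"
  have mixed_nz: "i \<le> n \<and> i' \<le> n" if "mixed j k n i i' D \<noteq> 0" for i i'
    using mixed_zero that not_le by blast
  have "op_exp H (state j k) D = (\<Sum>m. graded j k n m D)"
    unfolding op_exp_def H_pow_state[OF n] by simp
  also have "\<dots> = (\<Sum>m\<le>2 * n. graded j k n m D)"
    unfolding graded_def by (intro suminf_finite) (auto intro!: sum.neutral mixed_zero)
  also have "\<dots> = (\<Sum>(i, i')\<in>{(i, i'). i + i' \<le> 2 * n}. ?W i i')"
    unfolding graded_def by (rule sum.triangle_reindex_eq[symmetric])
  also have "\<dots> = (\<Sum>(i, i')\<in>{..n} \<times> {..n}. ?W i i')"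
  proof (rule sum.mono_neutral_right)
    show "finite {(i, i'). i + i' \<le> 2 * n}"
      by (rule finite_subset[of _ "{..2 * n} \<times> {..2 * n}"]) auto
  qed (use mixed_nz in auto)
  also have "\<dots> = (\<Sum>i\<le>n. \<Sum>i'\<le>n. \<Sum>a\<le>n. \<Sum>b\<le>n. inverse (fact i * fact i') *
      (fps_nth (xi X ^ i) a * fps_nth (xi Y ^ i') b * state (j - int a) (k - int b) D))"
    by (simp add: sum.cartesian_product[symmetric] mixed_def sum_distrib_left)
  also have "\<dots> = (\<Sum>a\<le>n. \<Sum>b\<le>n. \<Sum>i\<le>n. \<Sum>i'\<le>n. inverse (fact i * fact i') *
      (fps_nth (xi X ^ i) a * fps_nth (xi Y ^ i') b * state (j - int a) (k - int b) D))"
    by (subst sum_rotate, intro sum.cong refl sum_rotate)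
  also have "\<dots> = (\<Sum>a\<le>n. \<Sum>b\<le>n.
     fps_nth (exp_xi X) a * fps_nth (exp_xi Y) b * state (j - int a) (k - int b) D)"
  proof (intro sum.cong refl)
    fix a b assume "a \<in> {..n}" "b \<in> {..n}"
    then have "fps_nth (exp_xi X) a * fps_nth (exp_xi Y) b =
        (\<Sum>i\<le>n. \<Sum>i'\<le>n. fps_nth (xi X ^ i) a / fact i * (fps_nth (xi Y ^ i') b / fact i'))"
      by (simp add: exp_xi_nth[where n = n] sum_product)
    then show "(\<Sum>i\<le>n. \<Sum>i'\<le>n. inverse (fact i * fact i') *
      (fps_nth (xi X ^ i) a * fps_nth (xi Y ^ i') b * state (j - int a) (k - int b) D)) =
      fps_nth (exp_xi X) a * fps_nth (exp_xi Y) b * state (j - int a) (k - int b) D"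
      by (simp only: sum_distrib_right) (intro sum.cong refl, simp add: field_simps)
  qed
  finally show ?thesis
    by (simp add: n_def)
qed

end

lemma H_one_field:
  assumes ham: "hamiltonian H" and shB: "shifts H B Y" 
    and vacB: "\<And>k. k < kB \<Longrightarrow> lop (B k) vac = (\<lambda>_. 0)"
    and n: "k - kB \<le> int n"
  shows "H (lop (B k) vac) = (\<lambda>D. \<Sum>l\<le>n. fps_nth (xi Y) l * lop (B (k - int l)) vac D)"
proof
  fix D
  have Hvac: "lop (B k) (H vac) = (\<lambda>_. 0)"
    using ham by (simp add: hamiltonian_def)
  have "H (lop (B k) vac) D = (\<Sum>\<^sub>\<infinity>l\<in>{1..}. Y l * lop (B (k - int l)) vac D)"
    using shB fin_supp_vac Hvac unfolding shifts_def by simp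
  also have "\<dots> = (\<Sum>l\<le>n. if l = 0 then 0 else Y l * lop (B (k - int l)) vac D)"
    using n by (intro infsum_truncate) (auto simp: vacB)
  also have "\<dots> = (\<Sum>l\<le>n. fps_nth (xi Y) l * lop (B (k - int l)) vac D)"
    by (intro sum.cong) (auto simp: xi_def)
  finally show "H (lop (B k) vac) D = (\<Sum>l\<le>n. fps_nth (xi Y) l * lop (B (k - int l)) vac D)" .
qed

section \<open>The Hamiltonians\<close>

lemma graph_infsum:
  fixes f :: "'l \<Rightarrow> complex"
  shows "(\<Sum>\<^sub>\<infinity>(l, m)\<in>T \<times> UNIV. if m = h l then f l else 0) = (\<Sum>\<^sub>\<infinity>l\<in>T. f l)"
proof -
  have "(\<Sum>\<^sub>\<infinity>(l, m)\<in>T \<times> UNIV. if m = h l then f l else 0) = (\<Sum>\<^sub>\<infinity>(l, m)\<in>(\<lambda>l. (l, h l)) ` T. f l)"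
    by (rule infsum_cong_neutral) auto
  also have "\<dots> = (\<Sum>\<^sub>\<infinity>l\<in>T. f l)"
    by (subst infsum_reindex) (auto simp: inj_on_def comp_def)
  finally show ?thesis .
qed

definition psi_modes :: "nat \<Rightarrow> int \<Rightarrow> lin" where
  "psi_modes c j = [(1, Psi c j)]"

definition psistar_modes :: "nat \<Rightarrow> int \<Rightarrow> lin" where
  "psistar_modes c j = [(1, PsiStar c (- j))]"

definition current :: "nat \<Rightarrow> time \<Rightarrow> fock \<Rightarrow> fock" where
  "current c x = quadratic (\<lambda>(l, j). x l) (\<lambda>(l, j). [(1, Psi c j)])
     (\<lambda>(l, j). [(1, PsiStar c (j + int l))]) ({1..} \<times> UNIV)"

lemma locally_finite_current:
  "locally_finite (\<lambda>(l, j). [(1, Psi c j)]) (\<lambda>(l, j). [(1, PsiStar c (j + int l))]) ({1..} \<times> UNIV)"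
proof (rule locally_finiteI[where L = "\<lambda>i. {(c, i)}" and p = snd and q = "\<lambda>(l, j). j + int l"])
  fix F :: "(nat \<times> int) set" assume "finite F"
  moreover have "{i. {(c, i)} \<inter> F \<noteq> {}} \<subseteq> snd ` F"
    by force
  ultimately show "finite {i. {(c, i)} \<inter> F \<noteq> {}}"
    using finite_subset by blast
qed (auto simp: inj_on_def)

lemma current_commute_psi:
  assumes "fin_supp v"
  shows "current c x (lop (psi_modes d j) v) D = lop (psi_modes d j) (current c x v) D +
    (if c = d then \<Sum>\<^sub>\<infinity>l\<in>{1..}. x l * lop (psi_modes d (j - int l)) v D else 0)"
proof -
  have "(\<Sum>\<^sub>\<infinity>t\<in>{1..} \<times> UNIV. (case t of (l, i) \<Rightarrow> x l) *
      (lin_bracket (case t of (l, i) \<Rightarrow> [(1, PsiStar c (i + int l))]) (psi_modes d j) *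
         lop (case t of (l, i) \<Rightarrow> [(1, Psi c i)]) v D -
       lin_bracket (case t of (l, i) \<Rightarrow> [(1, Psi c i)]) (psi_modes d j) *
         lop (case t of (l, i) \<Rightarrow> [(1, PsiStar c (i + int l))]) v D)) =
    (\<Sum>\<^sub>\<infinity>(l, m)\<in>{1..} \<times> UNIV. if m = j - int l then
      if c = d then x l * lop (psi_modes d (j - int l)) v D else 0 else 0)"
    by (intro infsum_cong) (auto simp: lin_bracket_def psi_modes_def)
  then show ?thesis
    unfolding current_def quadratic_commute[OF locally_finite_current assms] graph_infsum by simp
qed

lemma current_commute_psistar:
  assumes "fin_supp v"
  shows "current c x (lop (psistar_modes d j) v) D = lop (psistar_modes d j) (current c x v) D +
    (if c = d then \<Sum>\<^sub>\<infinity>l\<in>{1..}. (- x) l * lop (psistar_modes d (j - int l)) v D else 0)"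
proof -
  have "(\<Sum>\<^sub>\<infinity>t\<in>{1..} \<times> UNIV. (case t of (l, i) \<Rightarrow> x l) *
      (lin_bracket (case t of (l, i) \<Rightarrow> [(1, PsiStar c (i + int l))]) (psistar_modes d j) *
         lop (case t of (l, i) \<Rightarrow> [(1, Psi c i)]) v D -
       lin_bracket (case t of (l, i) \<Rightarrow> [(1, Psi c i)]) (psistar_modes d j) *
         lop (case t of (l, i) \<Rightarrow> [(1, PsiStar c (i + int l))]) v D)) =
    (\<Sum>\<^sub>\<infinity>(l, m)\<in>{1..} \<times> UNIV. if m = - j then
      if c = d then (- x) l * lop (psistar_modes d (j - int l)) v D else 0 else 0)"
    by (intro infsum_cong) (auto simp: lin_bracket_def psistar_modes_def algebra_simps)
  then show ?thesis
    unfolding current_def quadratic_commute[OF locally_finite_current assms] graph_infsum by simp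
qed

lemma Ham2_eq:
  assumes "fin_supp v"
  shows "Ham2 x y v = (\<lambda>D. current 1 x v D + current 2 y v D)"
proof
  fix D
  have "(\<lambda>t. (case t of (l, j) \<Rightarrow> z l) * lop (case t of (l, j) \<Rightarrow> [(1, Psi c j)])
      (lop (case t of (l, j) \<Rightarrow> [(1, PsiStar c (j + int l))]) v) D) summable_on {1..} \<times> UNIV"
          for c and z :: time
    by (rule locally_finite_summable[OF locally_finite_current assms])
  then show "Ham2 x y v D = current 1 x v D + current 2 y v D"
    unfolding current_def quadratic_def Ham2_def
    by (subst infsum_add[symmetric]) (auto simp: case_prod_unfold lop_single)
qed

lemma lop_lop_vac_zero:
  assumes "lop A vac = (\<lambda>_. 0)" "lin_bracket A B = 0"
  shows "lop A (lop B vac) = (\<lambda>_. 0)"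
proof
  show "lop A (lop B vac) D = 0" for D
    using lop_anticommute[OF fin_supp_vac, of A B D] assms by simp
qed

lemma hamiltonian_Ham2: "hamiltonian (Ham2 x y)"
  unfolding hamiltonian_def
proof (intro conjI allI impI)
  have *: "op (Psi c j) (op (PsiStar c (j + int l)) vac) = (\<lambda>_. 0)" if "l \<ge> 1" for c j l
  proof (cases "j + int l \<ge> 0")
    case True
    then show ?thesis
      by (simp only: vac_conditions op_zero)
  next
    case False
    then have "op (Psi c j) vac = (\<lambda>_. 0)"
      by (intro vac_conditions) simp
    then show ?thesis
      using that lop_lop_vac_zero[of "[(1, Psi c j)]" "[(1, PsiStar c (j + int l))]"]
      by (simp add: lop_single lin_bracket_def del: op.simps)
  qed
  have "current c x vac D = 0" for c x D
    unfolding current_def quadratic_def by (intro infsum_0) (auto simp: lop_single * simp del: op.simps)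
  then show "Ham2 x y vac = (\<lambda>_. 0)"
    by (simp add: Ham2_eq fin_supp_vac)
  fix v w a b assume v: "fin_supp v" and w: "fin_supp w"
  have "current c x (\<lambda>D. a * v D + b * w D) D = a * current c x v D + b * current c x w D" for c x D
    unfolding current_def using locally_finite_current v w by (rule quadratic_linear)
  then show "Ham2 x y (\<lambda>D. a * v D + b * w D) = (\<lambda>D. a * Ham2 x y v D + b * Ham2 x y w D)"
    by (simp add: Ham2_eq fin_supp_linear v w fun_eq_iff algebra_simps)
qed

lemma lop_add: "lop A (\<lambda>D. v D + w D) D = lop A v D + lop A w D"
  using lop_linear[of A 1 v 1 w D] by simp

lemma shifts_Ham2:
  "shifts (Ham2 x y) (psi_modes 1) x" "shifts (Ham2 x y) (psi_modes 2) y"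
  "shifts (Ham2 x y) (psistar_modes 1) (- x)" "shifts (Ham2 x y) (psistar_modes 2) (- y)"
  unfolding shifts_def
  by (auto simp: Ham2_eq fin_supp_lop lop_add current_commute_psi current_commute_psistar)

lemma shifts_index: "shifts H A X \<Longrightarrow> shifts H (\<lambda>j. A (j + i)) X"
  unfolding shifts_def by (simp add: algebra_simps diff_add_eq)

lemma phi_brackets:
  "lin_bracket (phi_mode m) (phi_mode j) = (if m = - j then (-1) powi j else 0)"
  "lin_bracket (phihat_mode m) (phihat_mode j) = (if m = - j then (-1) powi j else 0)"
  "lin_bracket (phi_mode m) (phihat_mode j) = 0"
  "lin_bracket (phihat_mode m) (phi_mode j) = 0"
proof -
  have s: "complex_of_real (sqrt 2) * complex_of_real (sqrt 2) = 2"
    by (simp flip: of_real_mult)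
  have half: "1 / complex_of_real (sqrt 2) / complex_of_real (sqrt 2) = 1 / 2"
    using s by (simp add: divide_divide_eq_left)
  have sgn: "(-1 :: complex) powi (- j) = (-1) powi j"
    by (simp add: power_int_minus flip: power_int_inverse)
  show "lin_bracket (phi_mode m) (phi_mode j) = (if m = - j then (-1) powi j else 0)"
    "lin_bracket (phihat_mode m) (phihat_mode j) = (if m = - j then (-1) powi j else 0)"
    "lin_bracket (phi_mode m) (phihat_mode j) = 0"
    "lin_bracket (phihat_mode m) (phi_mode j) = 0"
    using s half sgn by (auto simp: lin_bracket_def phi_mode_def phihat_mode_def field_simps)
qed

definition neutral_current :: "(int \<Rightarrow> lin) \<Rightarrow> time \<Rightarrow> fock \<Rightarrow> fock" where
  "neutral_current A x = quadratic (\<lambda>(l, m). 1 / 2 * (-1) powi (m + 1) * x l) (\<lambda>(l, m). A m)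
     (\<lambda>(l, m). A (- m - int l)) ({l. odd l} \<times> UNIV)"

definition neutral_modes :: "(int \<Rightarrow> lin) \<Rightarrow> bool" where
  "neutral_modes A \<longleftrightarrow> A = phi_mode \<or> A = phihat_mode"

lemma neutral_labels:
  "neutral_modes A \<Longrightarrow> snd ` set (A m) \<subseteq> {a. mode_label a \<in> {(0, m), (0, - m)}}"
  by (auto simp: neutral_modes_def phi_mode_def phihat_mode_def)

lemma finite_neutral_labels:
  assumes "finite F"
  shows "finite {i :: int. {(0, i), (0, - i)} \<inter> F \<noteq> {}}"
proof -
  have "{i. {(0, i), (0, - i)} \<inter> F \<noteq> {}} \<subseteq> snd ` F \<union> (\<lambda>p. - snd p) ` F"
    by (auto simp: image_iff) force+
  then show ?thesis
    using assms by (meson finite_UnI finite_imageI finite_subset)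
qed

lemma locally_finite_neutral:
  assumes "neutral_modes A"
  shows "locally_finite (\<lambda>(l, m). A m) (\<lambda>(l, m). A (- m - int l)) ({l. odd l} \<times> UNIV)"
proof (rule locally_finiteI[where L = "\<lambda>i. {(0, i), (0, - i)}" and p = snd and q = "\<lambda>(l, m). - m - int l"])
  fix t :: "nat \<times> int" assume t: "t \<in> {l. odd l} \<times> UNIV"
  obtain l m where lm: "t = (l, m)" "odd l"
    using t by (cases t) auto
  show "{(0, snd t), (0, - snd t)} \<inter> {(0, case t of (l, m) \<Rightarrow> - m - int l), (0, - (case t of (l, m) \<Rightarrow>
      - m - int l))} = {}"
    using lm by (auto simp: lm(1)) presburger+
  show "snd ` set (case t of (l, m) \<Rightarrow> A m) \<subseteq> {a. mode_label a \<in> {(0, snd t), (0, - snd t)}}"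
    using neutral_labels[OF assms, of m] by (simp add: lm(1))
  show "snd ` set (case t of (l, m) \<Rightarrow> A (- m - int l)) \<subseteq> {a. mode_label a \<in>
      {(0, case t of (l, m) \<Rightarrow> - m - int l), (0, - (case t of (l, m) \<Rightarrow> - m - int l))}}"
    using neutral_labels[OF assms, of "- m - int l"] by (simp add: lm(1))
next
  show "finite {i :: int. {(0, i), (0, - i)} \<inter> F \<noteq> {}}" if "finite F" for F :: "(nat \<times> int) set"
    using that by (rule finite_neutral_labels)
qed (auto simp: inj_on_def)

lemma finite_neutral_family:
  assumes A: "neutral_modes A" and v: "fin_supp v"
  shows "finite {l :: nat. lop (A (j - int l)) v D \<noteq> 0}"
proof -
  define F where "F = (\<Union>S\<in>{S. v S \<noteq> 0}. if finite (sym_diff D S) then sym_diff D S else {})"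
  have F: "finite F"
    unfolding F_def using v by (auto simp: fin_supp_def)
  have lopD: "\<exists>m\<in>snd ` set C. op m w D' \<noteq> 0" if "lop C w D' \<noteq> 0" for C w D'
    using that by (induction C) (auto simp: lop_Cons)
  have "{l :: nat. lop (A (j - int l)) v D \<noteq> 0} \<subseteq> (\<lambda>i. nat (j - i)) ` {i. {(0, i), (0, - i)} \<inter> F \<noteq> {}}"
  proof
    fix l assume "l \<in> {l :: nat. lop (A (j - int l)) v D \<noteq> 0}"
    then obtain a where a: "a \<in> snd ` set (A (j - int l))" "op a v D \<noteq> 0"
      using lopD by blast
    have S: "v (flip (mode_label a) D) \<noteq> 0"
      using op_nonzeroD[OF a(2)] .
    have eq: "sym_diff D (flip (mode_label a) D) = {mode_label a}"
      by blast
    have "(if finite (sym_diff D (flip (mode_label a) D)) then sym_diff D (flip (mode_label a) D)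
        else {}) \<subseteq> F"
      unfolding F_def by (rule UN_upper) (simp only: mem_Collect_eq S not_False_eq_True)
    then have "mode_label a \<in> F"
      unfolding eq by simp
    then have "j - int l \<in> {i. {(0, i), (0, - i)} \<inter> F \<noteq> {}}"
      using a(1) neutral_labels[OF A] by blast
    then show "l \<in> (\<lambda>i. nat (j - i)) ` {i. {(0, i), (0, - i)} \<inter> F \<noteq> {}}"
      by (rule image_eqI[rotated]) simp
  qed
  then show ?thesis
    using finite_neutral_labels[OF F] finite_subset by blast
qed

lemma odd_time_even: "odd_time x \<Longrightarrow> even l \<Longrightarrow> x l = 0"
proof -
  assume x: "odd_time x" and l: "even l"
  have "x l = tilde x l"
    using x by (simp add: odd_time_def)
  also have "\<dots> = - x l"
    using l by (simp add: tilde_def)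
  finally have "x l + x l = - x l + x l"
    by (rule arg_cong)
  then show "x l = 0"
    by simp
qed

lemma neutral_current_commute:
  assumes A: "neutral_modes A" and v: "fin_supp v" and x: "odd_time x"
    and C: "\<And>m. lin_bracket (A m) C = (if m = - j then c * (-1) powi j else 0)"
  shows "neutral_current A x (lop C v) D = lop C (neutral_current A x v) D +
    c * (\<Sum>\<^sub>\<infinity>l\<in>{1..}. x l * lop (A (j - int l)) v D)"
proof -
  let ?T = "{l :: nat. odd l} \<times> (UNIV :: int set)"
  let ?f = "\<lambda>l. c * (1 / 2 * (x l * lop (A (j - int l)) v D))"
  have fin: "finite {l \<in> {l. odd l}. ?f l \<noteq> 0}"
    by (rule finite_subset[OF _ finite_neutral_family[OF A v, of j D]]) auto
  have sum: "(\<lambda>t. if snd t = h (fst t) then ?f (fst t) else 0) summable_on ?T" for h :: "nat \<Rightarrow> int"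
  proof (rule finite_support_summable)
    have "{t \<in> ?T. (if snd t = h (fst t) then ?f (fst t) else 0) \<noteq> 0} \<subseteq> (\<lambda>l. (l, h l)) ` {l \<in> {l.
        odd l}. ?f l \<noteq> 0}"
      by (auto split: if_splits)
    then show "finite {t \<in> ?T. (if snd t = h (fst t) then ?f (fst t) else 0) \<noteq> 0}"
      using fin by (meson finite_imageI finite_subset)
  qed
  have pw: "(-1 :: complex) powi (j - int l + 1) * (-1) powi j = 1" "(-1 :: complex) powi (- j +
      1) * (-1) powi j = - 1"
    if "odd l" for l
  proof -
    have "(-1 :: complex) powi (j - int l + 1) * (-1) powi j = (-1) powi (2 * j + (1 - int l))"
      by (subst power_int_add[symmetric]) (simp_all add: algebra_simps)
    also have "2 * j + (1 - int l) = 2 * (j + (1 - int l) div 2)"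
      using that by (auto elim: oddE)
    also have "(-1 :: complex) powi (2 * (j + (1 - int l) div 2)) = 1"
      by (simp only: power_int_mult) simp
    finally show "(-1 :: complex) powi (j - int l + 1) * (-1) powi j = 1" .
    show "(-1 :: complex) powi (- j + 1) * (-1) powi j = - 1"
      by (subst power_int_add[symmetric]) simp_all
  qed
  have "(\<Sum>\<^sub>\<infinity>t\<in>?T. (case t of (l, m) \<Rightarrow> 1 / 2 * (-1) powi (m + 1) * x l) *
      (lin_bracket (case t of (l, m) \<Rightarrow> A (- m - int l)) C * lop (case t of (l, m) \<Rightarrow> A m) v D -
       lin_bracket (case t of (l, m) \<Rightarrow> A m) C * lop (case t of (l, m) \<Rightarrow> A (- m - int l)) v D)) =
    (\<Sum>\<^sub>\<infinity>t\<in>?T. (if snd t = j - int (fst t) then ?f (fst t) else 0) + (if snd t =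
        - j then ?f (fst t) else 0))"
  proof (intro infsum_cong)
    fix t assume "t \<in> ?T"
    then obtain l m where t: "t = (l, m)" "odd l"
      by (cases t) auto
    have ne: "j - int l \<noteq> - j"
      using t(2) by presburger
    show "(case t of (l, m) \<Rightarrow> 1 / 2 * (-1) powi (m + 1) * x l) *
      (lin_bracket (case t of (l, m) \<Rightarrow> A (- m - int l)) C * lop (case t of (l, m) \<Rightarrow> A m) v D -
       lin_bracket (case t of (l, m) \<Rightarrow> A m) C * lop (case t of (l, m) \<Rightarrow> A (- m - int l)) v D) =
      (if snd t = j - int (fst t) then ?f (fst t) else 0) + (if snd t = - j then ?f (fst t) else 0)"
    proof -
      consider "m = j - int l" | "m = - j" | "m \<noteq> j - int l" "m \<noteq> - j"
        by blast
      then show ?thesis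
      proof cases
        case 1
        have "1 / 2 * (-1) powi (j - int l + 1) * x l * (c * (-1) powi j * lop (A (j - int l)) v D) =
            ((-1) powi (j - int l + 1) * (-1) powi j) * ?f l"
          by (simp add: mult_ac)
        then show ?thesis
          using 1 ne pw[OF t(2)] by (simp add: t(1) C)
      next
        case 2
        have "(-1) powi (1 - j) * x l * (c * (-1) powi j * lop (A (j - int l)) v D) =
            ((-1) powi (- j + 1) * (-1) powi j) * (c * (x l * lop (A (j - int l)) v D))"
          by (simp add: mult_ac)
        then show ?thesis
          unfolding pw(2)[OF t(2)] using 2 ne by (auto simp: t(1) C)
      next
        case 3
        then show ?thesis
          by (auto simp: t(1) C)
      qed
    qed
  qed
  also have "\<dots> = (\<Sum>\<^sub>\<infinity>t\<in>?T. if snd t = j - int (fst t) then ?f (fst t) else 0) +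
      (\<Sum>\<^sub>\<infinity>t\<in>?T. if snd t = - j then ?f (fst t) else 0)"
    using sum[of "\<lambda>l. j - int l"] sum[of "\<lambda>_. - j"] by (rule infsum_add)
  also have "\<dots> = (\<Sum>\<^sub>\<infinity>l\<in>{l. odd l}. ?f l) + (\<Sum>\<^sub>\<infinity>l\<in>{l. odd l}. ?f l)"
    using graph_infsum[where T = "{l. odd l}" and f = ?f and h = "\<lambda>l. j - int l"]
      graph_infsum[where T = "{l. odd l}" and f = ?f and h = "\<lambda>l. - j"]
    by (simp add: case_prod_unfold)
  also have "\<dots> = c * (\<Sum>\<^sub>\<infinity>l\<in>{l. odd l}. x l * lop (A (j - int l)) v D)"
    by (simp only: infsum_cmult_right') simp
  also have "(\<Sum>\<^sub>\<infinity>l\<in>{l. odd l}. x l * lop (A (j - int l)) v D) = (\<Sum>\<^sub>\<infinity>l\<in>{1..}. x l * lop (A (j - int l)) v D)"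
    by (rule infsum_cong_neutral) (use x in \<open>auto simp: odd_time_even elim: oddE\<close>)
  finally show ?thesis
    unfolding neutral_current_def quadratic_commute[OF locally_finite_neutral[OF A] v] by simp
qed

lemma Ham1_eq:
  assumes "fin_supp v"
  shows "Ham1 x y v = (\<lambda>D. neutral_current phi_mode x v D + neutral_current phihat_mode y v D)"
proof
  fix D
  have "(\<lambda>t. (case t of (l, m) \<Rightarrow> 1 / 2 * (-1) powi (m + 1) * z l) * lop (case t of (l, m) \<Rightarrow> A m)
      (lop (case t of (l, m) \<Rightarrow> A (- m - int l)) v) D) summable_on {l. odd l} \<times> UNIV"
    if "neutral_modes A" for A and z :: time
    by (rule locally_finite_summable[OF locally_finite_neutral[OF that] assms])
  then have "neutral_current phi_mode x v D + neutral_current phihat_mode y v D =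
      (\<Sum>\<^sub>\<infinity>t\<in>{l. odd l} \<times> UNIV. 1 / 2 * (case t of (l, m) \<Rightarrow> (-1) powi (m + 1) *
        (x l * lop (phi_mode m) (lop (phi_mode (- m - int l)) v) D
       + y l * lop (phihat_mode m) (lop (phihat_mode (- m - int l)) v) D)))"
    unfolding neutral_current_def quadratic_def
    by (subst infsum_add[symmetric]) (auto simp: neutral_modes_def case_prod_unfold algebra_simps)
  then show "Ham1 x y v D = neutral_current phi_mode x v D + neutral_current phihat_mode y v D"
    unfolding Ham1_def by (simp only: infsum_cmult_right')
qed

lemma neutral_vac:
  assumes "neutral_modes A" "j < 0"
  shows "lop (A j) vac = (\<lambda>_. 0)"
  using assms unfolding neutral_modes_def
  by (auto simp: phi_mode_def phihat_mode_def lop_Cons op_annihilator_vac simp del: op.simps)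

lemma hamiltonian_Ham1: "hamiltonian (Ham1 x y)"
  unfolding hamiltonian_def
proof (intro conjI allI impI)
  have *: "lop (A m) (lop (A (- m - int l)) vac) = (\<lambda>_. 0)" if A: "neutral_modes A" and l: "odd l" for A m l
  proof (cases "- m - int l < 0")
    case True
    then show ?thesis
      by (simp add: neutral_vac[OF A])
  next
    case False
    then have "lop (A m) vac = (\<lambda>_. 0)"
      using l by (intro neutral_vac[OF A]) (auto elim: oddE)
    moreover have "lin_bracket (A m) (A (- m - int l)) = 0"
      using A l unfolding neutral_modes_def by (auto simp: phi_brackets elim: oddE)
    ultimately show ?thesis
      by (rule lop_lop_vac_zero)
  qed
  have "neutral_current A x vac D = 0" if "neutral_modes A" for A x D
    unfolding neutral_current_def quadratic_def by (intro infsum_0) (auto simp: *[OF that])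
  then show "Ham1 x y vac = (\<lambda>_. 0)"
    by (simp add: Ham1_eq fin_supp_vac neutral_modes_def)
  fix v w a b assume v: "fin_supp v" and w: "fin_supp w"
  have "neutral_current A x (\<lambda>D. a * v D + b * w D) D = a * neutral_current A x v D +
      b * neutral_current A x w D"
    if "neutral_modes A" for A x D
    unfolding neutral_current_def using locally_finite_neutral[OF that] v w by (rule quadratic_linear)
  then show "Ham1 x y (\<lambda>D. a * v D + b * w D) = (\<lambda>D. a * Ham1 x y v D + b * Ham1 x y w D)"
    by (simp add: Ham1_eq fin_supp_linear v w fun_eq_iff neutral_modes_def algebra_simps)
qed

lemma shifts_Ham1:
  assumes "odd_time x" "odd_time y"
  shows "shifts (Ham1 x y) phi_mode x" "shifts (Ham1 x y) phihat_mode y"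
proof -
  have N: "neutral_modes phi_mode" "neutral_modes phihat_mode"
    by (simp_all add: neutral_modes_def)
  show "shifts (Ham1 x y) phi_mode x"
    unfolding shifts_def
    using neutral_current_commute[where A = phi_mode and c = 1, OF N(1) _ assms(1)]
      neutral_current_commute[where A = phihat_mode and c = 0, OF N(2) _ assms(2)]
    by (simp add: Ham1_eq fin_supp_lop lop_add phi_brackets)
  show "shifts (Ham1 x y) phihat_mode y"
    unfolding shifts_def
    using neutral_current_commute[where A = phi_mode and c = 0, OF N(1) _ assms(1)]
      neutral_current_commute[where A = phihat_mode and c = 1, OF N(2) _ assms(2)]
    by (simp add: Ham1_eq fin_supp_lop lop_add phi_brackets)
qed

section \<open>Values of power series and readings of Laurent series\<close>

lemma xi_nth_0 [simp]: "fps_nth (xi x) 0 = 0"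
  by (simp add: xi_def)

lemma exp_xi_deriv: "fps_deriv (exp_xi x) = exp_xi x * fps_deriv (xi x)"
  unfolding exp_xi_altdef by (simp add: fps_compose_deriv)

lemma exp_xi_nth_0 [simp]: "fps_nth (exp_xi x) 0 = 1"
  by (simp add: exp_xi_altdef)

lemma fps_linear_ode_unique:
  fixes F G h :: "complex fps"
  assumes F: "fps_deriv F = F * h" and G: "fps_deriv G = G * h"
    and F0: "fps_nth F 0 = 1" and G0: "fps_nth G 0 = 1"
  shows "F = G"
proof -
  have "fps_deriv (F * inverse G) = 0"
  proof -
    have "fps_deriv (inverse G) = - fps_deriv G * (inverse G)\<^sup>2"
      using G0 by (intro fps_inverse_deriv) simp
    moreover have "G * inverse G = 1"
      using G0 by (metis inverse_mult_eq_1 mult.commute zero_neq_one)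
    ultimately show ?thesis
      unfolding fps_deriv_mult F G by (simp add: power2_eq_square algebra_simps)
  qed
  then have "F * inverse G = fps_const (fps_nth (F * inverse G) 0)"
    by (simp only: fps_deriv_eq_0_iff)
  also have "\<dots> = 1"
    using F0 G0 by simp
  finally have "F * (inverse G * G) = G"
    by (simp flip: mult.assoc)
  moreover have "inverse G * G = 1"
    using G0 by (intro inverse_mult_eq_1) simp
  ultimately show ?thesis
    by simp
qed

lemma exp_xi_add: "exp_xi (x + y) = exp_xi x * exp_xi y"
proof (rule fps_linear_ode_unique)
  have "xi (x + y) = xi x + xi y"
    by (auto simp: xi_def fps_eq_iff)
  then show "fps_deriv (exp_xi (x + y)) = exp_xi (x + y) * fps_deriv (xi x + xi y)"
    by (simp add: exp_xi_deriv)
  show "fps_deriv (exp_xi x * exp_xi y) = exp_xi x * exp_xi y * fps_deriv (xi x + xi y)"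
    by (simp add: exp_xi_deriv algebra_simps)
qed simp_all

lemma exp_xi_zero [simp]: "exp_xi 0 = 1"
proof -
  have "xi 0 = 0"
    by (auto simp: xi_def fps_eq_iff)
  then show ?thesis
    by (simp add: exp_xi_altdef)
qed

lemma exp_xi_eps: "fps_of_poly [:1, - c:] * exp_xi (eps c) = 1"
proof -
  let ?p = "fps_of_poly [:1, - c:]"
  have "?p * fps_deriv (xi (eps c)) = fps_const c"
  proof (rule fps_ext)
    fix m
    have xi: "of_nat (Suc k) * fps_nth (xi (eps c)) (Suc k) = c ^ Suc k" for k
      using of_nat_0_neq[of k, where 'a = complex] by (simp add: xi_def eps_def del: of_nat_Suc)
    have p: "?p = 1 - fps_const c * fps_X"
      by (simp add: fps_of_poly_pCons fps_const_neg[symmetric] del: fps_const_neg)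
    show "fps_nth (?p * fps_deriv (xi (eps c))) m = fps_nth (fps_const c) m"
    proof (cases m)
      case 0
      then show ?thesis
        using xi[of 0] by (simp add: p algebra_simps)
    next
      case (Suc k)
      then show ?thesis
        using xi[of k] xi[of "Suc k"] unfolding p
        by (simp add: algebra_simps fps_mult_left_const_nth del: of_nat_Suc)
    qed
  qed
  then have "fps_deriv (?p * exp_xi (eps c)) = 0"
    by (simp add: exp_xi_deriv fps_of_poly_pderiv[symmetric] pderiv_pCons mult.left_commute[of ?p]
        fps_of_poly_const fps_const_neg[symmetric] del: fps_const_neg)
  then have "?p * exp_xi (eps c) = fps_const (fps_nth (?p * exp_xi (eps c)) 0)"
    by (simp only: fps_deriv_eq_0_iff)
  then show ?thesis
    by simp
qed

lemma exp_xi_odd: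
  assumes "odd_time x"
  shows "exp_xi (- x) = fps_compose (exp_xi x) (- fps_X)"
proof -
  have "xi (- x) = fps_compose (xi x) (- fps_X)"
    unfolding fps_compose_uminus'
    using assms by (auto simp: xi_def fps_eq_iff minus_one_power_iff odd_time_even)
  then show ?thesis
    unfolding exp_xi_altdef by (simp add: fps_compose_assoc)
qed

text \<open>The one-variable analogue of \<^const>\<open>has_reading\<close>, matching \<^const>\<open>exp_xi_defined\<close>.\<close>

definition has_value :: "complex fps \<Rightarrow> complex \<Rightarrow> complex \<Rightarrow> bool" where
  "has_value f u r \<longleftrightarrow> (\<exists>D. poly D u \<noteq> 0 \<and> summable (\<lambda>m. norm (fps_nth (fps_of_poly D * f) m * u ^ m)) \<and>
     r = (\<Sum>m. fps_nth (fps_of_poly D * f) m * u ^ m) / poly D u)"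

lemma has_value_exists: "exp_xi_defined x u \<Longrightarrow> \<exists>r. has_value (exp_xi x) u r"
  by (auto simp: exp_xi_defined_def has_value_def)

lemma has_value_one: "has_value 1 u 1"
  unfolding has_value_def
proof (intro exI[of _ 1] conjI)
  have nz: "fps_nth (fps_of_poly 1 * 1) m * u ^ m = 0" if "m \<notin> {0}" for m
    using that by simp
  show "summable (\<lambda>m. norm (fps_nth (fps_of_poly 1 * 1) m * u ^ m))"
    by (rule summable_finite[of "{0}"]) (use nz in auto)
  have "(\<Sum>m. fps_nth (fps_of_poly 1 * 1) m * u ^ m) = (\<Sum>m\<in>{0}. fps_nth (fps_of_poly 1 * 1) m * u ^ m)"
    by (rule suminf_finite) (use nz in auto)
  then show "1 = (\<Sum>m. fps_nth (fps_of_poly 1 * 1) m * u ^ m) / poly 1 u"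
    by simp
qed simp

lemma has_value_mult_linear:
  assumes "has_value f u r"
  shows "has_value (fps_of_poly [:1, - c:] * f) u ((1 - c * u) * r)"
proof -
  obtain D where D: "poly D u \<noteq> 0" "summable (\<lambda>m. norm (fps_nth (fps_of_poly D * f) m * u ^ m))"
    "r = (\<Sum>m. fps_nth (fps_of_poly D * f) m * u ^ m) / poly D u"
    using assms unfolding has_value_def by blast
  define F where "F m = fps_nth (fps_of_poly D * f) m * u ^ m" for m
  define G where "G m = (if m = 0 then 0 else - c * u * F (m - 1))" for m
  have eq: "fps_nth (fps_of_poly D * (fps_of_poly [:1, - c:] * f)) m * u ^ m = F m + G m" for m
  proof -
    define K where "K = fps_of_poly D * f"
    have "fps_of_poly D * (fps_of_poly [:1, - c:] * f) = K - fps_const c * (fps_X * K)"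
      by (simp add: K_def fps_of_poly_pCons fps_const_neg[symmetric] algebra_simps del: fps_const_neg)
    then show ?thesis
      unfolding F_def G_def K_def[symmetric] by (simp only:) (cases m; simp add: algebra_simps)
  qed
  have F: "summable (\<lambda>m. norm (F m))"
    using D(2) by (simp add: F_def)
  have "summable (\<lambda>m. norm (G (Suc m)))"
    unfolding G_def using F by (simp add: norm_mult summable_mult)
  then have G: "summable (\<lambda>m. norm (G m))"
    by (subst (asm) summable_Suc_iff)
  have "(\<Sum>m. G m) = G 0 + (\<Sum>m. G (Suc m))"
    using summable_norm_cancel[OF G] by (simp add: suminf_split_head)
  also have "\<dots> = - c * u * (\<Sum>m. F m)"
    using suminf_mult[OF summable_norm_cancel[OF F], of "- c * u"] by (simp add: G_def)
  finally have sumG: "(\<Sum>m. G m) = - c * u * (\<Sum>m. F m)" .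
  have "summable (\<lambda>m. norm (F m + G m))"
    by (rule summable_comparison_test'[OF summable_add[OF F G], of 0]) (simp add: norm_triangle_ineq)
  moreover have "(\<Sum>m. F m + G m) = (1 - c * u) * (\<Sum>m. F m)"
    using suminf_add[OF summable_norm_cancel[OF F] summable_norm_cancel[OF G]] sumG by (simp add:
        algebra_simps)
  ultimately show ?thesis
    unfolding has_value_def by (intro exI[of _ D]) (simp add: eq D(1,3) F_def)
qed

lemma has_value_div_linear:
  assumes "has_value (fps_of_poly [:1, - c:] * f) u r" "1 - c * u \<noteq> 0"
  shows "has_value f u (r / (1 - c * u))"
proof -
  obtain D where D: "poly D u \<noteq> 0"
    "summable (\<lambda>m. norm (fps_nth (fps_of_poly D * (fps_of_poly [:1, - c:] * f)) m * u ^ m))"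
    "r = (\<Sum>m. fps_nth (fps_of_poly D * (fps_of_poly [:1, - c:] * f)) m * u ^ m) / poly D u"
    using assms(1) unfolding has_value_def by blast
  have "fps_of_poly (D * [:1, - c:]) * f = fps_of_poly D * (fps_of_poly [:1, - c:] * f)"
    by (simp only: fps_of_poly_mult mult.assoc)
  note eq = this
  show ?thesis
    unfolding has_value_def
  proof (intro exI[of _ "D * [:1, - c:]"] conjI)
    have p: "poly (D * [:1, - c:]) u = poly D u * (1 - c * u)"
      by (simp add: algebra_simps)
    show "poly (D * [:1, - c:]) u \<noteq> 0"
      unfolding p using D(1) assms(2) by simp
    show "r / (1 - c * u) = (\<Sum>m. fps_nth (fps_of_poly (D * [:1, - c:]) * f) m * u ^ m) / poly (D *
        [:1, - c:]) u"
      unfolding eq p D(3) by simp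
  qed (use D(2) in \<open>simp only: eq\<close>)
qed

lemma has_value_reflect:
  assumes "has_value f u r"
  shows "has_value (fps_compose f (- fps_X)) (- u) r"
proof -
  obtain D where D: "poly D u \<noteq> 0" "summable (\<lambda>m. norm (fps_nth (fps_of_poly D * f) m * u ^ m))"
    "r = (\<Sum>m. fps_nth (fps_of_poly D * f) m * u ^ m) / poly D u"
    using assms unfolding has_value_def by blast
  have "fps_of_poly (pcompose D [:0, - 1:]) = fps_compose (fps_of_poly D) (- fps_X)"
    by (subst fps_of_poly_pcompose) (simp_all add: fps_of_poly_pCons fps_const_neg[symmetric] del:
        fps_const_neg)
  then have "fps_of_poly (pcompose D [:0, - 1:]) * fps_compose f (- fps_X) =
      fps_compose (fps_of_poly D * f) (- fps_X)"
    by (simp add: fps_compose_mult_distrib)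
  then have "fps_nth (fps_of_poly (pcompose D [:0, - 1:]) * fps_compose f (- fps_X)) m * (- u) ^ m =
      fps_nth (fps_of_poly D * f) m * u ^ m" for m
    by (simp add: fps_compose_uminus' power_minus[of u])
  then show ?thesis
    unfolding has_value_def using D
    by (intro exI[of _ "pcompose D [:0, - 1:]"]) (simp add: poly_pcompose)
qed

text \<open>\<open>exp_values x u r r'\<close>: the fields \<open>\<psi>(u)\<close> and \<open>\<psi>\<^sup>*(-u)\<close> acquire the factors \<open>r\<close> and
    \<open>r'\<close> at the time \<open>x\<close>.\<close>

definition exp_values :: "time \<Rightarrow> complex \<Rightarrow> complex \<Rightarrow> complex \<Rightarrow> bool" where
  "exp_values x u r r' \<longleftrightarrow> has_value (exp_xi x) u r \<and> has_value (exp_xi (- x)) (- u) r'"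

lemma exp_values_odd:
  assumes "odd_time x" "has_value (exp_xi x) u r"
  shows "exp_values x u r r"
  using has_value_reflect[OF assms(2)] assms by (simp add: exp_values_def exp_xi_odd)

lemma exp_xi_minus_eps: "exp_xi (x - eps c) = fps_of_poly [:1, - c:] * exp_xi x"
proof -
  have "exp_xi x = exp_xi (x - eps c) * exp_xi (eps c)"
    by (simp flip: exp_xi_add)
  then have "fps_of_poly [:1, - c:] * exp_xi x = exp_xi (x - eps c) * (fps_of_poly [:1, -
      c:] * exp_xi (eps c))"
    by (simp only: mult.left_commute)
  then show ?thesis
    by (simp only: exp_xi_eps mult_1_right)
qed

lemma exp_values_minus_eps:
  assumes "exp_values x u r r'" "1 + c * u \<noteq> 0"
  shows "exp_values (x - eps c) u ((1 - c * u) * r) (r' / (1 + c * u))"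
  unfolding exp_values_def
proof
  show "has_value (exp_xi (x - eps c)) u ((1 - c * u) * r)"
    unfolding exp_xi_minus_eps using assms by (intro has_value_mult_linear) (simp add: exp_values_def)
  have "fps_of_poly [:1, - c:] * exp_xi (- (x - eps c)) = exp_xi (- x)"
    unfolding exp_xi_minus_eps[symmetric] by simp
  then show "has_value (exp_xi (- (x - eps c))) (- u) (r' / (1 + c * u))"
    using has_value_div_linear[of c "exp_xi (- (x - eps c))" "- u" r'] assms by (simp add: exp_values_def)
qed

lemma exp_values_minus_teps:
  assumes "exp_values x u r r'" "1 + c * u \<noteq> 0"
  shows "exp_values (x - teps c) u (r / (1 + c * u)) ((1 - c * u) * r')"
  unfolding exp_values_def
proof
  have "fps_of_poly [:1, - (- c):] * exp_xi (x - teps c) = exp_xi x"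
    unfolding exp_xi_minus_eps[symmetric] by (simp add: teps_altdef)
  then show "has_value (exp_xi (x - teps c)) u (r / (1 + c * u))"
    using has_value_div_linear[of "- c" "exp_xi (x - teps c)" u r] assms by (simp add: exp_values_def)
  have "exp_xi (- (x - teps c)) = fps_of_poly [:1, - (- c):] * exp_xi (- x)"
    unfolding exp_xi_minus_eps[symmetric] by (simp add: teps_altdef)
  then show "has_value (exp_xi (- (x - teps c))) (- u) ((1 - c * u) * r')"
    using has_value_mult_linear[of "exp_xi (- x)" "- u" r' "- c"] assms by (simp add: exp_values_def)
qed

definition eval2 :: "laurent2 \<Rightarrow> complex \<Rightarrow> complex \<Rightarrow> complex" where
  "eval2 D u v = infsum (lterm D u v) UNIV"

definition finite_laurent :: "laurent2 \<Rightarrow> bool" where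
  "finite_laurent D \<longleftrightarrow> finite {d. D d \<noteq> 0}"

lemma lmult_superset:
  assumes "finite S" "{d. D d \<noteq> 0} \<subseteq> S"
  shows "lmult D G d = (\<Sum>e\<in>S. D e * G (d - e))"
  unfolding lmult_def using assms by (intro sum.mono_neutral_left) auto

lemma eval2_finite:
  assumes "finite S" "{d. D d \<noteq> 0} \<subseteq> S"
  shows "eval2 D u v = (\<Sum>d\<in>S. lterm D u v d)"
proof -
  have "eval2 D u v = infsum (lterm D u v) S"
    unfolding eval2_def using assms(2) by (intro infsum_cong_neutral) (auto simp: lterm_def)
  then show ?thesis
    using assms(1) by simp
qed

lemma lterm_finite_summable:
  "finite_laurent D \<Longrightarrow> (\<lambda>d. norm (lterm D u v d)) summable_on UNIV"
proof (rule finite_nonzero_values_imp_summable_on)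
  assume "finite_laurent D"
  moreover have "{d \<in> UNIV. norm (lterm D u v d) \<noteq> 0} \<subseteq> {d. D d \<noteq> 0}"
    by (auto simp: lterm_def)
  ultimately show "finite {d \<in> UNIV. norm (lterm D u v d) \<noteq> 0}"
    unfolding finite_laurent_def by (rule rev_finite_subset)
qed

lemma lmult_assoc:
  assumes D: "finite_laurent D" and D': "finite_laurent D'"
  shows "lmult (lmult D D') G = lmult D (lmult D' G)" and "finite_laurent (lmult D D')"
proof -
  let ?S = "{d. D d \<noteq> 0}" and ?S' = "{d. D' d \<noteq> 0}"
  let ?T = "(\<lambda>(e, f). e + f) ` (?S \<times> ?S')"
  have fin: "finite ?S" "finite ?S'" "finite ?T"
    using D D' by (auto simp: finite_laurent_def)
  have T: "{d. lmult D D' d \<noteq> 0} \<subseteq> ?T"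
  proof
    fix d assume "d \<in> {d. lmult D D' d \<noteq> 0}"
    then obtain e where "e \<in> ?S" "D' (d - e) \<noteq> 0"
      unfolding lmult_def by (auto elim!: sum.not_neutral_contains_not_neutral)
    then show "d \<in> ?T"
      by (intro image_eqI[of _ _ "(e, d - e)"]) auto
  qed
  then show "finite_laurent (lmult D D')"
    unfolding finite_laurent_def using fin finite_subset by blast
  show "lmult (lmult D D') G = lmult D (lmult D' G)"
  proof
    fix d
    have "lmult (lmult D D') G d = (\<Sum>e\<in>?T. \<Sum>f\<in>?S. D f * (D' (e - f) * G (d - e)))"
      unfolding lmult_superset[OF fin(3) T] by (simp add: lmult_def sum_distrib_right mult.assoc)
    also have "\<dots> = (\<Sum>f\<in>?S. \<Sum>e\<in>?T. D f * (D' (e - f) * G (d - e)))"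
      by (rule sum.swap)
    also have "\<dots> = (\<Sum>f\<in>?S. D f * lmult D' G (d - f))"
    proof (rule sum.cong[OF refl])
      fix f assume f: "f \<in> ?S"
      have "(\<Sum>e\<in>?T. D' (e - f) * G (d - e)) = (\<Sum>e\<in>(\<lambda>h. f + h) ` ?S'. D' (e - f) * G (d - e))"
      proof (rule sum.mono_neutral_right)
        show "(\<lambda>h. f + h) ` ?S' \<subseteq> ?T"
        proof (rule image_subsetI)
          fix h assume "h \<in> ?S'"
          then show "f + h \<in> ?T"
            using f by (intro image_eqI[of _ _ "(f, h)"]) auto
        qed
        show "\<forall>e\<in>?T - (\<lambda>h. f + h) ` ?S'. D' (e - f) * G (d - e) = 0"
        proof
          fix e assume "e \<in> ?T - (\<lambda>h. f + h) ` ?S'"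
          then have "e - f \<notin> ?S'"
            using image_eqI[of e "\<lambda>h. f + h" "e - f" ?S'] by auto
          then show "D' (e - f) * G (d - e) = 0"
            by simp
        qed
      qed (rule fin)
      also have "\<dots> = lmult D' G (d - f)"
        by (subst sum.reindex) (auto simp: lmult_def diff_diff_eq)
      finally show "(\<Sum>e\<in>?T. D f * (D' (e - f) * G (d - e))) = D f * lmult D' G (d - f)"
        by (simp only: sum_distrib_left[symmetric])
    qed
    finally show "lmult (lmult D D') G d = lmult D (lmult D' G) d"
      by (simp add: lmult_def[of D])
  qed
qed

lemma eval2_lmult:
  assumes "finite_laurent D" "u \<noteq> 0" "v \<noteq> 0" "(\<lambda>d. norm (lterm C u v d)) summable_on UNIV"
  shows "eval2 (lmult D C) u v = eval2 D u v * eval2 C u v"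
  unfolding eval2_def using assms by (intro infsum_lmult) (simp_all add: finite_laurent_def)

lemma lmult_abs_summable:
  assumes D: "finite_laurent D" and uv: "u \<noteq> 0" "v \<noteq> 0"
    and C: "(\<lambda>d. norm (lterm C u v d)) summable_on UNIV"
  shows "(\<lambda>d. norm (lterm (lmult D C) u v d)) summable_on UNIV"
proof -
  let ?S = "{d. D d \<noteq> 0}"
  have fin: "finite ?S"
    using D by (simp add: finite_laurent_def)
  have eq: "lterm (lmult D C) u v d = (\<Sum>e\<in>?S. lterm D u v e * lterm C u v (d - e))" for d
    using uv by (cases d)
      (auto simp: lterm_def lmult_def sum_distrib_right power_int_diff intro!: sum.cong)
  have shift: "(\<lambda>d. norm (lterm D u v e * lterm C u v (d - e))) summable_on UNIV" for e
  proof -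
    have "bij (\<lambda>d :: int \<times> int. d - e)"
      by (rule bij_betw_byWitness[where f' = "\<lambda>d. d + e"]) auto
    then have "(\<lambda>d. norm (lterm C u v (d - e))) summable_on UNIV"
      using summable_on_reindex_bij_betw[of "\<lambda>d. d - e" UNIV UNIV "\<lambda>d. norm (lterm C u v d)"] C by blast
    then show ?thesis
      unfolding norm_mult by (rule summable_on_cmult_right)
  qed
  have "(\<lambda>d. norm (\<Sum>e\<in>T. lterm D u v e * lterm C u v (d - e))) summable_on UNIV" if "finite T" for T
    using that
  proof induction
    case (insert e T)
    have "(\<lambda>d. norm (lterm D u v e * lterm C u v (d - e)) + norm (\<Sum>e\<in>T. lterm D u v e * lterm C u v
        (d - e))) summable_on UNIV"
      using shift insert.IH by (rule summable_on_add)
    then show ?case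
      by (rule summable_on_comparison_test) (use insert.hyps in \<open>auto intro: norm_triangle_ineq\<close>)
  qed simp
  then show ?thesis
    unfolding eq using fin by blast
qed

definition tensor :: "complex fps \<Rightarrow> complex fps \<Rightarrow> laurent2" where
  "tensor A B = (\<lambda>(j, k). if j \<ge> 0 \<and> k \<ge> 0 then fps_nth A (nat j) * fps_nth B (nat k) else 0)"

lemma has_sum_tensor:
  assumes A: "summable (\<lambda>m. norm (fps_nth A m * u ^ m))" and B: "summable (\<lambda>m. norm (fps_nth B m * v ^ m))"
  shows "(\<lambda>d. norm (lterm (tensor A B) u v d)) summable_on UNIV"
    and "eval2 (tensor A B) u v = (\<Sum>m. fps_nth A m * u ^ m) * (\<Sum>m. fps_nth B m * v ^ m)"
proof -
  define x where "x m = fps_nth A m * u ^ m" for m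
  define y where "y m = fps_nth B m * v ^ m" for m
  have x: "summable (\<lambda>m. norm (x m))" and y: "summable (\<lambda>m. norm (y m))"
    using A B by (simp_all add: x_def y_def)
  let ?h = "map_prod int int"
  have inj: "inj ?h"
    by (auto simp: inj_on_def)
  have lt: "lterm (tensor A B) u v (?h p) = x (fst p) * y (snd p)" for p
    by (cases p) (simp add: lterm_def tensor_def x_def y_def)
  have zero: "lterm (tensor A B) u v d = 0" if "d \<notin> range ?h" for d
  proof -
    obtain j k where d: "d = (j, k)"
      by (cases d)
    have "\<not> (j \<ge> 0 \<and> k \<ge> 0)"
      using that d by (metis (no_types, lifting) int_nat_eq map_prod_simp rangeI)
    then show ?thesis
      by (auto simp: d lterm_def tensor_def)
  qed
  have xs: "(\<lambda>m. norm (x m)) summable_on UNIV" and ys: "(\<lambda>m. norm (y m)) summable_on UNIV"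
    using x y by (simp_all add: norm_summable_imp_summable_on)
  have "(\<lambda>p. norm (x (fst p) * y (snd p))) summable_on UNIV \<times> UNIV"
    unfolding Infinite_Sum.abs_summable_on_Sigma_iff
  proof (intro conjI ballI)
    show "(\<lambda>b. norm (x (fst (a, b)) * y (snd (a, b)))) summable_on UNIV" for a
      using ys by (simp add: norm_mult summable_on_cmult_right)
    show "(\<lambda>a. norm (\<Sum>\<^sub>\<infinity>b. norm (x (fst (a, b)) * y (snd (a, b))))) summable_on UNIV"
      using xs by (simp add: norm_mult infsum_cmult_right' summable_on_cmult_left abs_mult)
  qed
  then have prod: "(\<lambda>p. norm (x (fst p) * y (snd p))) summable_on UNIV"
    by simp
  have "(\<lambda>d. norm (lterm (tensor A B) u v d)) summable_on range ?h"
    using prod by (subst summable_on_reindex[OF inj]) (simp add: comp_def lt)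
  then show "(\<lambda>d. norm (lterm (tensor A B) u v d)) summable_on UNIV"
    by (rule summable_on_cong_neutral[THEN iffD1, rotated -1]) (auto simp: zero)
  have "eval2 (tensor A B) u v = infsum (lterm (tensor A B) u v) (range ?h)"
    unfolding eval2_def by (rule infsum_cong_neutral) (auto simp: zero)
  also have "\<dots> = (\<Sum>\<^sub>\<infinity>p. x (fst p) * y (snd p))"
    by (subst infsum_reindex[OF inj]) (simp add: comp_def lt)
  also have "\<dots> = (\<Sum>\<^sub>\<infinity>a. \<Sum>\<^sub>\<infinity>b. x a * y b)"
    using infsum_Sigma'_banach[of "\<lambda>a b. x a * y b" UNIV "\<lambda>_. UNIV"] abs_summable_summable[OF prod]
    by (simp add: case_prod_unfold)
  also have "\<dots> = infsum x UNIV * infsum y UNIV"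
    by (simp add: infsum_cmult_right' infsum_cmult_left')
  also have "infsum x UNIV = suminf x"
    using norm_summable_imp_has_sum[OF x] summable_norm_cancel[OF x] by (intro infsumI) (simp add:
        summable_sums)
  also have "infsum y UNIV = suminf y"
    using norm_summable_imp_has_sum[OF y] summable_norm_cancel[OF y] by (intro infsumI) (simp add:
        summable_sums)
  finally show "eval2 (tensor A B) u v = (\<Sum>m. fps_nth A m * u ^ m) * (\<Sum>m. fps_nth B m * v ^ m)"
    by (simp add: x_def[abs_def] y_def[abs_def])
qed

lemma finite_laurent_tensor: "finite_laurent (tensor (fps_of_poly p) (fps_of_poly q))"
proof -
  have "{d. tensor (fps_of_poly p) (fps_of_poly q) d \<noteq> 0} \<subseteq> map_prod int int ` ({..degree p} \<times>
      {..degree q})"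
  proof clarify
    fix j k assume "tensor (fps_of_poly p) (fps_of_poly q) (j, k) \<noteq> 0"
    then have "j \<ge> 0" "k \<ge> 0" "coeff p (nat j) \<noteq> 0" "coeff q (nat k) \<noteq> 0"
      by (auto simp: tensor_def split: if_splits)
    then show "(j, k) \<in> map_prod int int ` ({..degree p} \<times> {..degree q})"
      by (intro image_eqI[of _ _ "(nat j, nat k)"]) (auto simp: le_degree)
  qed
  then show ?thesis
    unfolding finite_laurent_def by (rule finite_subset) auto
qed

lemma eval2_tensor_poly:
  "eval2 (tensor (fps_of_poly p) (fps_of_poly q)) u v = poly p u * poly q v"
proof -
  have "(\<lambda>m. fps_nth (fps_of_poly p) m * u ^ m) sums poly p u" for p :: "complex poly" and u
    unfolding poly_altdef fps_of_poly_nth by (rule sums_finite) (auto simp: coeff_eq_0)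
  moreover have "summable (\<lambda>m. norm (fps_nth (fps_of_poly p) m * u ^ m))" for p :: "complex poly" and u
    by (rule summable_finite[of "{..degree p}"]) (auto simp: coeff_eq_0)
  ultimately show ?thesis
    by (simp add: has_sum_tensor(2) sums_iff)
qed

lemma lmult_tensor:
  "lmult (tensor (fps_of_poly p) (fps_of_poly q)) (tensor A B) = tensor (fps_of_poly p * A)
      (fps_of_poly q * B)"
proof
  fix d :: "int \<times> int"
  obtain j k where d: "d = (j, k)"
    by (cases d)
  let ?D = "tensor (fps_of_poly p) (fps_of_poly q)"
  let ?h = "map_prod int int"
  define m n where "m = degree p + nat j" and "n = degree q + nat k"
  have sub: "{d. ?D d \<noteq> 0} \<subseteq> ?h ` ({..m} \<times> {..n})"
  proof clarify
    fix j k assume "?D (j, k) \<noteq> 0"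
    then have "j \<ge> 0" "k \<ge> 0" "coeff p (nat j) \<noteq> 0" "coeff q (nat k) \<noteq> 0"
      by (auto simp: tensor_def split: if_splits)
    then show "(j, k) \<in> ?h ` ({..m} \<times> {..n})"
      using le_degree[of p "nat j"] le_degree[of q "nat k"]
      by (intro image_eqI[of _ _ "(nat j, nat k)"]) (auto simp: m_def n_def)
  qed
  have "lmult ?D (tensor A B) d = (\<Sum>e\<in>?h ` ({..m} \<times> {..n}). ?D e * tensor A B (d - e))"
    using sub by (intro lmult_superset) auto
  also have "\<dots> = (\<Sum>(a, b)\<in>{..m} \<times> {..n}. coeff p a * coeff q b * tensor A B (j - int a, k - int b))"
  proof (subst sum.reindex)
    show "inj_on ?h ({..m} \<times> {..n})"
      by (auto simp: inj_on_def)
    show "sum ((\<lambda>e. ?D e * tensor A B (d - e)) \<circ> ?h) ({..m} \<times> {..n}) =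
        (\<Sum>(a, b)\<in>{..m} \<times> {..n}. coeff p a * coeff q b * tensor A B (j - int a, k - int b))"
    proof (rule sum.cong[OF refl])
      fix z :: "nat \<times> nat"
      obtain a b where z: "z = (a, b)"
        by (cases z)
      have "?D (int a, int b) = coeff p a * coeff q b"
        by (simp add: tensor_def)
      then show "((\<lambda>e. ?D e * tensor A B (d - e)) \<circ> ?h) z =
          (case z of (a, b) \<Rightarrow> coeff p a * coeff q b * tensor A B (j - int a, k - int b))"
        by (simp add: z d)
    qed
  qed
  also have "\<dots> = tensor (fps_of_poly p * A) (fps_of_poly q * B) d"
  proof (cases "j \<ge> 0 \<and> k \<ge> 0")
    case True
    have "(\<Sum>(a, b)\<in>{..m} \<times> {..n}. coeff p a * coeff q b * tensor A B (j - int a, k - int b)) =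
        (\<Sum>(a, b)\<in>{..nat j} \<times> {..nat k}. coeff p a * coeff q b * tensor A B (j - int a, k - int b))"
    proof (rule sum.mono_neutral_right)
      show "{..nat j} \<times> {..nat k} \<subseteq> {..m} \<times> {..n}"
        by (auto simp: m_def n_def)
      show "\<forall>z\<in>{..m} \<times> {..n} - {..nat j} \<times> {..nat k}.
          (case z of (a, b) \<Rightarrow> coeff p a * coeff q b * tensor A B (j - int a, k - int b)) = 0"
      proof
        fix z assume "z \<in> {..m} \<times> {..n} - {..nat j} \<times> {..nat k}"
        then have "\<not> (j - int (fst z) \<ge> 0 \<and> k - int (snd z) \<ge> 0)"
          using True by (cases z) auto
        then show "(case z of (a, b) \<Rightarrow> coeff p a * coeff q b * tensor A B (j - int a, k - int b)) = 0"
          by (auto simp: tensor_def case_prod_unfold)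
      qed
    qed simp
    also have "\<dots> = (\<Sum>a\<le>nat j. \<Sum>b\<le>nat k. (coeff p a * fps_nth A (nat j - a)) * (coeff q b * fps_nth B
        (nat k - b)))"
      unfolding sum.cartesian_product
    proof (rule sum.cong[OF refl], clarify)
      fix a b assume "a \<le> nat j" "b \<le> nat k"
      then have "j - int a \<ge> 0" "k - int b \<ge> 0" "nat (j - int a) = nat j - a" "nat (k - int b) = nat k - b"
        using True by auto
      then show "coeff p a * coeff q b * tensor A B (j - int a, k - int b) =
          (coeff p a * fps_nth A (nat j - a)) * (coeff q b * fps_nth B (nat k - b))"
        by (simp add: tensor_def)
    qed
    finally show ?thesis
      using True by (simp add: d tensor_def fps_mult_nth atLeast0AtMost sum_product)
  next
    case False
    then show ?thesis
      by (auto simp: d tensor_def intro!: sum.neutral)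
  qed
  finally show "lmult ?D (tensor A B) d = tensor (fps_of_poly p * A) (fps_of_poly q * B) d" .
qed

definition conv2 :: "complex fps \<Rightarrow> complex fps \<Rightarrow> laurent2 \<Rightarrow> laurent2" where
  "conv2 A B c = (\<lambda>(j, k). \<Sum>a\<le>nat (j + k). \<Sum>b\<le>nat (j + k). fps_nth A a * fps_nth B b * c (j -
      int a, k - int b))"

lemma lmult_conv2:
  assumes c: "\<And>j k. j + k < 0 \<Longrightarrow> c (j, k) = 0"
    and D: "finite_laurent D" and C: "finite_laurent (lmult D c)"
  shows "lmult D (conv2 A B c) = lmult (lmult D c) (tensor A B)"
proof
  fix d :: "int \<times> int"
  let ?S = "{d. D d \<noteq> 0}" and ?C = "{d. lmult D c d \<noteq> 0}"
  let ?h = "\<lambda>p. d - map_prod int int p"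
  define S where "S = ?S \<union> ?C"
  have S: "finite ?S" "finite ?C" "finite S"
    using D C by (auto simp: S_def finite_laurent_def)
  define N where "N = (\<Sum>e\<in>S. nat (\<bar>fst (d - e)\<bar> + \<bar>snd (d - e)\<bar>))"
  have N: "nat (\<bar>fst (d - e)\<bar> + \<bar>snd (d - e)\<bar>) \<le> N" if "e \<in> S" for e
    unfolding N_def using that S by (intro member_le_sum) auto
  have big: "conv2 A B c (d - e) = (\<Sum>p\<in>{..N} \<times> {..N}. fps_nth A (fst p) * fps_nth B (snd p) * c (?h p - e))"
    if "e \<in> S" for e
  proof -
    obtain j k where jk: "d - e = (j, k)"
      by (cases "d - e")
    have le: "nat (j + k) \<le> N"
      using N[OF that] jk by auto
    have "conv2 A B c (d - e) = (\<Sum>p\<in>{..nat (j + k)} \<times> {..nat (j + k)}. fps_nth A (fst p) * fps_nth B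
        (snd p) *
        c (j - int (fst p), k - int (snd p)))"
      by (simp add: conv2_def jk sum.cartesian_product case_prod_unfold)
    also have "\<dots> = (\<Sum>p\<in>{..N} \<times> {..N}. fps_nth A (fst p) * fps_nth B (snd p) * c (j - int (fst p),
        k - int (snd p)))"
      using le by (intro sum.mono_neutral_left) (auto intro!: c)
    also have "\<dots> = (\<Sum>p\<in>{..N} \<times> {..N}. fps_nth A (fst p) * fps_nth B (snd p) * c (?h p - e))"
    proof (intro sum.cong refl)
      fix p :: "nat \<times> nat"
      have "?h p - e = (d - e) - map_prod int int p"
        by (simp add: algebra_simps)
      then show "fps_nth A (fst p) * fps_nth B (snd p) * c (j - int (fst p), k - int (snd p)) =
          fps_nth A (fst p) * fps_nth B (snd p) * c (?h p - e)"
        by (simp add: jk map_prod_def case_prod_unfold)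
    qed
    finally show ?thesis .
  qed
  have "lmult D (conv2 A B c) d = (\<Sum>e\<in>?S. D e * (\<Sum>p\<in>{..N} \<times> {..N}. fps_nth A (fst p) * fps_nth B
      (snd p) * c (?h p - e)))"
    unfolding lmult_def by (intro sum.cong refl) (simp add: big S_def)
  also have "\<dots> = (\<Sum>p\<in>{..N} \<times> {..N}. fps_nth A (fst p) * fps_nth B (snd p) * lmult D c (?h p))"
    unfolding lmult_def sum_distrib_left by (subst sum.swap) (simp add: mult_ac)
  also have "\<dots> = (\<Sum>p\<in>{p \<in> {..N} \<times> {..N}. ?h p \<in> ?C}. fps_nth A (fst p) * fps_nth B (snd p) * lmult D
      c (?h p))"
    by (rule sum.mono_neutral_right) auto
  also have "\<dots> = (\<Sum>e\<in>{e \<in> ?C. fst (d - e) \<ge> 0 \<and> snd (d - e) \<ge> 0}. lmult D c e * tensor A B (d - e))"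
  proof (rule sum.reindex_bij_witness[where j = ?h and i = "\<lambda>e. (nat (fst (d - e)), nat (snd (d - e)))"])
    fix e assume e: "e \<in> {e \<in> ?C. fst (d - e) \<ge> 0 \<and> snd (d - e) \<ge> 0}"
    then have le: "nat (fst (d - e)) \<le> N" "nat (snd (d - e)) \<le> N"
      using N[of e] by (auto simp: S_def)
    show inv: "?h (nat (fst (d - e)), nat (snd (d - e))) = e"
      using e by (cases d; cases e) auto
    show "(nat (fst (d - e)), nat (snd (d - e))) \<in> {p \<in> {..N} \<times> {..N}. ?h p \<in> ?C}"
      using le e inv by auto
  qed (auto simp: tensor_def map_prod_def case_prod_unfold split: prod.split)
  also have "\<dots> = (\<Sum>e\<in>?C. lmult D c e * tensor A B (d - e))"
    using S by (intro sum.mono_neutral_left) (auto simp: tensor_def case_prod_unfold split: if_splits)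
  also have "\<dots> = lmult (lmult D c) (tensor A B) d"
    by (simp add: lmult_def[of "lmult D c"])
  finally show "lmult D (conv2 A B c) d = lmult (lmult D c) (tensor A B) d" .
qed

lemma reading_conv2:
  assumes A: "has_value A u \<alpha>" and B: "has_value B v \<beta>" and uv: "u \<noteq> 0" "v \<noteq> 0"
    and c: "\<And>j k. j + k < 0 \<Longrightarrow> c (j, k) = 0"
    and D: "finite_laurent D" "eval2 D u v \<noteq> 0" and C: "finite_laurent (lmult D c)"
  shows "reading (conv2 A B c) u v = \<alpha> * \<beta> * (eval2 (lmult D c) u v / eval2 D u v)"
proof -
  obtain p where p: "poly p u \<noteq> 0" "summable (\<lambda>m. norm (fps_nth (fps_of_poly p * A) m * u ^ m))"
    "\<alpha> = (\<Sum>m. fps_nth (fps_of_poly p * A) m * u ^ m) / poly p u"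
    using A unfolding has_value_def by blast
  obtain q where q: "poly q v \<noteq> 0" "summable (\<lambda>m. norm (fps_nth (fps_of_poly q * B) m * v ^ m))"
    "\<beta> = (\<Sum>m. fps_nth (fps_of_poly q * B) m * v ^ m) / poly q v"
    using B unfolding has_value_def by blast
  define P where "P = tensor (fps_of_poly p) (fps_of_poly q)"
  define E where "E = lmult P D"
  define T where "T = tensor (fps_of_poly p * A) (fps_of_poly q * B)"
  have P: "finite_laurent P"
    unfolding P_def by (rule finite_laurent_tensor)
  have E: "finite_laurent E"
    unfolding E_def using P D(1) by (rule lmult_assoc)
  have evE: "eval2 E u v = poly p u * poly q v * eval2 D u v"
    unfolding E_def using P uv lterm_finite_summable[OF D(1)]
    by (simp add: eval2_lmult eval2_tensor_poly P_def)
  have "lmult E (conv2 A B c) = lmult P (lmult (lmult D c) (tensor A B))"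
    unfolding E_def using P D(1) C c by (simp add: lmult_assoc lmult_conv2)
  also have "\<dots> = lmult (lmult D c) T"
    unfolding T_def P_def by (subst lmult_commute) (simp add: lmult_tensor)
  finally have EG: "lmult E (conv2 A B c) = lmult (lmult D c) T" .
  have T: "(\<lambda>d. norm (lterm T u v d)) summable_on UNIV"
    "eval2 T u v = (\<alpha> * poly p u) * (\<beta> * poly q v)"
    unfolding T_def using p q by (simp_all add: has_sum_tensor)
  have evEG: "eval2 (lmult E (conv2 A B c)) u v = eval2 (lmult D c) u v * ((\<alpha> * poly p u) * (\<beta> * poly q v))"
    unfolding EG using C uv T by (simp add: eval2_lmult)
  have "has_reading (conv2 A B c) u v (\<alpha> * \<beta> * (eval2 (lmult D c) u v / eval2 D u v))"
    unfolding has_reading_def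
  proof (intro exI[of _ E] conjI)
    show "finite {d. E d \<noteq> 0}"
      using E by (simp add: finite_laurent_def)
    show "infsum (lterm E u v) UNIV \<noteq> 0"
      using evE p(1) q(1) D(2) by (simp add: eval2_def)
    show "(\<lambda>d. norm (lterm (lmult E (conv2 A B c)) u v d)) summable_on UNIV"
      unfolding EG using C uv T(1) by (rule lmult_abs_summable)
    show "\<alpha> * \<beta> * (eval2 (lmult D c) u v / eval2 D u v) =
        infsum (lterm (lmult E (conv2 A B c)) u v) UNIV / infsum (lterm E u v) UNIV"
      using evE evEG p(1) q(1) unfolding eval2_def[symmetric] by simp
  qed
  then show ?thesis
    unfolding reading_def using has_reading_unique[OF _ _ uv] by blast
qed

section \<open>Expectation values as Pfaffian and determinant sums\<close>

lemma wick_cong_ordered: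
  "sorted_wrt (\<lambda>a b. P a b = Q a b) ws \<Longrightarrow> wick P ws = wick Q ws"
proof (induction "length ws" arbitrary: ws rule: less_induct)
  case less
  show ?case
  proof (cases ws)
    case (Cons a us)
    have *: "\<And>b. b \<in> set us \<Longrightarrow> P a b = Q a b" "sorted_wrt (\<lambda>a b. P a b = Q a b) us"
      using less.prems Cons by auto
    have "sorted_wrt (\<lambda>a b. P a b = Q a b) (take i us @ drop (Suc i) us)" if "i < length us" for i
      using *(2) id_take_nth_drop[OF that]
      by (metis (no_types, lifting) sorted_wrt_append sorted_wrt.simps(2) list.set_intros(2))
    then have "wick P (take i us @ drop (Suc i) us) = wick Q (take i us @ drop (Suc i) us)"
        if "i < length us" for i
      using that Cons by (intro less.hyps) auto
    then show ?thesis
      using * by (simp add: Cons wick.simps)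
  qed simp
qed

lemma wick_odd: "odd (length ws) \<Longrightarrow> wick P ws = 0"
proof (induction "length ws" arbitrary: ws rule: less_induct)
  case less
  show ?case
  proof (cases ws)
    case (Cons a us)
    have "wick P (take i us @ drop (Suc i) us) = 0" if "i < length us" for i
      using that less.prems Cons by (intro less.hyps) auto
    then show ?thesis
      by (simp add: Cons wick.simps)
  qed (use less.prems in simp)
qed

lemma alternating_move:
  "alternating T \<Longrightarrow> T (us @ m @ w # ws) = (-1) ^ length m * T (us @ w # m @ ws)"
proof (induction m arbitrary: us)
  case (Cons a m)
  have "T (us @ (a # m) @ w # ws) = (-1) ^ length m * T ((us @ [a]) @ w # m @ ws)"
    using Cons.IH[OF Cons.prems, of "us @ [a]"] by simp
  also have "T ((us @ [a]) @ w # m @ ws) = - T (us @ w # a # m @ ws)"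
    using alternatingD[OF Cons.prems, of us a w "m @ ws"] by simp
  finally show ?case
    by simp
qed simp

lemma wick_sandwich_rank_two:
  "wick P (u # l @ [w]) =
   (P u w - 1) * wick P l + wick (\<lambda>a b. P a b + 1 * (P u a * P b w - P a w * P u b)) l"
proof (cases "even (length l)")
  case True
  define n where "n = length l"
  define f where "f i = (u # l @ [w]) ! i" for i
  define Q where "Q i j = (if i < j then P (f i) (f j) else if j < i then - P (f j) (f i) else 0)" for i j
  define is' where "is' = [1..<Suc n]"
  have Q: "antisymmetric Q"
    unfolding antisymmetric_def Q_def by auto
  have l: "l = map f is'"
    by (rule nth_equalityI) (auto simp: f_def is'_def n_def nth_append simp del: upt_Suc)
  have uw: "f 0 = u" "f (Suc n) = w"
    by (auto simp: f_def n_def nth_append)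
  have is': "sorted_wrt (<) is'" "set is' = {1..n}" "length is' = n"
    by (auto simp: is'_def simp del: upt_Suc)
  have Q0: "Q 0 (Suc n) = P u w"
    by (simp add: Q_def uw)
  have "u # l @ [w] = map f (0 # is' @ [Suc n])"
    by (simp add: l uw)
  then have "wick P (u # l @ [w]) = wick (\<lambda>i j. P (f i) (f j)) (0 # is' @ [Suc n])"
    by (simp only: wick_map)
  also have "\<dots> = wick Q (0 # is' @ [Suc n])"
  proof (rule wick_cong_ordered)
    have "sorted_wrt (<) (0 # is' @ [Suc n])"
      using is' by (auto simp: sorted_wrt_append)
    then show "sorted_wrt (\<lambda>i j. P (f i) (f j) = Q i j) (0 # is' @ [Suc n])"
      by (rule sorted_wrt_mono_rel[rotated]) (auto simp: Q_def)
  qed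
  also have "\<dots> = wick Q (0 # Suc n # is')"
    using alternating_move[OF alternating_wick[OF Q], of "[0]" is' "Suc n" "[]"] True
    by (simp add: is' n_def)
  also have "\<dots> = Q 0 (Suc n) * wick Q is' - contract (Q 0) (contract (Q (Suc n)) (wick Q)) is'"
    by (rule wick_Cons_Cons)
  also have "\<dots> = (P u w - 1) * wick Q is' + wick (\<lambda>i j. Q i j + - 1 * (Q 0 i * Q (Suc n) j -
      Q (Suc n) i * Q 0 j)) is'"
    unfolding wick_rank_two by (simp add: Q0 algebra_simps)
  also have "wick Q is' = wick P l"
    unfolding l wick_map
  proof (rule wick_cong_ordered)
    show "sorted_wrt (\<lambda>i j. Q i j = P (f i) (f j)) is'"
      using is'(1) by (rule sorted_wrt_mono_rel[rotated]) (auto simp: Q_def)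
  qed
  also have "wick (\<lambda>i j. Q i j + - 1 * (Q 0 i * Q (Suc n) j - Q (Suc n) i * Q 0 j)) is' =
      wick (\<lambda>a b. P a b + 1 * (P u a * P b w - P a w * P u b)) l"
    unfolding l wick_map
  proof (rule wick_cong_ordered)
    show "sorted_wrt (\<lambda>i j. Q i j + - 1 * (Q 0 i * Q (Suc n) j - Q (Suc n) i * Q 0 j) =
        P (f i) (f j) + 1 * (P u (f i) * P (f j) w - P (f i) w * P u (f j))) is'"
      using is'(1) by (rule sorted_wrt_mono_rel[rotated]) (auto simp: Q_def uw is')
  qed
  finally show ?thesis .
next
  case False
  then show ?thesis
    by (simp add: wick_odd)
qed

lemma wick_sandwich_one:
  assumes "P u w = 1"
  shows "wick P (u # l @ [w]) = wick (\<lambda>a b. P a b + (P u a * P b w - P a w * P u b)) l"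
  unfolding wick_sandwich_rank_two using assms by simp

definition vac_shifts :: "(fock \<Rightarrow> fock) \<Rightarrow> (int \<Rightarrow> lin) \<Rightarrow> time \<Rightarrow> bool" where
  "vac_shifts H B Y \<longleftrightarrow> (\<forall>k<0. lop (B k) vac = (\<lambda>_. 0)) \<and> (\<forall>k n. k \<le> int n \<longrightarrow>
     H (lop (B k) vac) = (\<lambda>D. \<Sum>l\<le>n. fps_nth (xi Y) l * lop (B (k - int l)) vac D))"

lemma vac_shiftsI:
  assumes "hamiltonian H" "shifts H B Y" "\<And>k. k < 0 \<Longrightarrow> lop (B k) vac = (\<lambda>_. 0)"
  shows "vac_shifts H B Y"
  unfolding vac_shifts_def using assms H_one_field[where kB = 0, OF assms] by auto

definition mode_modes :: "mode \<Rightarrow> int \<Rightarrow> lin" where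
  "mode_modes m j = (if j = 0 then [(1, m)] else [])"

lemma mode_field_altdef: "mode_field m = (mode_modes m, 1)"
  by (simp add: mode_field_def mode_modes_def[abs_def])

lemma xi_zero [simp]: "xi 0 = 0"
  by (simp add: xi_def fps_eq_iff)

lemma vac_shifts_mode:
  assumes ham: "hamiltonian H" and B: "vac_shifts H B Y" and m: "op m vac = (\<lambda>D. c * lop (B 0) vac D)"
  shows "vac_shifts H (mode_modes m) 0"
proof -
  have "H (lop (B 0) vac) = (\<lambda>_. 0)"
    using B[unfolded vac_shifts_def, THEN conjunct2, rule_format, of 0 0] by simp
  then have "H (op m vac) = (\<lambda>_. 0)"
    using hamiltonianD[OF ham fin_supp_lop[OF fin_supp_vac] fin_supp_zero, of c "B 0" 0] by (simp add: m)
  then show ?thesis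
    unfolding vac_shifts_def by (auto simp: mode_modes_def lop_single lop_Nil hamiltonian_zero[OF ham])
qed

lemma field_states_single:
  assumes ham: "hamiltonian H" and B: "vac_shifts H B Y"
  shows "field_states H 0 Y (\<lambda>j k. if j = 0 then lop (B k) vac else (\<lambda>_. 0))"
proof (unfold_locales, goal_cases)
  case (4 j k n D)
  then show ?case
    using B unfolding vac_shifts_def by (auto simp: hamiltonian_zero[OF ham])
qed (use B in \<open>auto simp: ham vac_shifts_def fin_supp_zero intro: fin_supp_lop fin_supp_vac\<close>)

lemma field_states_pair:
  assumes ham: "hamiltonian H" and shA: "shifts H A X" and B: "vac_shifts H B Y"
    and neg: "\<And>j k. j + k < 0 \<Longrightarrow> lop (A j) (lop (B k) vac) = (\<lambda>_. 0)"
  shows "field_states H X Y (\<lambda>j k. lop (A j) (lop (B k) vac))"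
proof (unfold_locales, goal_cases)
  case (4 j k n D)
  define N where "N = max n (nat k)"
  have HB: "H (lop (B k) vac) = (\<lambda>D. \<Sum>l\<le>N. fps_nth (xi Y) l * lop (B (k - int l)) vac D)"
    using B unfolding vac_shifts_def by (auto simp: N_def)
  have "lop (A j) (H (lop (B k) vac)) D = (\<Sum>l\<le>N. fps_nth (xi Y) l * lop (A j) (lop (B (k - int l)) vac) D)"
    unfolding HB lop_sum ..
  also have "\<dots> = (\<Sum>l\<le>n. fps_nth (xi Y) l * lop (A j) (lop (B (k - int l)) vac) D)"
    using 4 by (intro sum.mono_neutral_right) (auto simp: N_def neg)
  finally have 1: "lop (A j) (H (lop (B k) vac)) D = (\<Sum>l\<le>n. fps_nth (xi Y) l * lop (A j) (lop (B (k
      - int l)) vac) D)" .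
  have "H (lop (A j) (lop (B k) vac)) D = lop (A j) (H (lop (B k) vac)) D +
      (\<Sum>\<^sub>\<infinity>l\<in>{1..}. X l * lop (A (j - int l)) (lop (B k) vac) D)"
    using shA fin_supp_lop[OF fin_supp_vac] unfolding shifts_def by blast
  also have "(\<Sum>\<^sub>\<infinity>l\<in>{1..}. X l * lop (A (j - int l)) (lop (B k) vac) D) =
      (\<Sum>l\<le>n. if l = 0 then 0 else X l * lop (A (j - int l)) (lop (B k) vac) D)"
    using 4 by (intro infsum_truncate) (auto simp: neg)
  also have "\<dots> = (\<Sum>l\<le>n. fps_nth (xi X) l * lop (A (j - int l)) (lop (B k) vac) D)"
    by (intro sum.cong) (auto simp: xi_def)
  finally show ?case
    unfolding 1 by simp
qed (auto simp: ham neg intro: fin_supp_lop fin_supp_vac)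

definition rational_value :: "laurent2 \<Rightarrow> complex \<Rightarrow> complex \<Rightarrow> complex \<Rightarrow> bool" where
  "rational_value c u v r \<longleftrightarrow> (\<exists>D. finite_laurent D \<and> eval2 D u v \<noteq> 0 \<and> finite_laurent (lmult D c) \<and>
     r = eval2 (lmult D c) u v / eval2 D u v)"

lemma rational_value_conv2:
  assumes "rational_value c u v r" "has_value A u \<alpha>" "has_value B v \<beta>" "u \<noteq> 0" "v \<noteq> 0"
    and "\<And>j k. j + k < 0 \<Longrightarrow> c (j, k) = 0"
  shows "reading (conv2 A B c) u v = \<alpha> * \<beta> * r"
proof -
  obtain D where D: "finite_laurent D" "eval2 D u v \<noteq> 0" "finite_laurent (lmult D c)"
    "r = eval2 (lmult D c) u v / eval2 D u v"
    using assms(1) unfolding rational_value_def by blast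
  show ?thesis
    unfolding D(4) by (rule reading_conv2) (use assms D in auto)
qed

lemma eval2_superset_delta: "eval2 (\<lambda>d. if d = e then z else 0) u v = z * u powi fst e * v powi snd e"
  by (subst eval2_finite[of "{e}"]) (auto simp: lterm_def split: prod.split)

lemma rational_value_single:
  assumes "\<And>d. c d = (if d = e then z else 0)"
  shows "rational_value c u v (z * u powi fst e * v powi snd e)"
proof -
  let ?D = "\<lambda>d :: int \<times> int. if d = 0 then 1 else 0 :: complex"
  have c: "c = (\<lambda>d. if d = e then z else 0)"
    using assms by blast
  have "lmult ?D c = c"
    by (rule ext, subst lmult_superset[of "{0}"]) auto
  moreover have "finite_laurent ?D"
    unfolding finite_laurent_def by (rule finite_subset[of _ "{0}"]) auto
  moreover have "finite_laurent c"
    unfolding finite_laurent_def c by (rule finite_subset[of _ "{e}"]) auto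
  ultimately show ?thesis
    unfolding rational_value_def
    by (intro exI[of _ ?D]) (simp add: eval2_superset_delta zero_prod_def, simp add: c eval2_superset_delta)
qed

lemma rational_value_zero: "(\<And>d. c d = 0) \<Longrightarrow> rational_value c u v 0"
  using rational_value_single[of c 0 0 u v] by simp

lemma rational_value_geometric:
  assumes uv: "u - \<sigma> * v \<noteq> 0"
    and c: "\<And>j k. c (j, k) = (if j + k = 0 then if j < 0 then \<sigma> ^ nat (- j) else if j =
        0 then r else 0 else 0)"
  shows "rational_value c u v ((r * u + (1 - r) * \<sigma> * v) / (u - \<sigma> * v))"
proof -
  define D :: laurent2 where "D d = (if d = (1, 0) then 1 else if d = (0, 1) then - \<sigma> else 0)" for d
  define C :: laurent2 where "C d = (if d = (1, 0) then r else if d = (0, 1) then (1 - r) * \<sigma> else 0)" for d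
  have D: "{d. D d \<noteq> 0} \<subseteq> {(1, 0), (0, 1)}" and C: "{d. C d \<noteq> 0} \<subseteq> {(1, 0), (0, 1)}"
    by (auto simp: D_def C_def split: if_splits)
  have fin: "finite_laurent D" "finite_laurent C"
    unfolding finite_laurent_def using D C by (auto intro: finite_subset)
  have ev: "eval2 D u v = u - \<sigma> * v" "eval2 C u v = r * u + (1 - r) * \<sigma> * v"
    by (simp_all add: eval2_finite[OF _ D] eval2_finite[OF _ C] lterm_def) (simp_all add: D_def C_def)
  have "lmult D c = C"
  proof
    fix d :: "int \<times> int"
    obtain j k where d: "d = (j, k)"
      by (cases d)
    have "lmult D c d = c (j - 1, k) - \<sigma> * c (j, k - 1)"
      by (subst lmult_superset[OF _ D]) (auto simp: d D_def)
    also have "\<dots> = C d"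
    proof (cases "j + k = 1")
      case False
      then show ?thesis
        by (auto simp: c C_def d)
    next
      case True
      consider "j < 0" | "j = 0" | "j = 1" | "j > 1"
        by linarith
      then show ?thesis
      proof cases
        case 1
        then have "nat (- (j - 1)) = Suc (nat (- j))"
          by simp
        then show ?thesis
          using 1 True by (auto simp: c C_def d)
      qed (use True in \<open>auto simp: c C_def d algebra_simps\<close>)
    qed
    finally show "lmult D c d = C d" .
  qed
  then show ?thesis
    unfolding rational_value_def using fin ev uv by (intro exI[of _ D]) auto
qed

lemma conv2_one: 
  assumes "\<And>j k. j + k < 0 \<Longrightarrow> c (j, k) = 0"
  shows "conv2 1 1 c = c"
proof (rule ext, clarify)
  fix j k :: int
  have "(\<Sum>a\<le>nat (j + k). \<Sum>b\<le>nat (j + k). fps_nth 1 a * fps_nth 1 b * c (j - int a, k - int b)) =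
      (\<Sum>a\<le>nat (j + k). \<Sum>b\<le>nat (j + k). if b = 0 then if a = 0 then c (j, k) else 0 else 0)"
    by (intro sum.cong) auto
  also have "\<dots> = c (j, k)"
    by simp
  finally show "conv2 1 1 c (j, k) = c (j, k)"
    by (simp add: conv2_def)
qed

lemma op_exp_vac:
  assumes "hamiltonian H"
  shows "op_exp H vac = vac"
proof
  fix D
  have "(H ^^ k) vac D / fact k = (if k = 0 then vac D else 0)" for k
  proof (cases k)
    case (Suc m)
    have "(H ^^ Suc m) vac = (\<lambda>_. 0)"
      using assms by (induction m) (auto simp: hamiltonian_def hamiltonian_zero[OF assms])
    then show ?thesis
      by (simp add: Suc del: funpow.simps)
  qed simp
  then show "op_exp H vac D = vac D"
    unfolding op_exp_def using suminf_finite[of "{0}" "\<lambda>k. (H ^^ k) vac D / fact k"] by simp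
qed

lemma lop_lop_vac_negative:
  fixes A B :: "int \<Rightarrow> lin"
  assumes "\<And>j. j < 0 \<Longrightarrow> lop (A j) vac = (\<lambda>_. 0)" "\<And>k. k < 0 \<Longrightarrow> lop (B k) vac = (\<lambda>_. 0)"
    and "\<And>j k. j + k < 0 \<Longrightarrow> lin_bracket (A j) (B k) = 0" and jk: "j + k < 0"
  shows "lop (A j) (lop (B k) vac) = (\<lambda>_. 0)"
proof (cases "k < 0")
  case True
  then show ?thesis
    by (simp add: assms(2) lop_zero)
next
  case False
  then have "j < 0"
    using jk by linarith
  then show ?thesis
    by (rule lop_lop_vac_zero[OF assms(1) assms(3)[OF jk]])
qed

lemma pairing_right:
  assumes ham: "hamiltonian H" and A: "shifts H A X" "\<And>j. j < 0 \<Longrightarrow> lop (A j) vac = (\<lambda>_. 0)"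
    and B: "vac_shifts H B Y" and AB: "\<And>j k. j + k < 0 \<Longrightarrow> lin_bracket (A j) (B k) = 0"
    and vals: "has_value (exp_xi X) u \<alpha>" "has_value (exp_xi Y) v \<beta>" "u \<noteq> 0" "v \<noteq> 0"
    and r: "rational_value (\<lambda>(j, k). lop (A j) (lop (B k) vac) {}) u v r"
  shows "pairing (op_exp H) (Inr (A, u)) (Inr (B, v)) = \<alpha> * \<beta> * r"
proof -
  have neg: "lop (A j) (lop (B k) vac) = (\<lambda>_. 0)" if "j + k < 0" for j k
    using that B unfolding vac_shifts_def by (intro lop_lop_vac_negative A AB) auto
  interpret field_states H X Y "\<lambda>j k. lop (A j) (lop (B k) vac)"
    using ham A(1) B neg by (rule field_states_pair)
  have "(\<lambda>(j, k). op_exp H (lop (A j) (lop (B k) vac)) {}) =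
      conv2 (exp_xi X) (exp_xi Y) (\<lambda>(j, k). lop (A j) (lop (B k) vac) {})"
    by (auto simp: conv2_def op_exp_state fun_eq_iff)
  then show ?thesis
    using rational_value_conv2[OF r vals] neg by simp
qed

lemma pairing_left:
  assumes ham: "hamiltonian H" and B: "vac_shifts H B Y"
    and vals: "has_value (exp_xi Y) v \<beta>" "v \<noteq> 0"
    and r: "rational_value (\<lambda>(j, k). lop (mode_modes m j) (lop (B k) vac) {}) 1 v r"
  shows "pairing (op_exp H) (Inl (mode_field m)) (Inr (B, v)) = \<beta> * r"
proof -
  interpret field_states H 0 Y "\<lambda>j k. if j = 0 then lop (B k) vac else (\<lambda>_. 0)"
    using ham B by (rule field_states_single)
  let ?c = "\<lambda>(j, k). lop (mode_modes m j) (lop (B k) vac) {}"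
  have c: "?c (j, k) = 0" if "j + k < 0" for j k
    using that B by (auto simp: mode_modes_def vac_shifts_def lop_zero lop_Nil)
  have "(\<lambda>(j, k). lop (mode_modes m j) (op_exp H (lop (B k) vac)) {}) = conv2 1 (exp_xi Y) ?c"
  proof (rule ext, clarify)
    fix j k :: int
    show "lop (mode_modes m j) (op_exp H (lop (B k) vac)) {} = conv2 1 (exp_xi Y) ?c (j, k)"
    proof (cases "j = 0")
      case True
      have state: "op_exp H (lop (B k) vac) = (\<lambda>D. \<Sum>b\<le>nat k. fps_nth (exp_xi Y) b * lop (B (k -
          int b)) vac D)"
      proof
        fix D
        have "op_exp H (lop (B k) vac) D = (\<Sum>a\<le>nat k. \<Sum>b\<le>nat k. fps_nth (exp_xi 0) a * fps_nth
            (exp_xi Y) b *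
            (if - int a = 0 then lop (B (k - int b)) vac else (\<lambda>_. 0)) D)"
          using op_exp_state[of 0 k D] by simp
        also have "\<dots> = (\<Sum>a\<le>nat k. if a = 0 then \<Sum>b\<le>nat k. fps_nth (exp_xi Y) b * lop (B (k -
            int b)) vac D else 0)"
          by (intro sum.cong) auto
        finally show "op_exp H (lop (B k) vac) D = (\<Sum>b\<le>nat k. fps_nth (exp_xi Y) b * lop (B (k -
            int b)) vac D)"
          by simp
      qed
      have "fps_nth 1 a * fps_nth (exp_xi Y) b * ?c (0 - int a, k - int b) =
          (if a = 0 then fps_nth (exp_xi Y) b * lop (mode_modes m 0) (lop (B (k - int b)) vac) {}
              else 0)" for a b
        by (simp add: mode_modes_def lop_Nil)
      then have "conv2 1 (exp_xi Y) ?c (j, k) = (\<Sum>a\<le>nat k. \<Sum>b\<le>nat k.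
          if a = 0 then fps_nth (exp_xi Y) b * lop (mode_modes m 0) (lop (B (k - int b)) vac) {} else 0)"
        by (simp add: conv2_def True)
      also have "\<dots> = (\<Sum>a\<le>nat k. if a = 0 then
          \<Sum>b\<le>nat k. fps_nth (exp_xi Y) b * lop (mode_modes m 0) (lop (B (k - int b)) vac) {} else 0)"
        by (intro sum.cong) auto
      finally have "conv2 1 (exp_xi Y) ?c (j, k) =
          (\<Sum>b\<le>nat k. fps_nth (exp_xi Y) b * lop (mode_modes m 0) (lop (B (k - int b)) vac) {})"
        by simp
      then show ?thesis
        by (simp add: True state lop_sum)
    next
      case False
      then have "fps_nth 1 a * fps_nth (exp_xi Y) b * ?c (j - int a, k - int b) = 0" for a b
        by (cases "a = 0") (auto simp: mode_modes_def lop_Nil)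
      then have "conv2 1 (exp_xi Y) ?c (j, k) = 0"
        unfolding conv2_def split_conv by (intro sum.neutral ballI) blast
      then show ?thesis
        using False by (simp add: mode_modes_def lop_Nil)
    qed
  qed
  then show ?thesis
    using rational_value_conv2[OF r has_value_one vals(1) _ vals(2) c] by (simp add: mode_field_altdef)
qed

lemma reading_single:
  assumes "\<And>j k. c (j, k) = (if j = 0 \<and> k = 0 then z else 0)" "u \<noteq> 0" "v \<noteq> 0"
  shows "reading c u v = z"
proof -
  have "rational_value c u v z"
    using rational_value_single[of c "(0, 0)" z u v] assms(1) by auto
  then have "reading (conv2 1 1 c) u v = 1 * 1 * z"
    by (rule rational_value_conv2) (auto simp: assms has_value_one)
  moreover have "conv2 1 1 c = c"
    by (rule conv2_one) (auto simp: assms(1))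
  ultimately show ?thesis
    by simp
qed

lemma pairing_left_mode:
  assumes ham: "hamiltonian H" and m': "vac_shifts H (mode_modes m') 0"
  shows "pairing (op_exp H) (Inl (mode_field m)) (Inr (mode_field m')) = op m (op m' vac) {}"
proof -
  let ?c = "\<lambda>(j, k). lop (mode_modes m j) (lop (mode_modes m' k) vac) {}"
  have "?c d = (if d = (0, 0) then op m (op m' vac) {} else 0)" for d
    by (cases d) (auto simp: mode_modes_def lop_single lop_Nil lop_zero)
  then have r: "rational_value ?c 1 1 (op m (op m' vac) {})"
    using rational_value_single[of ?c "(0, 0)" "op m (op m' vac) {}" 1 1] by simp
  have "has_value (exp_xi 0) 1 1"
    by (simp add: has_value_one)
  then show ?thesis
    unfolding mode_field_altdef[of m'] using pairing_left[OF ham m' _ _ r] by simp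
qed

lemma pairing_left_left:
  assumes "hamiltonian H"
  shows "pairing (op_exp H) (Inl (mode_field m)) (Inl (mode_field m')) = op m (op m' vac) {}"
  unfolding mode_field_altdef pairing.simps op_exp_vac[OF assms]
  by (rule reading_single) (auto simp: mode_modes_def lop_single lop_Nil lop_zero)

fun charged_sym :: "'i charged \<Rightarrow> 'i" where
  "charged_sym (Cr s) = s"
| "charged_sym (An s) = s"

definition component :: "('i \<Rightarrow> bool) \<Rightarrow> 'i \<Rightarrow> nat" where
  "component c1 s = (if c1 s then 1 else 2)"

fun charged_modes :: "bool \<Rightarrow> ('i \<Rightarrow> bool) \<Rightarrow> 'i charged \<Rightarrow> int \<Rightarrow> lin" where
  "charged_modes b c1 (Cr s) = (\<lambda>j. psi_modes (component c1 s) (j + - of_bool b))"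
| "charged_modes b c1 (An s) = (\<lambda>j. psistar_modes (component c1 s) (j + of_bool b))"

fun charged_point :: "('i \<Rightarrow> complex) \<Rightarrow> 'i charged \<Rightarrow> complex" where
  "charged_point v (Cr s) = v s"
| "charged_point v (An s) = - v s"

definition charged_field :: "bool \<Rightarrow> ('i \<Rightarrow> bool) \<Rightarrow> ('i \<Rightarrow> complex) \<Rightarrow> 'i charged \<Rightarrow> field" where
  "charged_field b c1 v a = (charged_modes b c1 a, charged_point v a)"

definition charged_kernel ::
  "bool \<Rightarrow> ('i \<Rightarrow> bool) \<Rightarrow> ('i \<Rightarrow> complex) \<Rightarrow> ('i \<Rightarrow> complex) \<Rightarrow> ('i \<Rightarrow> complex) \<Rightarrow> 'i \<Rightarrow> 'i \<Rightarrow> complex" where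
  "charged_kernel b c1 v X Y = (if b then kernel_11 c1 v X Y else kernel_00 c1 v X Y)"

lemma pairing_right_mode:
  assumes ham: "hamiltonian H" and A: "shifts H A X" "\<And>j. j < 0 \<Longrightarrow> lop (A j) vac = (\<lambda>_. 0)" "A 0 = [(1, m)]"
    and B: "vac_shifts H (mode_modes m') Y" and AB: "\<And>j k. j + k < 0 \<Longrightarrow> lin_bracket (A j) (mode_modes
        m' k) = 0"
  shows "pairing (op_exp H) (Inr (mode_field m)) (Inr (mode_field m')) = op m (op m' vac) {}"
proof -
  have neg: "lop (A j) (lop (mode_modes m' k) vac) = (\<lambda>_. 0)" if "j + k < 0" for j k
    using that B unfolding vac_shifts_def by (intro lop_lop_vac_negative A AB) auto
  interpret field_states H X Y "\<lambda>j k. lop (A j) (lop (mode_modes m' k) vac)"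
    using ham A(1) B neg by (rule field_states_pair)
  have "op_exp H (op m (op m' vac)) = op m (op m' vac)"
    using op_exp_state[of 0 0] by (simp add: A(3) mode_modes_def lop_single fun_eq_iff)
  moreover have "op_exp H (\<lambda>_. 0) {} = 0"
    using op_exp_state[of "- 1" 0 "{}"] by (simp add: neg)
  ultimately show ?thesis
    unfolding mode_field_altdef pairing.simps
    by (intro reading_single) (auto simp: mode_modes_def lop_single lop_Nil lop_zero)
qed

locale charged_fields =
  fixes x y :: time and c1 :: "'i \<Rightarrow> bool" and v X Y :: "'i \<Rightarrow> complex" and S :: "'i set"
  assumes nz: "\<And>s t. s \<in> S \<Longrightarrow> t \<in> S \<Longrightarrow> c1 s = c1 t \<Longrightarrow> v s + v t \<noteq> 0"
    and vals: "\<And>s. s \<in> S \<Longrightarrow> exp_values (if c1 s then x else y) (v s) (X s) (Y s)"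
begin

lemma v_nonzero: "s \<in> S \<Longrightarrow> v s \<noteq> 0"
  using nz[of s s] by auto

definition charged_time :: "'i charged \<Rightarrow> time" where
  "charged_time a = (case a of Cr s \<Rightarrow> if c1 s then x else y | An s \<Rightarrow> - (if c1 s then x else y))"

definition charged_value :: "'i charged \<Rightarrow> complex" where
  "charged_value a = (case a of Cr s \<Rightarrow> X s | An s \<Rightarrow> Y s)"

lemma shifts_charged: "shifts (Ham2 x y) (charged_modes b c1 a) (charged_time a)"
  by (cases a) (auto simp: component_def charged_time_def simp del: add_uminus_conv_diff
    intro!: shifts_index shifts_Ham2 shifts_Ham2[unfolded One_nat_def])

lemma charged_vac: "j < 0 \<Longrightarrow> lop (charged_modes b c1 a j) vac = (\<lambda>_. 0)"
  by (cases a) (auto simp: psi_modes_def psistar_modes_def lop_single excite_def relax_def vac_def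
      fun_eq_iff)

lemma vac_shifts_charged: "vac_shifts (Ham2 x y) (charged_modes b c1 a) (charged_time a)"
  by (rule vac_shiftsI[OF hamiltonian_Ham2 shifts_charged charged_vac])

lemma lin_bracket_single: "lin_bracket [(1, m)] [(1, m')] = bracket m m'"
  by (simp add: lin_bracket_def)

lemma lop_pair_vac: "lop [(1, m)] (lop [(1, m')] vac) {} = (if annihilator m then bracket m m' else 0)"
  by (simp add: lop_single op_op_vac)

lemma value_charged:
  "charged_sym a \<in> S \<Longrightarrow> has_value (exp_xi (charged_time a)) (charged_point v a) (charged_value a)"
  using vals[of "charged_sym a"] by (cases a) (auto simp: charged_time_def charged_value_def exp_values_def)

lemma pairing_charged:
  assumes S: "charged_sym a \<in> S" "charged_sym a' \<in> S"
  shows "pairing (op_exp (Ham2 x y)) (Inr (charged_field b c1 v a)) (Inr (charged_field b c1 v a')) =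
    charge (charged_kernel b c1 v X Y) a a'"
proof -
  define r where "r = (case a of Cr s \<Rightarrow> (case a' of Cr t \<Rightarrow> 0 | An t \<Rightarrow> if c1 s =
      c1 t then (if b then v s else - v t) / (v s + v t) else 0)
    | An s \<Rightarrow> (case a' of An t \<Rightarrow> 0 | Cr t \<Rightarrow> if c1 s = c1 t then - (if b then v t else - v s) / (v s +
        v t) else 0))"
  let ?c = "\<lambda>(j, k). lop (charged_modes b c1 a j) (lop (charged_modes b c1 a' k) vac) {}"
  have r: "rational_value ?c (charged_point v a) (charged_point v a') r"
  proof (cases a; cases a')
    fix s t assume *: "a = Cr s" "a' = An t"
    show ?thesis
    proof (cases "c1 s = c1 t")
      case True
      then have "rational_value ?c (v s) (- v t) ((of_bool b * v s + (1 - of_bool b) * 1 * (- v t))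
          / (v s - 1 * (- v t)))"
        using nz[of s t] S * by (intro rational_value_geometric)
          (auto simp: psi_modes_def psistar_modes_def lop_pair_vac component_def)
      then show ?thesis
        using True * by (cases b) (auto simp: r_def)
    qed (use * in \<open>auto simp: r_def psi_modes_def psistar_modes_def lop_pair_vac component_def
        intro!: rational_value_zero\<close>)
  next
    fix s t assume *: "a = An s" "a' = Cr t"
    show ?thesis
    proof (cases "c1 s = c1 t")
      case True
      have nz': "v s + v t \<noteq> 0"
        using nz[of s t] S * True by simp
      have "rational_value ?c (- v s) (v t) (((1 - of_bool b) * (- v s) + (1 - (1 - of_bool b)) * 1
          * v t) / (- v s - 1 * v t))"
        using nz' True * by (intro rational_value_geometric)
          (auto simp: psi_modes_def psistar_modes_def lop_pair_vac component_def neg_eq_iff_add_eq_0)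
      moreover have "((1 - of_bool b) * (- v s) + (1 - (1 - of_bool b)) * 1 * v t) / (- v s - 1 * v t) = r"
        using True * nz' by (cases b) (auto simp: r_def divide_simps neg_eq_iff_add_eq_0, auto simp:
            algebra_simps)
      ultimately show ?thesis
        using * by simp
    qed (use * in \<open>auto simp: r_def psi_modes_def psistar_modes_def lop_pair_vac component_def
        intro!: rational_value_zero\<close>)
  qed (auto simp: r_def psi_modes_def psistar_modes_def lop_pair_vac intro!: rational_value_zero)
  have "pairing (op_exp (Ham2 x y)) (Inr (charged_modes b c1 a, charged_point v a)) (Inr
      (charged_modes b c1 a', charged_point v a')) =
      charged_value a * charged_value a' * r"
  proof (rule pairing_right[OF hamiltonian_Ham2 shifts_charged charged_vac vac_shifts_charged _
      value_charged[OF S(1)] value_charged[OF S(2)] _ _ r])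
    show "lin_bracket (charged_modes b c1 a j) (charged_modes b c1 a' k) = 0" if "j + k < 0" for j k
      using that by (cases a; cases a') (auto simp: psi_modes_def psistar_modes_def lin_bracket_single)
    show "charged_point v a \<noteq> 0" "charged_point v a' \<noteq> 0"
      using S v_nonzero by (cases a; cases a'; auto)+
  qed
  also have "\<dots> = charge (charged_kernel b c1 v X Y) a a'"
    by (cases a; cases a') (auto simp: r_def charged_kernel_def kernel_11_def kernel_00_def
        charged_value_def add.commute)
  finally show ?thesis
    by (simp add: charged_field_def)
qed

definition creation_row :: "nat \<Rightarrow> 'i charged \<Rightarrow> complex" where
  "creation_row c a = (case a of Cr s \<Rightarrow> if component c1 s = c then X s else 0 | An s \<Rightarrow> 0)"

definition annihilation_row :: "nat \<Rightarrow> 'i charged \<Rightarrow> complex" where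
  "annihilation_row c a = (case a of Cr s \<Rightarrow> 0 | An s \<Rightarrow> if component c1 s = c then Y s else 0)"

lemma charged_point_nonzero: "charged_sym a \<in> S \<Longrightarrow> charged_point v a \<noteq> 0"
  using v_nonzero by (cases a) auto

lemma pairing_left_star:
  assumes S: "charged_sym a \<in> S"
  shows "pairing (op_exp (Ham2 x y)) (Inl (mode_field (PsiStar c 0))) (Inr (charged_field b c1 v a)) =
    (if b then v (charged_sym a) else 1) * creation_row c a"
proof -
  define r where "r = (case a of Cr s \<Rightarrow> if component c1 s = c then if b then v s else 1 else 0 | An s \<Rightarrow> 0)"
  let ?c = "\<lambda>(j, k). lop (mode_modes (PsiStar c 0) j) (lop (charged_modes b c1 a k) vac) {}"
  have "rational_value ?c 1 (charged_point v a) r"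
  proof (cases a)
    case (Cr s)
    have "rational_value ?c 1 (v s) ((if component c1 s = c then 1 else 0) * 1 powi fst (0 :: int,
        of_bool b :: int) * v s powi snd (0 :: int, of_bool b :: int))"
      by (rule rational_value_single)
        (auto simp: Cr mode_modes_def psi_modes_def lop_pair_vac lop_Nil split: prod.split)
    then show ?thesis
      by (cases b) (auto simp: r_def Cr)
  next
    case (An s)
    have "rational_value ?c 1 (- v s) 0"
      by (rule rational_value_zero)
        (auto simp: An mode_modes_def psistar_modes_def lop_pair_vac lop_Nil split: prod.split)
    then show ?thesis
      by (simp add: r_def An)
  qed
  from pairing_left[OF hamiltonian_Ham2 vac_shifts_charged value_charged[OF S]
      charged_point_nonzero[OF S] this]
  show ?thesis
    unfolding charged_field_def by (cases a) (auto simp: r_def creation_row_def charged_value_def)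
qed

lemma pairing_left_psi:
  assumes S: "charged_sym a \<in> S"
  shows "pairing (op_exp (Ham2 x y)) (Inl (mode_field (Psi c (- 1)))) (Inr (charged_field True c1 v a)) =
    annihilation_row c a"
proof -
  define r where "r = (case a of Cr s \<Rightarrow> 0 | An s \<Rightarrow> if component c1 s = c then (1 :: complex) else 0)"
  let ?c = "\<lambda>(j, k). lop (mode_modes (Psi c (- 1)) j) (lop (charged_modes True c1 a k) vac) {}"
  have "rational_value ?c 1 (charged_point v a) r"
  proof (cases a)
    case (An s)
    have "rational_value ?c 1 (- v s) ((if component c1 s = c then 1 else 0) * 1 powi fst (0 :: int,
        0 :: int) * (- v s) powi snd (0 :: int, 0 :: int))"
      by (rule rational_value_single)
        (auto simp: An mode_modes_def psistar_modes_def lop_pair_vac lop_Nil split: prod.split)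
    then show ?thesis
      by (auto simp: r_def An)
  next
    case (Cr s)
    have "rational_value ?c 1 (v s) 0"
      by (rule rational_value_zero)
        (auto simp: Cr mode_modes_def psi_modes_def lop_pair_vac lop_Nil split: prod.split)
    then show ?thesis
      by (simp add: r_def Cr)
  qed
  from pairing_left[OF hamiltonian_Ham2 vac_shifts_charged value_charged[OF S]
      charged_point_nonzero[OF S] this]
  show ?thesis
    unfolding charged_field_def by (cases a) (auto simp: r_def annihilation_row_def charged_value_def)
qed

lemma vac_shifts_psi_mode: "c \<in> {1, 2} \<Longrightarrow> vac_shifts (Ham2 x y) (mode_modes (Psi c 0)) 0"
proof -
  assume c: "c \<in> {1, 2}"
  have "shifts (Ham2 x y) (psi_modes c) (if c = 1 then x else y)"
    using c shifts_Ham2 by auto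
  then have "vac_shifts (Ham2 x y) (psi_modes c) (if c = 1 then x else y)"
    by (rule vac_shiftsI[OF hamiltonian_Ham2]) (auto simp: psi_modes_def lop_single relax_def
        vac_def fun_eq_iff)
  then show ?thesis
    by (rule vac_shifts_mode[OF hamiltonian_Ham2, where c = 1]) (auto simp: psi_modes_def lop_single)
qed

lemma pairing_right_psi:
  assumes S: "charged_sym a \<in> S" and c: "c \<in> {1, 2}"
  shows "pairing (op_exp (Ham2 x y)) (Inr (charged_field False c1 v a)) (Inr (mode_field (Psi c 0))) =
    annihilation_row c a"
proof -
  define r where "r = (case a of Cr s \<Rightarrow> 0 | An s \<Rightarrow> if component c1 s = c then (1 :: complex) else 0)"
  let ?c = "\<lambda>(j, k). lop (charged_modes False c1 a j) (lop (mode_modes (Psi c 0) k) vac) {}"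
  have r: "rational_value ?c (charged_point v a) 1 r"
  proof (cases a)
    case (An s)
    have "rational_value ?c (- v s) 1 ((if component c1 s = c then 1 else 0) * (- v s) powi fst (0
        :: int, 0 :: int) * 1 powi snd (0 :: int, 0 :: int))"
      by (rule rational_value_single)
        (auto simp: An mode_modes_def psistar_modes_def lop_pair_vac lop_Nil lop_zero split: prod.split)
    then show ?thesis
      by (auto simp: r_def An)
  next
    case (Cr s)
    have "rational_value ?c (v s) 1 0"
      by (rule rational_value_zero)
        (auto simp: Cr mode_modes_def psi_modes_def lop_pair_vac lop_Nil lop_zero split: prod.split)
    then show ?thesis
      by (simp add: r_def Cr)
  qed
  have "pairing (op_exp (Ham2 x y)) (Inr (charged_modes False c1 a, charged_point v a)) (Inr
      (mode_modes (Psi c 0), 1)) =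
      charged_value a * 1 * r"
  proof (rule pairing_right[OF hamiltonian_Ham2 shifts_charged charged_vac vac_shifts_psi_mode[OF c]
      _ value_charged[OF S] _ charged_point_nonzero[OF S] _ r])
    show "lin_bracket (charged_modes False c1 a j) (mode_modes (Psi c 0) k) = 0" if "j + k < 0" for j k
      using that by (cases a) (auto simp: psi_modes_def psistar_modes_def mode_modes_def lin_bracket_single)
  qed (simp_all add: has_value_one)
  then show ?thesis
    unfolding charged_field_def mode_field_altdef
    by (cases a) (auto simp: r_def annihilation_row_def charged_value_def)
qed

lemma pairing_psi_psi:
  "pairing (op_exp (Ham2 x y)) (Inr (mode_field (Psi 2 0))) (Inr (mode_field (Psi 1 0))) = 0"
proof -
  have "pairing (op_exp (Ham2 x y)) (Inr (mode_field (Psi 2 0))) (Inr (mode_field (Psi 1 0))) =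
      op (Psi 2 0) (op (Psi 1 0) vac) {}"
  proof (rule pairing_right_mode[OF hamiltonian_Ham2 shifts_Ham2(2)])
    show "vac_shifts (Ham2 x y) (mode_modes (Psi 1 0)) 0"
      by (rule vac_shifts_psi_mode) simp
  qed (auto simp: psi_modes_def mode_modes_def lop_single relax_def vac_def fun_eq_iff lin_bracket_single)
  then show ?thesis
    by (simp add: op_op_vac del: op.simps)
qed

end

lemma vev_eq_pair_exp:
  fixes gs :: "(complex \<times> 'i \<times> 'i) list"
  assumes g: "g = map (\<lambda>(z, a, b). (z, fld a, fld b)) gs"
    and T: "\<And>l. set l \<subseteq> syms gs \<Longrightarrow>
      T l = wick (pairing eH) (map Inl (map mode_field us) @ map (\<lambda>a. Inr (fld a)) l @ map Inr (map
          mode_field ws))"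
    and alt: "alternating T"
  shows "vev eH us g ws = pair_exp gs T []"
proof -
  let ?S = "\<lambda>k. \<Sum>is | set is \<subseteq> {..<length gs} \<and> length is = k.
     (\<Prod>i\<leftarrow>is. fst (gs ! i)) * T (concat (map (\<lambda>i. case gs ! i of (z, a, b) \<Rightarrow> [a, b]) is) @ [])"
  have "(\<Sum>is | set is \<subseteq> {..<length g} \<and> length is = k.
         (\<Prod>i\<leftarrow>is. fst (g ! i)) *
         wick (pairing eH)
           (map Inl (map mode_field us) @
            map Inr (concat (map (\<lambda>i. case g ! i of (z, A, B) \<Rightarrow> [A, B]) is) @ map mode_field ws))) =
                ?S k" for k
  proof (intro sum.cong)
    show "{is. set is \<subseteq> {..<length g} \<and> length is = k} = {is. set is \<subseteq> {..<length gs} \<and> length is = k}"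
      by (simp add: g)
    fix "is" assume "is \<in> {is. set is \<subseteq> {..<length gs} \<and> length is = k}"
    then have *: "set is \<subseteq> {..<length gs}"
      by simp
    let ?l = "concat (map (\<lambda>i. case gs ! i of (z, a, b) \<Rightarrow> [a, b]) is)"
    have "set ?l \<subseteq> syms gs"
    proof
      fix s assume "s \<in> set ?l"
      then obtain i where i: "i \<in> set is" "s \<in> set (case gs ! i of (z, a, b) \<Rightarrow> [a, b])"
        by auto
      then have "gs ! i \<in> set gs"
        using * by auto
      then show "s \<in> syms gs"
        using i(2) unfolding syms_def by (intro UN_I[of "gs ! i"]) (auto split: prod.splits)
    qed
    moreover have "(\<Prod>i\<leftarrow>is. fst (g ! i)) = (\<Prod>i\<leftarrow>is. fst (gs ! i))"
      using * by (intro arg_cong[where f = prod_list] map_cong) (auto simp: g split: prod.split)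
    moreover have "concat (map (\<lambda>i. case g ! i of (z, A, B) \<Rightarrow> [A, B]) is) = map fld ?l"
      unfolding map_concat map_map using *
      by (intro arg_cong[where f = concat] map_cong) (auto simp: g split: prod.split)
    ultimately show "(\<Prod>i\<leftarrow>is. fst (g ! i)) *
         wick (pairing eH)
           (map Inl (map mode_field us) @
            map Inr (concat (map (\<lambda>i. case g ! i of (z, A, B) \<Rightarrow> [A, B]) is) @ map mode_field ws)) =
        (\<Prod>i\<leftarrow>is. fst (gs ! i)) * T (?l @ [])"
      by (simp add: T comp_def)
  qed
  then have "vev eH us g ws = (\<Sum>k. (pair_sum gs ^^ k) T [] / fact k)"
    unfolding vev_def pair_sum_pow_eq_sum_lists by simp
  also have "\<dots> = (\<Sum>k\<le>length gs. (pair_sum gs ^^ k) T [] / fact k)"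
    by (rule suminf_finite) (auto simp: pair_sum_pow_eq_zero[OF alt])
  finally show ?thesis
    by (simp add: pair_exp_eq_sum[OF alt])
qed

lemma alternating_diff:
  "alternating T \<Longrightarrow> alternating T' \<Longrightarrow> alternating (\<lambda>l. T l - T' l)"
  unfolding alternating_def
proof (intro allI)
  fix us a b ws
  assume *: "\<forall>us a b ws. T (us @ a # b # ws) = - T (us @ b # a # ws)"
    "\<forall>us a b ws. T' (us @ a # b # ws) = - T' (us @ b # a # ws)"
  show "T (us @ a # b # ws) - T' (us @ a # b # ws) = - (T (us @ b # a # ws) - T' (us @ b # a # ws))"
    using *(1)[THEN spec, THEN spec, THEN spec, THEN spec, of us a b ws]
      *(2)[THEN spec, THEN spec, THEN spec, THEN spec, of us a b ws] by simp
qed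

lemma alternating_wick_charge: "alternating (wick (charge M))"
  by (rule alternating_wick[OF antisymmetric_charge])

fun on_Cr :: "('i \<Rightarrow> complex) \<Rightarrow> 'i charged \<Rightarrow> complex" where
  "on_Cr \<alpha> (Cr s) = \<alpha> s"
| "on_Cr \<alpha> (An s) = 0"

fun on_An :: "('i \<Rightarrow> complex) \<Rightarrow> 'i charged \<Rightarrow> complex" where
  "on_An \<alpha> (Cr s) = 0"
| "on_An \<alpha> (An s) = \<alpha> s"

lemma charge_rank_one:
  "charge (\<lambda>s t. M s t + \<alpha> s * \<beta> t) =
   (\<lambda>a b. charge M a b + 1 * (on_Cr \<alpha> a * on_An \<beta> b - on_An \<beta> a * on_Cr \<alpha> b))"
proof (intro ext)
  show "charge (\<lambda>s t. M s t + \<alpha> s * \<beta> t) a b =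
      charge M a b + 1 * (on_Cr \<alpha> a * on_An \<beta> b - on_An \<beta> a * on_Cr \<alpha> b)" for a b
    by (cases a; cases b) auto
qed

lemma det_sum_rank_one_linear:
  "det_sum G (\<lambda>s t. M s t + \<alpha> s * (\<beta> t + r * \<gamma> t)) =
   det_sum G (\<lambda>s t. M s t + \<alpha> s * \<beta> t) + r * (det_sum G (\<lambda>s t. M s t + \<alpha> s * \<gamma> t) - det_sum G M)"
proof -
  have "on_An (\<lambda>t. \<beta> t + r * \<gamma> t) = (\<lambda>a. on_An \<beta> a + r * on_An \<gamma> a)"
  proof
    show "on_An (\<lambda>t. \<beta> t + r * \<gamma> t) a = on_An \<beta> a + r * on_An \<gamma> a" for a
      by (cases a) auto
  qed
  then have "wick (charge (\<lambda>s t. M s t + \<alpha> s * (\<beta> t + r * \<gamma> t))) =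
      (\<lambda>l. (wick (charge (\<lambda>s t. M s t + \<alpha> s * \<beta> t)) l - (- r) * wick (charge (\<lambda>s t. M s t + \<alpha> s * \<gamma> t)) l) -
        r * wick (charge M) l)"
    unfolding charge_rank_one wick_rank_two fun_eq_iff
    by (simp add: contract_form_add contract_form_scale contract_add contract_scale algebra_simps
        fun_eq_iff cong: contract_cong_length)
  then show ?thesis
    unfolding det_sum_def by (simp only: pair_exp_diff_scale) (simp add: algebra_simps)
qed

lemma Psis_simps:
  "Psis c 0 = []" "Psis c 1 = [Psi c 0]" "PsiStars c 0 = []" "PsiStars c 1 = [PsiStar c 0]"
  "PsiStars c (- 1) = [Psi c (- 1)]"
  by (simp_all add: Psis_def PsiStars_def upto.simps)

definition charged_gexp ::
  "bool \<Rightarrow> ('i \<Rightarrow> bool) \<Rightarrow> ('i \<Rightarrow> complex) \<Rightarrow> (complex \<times> 'i \<times> 'i) list \<Rightarrow> gexp" where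
  "charged_gexp b c1 v G = map (\<lambda>(z, s, t). (z, charged_field b c1 v (Cr s), charged_field b c1 v
      (An t))) G"

lemma charged_gexp_altdef:
  "charged_gexp b c1 v G = map (\<lambda>(z, s, t). (z, charged_field b c1 v s, charged_field b c1 v t))
      (charge_exp G)"
  by (auto simp: charged_gexp_def charge_exp_def)

lemma syms_charge_exp: "s \<in> syms (charge_exp G) \<Longrightarrow> charged_sym s \<in> syms G"
  by (force simp: syms_def charge_exp_def)

context charged_fields
begin

abbreviation (input) "eH \<equiv> op_exp (Ham2 x y)"
abbreviation (input) "right b a \<equiv> Inr (charged_field b c1 v a) :: field + field"
abbreviation (input) "lmode m \<equiv> Inl (mode_field m) :: field + field"
abbreviation (input) "rmode m \<equiv> Inr (mode_field m) :: field + field"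

lemma pairing_modes:
  "pairing eH (lmode (PsiStar 1 0)) (rmode (Psi 1 0)) = 1"
  "pairing eH (lmode (PsiStar 1 0)) (rmode (Psi 2 0)) = 0"
  "pairing eH (lmode (PsiStar 2 0)) (rmode (Psi 1 0)) = 0"
  "pairing eH (lmode (PsiStar 2 0)) (rmode (Psi 2 0)) = 1"
  "pairing eH (lmode (PsiStar 1 0)) (lmode (PsiStar 2 0)) = 0"
  "pairing eH (lmode (Psi 1 (- 1))) (lmode (PsiStar 2 0)) = 0"
proof -
  have "vac_shifts (Ham2 x y) (mode_modes (Psi 1 0)) 0" "vac_shifts (Ham2 x y) (mode_modes (Psi 2 0)) 0"
    by (auto intro: vac_shifts_psi_mode)
  then show "pairing eH (lmode (PsiStar 1 0)) (rmode (Psi 1 0)) = 1"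
    "pairing eH (lmode (PsiStar 1 0)) (rmode (Psi 2 0)) = 0"
    "pairing eH (lmode (PsiStar 2 0)) (rmode (Psi 1 0)) = 0"
    "pairing eH (lmode (PsiStar 2 0)) (rmode (Psi 2 0)) = 1"
    by (simp_all add: pairing_left_mode[OF hamiltonian_Ham2] op_op_vac del: op.simps)
  show "pairing eH (lmode (PsiStar 1 0)) (lmode (PsiStar 2 0)) = 0"
    "pairing eH (lmode (Psi 1 (- 1))) (lmode (PsiStar 2 0)) = 0"
    by (simp_all add: pairing_left_left[OF hamiltonian_Ham2] op_op_vac del: op.simps)
qed

lemma F_vev_11:
  assumes G: "syms G \<subseteq> S"
  shows "F_vev y 1 1 0 x (charged_gexp False c1 v G) = det_sum G (kernel_11 c1 v X Y)"
  unfolding F_vev_def det_sum_def diff_0_right add_0_right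
proof (rule vev_eq_pair_exp[OF charged_gexp_altdef _ alternating_wick_charge])
  fix l assume l: "set l \<subseteq> syms (charge_exp G)"
  let ?P = "pairing eH"
  let ?u1 = "lmode (PsiStar 1 0)" and ?u2 = "lmode (PsiStar 2 0)"
  let ?w1 = "rmode (Psi 1 0)" and ?w2 = "rmode (Psi 2 0)"
  let ?P1 = "\<lambda>a b. ?P a b + (?P ?u1 a * ?P b ?w1 - ?P a ?w1 * ?P ?u1 b)"
  let ?P2 = "\<lambda>a b. ?P1 a b + (?P1 ?u2 a * ?P1 b ?w2 - ?P1 a ?w2 * ?P1 ?u2 b)"
  have S: "charged_sym a \<in> S" if "a \<in> set l" for a
    using that l G syms_charge_exp by blast
  have "wick ?P (?u1 # (?u2 # map (right False) l @ [?w2]) @ [?w1]) = wick ?P1 (?u2 # map (right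
      False) l @ [?w2])"
    by (rule wick_sandwich_one) (rule pairing_modes)
  also have "\<dots> = wick ?P2 (map (right False) l)"
    by (rule wick_sandwich_one) (simp only: pairing_modes pairing_psi_psi, simp)
  also have "\<dots> = wick (charge (kernel_11 c1 v X Y)) l"
    unfolding wick_map
  proof (rule wick_cong)
    fix a b assume "a \<in> set l" "b \<in> set l"
    then have ab: "charged_sym a \<in> S" "charged_sym b \<in> S"
      using S by auto
    have right_psi: "pairing eH (right False a) (rmode (Psi 1 0)) = annihilation_row 1 a"
      "pairing eH (right False a) (rmode (Psi 2 0)) = annihilation_row 2 a" if "charged_sym a \<in> S" for a
      using that by (simp_all add: pairing_right_psi del: One_nat_def)
    have "?P2 (right False a) (right False b) = charge (charged_kernel False c1 v X Y) a b +
        (creation_row 1 a * annihilation_row 1 b - annihilation_row 1 a * creation_row 1 b) +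
        (creation_row 2 a * annihilation_row 2 b - annihilation_row 2 a * creation_row 2 b)"
      unfolding pairing_modes pairing_psi_psi pairing_charged[OF ab] pairing_left_star[OF ab(1)]
          pairing_left_star[OF ab(2)]
        right_psi[OF ab(1)] right_psi[OF ab(2)]
      by simp
    also have "\<dots> = charge (kernel_11 c1 v X Y) a b"
      using nz[of "charged_sym a" "charged_sym b"] ab
      by (cases a; cases b)
        (auto simp: creation_row_def annihilation_row_def charged_kernel_def kernel_00_def
            kernel_11_def component_def divide_simps,
         auto simp: algebra_simps)
    finally show "?P2 (right False a) (right False b) = charge (kernel_11 c1 v X Y) a b" .
  qed
  finally show "wick (charge (kernel_11 c1 v X Y)) l =
      wick ?P (map Inl (map mode_field (PsiStars 1 1 @ PsiStars 2 1)) @ map (right False) l @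
        map Inr (map mode_field (Psis 2 1 @ Psis 1 1)))"
    by (simp add: Psis_simps)
qed

definition component_value :: "nat \<Rightarrow> ('i \<Rightarrow> complex) \<Rightarrow> 'i \<Rightarrow> complex" where
  "component_value c Z s = (if component c1 s = c then Z s else 0)"

lemma rows:
  "creation_row c = on_Cr (component_value c X)" "annihilation_row c = on_An (component_value c Y)"
proof -
  show "creation_row c = on_Cr (component_value c X)"
  proof
    show "creation_row c a = on_Cr (component_value c X) a" for a
      by (cases a) (auto simp: creation_row_def component_value_def)
  qed
  show "annihilation_row c = on_An (component_value c Y)"
  proof
    show "annihilation_row c a = on_An (component_value c Y) a" for a
      by (cases a) (auto simp: annihilation_row_def component_value_def)
  qed
qed

lemma vev_sandwich:
  assumes G: "syms G \<subseteq> S" and c: "c \<in> {1, 2}"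
  shows "vev eH [PsiStar 2 0] (charged_gexp False c1 v G) [Psi c 0] =
    det_sum G (\<lambda>s t. kernel_00 c1 v X Y s t + component_value 2 X s * component_value c Y t) -
    (if c = 2 then 0 else det_sum G (kernel_00 c1 v X Y))"
proof -
  let ?z = "if c = 2 then 0 else 1 :: complex"
  let ?M = "\<lambda>s t. kernel_00 c1 v X Y s t + component_value 2 X s * component_value c Y t"
  let ?T = "\<lambda>l. wick (charge ?M) l - ?z * wick (charge (kernel_00 c1 v X Y)) l"
  have "vev eH [PsiStar 2 0] (charged_gexp False c1 v G) [Psi c 0] = pair_exp (charge_exp G) ?T []"
  proof (rule vev_eq_pair_exp[OF charged_gexp_altdef])
    show "alternating ?T"
      by (cases "c = 2") (auto intro: alternating_diff alternating_wick_charge)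
    fix l assume l: "set l \<subseteq> syms (charge_exp G)"
    let ?P = "pairing eH"
    let ?u = "lmode (PsiStar 2 0)" and ?w = "rmode (Psi c 0)"
    let ?P1 = "\<lambda>a b. ?P a b + 1 * (?P ?u a * ?P b ?w - ?P a ?w * ?P ?u b)"
    have S: "charged_sym a \<in> S" if "a \<in> set l" for a
      using that l G syms_charge_exp by blast
    have "wick ?P (?u # map (right False) l @ [?w]) =
        (?P ?u ?w - 1) * wick ?P (map (right False) l) + wick ?P1 (map (right False) l)"
      by (rule wick_sandwich_rank_two)
    also have "?P ?u ?w - 1 = - ?z"
      using c pairing_modes by auto
    also have "wick ?P (map (right False) l) = wick (charge (kernel_00 c1 v X Y)) l"
      unfolding wick_map by (rule wick_cong) (simp add: pairing_charged S charged_kernel_def)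
    also have "wick ?P1 (map (right False) l) = wick (charge ?M) l"
      unfolding wick_map charge_rank_one
      by (rule wick_cong) (simp add: pairing_charged pairing_left_star pairing_right_psi[OF _ c] S
          charged_kernel_def rows)
    finally show "?T l = wick ?P (map Inl (map mode_field [PsiStar 2 0]) @ map (right False) l @
        map Inr (map mode_field [Psi c 0]))"
      by simp
  qed
  then show ?thesis
    unfolding det_sum_def pair_exp_diff_scale by (simp add: det_sum_def)
qed

lemma F_vev_01:
  assumes G: "syms G \<subseteq> S"
  shows "F_vev y 0 1 0 x (charged_gexp False c1 v G) + r * F_vev y 0 1 1 x (charged_gexp False c1 v G) =
    det_sum G (\<lambda>s t. kernel_00 c1 v X Y s t + (if c1 s then 0 else X s) * (if c1 t then r * Y t else Y t))"
proof -
  have "F_vev y 0 1 0 x (charged_gexp False c1 v G) + r * F_vev y 0 1 1 x (charged_gexp False c1 v G) =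
      det_sum G (\<lambda>s t. kernel_00 c1 v X Y s t + component_value 2 X s * (component_value 2 Y t +
          r * component_value 1 Y t))"
    unfolding det_sum_rank_one_linear using vev_sandwich[OF G, of 1] vev_sandwich[OF G, of 2]
    by (simp add: F_vev_def Psis_simps)
  also have "(\<lambda>s t. kernel_00 c1 v X Y s t + component_value 2 X s * (component_value 2 Y t +
      r * component_value 1 Y t)) =
      (\<lambda>s t. kernel_00 c1 v X Y s t + (if c1 s then 0 else X s) * (if c1 t then r * Y t else Y t))"
    by (auto simp: fun_eq_iff component_value_def component_def)
  finally show ?thesis .
qed

lemma F_vev_00_shifted:
  assumes G: "syms G \<subseteq> S"
  shows "F_vev y 0 0 0 x (charged_gexp True c1 v G) + r * F_vev y (- 1) 1 1 x (charged_gexp True c1 v G) =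
    det_sum G (\<lambda>s t. kernel_11 c1 v X Y s t + (if c1 s then 0 else v s * X s) * (if c1 t then r * Y
        t else 0))"
proof -
  let ?M = "\<lambda>s t. kernel_11 c1 v X Y s t + (v s * component_value 2 X s) * component_value 1 Y t"
  let ?T = "\<lambda>l. wick (charge ?M) l - 1 * wick (charge (kernel_11 c1 v X Y)) l"
  let ?P = "pairing eH"
  have S: "charged_sym a \<in> S" if "a \<in> set l" "set l \<subseteq> syms (charge_exp G)" for a l
    using that G syms_charge_exp by blast
  have core: "wick ?P (map (right True) l) = wick (charge (kernel_11 c1 v X Y)) l"
      if "set l \<subseteq> syms (charge_exp G)" for l
    unfolding wick_map by (rule wick_cong) (simp add: pairing_charged S[OF _ that] charged_kernel_def)
  have "F_vev y 0 0 0 x (charged_gexp True c1 v G) = det_sum G (kernel_11 c1 v X Y)"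
    unfolding F_vev_def det_sum_def
    by (rule vev_eq_pair_exp[OF charged_gexp_altdef _ alternating_wick_charge]) (simp add: core Psis_simps)
  moreover have "F_vev y (- 1) 1 1 x (charged_gexp True c1 v G) = pair_exp (charge_exp G) ?T []"
    unfolding F_vev_def
  proof (rule vev_eq_pair_exp[OF charged_gexp_altdef])
    show "alternating ?T"
      by (auto intro: alternating_diff alternating_wick_charge)
    fix l assume l: "set l \<subseteq> syms (charge_exp G)"
    let ?u1 = "lmode (Psi 1 (- 1))" and ?u2 = "lmode (PsiStar 2 0)"
    let ?P1 = "\<lambda>a b. ?P a b + - 1 * (?P ?u1 a * ?P ?u2 b - ?P ?u2 a * ?P ?u1 b)"
    have "on_Cr (\<lambda>s. v s * component_value 2 X s) a = v (charged_sym a) * on_Cr (component_value 2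
        X) a" for a
      by (cases a) auto
    then have "wick ?P1 (map (right True) l) = wick (charge ?M) l"
      unfolding wick_map charge_rank_one
      by (intro wick_cong) (simp add: pairing_charged pairing_left_star pairing_left_psi S[OF _ l]
          charged_kernel_def rows)
    moreover have "wick ?P1 (map (right True) l) = wick ?P (map (right True) l) - - 1 * wick ?P (?u1
        # ?u2 # map (right True) l)"
      by (rule wick_rank_two_insert) (rule pairing_modes)
    ultimately show "?T l = wick ?P (map Inl (map mode_field (PsiStars 1 (- 1) @ PsiStars 2 1)) @
        map (right True) l @
        map Inr (map mode_field (Psis 2 (1 - 1) @ Psis 1 (- 1 + 1))))"
      by (simp add: core[OF l] Psis_simps)
  qed
  ultimately have "F_vev y 0 0 0 x (charged_gexp True c1 v G) + r * F_vev y (- 1) 1 1 x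
      (charged_gexp True c1 v G) =
      det_sum G (\<lambda>s t. kernel_11 c1 v X Y s t + (v s * component_value 2 X s) * (0 +
          r * component_value 1 Y t))"
    unfolding det_sum_rank_one_linear pair_exp_diff_scale by (simp add: det_sum_def)
  also have "(\<lambda>s t. kernel_11 c1 v X Y s t + (v s * component_value 2 X s) * (0 +
      r * component_value 1 Y t)) =
      (\<lambda>s t. kernel_11 c1 v X Y s t + (if c1 s then 0 else v s * X s) * (if c1 t then r * Y t else 0))"
    by (auto simp: fun_eq_iff component_value_def component_def)
  finally show ?thesis .
qed

end

definition neutral_family :: "('i \<Rightarrow> bool) \<Rightarrow> 'i \<Rightarrow> int \<Rightarrow> lin" where
  "neutral_family c1 s = (if c1 s then phi_mode else phihat_mode)"

definition neutral_field :: "('i \<Rightarrow> bool) \<Rightarrow> ('i \<Rightarrow> complex) \<Rightarrow> 'i \<Rightarrow> field" where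
  "neutral_field c1 v s = (neutral_family c1 s, v s)"

definition neutral_gexp :: "('i \<Rightarrow> bool) \<Rightarrow> ('i \<Rightarrow> complex) \<Rightarrow> (complex \<times> 'i \<times> 'i) list \<Rightarrow> gexp" where
  "neutral_gexp c1 v G = map (\<lambda>(z, s, t). (z, neutral_field c1 v s, neutral_field c1 v t)) G"

lemma half_sqrt2: "1 / complex_of_real (sqrt 2) * (1 / complex_of_real (sqrt 2)) = 1 / 2"
proof -
  have "complex_of_real (sqrt 2) * complex_of_real (sqrt 2) = 2"
    by (simp flip: of_real_mult)
  then show ?thesis
    by simp
qed

lemma neutral_pair_vac:
  fixes j k :: int
  shows "lop [(z, Psi 0 j), (z', PsiStar 0 (- j))] (lop [(w, Psi 0 k), (w', PsiStar 0 (- k))] vac) {} =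
   (if j + k = 0 then (if j < 0 then z * w' else 0) + (if j \<le> 0 then z' * w else 0) else 0)"
  by (auto simp: lop_lop_vac)

locale neutral_fields =
  fixes x y :: time and c1 :: "'i \<Rightarrow> bool" and v e :: "'i \<Rightarrow> complex" and S :: "'i set"
  assumes odd: "odd_time x" "odd_time y"
    and nz: "\<And>s t. s \<in> S \<Longrightarrow> t \<in> S \<Longrightarrow> c1 s = c1 t \<Longrightarrow> v s + v t \<noteq> 0"
    and vals: "\<And>s. s \<in> S \<Longrightarrow> has_value (exp_xi (if c1 s then x else y)) (v s) (e s)"
begin

lemma v_nonzero: "s \<in> S \<Longrightarrow> v s \<noteq> 0"
  using nz[of s s] by auto

definition neutral_time :: "'i \<Rightarrow> time" where
  "neutral_time s = (if c1 s then x else y)"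

lemma shifts_neutral: "shifts (Ham1 x y) (neutral_family c1 s) (neutral_time s)"
  using shifts_Ham1[OF odd] by (simp add: neutral_family_def neutral_time_def)

lemma neutral_family_vac: "j < 0 \<Longrightarrow> lop (neutral_family c1 s j) vac = (\<lambda>_. 0)"
  by (rule neutral_vac) (simp_all add: neutral_modes_def neutral_family_def)

lemma vac_shifts_neutral: "vac_shifts (Ham1 x y) (neutral_family c1 s) (neutral_time s)"
  by (rule vac_shiftsI[OF hamiltonian_Ham1 shifts_neutral neutral_family_vac])

lemma vac_shifts_Psi: "vac_shifts (Ham1 x y) (mode_modes (Psi 0 0)) 0"
proof -
  have "vac_shifts (Ham1 x y) phi_mode x"
    using shifts_Ham1(1)[OF odd] neutral_vac
    by (intro vac_shiftsI hamiltonian_Ham1) (auto simp: neutral_modes_def)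
  moreover have "op (Psi 0 0) vac = (\<lambda>D. complex_of_real (sqrt 2) * lop (phi_mode 0) vac D)"
    by (auto simp: fun_eq_iff phi_mode_def lop_def relax_def vac_def)
  ultimately show ?thesis
    by (rule vac_shifts_mode[OF hamiltonian_Ham1])
qed

lemma value_neutral: "s \<in> S \<Longrightarrow> has_value (exp_xi (neutral_time s)) (v s) (e s)"
  using vals by (simp add: neutral_time_def)

lemma pairing_neutral:
  assumes S: "s \<in> S" "t \<in> S"
  shows "pairing (op_exp (Ham1 x y)) (Inr (neutral_field c1 v s)) (Inr (neutral_field c1 v t)) =
    pf_kernel c1 v \<i> e s t"
proof -
  define r where "r = (if c1 s = c1 t then (v s - v t) / (v s + v t) / 2 else if c1 s then \<i> / 2
      else - \<i> / 2)"
  let ?c = "\<lambda>(j, k). lop (neutral_family c1 s j) (lop (neutral_family c1 t k) vac) {}"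
  define h where "h = 1 / complex_of_real (sqrt 2)"
  have hh: "h * h = 1 / 2"
    unfolding h_def by (rule half_sqrt2)
  have phi: "phi_mode j = [(h, Psi 0 j), (h * (-1) powi j, PsiStar 0 (- j))]"
    "phihat_mode j = [(h * \<i>, Psi 0 j), (h * (- \<i> * (-1) powi j), PsiStar 0 (- j))]" for j
    by (simp_all add: phi_mode_def phihat_mode_def h_def)
  have pairs:
    "lop (phi_mode j) (lop (phi_mode k) vac) {} =
      (if j + k = 0 then (if j < 0 then h * (h * (-1) powi k) else 0) + (if j \<le> 0 then h * (-1) powi
          j * h else 0) else 0)"
    "lop (phi_mode j) (lop (phihat_mode k) vac) {} =
      (if j + k = 0 then (if j < 0 then h * (h * (- \<i> * (-1) powi k)) else 0) + (if j \<le> 0 then h *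
          (-1) powi j * (h * \<i>) else 0) else 0)"
    "lop (phihat_mode j) (lop (phi_mode k) vac) {} =
      (if j + k = 0 then (if j < 0 then h * \<i> * (h * (-1) powi k) else 0) + (if j \<le> 0 then h * (- \<i>
          * (-1) powi j) * h else 0) else 0)"
    "lop (phihat_mode j) (lop (phihat_mode k) vac) {} =
      (if j + k = 0 then (if j < 0 then h * \<i> * (h * (- \<i> * (-1) powi k)) else 0) + (if j \<le> 0 then h
          * (- \<i> * (-1) powi j) * (h * \<i>) else 0) else 0)"
    for j k
    unfolding phi neutral_pair_vac by (rule refl)+
  have ii: "\<i> * z * \<i> = - z" for z
    by (simp add: algebra_simps)
  have c: "?c (j, k) = (if j + k = 0 then if c1 s = c1 t then (if j < 0 then (-1) ^ nat (- j) else
      if j = 0 then 1 / 2 else 0)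
      else if j = 0 then if c1 s then \<i> / 2 else - \<i> / 2 else 0 else 0)" for j k :: int
  proof (cases "j + k = 0")
    case True
    then have k: "k = - j"
      by simp
    have pw: "(-1 :: complex) powi k = (-1) powi j"
      by (simp add: k power_int_minus_one_minus)
    have pn: "(-1 :: complex) powi j = (-1) ^ nat (- j)" if "j \<le> 0"
      using that by (simp add: power_int_def)
    have hx: "h * x * (h * y) = x * y / 2" "h * (h * y) = y / 2" "h * x * h = x / 2" for x y
      using hh by (simp_all add: algebra_simps)
    show ?thesis
      using True pn by (auto simp: neutral_family_def pairs pw hx hh ii)
  next
    case False
    then show ?thesis
      by (simp add: neutral_family_def pairs)
  qed
  have r: "rational_value ?c (v s) (v t) r"
  proof (cases "c1 s = c1 t")
    case True
    have "rational_value ?c (v s) (v t) ((1 / 2 * v s + (1 - 1 / 2) * - 1 * v t) / (v s - - 1 * v t))"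
      using nz[OF S True] c True by (intro rational_value_geometric) auto
    moreover have "(1 / 2 * v s + (1 - 1 / 2) * - 1 * v t) / (v s - - 1 * v t) = r"
      using nz[OF S True] by (simp add: r_def True field_simps)
    ultimately show ?thesis
      by simp
  next
    case False
    then have "?c d = (if d = (0, 0) then r else 0)" for d
      using c[of "fst d" "snd d"] by (cases d) (auto simp: r_def)
    then have "rational_value ?c (v s) (v t) (r * v s powi fst (0 :: int, 0 :: int) * v t powi snd
        (0 :: int, 0 :: int))"
      by (rule rational_value_single)
    then show ?thesis
      by simp
  qed
  have "pairing (op_exp (Ham1 x y)) (Inr (neutral_family c1 s, v s)) (Inr (neutral_family c1 t,
      v t)) = e s * e t * r"
  proof (rule pairing_right[OF hamiltonian_Ham1 shifts_neutral neutral_family_vac vac_shifts_neutral _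
        value_neutral[OF S(1)] value_neutral[OF S(2)] v_nonzero[OF S(1)] v_nonzero[OF S(2)] r])
    show "lin_bracket (neutral_family c1 s j) (neutral_family c1 t k) = 0" if "j + k < 0" for j k
      using that by (auto simp: neutral_family_def phi_brackets)
  qed
  then show ?thesis
    by (simp add: neutral_field_def pf_kernel_def r_def)
qed

definition left_row :: "'i \<Rightarrow> complex" where
  "left_row s = (if c1 s then 1 else \<i>) / complex_of_real (sqrt 2) * e s"

definition right_row :: "'i \<Rightarrow> complex" where
  "right_row s = (if c1 s then 1 else - \<i>) / complex_of_real (sqrt 2) * e s"

lemma pairing_left_neutral:
  assumes S: "s \<in> S"
  shows "pairing (op_exp (Ham1 x y)) (Inl (mode_field (PsiStar 0 0))) (Inr (neutral_field c1 v s)) =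
      left_row s"
proof -
  let ?z = "(if c1 s then 1 else \<i>) / complex_of_real (sqrt 2)"
  let ?c = "\<lambda>(j, k). lop (mode_modes (PsiStar 0 0) j) (lop (neutral_family c1 s k) vac) {}"
  have "rational_value ?c 1 (v s) (?z * 1 powi fst (0 :: int, 0 :: int) * v s powi snd (0 :: int,
      0 :: int))"
    by (rule rational_value_single)
      (auto simp: mode_modes_def neutral_family_def phi_mode_def phihat_mode_def lop_lop_vac split:
          prod.split)
  then have r: "rational_value ?c 1 (v s) ?z"
    by simp
  show ?thesis
    using pairing_left[OF hamiltonian_Ham1 vac_shifts_neutral value_neutral[OF S] v_nonzero[OF S] r]
    by (simp add: neutral_field_def left_row_def)
qed

lemma pairing_right_neutral:
  assumes S: "s \<in> S"
  shows "pairing (op_exp (Ham1 x y)) (Inr (neutral_field c1 v s)) (Inr (mode_field (Psi 0 0))) =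
      right_row s"
proof -
  let ?z = "(if c1 s then 1 else - \<i>) / complex_of_real (sqrt 2)"
  let ?c = "\<lambda>(j, k). lop (neutral_family c1 s j) (lop (mode_modes (Psi 0 0) k) vac) {}"
  have "rational_value ?c (v s) 1 (?z * v s powi fst (0 :: int, 0 :: int) * 1 powi snd (0 :: int,
      0 :: int))"
    by (rule rational_value_single)
      (auto simp: mode_modes_def neutral_family_def phi_mode_def phihat_mode_def lop_lop_vac split:
          prod.split)
  then have r: "rational_value ?c (v s) 1 ?z"
    by simp
  have "pairing (op_exp (Ham1 x y)) (Inr (neutral_family c1 s, v s)) (Inr (mode_modes (Psi 0 0),
      1)) = e s * 1 * ?z"
  proof (rule pairing_right[OF hamiltonian_Ham1 shifts_neutral neutral_family_vac vac_shifts_Psi _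
        value_neutral[OF S] _ v_nonzero[OF S] _ r])
    show "lin_bracket (neutral_family c1 s j) (mode_modes (Psi 0 0) k) = 0" if "j + k < 0" for j k
      using that by (auto simp: neutral_family_def phi_mode_def phihat_mode_def mode_modes_def
          lin_bracket_def)
  qed (simp_all add: has_value_one)
  then show ?thesis
    by (simp add: neutral_field_def right_row_def mode_field_altdef)
qed

lemma f_vev_0:
  assumes G: "syms G \<subseteq> S"
  shows "f_vev y 0 x (neutral_gexp c1 v G) = pf_sum G (pf_kernel c1 v \<i> e)"
  unfolding f_vev_def pf_sum_def
proof (rule vev_eq_pair_exp[OF neutral_gexp_def _ alternating_wick[OF antisymmetric_pf_kernel]])
  fix l assume "set l \<subseteq> syms G"
  then have S: "s \<in> S" if "s \<in> set l" for s
    using that G by blast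
  have "wick (pf_kernel c1 v \<i> e) l = wick (pairing (op_exp (Ham1 x y))) (map (\<lambda>a. Inr
      (neutral_field c1 v a)) l)"
    unfolding wick_map by (rule wick_cong) (simp add: S pairing_neutral)
  then show "wick (pf_kernel c1 v \<i> e) l = wick (pairing (op_exp (Ham1 x y))) (map Inl (map
      mode_field (PsiStars 0 0)) @
      map (\<lambda>a. Inr (neutral_field c1 v a)) l @ map Inr (map mode_field (Psis 0 0)))"
    by (simp add: Psis_simps)
qed

lemma f_vev_1:
  assumes G: "syms G \<subseteq> S"
  shows "f_vev y 1 x (neutral_gexp c1 v G) = pf_sum G (pf_kernel c1 v (- \<i>) e)"
  unfolding f_vev_def pf_sum_def
proof (rule vev_eq_pair_exp[OF neutral_gexp_def _ alternating_wick[OF antisymmetric_pf_kernel]])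
  fix l assume "set l \<subseteq> syms G"
  then have S: "s \<in> S" if "s \<in> set l" for s
    using that G by blast
  let ?P = "pairing (op_exp (Ham1 x y))"
  let ?u = "Inl (mode_field (PsiStar 0 0))" and ?w = "Inr (mode_field (Psi 0 0))"
  let ?P1 = "\<lambda>a b. ?P a b + (?P ?u a * ?P b ?w - ?P a ?w * ?P ?u b)"
  have "wick ?P (?u # map (\<lambda>a. Inr (neutral_field c1 v a)) l @ [?w]) =
      wick ?P1 (map (\<lambda>a. Inr (neutral_field c1 v a)) l)"
    by (rule wick_sandwich_one)
      (simp add: pairing_left_mode[OF hamiltonian_Ham1 vac_shifts_Psi] op_op_vac del: op.simps)
  also have "\<dots> = wick (pf_kernel c1 v (- \<i>) e) l"
    unfolding wick_map
  proof (rule wick_cong)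
    fix s t assume st: "s \<in> set l" "t \<in> set l"
    define h where "h = 1 / complex_of_real (sqrt 2)"
    have hh: "h * h = 1 / 2"
      unfolding h_def by (rule half_sqrt2)
    have rows: "left_row u = (if c1 u then 1 else \<i>) * h * e u" "right_row u =
        (if c1 u then 1 else - \<i>) * h * e u" for u
      by (simp_all add: left_row_def right_row_def h_def)
    have "left_row s * right_row t - right_row s * left_row t =
        (h * h) * (e s * e t * (if c1 s = c1 t then 0 else if c1 s then - 2 * \<i> else 2 * \<i>))"
      unfolding rows by (simp add: algebra_simps)
    then have "left_row s * right_row t - right_row s * left_row t =
        e s * e t * (if c1 s = c1 t then 0 else if c1 s then - \<i> else \<i>)"
      unfolding hh by (cases "c1 s"; cases "c1 t") simp_all
    then have "pf_kernel c1 v \<i> e s t + (left_row s * right_row t - right_row s * left_row t) =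
        pf_kernel c1 v (- \<i>) e s t"
      by (auto simp: pf_kernel_def algebra_simps)
    then show "?P1 (Inr (neutral_field c1 v s)) (Inr (neutral_field c1 v t)) = pf_kernel c1 v (- \<i>) e s t"
      using st by (simp add: S pairing_neutral pairing_left_neutral pairing_right_neutral)
  qed
  finally show "wick (pf_kernel c1 v (- \<i>) e) l = wick ?P (map Inl (map mode_field (PsiStars 0 1)) @
      map (\<lambda>a. Inr (neutral_field c1 v a)) l @ map Inr (map mode_field (Psis 0 1)))"
    by (simp add: Psis_simps)
qed

end

section \<open>Gauge transformations and limits\<close>

lemma tendsto_contract:
  assumes "\<And>w. w \<in> set ws \<Longrightarrow> ((\<lambda>\<epsilon>. \<alpha> \<epsilon> w) \<longlongrightarrow> \<alpha>0 w) F"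
    and "\<And>l. set l \<subseteq> set ws \<Longrightarrow> Suc (length l) = length ws \<Longrightarrow> ((\<lambda>\<epsilon>. T \<epsilon> l) \<longlongrightarrow> T0 l) F"
  shows "((\<lambda>\<epsilon>. contract (\<alpha> \<epsilon>) (T \<epsilon>) ws) \<longlongrightarrow> contract \<alpha>0 T0 ws) F"
  unfolding contract_altdef
proof (intro tendsto_sum tendsto_mult tendsto_const assms)
  fix i assume i: "i \<in> {..<length ws}"
  show "ws ! i \<in> set ws"
    using i by simp
  show "set (take i ws @ drop (Suc i) ws) \<subseteq> set ws"
    using set_take_subset set_drop_subset by (metis set_append sup.bounded_iff)
  show "Suc (length (take i ws @ drop (Suc i) ws)) = length ws"
    using i by simp
qed

lemma tendsto_wick:
  assumes "\<And>u v. u \<in> set ws \<Longrightarrow> v \<in> set ws \<Longrightarrow> ((\<lambda>\<epsilon>. P \<epsilon> u v) \<longlongrightarrow> P0 u v) F"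
  shows "((\<lambda>\<epsilon>. wick (P \<epsilon>) ws) \<longlongrightarrow> wick P0 ws) F"
  using assms
proof (induction "length ws" arbitrary: ws rule: less_induct)
  case less
  show ?case
  proof (cases ws)
    case (Cons a us)
    show ?thesis
      unfolding Cons wick_Cons
    proof (intro tendsto_contract less.hyps less.prems)
    qed (use Cons in auto)
  qed simp
qed

lemma tendsto_pair_exp:
  assumes "\<And>h. h \<in> set hs \<Longrightarrow> ((\<lambda>\<epsilon>. Z \<epsilon> h) \<longlongrightarrow> Z0 h) F"
    and "\<And>l. set l \<subseteq> set ws \<union> (\<Union>h\<in>set hs. {a h, b h}) \<Longrightarrow> ((\<lambda>\<epsilon>. T \<epsilon> l) \<longlongrightarrow> T0 l) F"
  shows "((\<lambda>\<epsilon>. pair_exp (map (\<lambda>h. (Z \<epsilon> h, a h, b h)) hs) (T \<epsilon>) ws) \<longlongrightarrow>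
    pair_exp (map (\<lambda>h. (Z0 h, a h, b h)) hs) T0 ws) F"
  using assms
proof (induction hs arbitrary: ws)
  case (Cons h hs)
  have "((\<lambda>\<epsilon>. pair_exp (map (\<lambda>h. (Z \<epsilon> h, a h, b h)) hs) (T \<epsilon>) ws) \<longlongrightarrow>
      pair_exp (map (\<lambda>h. (Z0 h, a h, b h)) hs) T0 ws) F"
    by (intro Cons.IH Cons.prems) auto
  moreover have "((\<lambda>\<epsilon>. pair_exp (map (\<lambda>h. (Z \<epsilon> h, a h, b h)) hs) (T \<epsilon>) (a h # b h # ws)) \<longlongrightarrow>
      pair_exp (map (\<lambda>h. (Z0 h, a h, b h)) hs) T0 (a h # b h # ws)) F"
    by (intro Cons.IH Cons.prems) auto
  ultimately show ?case
    using Cons.prems(1)[of h] by (auto intro!: tendsto_add tendsto_mult)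
qed simp

text \<open>A gauge transformation of \<^const>\<open>double_exp\<close> can give the two insertions of a pair different
  weights.\<close>

fun skew_exp :: "(complex \<times> complex \<times> 'i \<times> 'i) list \<Rightarrow> (complex \<times> 'i \<times> 'i) list" where
  "skew_exp [] = []"
| "skew_exp ((x, y, s, t) # g) = (x, s, t) # (- y, t, s) # skew_exp g"

lemma skew_exp_map:
  "skew_exp (map (\<lambda>h. (X h, Y h, a h, b h)) hs) =
   map (\<lambda>(i, h). (if i then X h else - Y h, if i then a h else b h, if i then b h else a h))
     (concat (map (\<lambda>h. [(True, h), (False, h)]) hs))"
  by (induction hs) auto

lemma tendsto_det_sum_skew:
  assumes X: "\<And>h. h \<in> set hs \<Longrightarrow> ((\<lambda>\<epsilon>. X \<epsilon> h) \<longlongrightarrow> X0 h) F"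
    and Y: "\<And>h. h \<in> set hs \<Longrightarrow> ((\<lambda>\<epsilon>. Y \<epsilon> h) \<longlongrightarrow> Y0 h) F"
    and M: "\<And>s t. s \<in> (\<Union>h\<in>set hs. {a h, b h}) \<Longrightarrow> t \<in> (\<Union>h\<in>set hs. {a h, b h}) \<Longrightarrow>
      ((\<lambda>\<epsilon>. M \<epsilon> s t) \<longlongrightarrow> M0 s t) F"
  shows "((\<lambda>\<epsilon>. det_sum (skew_exp (map (\<lambda>h. (X \<epsilon> h, Y \<epsilon> h, a h, b h)) hs)) (M \<epsilon>)) \<longlongrightarrow>
    det_sum (skew_exp (map (\<lambda>h. (X0 h, Y0 h, a h, b h)) hs)) M0) F"
proof -
  let ?hs = "concat (map (\<lambda>h. [(True, h), (False, h)]) hs)"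
  let ?a = "\<lambda>p. Cr (if fst p then a (snd p) else b (snd p))" and ?b = "\<lambda>p. An (if fst p then b (snd
      p) else a (snd p))"
  let ?Z = "\<lambda>X Y p. if fst p then X (snd p) else - Y (snd p)"
  have eq: "charge_exp (skew_exp (map (\<lambda>h. (X h, Y h, a h, b h)) hs)) = map (\<lambda>p. (?Z X Y p, ?a p,
      ?b p)) ?hs" for X Y
    unfolding skew_exp_map charge_exp_def by (simp add: case_prod_unfold comp_def)
  have hs: "snd p \<in> set hs" if "p \<in> set ?hs" for p
    using that by auto
  show ?thesis
    unfolding det_sum_def eq
  proof (rule tendsto_pair_exp)
    show "((\<lambda>\<epsilon>. ?Z (X \<epsilon>) (Y \<epsilon>) p) \<longlongrightarrow> ?Z X0 Y0 p) F" if "p \<in> set ?hs" for p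
      using X[OF hs[OF that]] Y[OF hs[OF that]] by (cases "fst p") (auto intro: tendsto_minus)
    fix l assume l: "set l \<subseteq> set [] \<union> (\<Union>p\<in>set ?hs. {?a p, ?b p})"
    show "((\<lambda>\<epsilon>. wick (charge (M \<epsilon>)) l) \<longlongrightarrow> wick (charge M0) l) F"
    proof (rule tendsto_wick)
      have sym: "charged_sym u \<in> (\<Union>h\<in>set hs. {a h, b h})" if u: "u \<in> set l" for u
      proof -
        have "u \<in> (\<Union>p\<in>set ?hs. {?a p, ?b p})"
          using u l by (simp only: list.set Un_empty_left subset_iff)
        then obtain p where p: "p \<in> set ?hs" "u \<in> {?a p, ?b p}"
          by (rule UN_E)
        from p(2) show ?thesis
          using hs[OF p(1)] by (auto split: if_splits)
      qed
      fix u v assume "u \<in> set l" "v \<in> set l"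
      then have uv: "charged_sym u \<in> (\<Union>h\<in>set hs. {a h, b h})" "charged_sym v \<in> (\<Union>h\<in>set hs. {a h, b h})"
        using sym by blast+
      show "((\<lambda>\<epsilon>. charge (M \<epsilon>) u v) \<longlongrightarrow> charge M0 u v) F"
      proof (cases u)
        case (Cr s)
        then show ?thesis
          using M uv by (cases v) auto
      next
        case (An t)
        then show ?thesis
          using M uv by (cases v) (auto intro!: tendsto_minus)
      qed
    qed
  qed
qed

lemma tendsto_pf_sum:
  assumes "\<And>h. h \<in> set hs \<Longrightarrow> ((\<lambda>\<epsilon>. Z \<epsilon> h) \<longlongrightarrow> Z0 h) F"
    and M: "\<And>s t. s \<in> (\<Union>h\<in>set hs. {a h, b h}) \<Longrightarrow> t \<in> (\<Union>h\<in>set hs. {a h, b h}) \<Longrightarrow>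
      ((\<lambda>\<epsilon>. M \<epsilon> s t) \<longlongrightarrow> M0 s t) F"
  shows "((\<lambda>\<epsilon>. pf_sum (map (\<lambda>h. (Z \<epsilon> h, a h, b h)) hs) (M \<epsilon>)) \<longlongrightarrow>
    pf_sum (map (\<lambda>h. (Z0 h, a h, b h)) hs) M0) F"
  unfolding pf_sum_def
proof (rule tendsto_pair_exp[OF assms(1)])
  fix l assume l: "set l \<subseteq> set [] \<union> (\<Union>h\<in>set hs. {a h, b h})"
  show "((\<lambda>\<epsilon>. wick (M \<epsilon>) l) \<longlongrightarrow> wick M0 l) F"
    by (rule tendsto_wick, rule M) (use l in auto)
qed

lemma pair_exp_scale_weights:
  "pair_exp (map (\<lambda>(z, a, b). (z * (w a * w b), a, b)) G) (wick P) ws * prod_list (map w ws) =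
   pair_exp G (wick (\<lambda>a b. w a * w b * P a b)) ws"
proof (induction G arbitrary: ws)
  case (Cons c G)
  obtain z a b where c: "c = (z, a, b)"
    by (cases c)
  show ?case
    using Cons[of ws] Cons[of "a # b # ws"] by (simp add: c algebra_simps)
qed (simp add: wick_scale)

lemma det_sum_scale_weights:
  "det_sum (map (\<lambda>(z, s, t). (z * (\<alpha> s * \<gamma> t), s, t)) G) M = det_sum G (\<lambda>s t. \<alpha> s * M s t * \<gamma> t)"
proof -
  define w where "w a = (case a of Cr s \<Rightarrow> \<alpha> s | An t \<Rightarrow> \<gamma> t)" for a
  have "charge_exp (map (\<lambda>(z, s, t). (z * (\<alpha> s * \<gamma> t), s, t)) G) =
      map (\<lambda>(z, a, b). (z * (w a * w b), a, b)) (charge_exp G)"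
    by (auto simp: charge_exp_def w_def)
  moreover have "charge (\<lambda>s t. \<alpha> s * M s t * \<gamma> t) = (\<lambda>a b. w a * w b * charge M a b)"
  proof (intro ext)
    show "charge (\<lambda>s t. \<alpha> s * M s t * \<gamma> t) a b = w a * w b * charge M a b" for a b
      by (cases a; cases b) (auto simp: w_def)
  qed
  ultimately show ?thesis
    unfolding det_sum_def using pair_exp_scale_weights[of w "charge_exp G" "charge M" "[]"] by simp
qed

lemma skew_exp_scale:
  "skew_exp (map (\<lambda>h. (z h * (\<alpha> (a h) * \<gamma> (b h)), z h * (\<alpha> (b h) * \<gamma> (a h)), a h, b h)) hs) =
   map (\<lambda>(z, s, t). (z * (\<alpha> s * \<gamma> t), s, t)) (double_exp (map (\<lambda>h. (z h, a h, b h)) hs))"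
  by (induction hs) auto

lemma syms_map: "syms (map (\<lambda>h. (z h, a h, b h)) hs) = (\<Union>h\<in>set hs. {a h, b h})"
  by (auto simp: syms_def)

lemma last_bilinear_regular:
  fixes \<kappa> \<nu> \<mu> w :: complex and y :: "'i \<Rightarrow> complex" and a b :: "'h \<Rightarrow> 'i" and z :: "'h \<Rightarrow> complex"
  assumes nz: "\<And>s t. s \<in> (\<Union>h\<in>set hs. {a h, b h}) \<Longrightarrow> t \<in> (\<Union>h\<in>set hs. {a h, b h}) \<Longrightarrow> c1 s = c1 t \<Longrightarrow>
      v s + v t \<noteq> 0"
    and w: "w * w = - 1" and \<mu>: "\<mu> \<noteq> 0"
    and nz\<mu>: "\<And>s. s \<in> (\<Union>h\<in>set hs. {a h, b h}) \<Longrightarrow> c1 s \<Longrightarrow> 1 - \<mu> * v s \<noteq> 0"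
  defines "d \<equiv> \<lambda>\<kappa> s. 1 - \<kappa> * v s" and "u \<equiv> \<lambda>\<kappa> s. 1 + \<kappa> * v s"
  defines "D \<equiv> \<lambda>s. if c1 s then 1 - \<mu> * v s else 1" and "U \<equiv> \<lambda>s. if c1 s then 1 + \<mu> * v s else 1"
  defines "G \<equiv> skew_exp (map (\<lambda>h. (z h * (1 / D (a h) * U (b h)), z h * (1 / D (b h) * U (a h)),
      a h, b h)) hs)"
  defines "f \<equiv> \<lambda>r. pf_sum (map (\<lambda>h. (z h, a h, b h)) hs) (pf_kernel c1 v w (twist c1 r y))"
    and "F \<equiv> \<lambda>r q. det_sum G (kernel_00 c1 v (twist c1 r y) (twist c1 q y))"
    and "F0 \<equiv> \<lambda>r. det_sum G (\<lambda>s t. kernel_00 c1 v (twist c1 r y) y s t +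
          (if c1 s then 0 else y s) * (if c1 t then w * (\<kappa> * \<nu> / \<mu>) * v t * y t else 0))"
  shows "\<nu> * (\<mu> - \<kappa>) * F (\<lambda>s. u \<kappa> s * u \<nu> s * d \<nu> s) (u \<kappa>) * f (\<lambda>s. d \<kappa> s * u \<nu> s)
       - \<kappa> * (\<mu> - \<nu>) * F (\<lambda>s. u \<kappa> s * u \<nu> s * d \<kappa> s) (u \<nu>) * f (\<lambda>s. u \<kappa> s * d \<nu> s)
       = \<mu> * (\<nu> - \<kappa>) * F0 (\<lambda>s. u \<kappa> s * u \<nu> s * d \<kappa> s * d \<nu> s) * f (\<lambda>s. u \<kappa> s * u \<nu> s)"
proof -
  let ?g = "map (\<lambda>h. (z h, a h, b h)) hs"
  have G: "det_sum G M = det_sum (double_exp ?g) (\<lambda>s t. 1 / D s * M s t * U t)" for M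
    unfolding G_def skew_exp_scale[of z "\<lambda>s. 1 / D s" a U b hs] by (rule det_sum_scale_weights)
  have F: "F r q = det_sum (double_exp ?g)
      (kernel_00 c1 v (twist c1 (\<lambda>s. r s / (1 - \<mu> * v s)) y) (twist c1 (\<lambda>s. q s * (1 +
          \<mu> * v s)) y))" for r q
    unfolding F_def G by (rule arg_cong[where f = "det_sum _"]) (auto simp: fun_eq_iff kernel_00_def
        twist_def D_def U_def)
  have F0: "F0 r = det_sum (double_exp ?g)
      (\<lambda>s t. kernel_00 c1 v (twist c1 (\<lambda>s. r s / (1 - \<mu> * v s)) y) (twist c1 (\<lambda>s. 1 + \<mu> * v s) y) s t +
          (if c1 s then 0 else y s) * (if c1 t then w * (\<kappa> * \<nu> / \<mu>) * v t * (1 + \<mu> * v t) * y t else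
              0))" for r
    unfolding F0_def G by (rule arg_cong[where f = "det_sum _"]) (auto simp: fun_eq_iff
        kernel_00_def twist_def D_def U_def)
  show ?thesis
    unfolding F F0 f_def d_def u_def
    by (rule last_bilinear_generic[OF _ w \<mu>]) (use nz nz\<mu> in \<open>auto simp only: syms_map\<close>)
qed

lemma tendsto_twist:
  "((\<lambda>\<epsilon>. r \<epsilon> s) \<longlongrightarrow> r0 s) F \<Longrightarrow> ((\<lambda>\<epsilon>. twist c1 (r \<epsilon>) y s) \<longlongrightarrow> twist c1 r0 y s) F"
  by (auto simp: twist_def intro!: tendsto_intros)

lemma tendsto_kernel_00:
  assumes "((\<lambda>\<epsilon>. v \<epsilon> s) \<longlongrightarrow> v0 s) F" "((\<lambda>\<epsilon>. v \<epsilon> t) \<longlongrightarrow> v0 t) F" "c1 s = c1 t \<Longrightarrow> v0 s + v0 t \<noteq> 0"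
    and "((\<lambda>\<epsilon>. X \<epsilon> s) \<longlongrightarrow> X0 s) F" "((\<lambda>\<epsilon>. Y \<epsilon> t) \<longlongrightarrow> Y0 t) F"
  shows "((\<lambda>\<epsilon>. kernel_00 c1 (v \<epsilon>) (X \<epsilon>) (Y \<epsilon>) s t) \<longlongrightarrow> kernel_00 c1 v0 X0 Y0 s t) F"
  unfolding kernel_00_def using assms by (cases "c1 s = c1 t") (auto intro!: tendsto_intros)

lemma tendsto_pf_kernel:
  assumes "((\<lambda>\<epsilon>. v \<epsilon> s) \<longlongrightarrow> v0 s) F" "((\<lambda>\<epsilon>. v \<epsilon> t) \<longlongrightarrow> v0 t) F" "c1 s = c1 t \<Longrightarrow> v0 s + v0 t \<noteq> 0"
    and "((\<lambda>\<epsilon>. X \<epsilon> s) \<longlongrightarrow> X0 s) F" "((\<lambda>\<epsilon>. X \<epsilon> t) \<longlongrightarrow> X0 t) F"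
  shows "((\<lambda>\<epsilon>. pf_kernel c1 (v \<epsilon>) w (X \<epsilon>) s t) \<longlongrightarrow> pf_kernel c1 v0 w X0 s t) F"
proof (cases "c1 s = c1 t")
  case True
  have "((\<lambda>\<epsilon>. X \<epsilon> s * X \<epsilon> t * ((v \<epsilon> s - v \<epsilon> t) / (v \<epsilon> s + v \<epsilon> t) / 2)) \<longlongrightarrow>
      X0 s * X0 t * ((v0 s - v0 t) / (v0 s + v0 t) / 2)) F"
    by (intro tendsto_intros assms True) simp
  then show ?thesis
    by (simp only: pf_kernel_def True simp_thms if_True)
next
  case False
  then show ?thesis
    unfolding pf_kernel_def by (simp only: if_False) (intro tendsto_intros assms)
qed

lemma last_bilinear:
  fixes \<kappa> \<nu> \<mu> w :: complex and y :: "'i \<Rightarrow> complex" and a b :: "'h \<Rightarrow> 'i" and X Y z :: "'h \<Rightarrow> complex"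
  assumes nz: "\<And>s t. s \<in> (\<Union>h\<in>set hs. {a h, b h}) \<Longrightarrow> t \<in> (\<Union>h\<in>set hs. {a h, b h}) \<Longrightarrow> c1 s = c1 t \<Longrightarrow>
      v s + v t \<noteq> 0"
    and w: "w * w = - 1" and \<mu>: "\<mu> \<noteq> 0"
  defines "d \<equiv> \<lambda>\<kappa> s. 1 - \<kappa> * v s" and "u \<equiv> \<lambda>\<kappa> s. 1 + \<kappa> * v s"
  defines "D \<equiv> \<lambda>s. if c1 s then 1 - \<mu> * v s else 1" and "U \<equiv> \<lambda>s. if c1 s then 1 + \<mu> * v s else 1"
  assumes X: "\<And>h. h \<in> set hs \<Longrightarrow> X h * D (a h) = z h * U (b h)"
    and Y: "\<And>h. h \<in> set hs \<Longrightarrow> Y h * D (b h) = z h * U (a h)"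
    and XY: "\<And>h. h \<in> set hs \<Longrightarrow> D (a h) = 0 \<Longrightarrow> D (b h) = 0 \<Longrightarrow> X h = Y h"
  defines "G \<equiv> skew_exp (map (\<lambda>h. (X h, Y h, a h, b h)) hs)"
  defines "f \<equiv> \<lambda>r. pf_sum (map (\<lambda>h. (z h, a h, b h)) hs) (pf_kernel c1 v w (twist c1 r y))"
    and "F \<equiv> \<lambda>r q. det_sum G (kernel_00 c1 v (twist c1 r y) (twist c1 q y))"
    and "F0 \<equiv> \<lambda>r. det_sum G (\<lambda>s t. kernel_00 c1 v (twist c1 r y) y s t +
          (if c1 s then 0 else y s) * (if c1 t then w * (\<kappa> * \<nu> / \<mu>) * v t * y t else 0))"
  shows "\<nu> * (\<mu> - \<kappa>) * F (\<lambda>s. u \<kappa> s * u \<nu> s * d \<nu> s) (u \<kappa>) * f (\<lambda>s. d \<kappa> s * u \<nu> s)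
       - \<kappa> * (\<mu> - \<nu>) * F (\<lambda>s. u \<kappa> s * u \<nu> s * d \<kappa> s) (u \<nu>) * f (\<lambda>s. u \<kappa> s * d \<nu> s)
       = \<mu> * (\<nu> - \<kappa>) * F0 (\<lambda>s. u \<kappa> s * u \<nu> s * d \<kappa> s * d \<nu> s) * f (\<lambda>s. u \<kappa> s * u \<nu> s)"
proof -
  let ?S = "\<Union>h\<in>set hs. {a h, b h}"
  define v' where "v' \<epsilon> s = (if D s = 0 then v s + \<epsilon> else v s)" for \<epsilon> s
  define D' where "D' \<epsilon> s = (if c1 s then 1 - \<mu> * v' \<epsilon> s else 1)" for \<epsilon> s
  define U' where "U' \<epsilon> s = (if c1 s then 1 + \<mu> * v' \<epsilon> s else 1)" for \<epsilon> s
  define z' where "z' \<epsilon> h = (if D (a h) = 0 then X h * D' \<epsilon> (a h) / U' \<epsilon> (b h)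
    else if D (b h) = 0 then Y h * D' \<epsilon> (b h) / U' \<epsilon> (a h) else z h)" for \<epsilon> h
  define X' where "X' \<epsilon> h = z' \<epsilon> h * (1 / D' \<epsilon> (a h) * U' \<epsilon> (b h))" for \<epsilon> h
  define Y' where "Y' \<epsilon> h = z' \<epsilon> h * (1 / D' \<epsilon> (b h) * U' \<epsilon> (a h))" for \<epsilon> h
  have lim_v: "((\<lambda>\<epsilon>. v' \<epsilon> s) \<longlongrightarrow> v s) (at 0)" for s
    unfolding v'_def by (cases "D s = 0") (auto intro!: tendsto_eq_intros)
  have lim_D: "((\<lambda>\<epsilon>. D' \<epsilon> s) \<longlongrightarrow> D s) (at 0)" and lim_U: "((\<lambda>\<epsilon>. U' \<epsilon> s) \<longlongrightarrow> U s) (at 0)" for s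
    unfolding D'_def D_def U'_def U_def by (cases "c1 s"; auto intro!: tendsto_eq_intros lim_v)+
  have D'_nz: "D' \<epsilon> s \<noteq> 0" if "\<epsilon> \<noteq> 0" for \<epsilon> s
    using that \<mu> by (auto simp: D'_def v'_def D_def algebra_simps split: if_splits)
  have D_zero: "c1 s" "\<mu> * v s = 1" if "D s = 0" for s
    using that by (auto simp: D_def split: if_splits)
  have U_nz: "U t \<noteq> 0" if "D s = 0" "s \<in> ?S" "t \<in> ?S" for s t
  proof
    assume "U t = 0"
    then have "c1 t" "\<mu> * v t = - 1"
      by (auto simp: U_def add_eq_0_iff split: if_splits)
    then have "\<mu> * (v s + v t) = 0"
      using D_zero[OF that(1)] by (simp add: distrib_left)
    then show False
      using nz[OF that(2,3)] D_zero[OF that(1)] \<open>c1 t\<close> \<mu> by simp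
  qed
  have ab: "a h \<in> ?S" "b h \<in> ?S" if "h \<in> set hs" for h
    using that by auto
  have lim_z: "((\<lambda>\<epsilon>. z' \<epsilon> h) \<longlongrightarrow> z h) (at 0)" if h: "h \<in> set hs" for h
  proof -
    consider "D (a h) = 0" | "D (a h) \<noteq> 0" "D (b h) = 0" | "D (a h) \<noteq> 0" "D (b h) \<noteq> 0"
      by blast
    then show ?thesis
    proof cases
      case 1
      have nz: "U (b h) \<noteq> 0"
        using U_nz[OF 1] ab[OF h] by blast
      then have "z h = X h * D (a h) / U (b h)"
        using X[OF h] by simp
      moreover have "((\<lambda>\<epsilon>. X h * D' \<epsilon> (a h) / U' \<epsilon> (b h)) \<longlongrightarrow> X h * D (a h) / U (b h)) (at 0)"
        by (intro tendsto_intros lim_D lim_U nz)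
      ultimately show ?thesis
        using 1 by (simp add: z'_def)
    next
      case 2
      have nz: "U (a h) \<noteq> 0"
        using U_nz[OF 2(2)] ab[OF h] by blast
      then have "z h = Y h * D (b h) / U (a h)"
        using Y[OF h] by simp
      moreover have "((\<lambda>\<epsilon>. Y h * D' \<epsilon> (b h) / U' \<epsilon> (a h)) \<longlongrightarrow> Y h * D (b h) / U (a h)) (at 0)"
        by (intro tendsto_intros lim_D lim_U nz)
      ultimately show ?thesis
        using 2 by (simp add: z'_def)
    qed (simp add: z'_def)
  qed
  have ev_nz: "eventually (\<lambda>\<epsilon> :: complex. \<epsilon> \<noteq> 0) (at 0)"
    by (simp add: eventually_at_filter)
  have ev_U: "eventually (\<lambda>\<epsilon>. U' \<epsilon> s \<noteq> 0) (at 0)" if "U s \<noteq> 0" for s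
    using tendsto_imp_eventually_ne[OF lim_U that] .
  have lim_X: "((\<lambda>\<epsilon>. X' \<epsilon> h) \<longlongrightarrow> X h) (at 0)" if h: "h \<in> set hs" for h
  proof (cases "D (a h) = 0")
    case True
    have "eventually (\<lambda>\<epsilon>. X' \<epsilon> h = X h) (at 0)"
      using ev_nz ev_U[OF U_nz[OF True ab[OF h]]]
    proof eventually_elim
      case (elim \<epsilon>)
      then show ?case
        using D'_nz[OF elim(1), of "a h"] by (simp add: X'_def z'_def True)
    qed
    then show ?thesis
      by (rule tendsto_eventually)
  next
    case False
    have "((\<lambda>\<epsilon>. X' \<epsilon> h) \<longlongrightarrow> z h * (1 / D (a h) * U (b h))) (at 0)"
      unfolding X'_def by (intro tendsto_intros lim_D lim_U lim_z h False)
    moreover have "X h = z h * (1 / D (a h) * U (b h))"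
      using X[OF h] False by (simp add: field_simps)
    ultimately show ?thesis
      by simp
  qed
  have lim_Y: "((\<lambda>\<epsilon>. Y' \<epsilon> h) \<longlongrightarrow> Y h) (at 0)" if h: "h \<in> set hs" for h
  proof (cases "D (b h) = 0")
    case True
    have Ua: "U (a h) \<noteq> 0"
      using U_nz[OF True] ab[OF h] by blast
    have "eventually (\<lambda>\<epsilon>. Y' \<epsilon> h = Y h) (at 0)"
      using ev_nz ev_U[OF Ua]
    proof eventually_elim
      case (elim \<epsilon>)
      show ?case
      proof (cases "D (a h) = 0")
        case Da: True
        have "\<mu> * v (a h) = \<mu> * v (b h)"
          using D_zero[OF True] D_zero[OF Da] by simp
        then have "v (a h) = v (b h)"
          using \<mu> by simp
        then have "D' \<epsilon> (a h) = D' \<epsilon> (b h)" "U' \<epsilon> (a h) = U' \<epsilon> (b h)"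
          using D_zero[OF True] D_zero[OF Da] by (auto simp: D'_def U'_def v'_def True Da)
        then show ?thesis
          using elim D'_nz[OF elim(1), of "b h"] XY[OF h Da True] by (simp add: Y'_def z'_def True Da)
      next
        case False
        then show ?thesis
          using elim D'_nz[OF elim(1), of "b h"] by (simp add: Y'_def z'_def True)
      qed
    qed
    then show ?thesis
      by (rule tendsto_eventually)
  next
    case False
    have "((\<lambda>\<epsilon>. Y' \<epsilon> h) \<longlongrightarrow> z h * (1 / D (b h) * U (a h))) (at 0)"
      unfolding Y'_def by (intro tendsto_intros lim_D lim_U lim_z h False)
    moreover have "Y h = z h * (1 / D (b h) * U (a h))"
      using Y[OF h] False by (simp add: field_simps)
    ultimately show ?thesis
      by simp
  qed
  define d' where "d' \<epsilon> \<kappa> s = 1 - \<kappa> * v' \<epsilon> s" for \<epsilon> \<kappa> s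
  define u' where "u' \<epsilon> \<kappa> s = 1 + \<kappa> * v' \<epsilon> s" for \<epsilon> \<kappa> s
  define G' where "G' \<epsilon> = skew_exp (map (\<lambda>h. (X' \<epsilon> h, Y' \<epsilon> h, a h, b h)) hs)" for \<epsilon>
  define f' where "f' \<epsilon> r = pf_sum (map (\<lambda>h. (z' \<epsilon> h, a h, b h)) hs) (pf_kernel c1 (v' \<epsilon>) w (twist
      c1 r y))" for \<epsilon> r
  define F' where "F' \<epsilon> r q = det_sum (G' \<epsilon>) (kernel_00 c1 (v' \<epsilon>) (twist c1 r y) (twist c1 q y))" for \<epsilon> r q
  define F0' where "F0' \<epsilon> r = det_sum (G' \<epsilon>) (\<lambda>s t. kernel_00 c1 (v' \<epsilon>) (twist c1 r y) y s t +
      (if c1 s then 0 else y s) * (if c1 t then w * (\<kappa> * \<nu> / \<mu>) * v' \<epsilon> t * y t else 0))" for \<epsilon> r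
  have lim_d: "((\<lambda>\<epsilon>. d' \<epsilon> \<kappa> s) \<longlongrightarrow> d \<kappa> s) (at 0)" and lim_u: "((\<lambda>\<epsilon>. u' \<epsilon> \<kappa> s) \<longlongrightarrow> u \<kappa> s) (at 0)" for \<kappa> s
    unfolding d'_def u'_def d_def u_def by (auto intro!: tendsto_intros lim_v)
  have lim_f: "((\<lambda>\<epsilon>. f' \<epsilon> (r \<epsilon>)) \<longlongrightarrow> f r0) (at 0)" if "\<And>s. ((\<lambda>\<epsilon>. r \<epsilon> s) \<longlongrightarrow> r0 s) (at 0)" for r r0
    unfolding f'_def f_def by (rule tendsto_pf_sum[OF lim_z]) (assumption | intro tendsto_pf_kernel
        tendsto_twist lim_v that nz)+
  have lim_F: "((\<lambda>\<epsilon>. F' \<epsilon> (r \<epsilon>) (q \<epsilon>)) \<longlongrightarrow> F r0 q0) (at 0)"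
    if "\<And>s. ((\<lambda>\<epsilon>. r \<epsilon> s) \<longlongrightarrow> r0 s) (at 0)" "\<And>s. ((\<lambda>\<epsilon>. q \<epsilon> s) \<longlongrightarrow> q0 s) (at 0)" for r r0 q q0
    unfolding F'_def F_def G'_def G_def
    by (rule tendsto_det_sum_skew[OF lim_X lim_Y]) (assumption | intro tendsto_kernel_00
        tendsto_twist lim_v that nz)+
  have lim_F0: "((\<lambda>\<epsilon>. F0' \<epsilon> (r \<epsilon>)) \<longlongrightarrow> F0 r0) (at 0)"
    if "\<And>s. ((\<lambda>\<epsilon>. r \<epsilon> s) \<longlongrightarrow> r0 s) (at 0)" for r r0
    unfolding F0'_def F0_def G'_def G_def
  proof (rule tendsto_det_sum_skew[OF lim_X lim_Y])
    fix s t assume st: "s \<in> ?S" "t \<in> ?S"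
    have "((\<lambda>\<epsilon>. if c1 t then w * (\<kappa> * \<nu> / \<mu>) * v' \<epsilon> t * y t else 0) \<longlongrightarrow>
        (if c1 t then w * (\<kappa> * \<nu> / \<mu>) * v t * y t else 0)) (at 0)"
      by (cases "c1 t") (auto intro!: tendsto_intros lim_v simp: \<mu>)
    then show "((\<lambda>\<epsilon>. kernel_00 c1 (v' \<epsilon>) (twist c1 (r \<epsilon>) y) y s t +
        (if c1 s then 0 else y s) * (if c1 t then w * (\<kappa> * \<nu> / \<mu>) * v' \<epsilon> t * y t else 0)) \<longlongrightarrow>
      kernel_00 c1 v (twist c1 r0 y) y s t +
        (if c1 s then 0 else y s) * (if c1 t then w * (\<kappa> * \<nu> / \<mu>) * v t * y t else 0)) (at 0)"
      using that nz[OF st] by (intro tendsto_intros tendsto_kernel_00 tendsto_twist lim_v) auto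
  qed
  have ev_v: "eventually (\<lambda>\<epsilon>. \<forall>s\<in>?S. \<forall>t\<in>?S. c1 s = c1 t \<longrightarrow> v' \<epsilon> s + v' \<epsilon> t \<noteq> 0) (at 0)"
  proof (intro eventually_ball_finite ballI)
    fix s t assume st: "s \<in> ?S" "t \<in> ?S"
    have "eventually (\<lambda>\<epsilon>. v' \<epsilon> s + v' \<epsilon> t \<noteq> 0) (at 0)" if "c1 s = c1 t"
      using tendsto_imp_eventually_ne[OF tendsto_add[OF lim_v lim_v] nz[OF st that]] .
    then show "eventually (\<lambda>\<epsilon>. c1 s = c1 t \<longrightarrow> v' \<epsilon> s + v' \<epsilon> t \<noteq> 0) (at 0)"
      by (cases "c1 s = c1 t") simp_all
  qed simp_all
  define lhs where "lhs \<epsilon> = \<nu> * (\<mu> - \<kappa>) * F' \<epsilon> (\<lambda>s. u' \<epsilon> \<kappa> s * u' \<epsilon> \<nu> s * d' \<epsilon> \<nu> s) (u' \<epsilon> \<kappa>) * f' \<epsilon>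
      (\<lambda>s. d' \<epsilon> \<kappa> s * u' \<epsilon> \<nu> s)
       - \<kappa> * (\<mu> - \<nu>) * F' \<epsilon> (\<lambda>s. u' \<epsilon> \<kappa> s * u' \<epsilon> \<nu> s * d' \<epsilon> \<kappa> s) (u' \<epsilon> \<nu>) * f' \<epsilon> (\<lambda>s. u' \<epsilon> \<kappa> s * d'
           \<epsilon> \<nu> s)" for \<epsilon>
  define rhs where "rhs \<epsilon> = \<mu> * (\<nu> - \<kappa>) * F0' \<epsilon> (\<lambda>s. u' \<epsilon> \<kappa> s * u' \<epsilon> \<nu> s * d' \<epsilon> \<kappa> s * d' \<epsilon> \<nu> s) * f'
      \<epsilon> (\<lambda>s. u' \<epsilon> \<kappa> s * u' \<epsilon> \<nu> s)" for \<epsilon>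
  have "eventually (\<lambda>\<epsilon>. rhs \<epsilon> = lhs \<epsilon>) (at 0)"
    using ev_nz ev_v
  proof eventually_elim
    case (elim \<epsilon>)
    have "1 - \<mu> * v' \<epsilon> s \<noteq> 0" if "c1 s" for s
      using D'_nz[OF elim(1), of s] that by (simp add: D'_def)
    then show ?case
      unfolding lhs_def rhs_def F'_def F0'_def f'_def G'_def X'_def Y'_def D'_def U'_def d'_def u'_def
      by (intro last_bilinear_regular[symmetric] w \<mu>) (use elim(2) in blast)+
  qed
  moreover have "(rhs \<longlongrightarrow> \<mu> * (\<nu> - \<kappa>) * F0 (\<lambda>s. u \<kappa> s * u \<nu> s * d \<kappa> s * d \<nu> s) * f (\<lambda>s. u \<kappa> s * u \<nu>
      s)) (at 0)"
    unfolding rhs_def by (intro tendsto_intros lim_F0 lim_f lim_d lim_u)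
  ultimately have "(lhs \<longlongrightarrow> \<mu> * (\<nu> - \<kappa>) * F0 (\<lambda>s. u \<kappa> s * u \<nu> s * d \<kappa> s * d \<nu> s) * f (\<lambda>s. u \<kappa> s * u \<nu>
      s)) (at 0)"
    by (rule Lim_transform_eventually[rotated])
  moreover have "(lhs \<longlongrightarrow> \<nu> * (\<mu> - \<kappa>) * F (\<lambda>s. u \<kappa> s * u \<nu> s * d \<nu> s) (u \<kappa>) * f (\<lambda>s. d \<kappa> s * u \<nu> s)
       - \<kappa> * (\<mu> - \<nu>) * F (\<lambda>s. u \<kappa> s * u \<nu> s * d \<kappa> s) (u \<nu>) * f (\<lambda>s. u \<kappa> s * d \<nu> s)) (at 0)"
    unfolding lhs_def by (intro tendsto_intros lim_F lim_f lim_d lim_u)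
  ultimately show ?thesis
    using tendsto_unique[OF at_neq_bot] by blast
qed

lemma twist_twist: "twist c1 r (twist c1 q y) = twist c1 (\<lambda>s. r s * q s) y"
  by (auto simp: twist_def fun_eq_iff)

definition F11 ::
  "(complex \<times> 'i \<times> 'i) list \<Rightarrow> ('i \<Rightarrow> bool) \<Rightarrow> ('i \<Rightarrow> complex) \<Rightarrow> ('i \<Rightarrow> complex) \<Rightarrow>
   ('i \<Rightarrow> complex) \<Rightarrow> ('i \<Rightarrow> complex) \<Rightarrow> complex" where
  "F11 g c1 v y r q = det_sum g (kernel_11 c1 v (twist c1 r y) (twist c1 q y))"

lemma F11_cong:
  assumes "\<And>s. s \<in> syms g \<Longrightarrow> c1 s \<Longrightarrow> r s = r' s" "\<And>s. s \<in> syms g \<Longrightarrow> c1 s \<Longrightarrow> q s = q' s"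
  shows "F11 g c1 v y r q = F11 g c1 v y r' q'"
  unfolding F11_def using assms by (intro det_sum_cong) (auto simp: kernel_11_def twist_def)

section \<open>The bilinear equations at one corner\<close>

lemma rescale_bilinear:
  fixes \<alpha> \<beta> \<gamma> :: complex
  assumes "\<alpha> * m = \<alpha>'" "\<beta> * m = \<beta>'" "\<gamma> * m = \<gamma>'" "\<alpha> * A * B - \<beta> * C * D = \<gamma> * E * F"
  shows "\<alpha>' * A * B - \<beta>' * C * D = \<gamma>' * E * F"
proof -
  have "\<alpha>' * A * B - \<beta>' * C * D = (\<alpha> * A * B - \<beta> * C * D) * m"
    unfolding assms(1,2)[symmetric] by (simp add: algebra_simps)
  then show ?thesis
    unfolding assms(4) assms(3)[symmetric] by (simp add: mult_ac)
qed

lemma corner_middle: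
  fixes K L a :: complex
  assumes nz: "\<And>s t. s \<in> syms g \<Longrightarrow> t \<in> syms g \<Longrightarrow> c1 s = c1 t \<Longrightarrow> v s + v t \<noteq> 0"
    and KLa: "K \<noteq> 0" "L \<noteq> 0" "a \<noteq> 0"
    and ua: "\<And>s. s \<in> syms g \<Longrightarrow> c1 s \<Longrightarrow> 1 + inverse a * v s \<noteq> 0"
    and rE: "\<And>s. rE s = (1 + inverse K * v s) * (1 + inverse L * v s) * (1 - inverse L * v s)"
    and qE: "\<And>s. qE s = 1 + inverse K * v s"
    and rN: "\<And>s. rN s = (1 + inverse K * v s) * (1 + inverse L * v s) * (1 - inverse K * v s)"
    and qN: "\<And>s. qN s = 1 + inverse L * v s"
    and r0: "\<And>s. r0 s = (1 + inverse K * v s) * (1 + inverse L * v s) * (1 - inverse K * v s) * (1 -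
        inverse L * v s)"
    and r1: "\<And>s. r1 s = (1 + inverse K * v s) * (1 + inverse L * v s)"
    and A': "\<And>s. A' s = A s * (1 - inverse a * v s)" and B': "\<And>s. B' s = B s * (1 + inverse a * v s)"
  shows "(K - a) * F11 g c1 v y (\<lambda>s. rE s * A s) (\<lambda>s. qE s / B s) * F11 g c1 v y (\<lambda>s. rN s * A' s)
      (\<lambda>s. qN s / B' s)
     - (L - a) * F11 g c1 v y (\<lambda>s. rN s * A s) (\<lambda>s. qN s / B s) * F11 g c1 v y (\<lambda>s. rE s * A' s)
         (\<lambda>s. qE s / B' s)
     = (K - L) * F11 g c1 v y (\<lambda>s. r0 s * A s) (\<lambda>s. 1 / B s) * F11 g c1 v y (\<lambda>s. r1 s * A' s) (\<lambda>s.
         r1 s / B' s)"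
proof -
  define \<kappa> \<nu> \<mu> where "\<kappa> = inverse K" "\<nu> = inverse L" "\<mu> = inverse a"
  define X where "X = twist c1 (\<lambda>s. (1 + \<kappa> * v s) * (1 + \<nu> * v s) * A s) y"
  define Y where "Y = twist c1 (\<lambda>s. 1 / (B s * (1 + \<mu> * v s))) y"
  note defs = \<kappa>_\<nu>_\<mu>_def
  have F: "det_sum g (kernel_11 c1 v (twist c1 r X) (twist c1 q Y)) = F11 g c1 v y r' q'"
    if "\<And>s. r s * ((1 + \<kappa> * v s) * (1 + \<nu> * v s) * A s) = r' s"
      "\<And>s. 1 + \<mu> * v s \<noteq> 0 \<Longrightarrow> q s * (1 / (B s * (1 + \<mu> * v s))) = q' s" for r q r' q'
  proof -
    have "det_sum g (kernel_11 c1 v (twist c1 r X) (twist c1 q Y)) =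
        F11 g c1 v y (\<lambda>s. r s * ((1 + \<kappa> * v s) * (1 + \<nu> * v s) * A s)) (\<lambda>s. q s * (1 / (B s * (1 +
            \<mu> * v s))))"
      by (simp add: F11_def X_def Y_def twist_twist)
    also have "\<dots> = F11 g c1 v y r' q'"
      by (rule F11_cong) (use that ua in \<open>auto simp: defs\<close>)
    finally show ?thesis .
  qed
  have E1: "det_sum g (kernel_11 c1 v (twist c1 (\<lambda>s. 1 - \<nu> * v s) X) (twist c1 (\<lambda>s. (1 +
      \<kappa> * v s) * (1 + \<mu> * v s)) Y)) =
      F11 g c1 v y (\<lambda>s. rE s * A s) (\<lambda>s. qE s / B s)"
    by (rule F) (simp_all add: rE qE defs mult_ac)
  have N1: "det_sum g (kernel_11 c1 v (twist c1 (\<lambda>s. 1 - \<kappa> * v s) X) (twist c1 (\<lambda>s. (1 +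
      \<nu> * v s) * (1 + \<mu> * v s)) Y)) =
      F11 g c1 v y (\<lambda>s. rN s * A s) (\<lambda>s. qN s / B s)"
    by (rule F) (simp_all add: rN qN defs mult_ac)
  have E2: "det_sum g (kernel_11 c1 v (twist c1 (\<lambda>s. (1 - \<nu> * v s) * (1 - \<mu> * v s)) X) (twist c1
      (\<lambda>s. 1 + \<kappa> * v s) Y)) =
      F11 g c1 v y (\<lambda>s. rE s * A' s) (\<lambda>s. qE s / B' s)"
    by (rule F) (simp_all add: rE qE A' B' defs mult_ac)
  have N2: "det_sum g (kernel_11 c1 v (twist c1 (\<lambda>s. (1 - \<kappa> * v s) * (1 - \<mu> * v s)) X) (twist c1
      (\<lambda>s. 1 + \<nu> * v s) Y)) =
      F11 g c1 v y (\<lambda>s. rN s * A' s) (\<lambda>s. qN s / B' s)"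
    by (rule F) (simp_all add: rN qN A' B' defs mult_ac)
  have O: "det_sum g (kernel_11 c1 v (twist c1 (\<lambda>s. (1 - \<kappa> * v s) * (1 - \<nu> * v s)) X) (twist c1 (\<lambda>s.
      1 + \<mu> * v s) Y)) =
      F11 g c1 v y (\<lambda>s. r0 s * A s) (\<lambda>s. 1 / B s)"
    by (rule F) (simp_all add: r0 defs mult_ac)
  have J: "det_sum g (kernel_11 c1 v (twist c1 (\<lambda>s. 1 - \<mu> * v s) X) (twist c1 (\<lambda>s. (1 +
      \<kappa> * v s) * (1 + \<nu> * v s)) Y)) =
      F11 g c1 v y (\<lambda>s. r1 s * A' s) (\<lambda>s. r1 s / B' s)"
    by (rule F) (simp_all add: r1 A' B' defs mult_ac)
  have HM: "\<nu> * (\<mu> - \<kappa>) * F11 g c1 v y (\<lambda>s. rE s * A s) (\<lambda>s. qE s / B s) * F11 g c1 v y (\<lambda>s. rN s *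
      A' s) (\<lambda>s. qN s / B' s)
     - \<kappa> * (\<mu> - \<nu>) * F11 g c1 v y (\<lambda>s. rN s * A s) (\<lambda>s. qN s / B s) * F11 g c1 v y (\<lambda>s. rE s * A' s)
         (\<lambda>s. qE s / B' s)
     = \<mu> * (\<nu> - \<kappa>) * F11 g c1 v y (\<lambda>s. r0 s * A s) (\<lambda>s. 1 / B s) * F11 g c1 v y (\<lambda>s. r1 s * A' s)
         (\<lambda>s. r1 s / B' s)"
    unfolding E1[symmetric] N1[symmetric] E2[symmetric] N2[symmetric] O[symmetric] J[symmetric]
    by (rule hirota_miwa_det_sum) (rule nz)
  have "\<nu> * (\<mu> - \<kappa>) * (K * L * a) = K - a" "\<kappa> * (\<mu> - \<nu>) * (K * L * a) = L - a"
      "\<mu> * (\<nu> - \<kappa>) * (K * L * a) = K - L"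
    using KLa by (simp_all add: defs field_simps)
  then show ?thesis
    using HM by (rule rescale_bilinear)
qed

definition F01 ::
  "complex \<Rightarrow> (complex \<times> 'i \<times> 'i) list \<Rightarrow> ('i \<Rightarrow> bool) \<Rightarrow> ('i \<Rightarrow> complex) \<Rightarrow> ('i \<Rightarrow> complex) \<Rightarrow>
   ('i \<Rightarrow> complex) \<Rightarrow> complex" where
  "F01 w g c1 v y r = det_sum g (\<lambda>s t. kernel_00 c1 v (twist c1 r y) y s t +
     (if c1 s then 0 else y s) * (if c1 t then w * y t else y t))"

lemma corner_first:
  fixes K L w :: complex and y :: "'i \<Rightarrow> complex"
  assumes nz: "\<And>s t. s \<in> syms g \<Longrightarrow> t \<in> syms g \<Longrightarrow> c1 s = c1 t \<Longrightarrow> v s + v t \<noteq> 0"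
    and KL: "K \<noteq> 0" "L \<noteq> 0" and w: "w * w = - 1"
    and rE: "\<And>s. rE s = (1 + inverse K * v s) * (1 + inverse L * v s) * (1 - inverse L * v s)"
    and qE: "\<And>s. qE s = 1 + inverse K * v s"
    and rN: "\<And>s. rN s = (1 + inverse K * v s) * (1 + inverse L * v s) * (1 - inverse K * v s)"
    and qN: "\<And>s. qN s = 1 + inverse L * v s"
    and r0: "\<And>s. r0 s = (1 + inverse K * v s) * (1 + inverse L * v s) * (1 - inverse K * v s) * (1 -
        inverse L * v s)"
    and r1: "\<And>s. r1 s = (1 + inverse K * v s) * (1 + inverse L * v s)"
    and r2: "\<And>s. r2 s = (1 - inverse K * v s) * (1 + inverse L * v s)"
    and r4: "\<And>s. r4 s = (1 + inverse K * v s) * (1 - inverse L * v s)"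
  defines "f \<equiv> \<lambda>w r. pf_sum g (pf_kernel c1 v w (twist c1 r y))"
  shows "K * F11 (double_exp g) c1 v y rN qN * f (- w) r4 - L * F11 (double_exp g) c1 v y rE qE * f
      (- w) r2 =
    (K - L) * F01 w (double_exp g) c1 v y r0 * f w r1"
proof -
  have fun_eqs: "rE = (\<lambda>s. (1 + inverse K * v s) * (1 + inverse L * v s) * (1 - inverse L * v s))"
    "qE = (\<lambda>s. 1 + inverse K * v s)"
    "rN = (\<lambda>s. (1 + inverse K * v s) * (1 + inverse L * v s) * (1 - inverse K * v s))"
    "qN = (\<lambda>s. 1 + inverse L * v s)"
    "r0 = (\<lambda>s. (1 + inverse K * v s) * (1 + inverse L * v s) * (1 - inverse K * v s) * (1 -
        inverse L * v s))"
    "r1 = (\<lambda>s. (1 + inverse K * v s) * (1 + inverse L * v s))"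
    "r2 = (\<lambda>s. (1 - inverse K * v s) * (1 + inverse L * v s))"
    "r4 = (\<lambda>s. (1 + inverse K * v s) * (1 - inverse L * v s))"
    using rE qE rN qN r0 r1 r2 r4 by auto
  have *: "inverse L * F11 (double_exp g) c1 v y rN qN * f (- w) r4 - inverse K * F11 (double_exp g)
      c1 v y rE qE * f (- w) r2 =
    (inverse L - inverse K) * F01 w (double_exp g) c1 v y r0 * f w r1"
    unfolding F11_def F01_def f_def fun_eqs by (rule first_bilinear_pf_sum[OF nz w])
  show ?thesis
    by (rule rescale_bilinear[where m = "K * L", OF _ _ _ *]) (use KL in \<open>simp_all add: field_simps\<close>)
qed

definition F00 ::
  "complex \<Rightarrow> (complex \<times> 'i \<times> 'i) list \<Rightarrow> ('i \<Rightarrow> bool) \<Rightarrow> ('i \<Rightarrow> complex) \<Rightarrow> ('i \<Rightarrow> complex) \<Rightarrow>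
   ('i \<Rightarrow> complex) \<Rightarrow> ('i \<Rightarrow> complex) \<Rightarrow> complex" where
  "F00 \<rho> g c1 v y r q = det_sum g (\<lambda>s t. kernel_11 c1 v (twist c1 r y) (twist c1 q y) s t +
     (if c1 s then 0 else v s * y s) * (if c1 t then \<rho> * (q t * y t) else 0))"

lemma corner_last:
  fixes K L a w :: complex and i j :: "'h \<Rightarrow> 'i" and z z' :: "'h \<Rightarrow> complex" and y A B :: "'i \<Rightarrow> complex"
  assumes nz: "\<And>s t. s \<in> (\<Union>h\<in>set hs. {i h, j h}) \<Longrightarrow> t \<in> (\<Union>h\<in>set hs. {i h, j h}) \<Longrightarrow> c1 s = c1 t \<Longrightarrow>
      v s + v t \<noteq> 0"
    and KLa: "K \<noteq> 0" "L \<noteq> 0" "a \<noteq> 0" and w: "w * w = - 1"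
    and rE: "\<And>s. rE s = (1 + inverse K * v s) * (1 + inverse L * v s) * (1 - inverse L * v s)"
    and qE: "\<And>s. qE s = 1 + inverse K * v s"
    and rN: "\<And>s. rN s = (1 + inverse K * v s) * (1 + inverse L * v s) * (1 - inverse K * v s)"
    and qN: "\<And>s. qN s = 1 + inverse L * v s"
    and r0: "\<And>s. r0 s = (1 + inverse K * v s) * (1 + inverse L * v s) * (1 - inverse K * v s) * (1 -
        inverse L * v s)"
    and r1: "\<And>s. r1 s = (1 + inverse K * v s) * (1 + inverse L * v s)"
    and r2: "\<And>s. r2 s = (1 - inverse K * v s) * (1 + inverse L * v s)"
    and r4: "\<And>s. r4 s = (1 + inverse K * v s) * (1 - inverse L * v s)"
  defines "\<alpha> \<equiv> \<lambda>s. v s * (if c1 s then A s else 1)" and "\<gamma> \<equiv> \<lambda>s. - 1 / (v s * (if c1 s then B s else 1))"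
  defines "D \<equiv> \<lambda>s. if c1 s then 1 - inverse a * v s else 1" and "U \<equiv> \<lambda>s. if c1 s then 1 +
      inverse a * v s else 1"
  assumes B: "\<And>s. s \<in> (\<Union>h\<in>set hs. {i h, j h}) \<Longrightarrow> c1 s \<Longrightarrow> B s \<noteq> 0"
    and AB: "\<And>s t. v s = v t \<Longrightarrow> A s = A t \<and> B s = B t"
    and X: "\<And>h. h \<in> set hs \<Longrightarrow> z h * (\<alpha> (i h) * \<gamma> (j h)) * D (i h) = z' h * U (j h)"
    and Y: "\<And>h. h \<in> set hs \<Longrightarrow> z h * (\<alpha> (j h) * \<gamma> (i h)) * D (j h) = z' h * U (i h)"
  defines "G \<equiv> double_exp (map (\<lambda>h. (z h, i h, j h)) hs)"
  defines "f \<equiv> \<lambda>r. pf_sum (map (\<lambda>h. (z' h, i h, j h)) hs) (pf_kernel c1 v w (twist c1 r y))"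
  shows "(K - a) * F11 G c1 v y (\<lambda>s. rE s * A s) (\<lambda>s. qE s / B s) * f r2
    - (L - a) * F11 G c1 v y (\<lambda>s. rN s * A s) (\<lambda>s. qN s / B s) * f r4
    = (K - L) * F00 (- w * a / (K * L)) G c1 v y (\<lambda>s. r0 s * A s) (\<lambda>s. 1 / B s) * f r1"
proof -
  let ?S = "\<Union>h\<in>set hs. {i h, j h}"
  define \<kappa> \<nu> \<mu> where "\<kappa> = inverse K" "\<nu> = inverse L" "\<mu> = inverse a"
  note defs = \<kappa>_\<nu>_\<mu>_def
  define X Y where "X h = z h * (\<alpha> (i h) * \<gamma> (j h))" and "Y h = z h * (\<alpha> (j h) * \<gamma> (i h))" for h
  define H where "H = skew_exp (map (\<lambda>h. (X h, Y h, i h, j h)) hs)"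
  have fun_eqs: "rE = (\<lambda>s. (1 + inverse K * v s) * (1 + inverse L * v s) * (1 - inverse L * v s))"
    "qE = (\<lambda>s. 1 + inverse K * v s)"
    "rN = (\<lambda>s. (1 + inverse K * v s) * (1 + inverse L * v s) * (1 - inverse K * v s))"
    "qN = (\<lambda>s. 1 + inverse L * v s)"
    "r0 = (\<lambda>s. (1 + inverse K * v s) * (1 + inverse L * v s) * (1 - inverse K * v s) * (1 -
        inverse L * v s))"
    "r1 = (\<lambda>s. (1 + inverse K * v s) * (1 + inverse L * v s))"
    "r2 = (\<lambda>s. (1 - inverse K * v s) * (1 + inverse L * v s))"
    "r4 = (\<lambda>s. (1 + inverse K * v s) * (1 - inverse L * v s))"
    using rE qE rN qN r0 r1 r2 r4 by auto
  have v_nz: "v s \<noteq> 0" if "s \<in> ?S" for s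
    using nz[OF that that] by auto
  have gauge: "det_sum G M = det_sum H M'"
    if "\<And>s t. s \<in> ?S \<Longrightarrow> t \<in> ?S \<Longrightarrow> M s t = \<alpha> s * M' s t * \<gamma> t" for M M'
  proof -
    have "det_sum G M = det_sum G (\<lambda>s t. \<alpha> s * M' s t * \<gamma> t)"
      by (rule det_sum_cong) (rule that; simp only: G_def syms_double_exp syms_map)
    also have "\<dots> = det_sum H M'"
      unfolding H_def G_def X_def Y_def skew_exp_scale det_sum_scale_weights ..
    finally show ?thesis .
  qed
  have F11_gauge: "F11 G c1 v y (\<lambda>s. r s * A s) (\<lambda>s. q s / B s) = det_sum H (kernel_00 c1 v (twist
      c1 r y) (twist c1 q y))" for r q
    unfolding F11_def
    by (rule gauge) (use v_nz B in \<open>auto simp: kernel_11_def kernel_00_def twist_def \<alpha>_def \<gamma>_def mult_ac\<close>)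
  have F00_gauge: "F00 (- w * a / (K * L)) G c1 v y (\<lambda>s. r s * A s) (\<lambda>s. 1 / B s) =
      det_sum H (\<lambda>s t. kernel_00 c1 v (twist c1 r y) y s t +
        (if c1 s then 0 else y s) * (if c1 t then w * (\<kappa> * \<nu> / \<mu>) * v t * y t else 0))" for r
    unfolding F00_def
  proof (rule gauge)
    fix s t assume st: "s \<in> ?S" "t \<in> ?S"
    let ?m = "kernel_11 c1 v (twist c1 (\<lambda>s. r s * A s) y) (twist c1 (\<lambda>s. 1 / B s) y) s t"
    let ?m' = "kernel_00 c1 v (twist c1 r y) y s t"
    let ?x = "(if c1 s then 0 else v s * y s) * (if c1 t then - w * a / (K * L) * (1 / B t * y t) else 0)"
    let ?x' = "(if c1 s then 0 else y s) * (if c1 t then w * (\<kappa> * \<nu> / \<mu>) * v t * y t else 0)"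
    have "?m = \<alpha> s * ?m' * \<gamma> t"
      using v_nz[OF st(2)] B[OF st(2)]
      by (auto simp: kernel_11_def kernel_00_def twist_def \<alpha>_def \<gamma>_def mult_ac)
    moreover have "?x = \<alpha> s * ?x' * \<gamma> t"
      using v_nz[OF st(2)] B[OF st(2)] by (auto simp: \<alpha>_def \<gamma>_def defs field_simps)
    ultimately show "?m + ?x = \<alpha> s * (?m' + ?x') * \<gamma> t"
      by (simp only: distrib_left distrib_right)
  qed
  have XY: "X h = Y h" if h: "D (i h) = 0" "D (j h) = 0" for h
  proof -
    have c: "c1 (i h)" "c1 (j h)" and "inverse a * v (i h) = 1" "inverse a * v (j h) = 1"
      using h by (auto simp: D_def split: if_splits)
    then have "v (i h) = v (j h)"
      using KLa(3) by (metis inverse_nonzero_iff_nonzero mult_left_cancel)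
    then show ?thesis
      using c AB[of "i h" "j h"] by (simp add: X_def Y_def \<alpha>_def \<gamma>_def)
  qed
  have *: "\<nu> * (\<mu> - \<kappa>) * F11 G c1 v y (\<lambda>s. rE s * A s) (\<lambda>s. qE s / B s) * f r2
    - \<kappa> * (\<mu> - \<nu>) * F11 G c1 v y (\<lambda>s. rN s * A s) (\<lambda>s. qN s / B s) * f r4
    = \<mu> * (\<nu> - \<kappa>) * F00 (- w * a / (K * L)) G c1 v y (\<lambda>s. r0 s * A s) (\<lambda>s. 1 / B s) * f r1"
    unfolding F11_gauge F00_gauge H_def f_def fun_eqs \<kappa>_\<nu>_\<mu>_def(1,2)[symmetric]
  proof (rule last_bilinear)
    fix h assume h: "h \<in> set hs"
    show "X h * (if c1 (i h) then 1 - \<mu> * v (i h) else 1) = z' h * (if c1 (j h) then 1 +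
        \<mu> * v (j h) else 1)"
      using X[OF h] by (simp only: X_def D_def U_def defs)
    show "Y h * (if c1 (j h) then 1 - \<mu> * v (j h) else 1) = z' h * (if c1 (i h) then 1 +
        \<mu> * v (i h) else 1)"
      using Y[OF h] by (simp only: Y_def D_def U_def defs)
    show "(if c1 (i h) then 1 - \<mu> * v (i h) else 1) = 0 \<Longrightarrow> (if c1 (j h) then 1 - \<mu> * v (j h) else 1)
        = 0 \<Longrightarrow> X h = Y h"
      using XY[of h] by (simp only: D_def defs)
  qed (use nz w KLa in \<open>auto simp only: defs inverse_nonzero_iff_nonzero\<close>)
  show ?thesis
    by (rule rescale_bilinear[where m = "K * L * a", OF _ _ _ *]) (use KLa in \<open>simp_all add: defs
        field_simps\<close>)
qed

section \<open>The theorem\<close>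

type_synonym symbol = "(nat + nat) \<times> bool"

fun on_first :: "symbol \<Rightarrow> bool" where
  "on_first (Inl _, _) = True"
| "on_first (Inr _, i) = i"

fun location ::
  "(nat \<Rightarrow> complex) \<Rightarrow> (nat \<Rightarrow> complex) \<Rightarrow> (nat \<Rightarrow> complex) \<Rightarrow> (nat \<Rightarrow> complex) \<Rightarrow> symbol \<Rightarrow> complex" where
  "location p q p' q' (Inl j, i) = (if i then p j else q j)"
| "location p q p' q' (Inr j, i) = (if i then p' j else q' j)"

definition indices :: "nat \<Rightarrow> nat \<Rightarrow> (nat + nat) list" where
  "indices N M = map Inl [1..<N+1] @ map Inr [1..<M+1]"

definition insertions :: "nat \<Rightarrow> nat \<Rightarrow> (nat \<Rightarrow> complex) \<Rightarrow> (nat \<Rightarrow> complex) \<Rightarrow> (complex \<times> symbol \<times>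
    symbol) list" where
  "insertions N M b c = map (\<lambda>h. (case_sum b c h, (h, True), (h, False))) (indices N M)"

lemma g_neutral_eq:
  "g_neutral N M b c p q p' q' = neutral_gexp on_first (location p q p' q') (insertions N M b c)"
  by (simp add: g_neutral_def neutral_gexp_def insertions_def indices_def neutral_field_def
      neutral_family_def
      phi_def phihat_def)

lemma double_exp_append: "double_exp (g @ g') = double_exp g @ double_exp g'"
  by (induction g rule: double_exp.induct) auto

lemma double_exp_map:
  "double_exp (map (\<lambda>j. (z j, s j, t j)) js) = concat (map (\<lambda>j. [(z j, s j, t j), (- z j, t j, s j)]) js)"
  by (induction js) auto

lemma g_charged_eq:
  "g_charged N M b c p q p' q' = charged_gexp False on_first (location p q p' q') (double_exp
      (insertions N M b c))"
  unfolding g_charged_def charged_gexp_def insertions_def indices_def map_append map_map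
      double_exp_append comp_def
    double_exp_map map_concat list.map
  by (simp add: charged_field_def component_def psi_def psistar_def psi_modes_def[abs_def]
      psistar_modes_def[abs_def])

lemma omega_charged_gexp: "omega (charged_gexp False c1 v G) = charged_gexp True c1 v G"
proof -
  have "omega_lin (psi_modes c j) = psi_modes c (j + - 1)" "omega_lin (psistar_modes c j) =
      psistar_modes c (j + 1)" for c j
    by (simp_all add: omega_lin_def psi_modes_def psistar_modes_def)
  then show ?thesis
    by (auto simp: omega_def charged_gexp_def charged_field_def)
qed

lemma syms_insertions:
  "syms (insertions N M b c) = (\<Union>h\<in>set (indices N M). {(h, True), (h, False)})"
  unfolding insertions_def by (rule syms_map)

lemma odd_time_shift:
  assumes "odd_time t"
  shows "odd_time (t - eps c - teps c)"
  unfolding odd_time_def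
proof
  fix l
  have "t l = tilde t l"
    using assms by (simp add: odd_time_def flip: fun_eq_iff)
  then have t: "tilde t l = t l"
    by simp
  have "tilde (t - eps c - teps c) l = tilde t l - tilde (eps c) l - tilde (tilde (eps c)) l"
    by (simp add: tilde_def teps_def algebra_simps)
  also have "tilde (tilde (eps c)) l = eps c l"
    by (simp add: tilde_def flip: mult.assoc power_mult_distrib)
  finally have "tilde (t - eps c - teps c) l = t l - tilde (eps c) l - eps c l"
    by (simp only: t)
  then show "(t - eps c - teps c) l = tilde (t - eps c - teps c) l"
    by (simp only: teps_def minus_apply) simp
qed

lemma exp_values_shifted:
  assumes "exp_values t u r r'" "\<And>k. k \<in> {2..i} \<Longrightarrow> 1 + inverse (a k) * u \<noteq> 0"
  shows "exp_values (shifted a t i) u ((\<Prod>k=2..i. 1 - inverse (a k) * u) * r) (r' / (\<Prod>k=2..i. 1 +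
      inverse (a k) * u))"
  using assms(2)
proof (induction i)
  case 0
  then show ?case
    using assms(1) by (simp add: shifted_def)
next
  case (Suc i)
  show ?case
  proof (cases "i = 0")
    case True
    then show ?thesis
      using assms(1) by (simp add: shifted_def)
  next
    case False
    then have i: "2 \<le> Suc i"
      by simp
    have "exp_values (shifted a t i - eps (inverse (a (Suc i)))) u
        ((1 - inverse (a (Suc i)) * u) * ((\<Prod>k=2..i. 1 - inverse (a k) * u) * r))
        (r' / (\<Prod>k=2..i. 1 + inverse (a k) * u) / (1 + inverse (a (Suc i)) * u))"
      using Suc i by (intro exp_values_minus_eps) auto
    moreover have "shifted a t i - eps (inverse (a (Suc i))) = shifted a t (Suc i)"
      using i by (simp add: shifted_def prod.cl_ivl_Suc sum.cl_ivl_Suc)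
    ultimately show ?thesis
      using i by (simp add: prod.cl_ivl_Suc mult_ac)
  qed
qed

definition values_at ::
  "('i \<Rightarrow> bool) \<Rightarrow> ('i \<Rightarrow> complex) \<Rightarrow> ('i \<Rightarrow> complex) \<Rightarrow> 'i set \<Rightarrow> time \<Rightarrow>
   ('i \<Rightarrow> complex) \<Rightarrow> ('i \<Rightarrow> complex) \<Rightarrow> bool" where
  "values_at c1 v e S t r q \<longleftrightarrow> (\<forall>s\<in>S. c1 s \<longrightarrow> exp_values t (v s) (r s * e s) (q s * e s))"

lemma values_at_eps:
  assumes "values_at c1 v e S t r q" "t - t' = eps c" "\<And>s. s \<in> S \<Longrightarrow> c1 s \<Longrightarrow> 1 + c * v s \<noteq> 0"
    and "\<And>s. r' s = r s * (1 - c * v s)" "\<And>s. q s = q' s * (1 + c * v s)"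
  shows "values_at c1 v e S t' r' q'"
  unfolding values_at_def
proof (intro ballI impI)
  fix s assume s: "s \<in> S" "c1 s"
  have t': "t' = t - eps c"
    unfolding assms(2)[symmetric] by simp
  have "exp_values t' (v s) ((1 - c * v s) * (r s * e s)) (q s * e s / (1 + c * v s))"
    unfolding t' using assms(1,3) s by (intro exp_values_minus_eps) (auto simp: values_at_def)
  then show "exp_values t' (v s) (r' s * e s) (q' s * e s)"
    using assms(3)[OF s] by (simp add: assms(4,5) mult_ac)
qed

lemma values_at_teps:
  assumes "values_at c1 v e S t r q" "t - t' = teps c" "\<And>s. s \<in> S \<Longrightarrow> c1 s \<Longrightarrow> 1 + c * v s \<noteq> 0"
    and "\<And>s. r s = r' s * (1 + c * v s)" "\<And>s. q' s = q s * (1 - c * v s)"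
  shows "values_at c1 v e S t' r' q'"
  unfolding values_at_def
proof (intro ballI impI)
  fix s assume s: "s \<in> S" "c1 s"
  have t': "t' = t - teps c"
    unfolding assms(2)[symmetric] by simp
  have "exp_values t' (v s) (r s * e s / (1 + c * v s)) ((1 - c * v s) * (q s * e s))"
    unfolding t' using assms(1,3) s by (intro exp_values_minus_teps) (auto simp: values_at_def)
  then show "exp_values t' (v s) (r' s * e s) (q' s * e s)"
    using assms(3)[OF s] by (simp add: assms(4,5) mult_ac)
qed

lemma bilinear_signs:
  fixes \<alpha> \<beta> \<gamma> :: complex
  assumes "\<alpha> * A * B - \<beta> * C * D = \<gamma> * E * F"
  shows "\<alpha>' = - \<alpha> \<Longrightarrow> \<beta>' = \<beta> \<Longrightarrow> \<gamma>' = - \<gamma> \<Longrightarrow> \<alpha>' * A * B + \<beta>' * C * D = \<gamma>' * E * F"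
    and "\<alpha>' = - \<alpha> \<Longrightarrow> \<beta>' = - \<beta> \<Longrightarrow> \<gamma>' = - \<gamma> \<Longrightarrow> \<alpha>' * A * B - \<beta>' * C * D = \<gamma>' * E * F"
    and "\<alpha>' = \<alpha> \<Longrightarrow> \<beta>' = - \<beta> \<Longrightarrow> \<gamma>' = \<gamma> \<Longrightarrow> \<alpha>' * A * B + \<beta>' * C * D = \<gamma>' * E * F"
  using assms by (auto simp: algebra_simps)

definition numer :: "(nat \<Rightarrow> complex) \<Rightarrow> ('i \<Rightarrow> complex) \<Rightarrow> nat \<Rightarrow> 'i \<Rightarrow> complex" where
  "numer a v i s = (\<Prod>k=2..i. 1 - inverse (a k) * v s)"

definition denom :: "(nat \<Rightarrow> complex) \<Rightarrow> ('i \<Rightarrow> complex) \<Rightarrow> nat \<Rightarrow> 'i \<Rightarrow> complex" where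
  "denom a v i s = (\<Prod>k=2..i. 1 + inverse (a k) * v s)"

lemma numer_denom_1 [simp]: "numer a v (Suc 0) s = 1" "denom a v (Suc 0) s = 1"
  by (simp_all add: numer_def denom_def)

lemma shifted_1: "shifted a t (Suc 0) = t"
  by (simp add: shifted_def)

locale corners =
  fixes c1 :: "'i \<Rightarrow> bool" and v e :: "'i \<Rightarrow> complex" and S :: "'i set" and y :: time and
      a :: "nat \<Rightarrow> complex" and m :: nat
  assumes nz: "\<And>s t. s \<in> S \<Longrightarrow> t \<in> S \<Longrightarrow> c1 s = c1 t \<Longrightarrow> v s + v t \<noteq> 0"
    and odd_y: "odd_time y"
    and value_y: "\<And>s. s \<in> S \<Longrightarrow> \<not> c1 s \<Longrightarrow> has_value (exp_xi y) (v s) (e s)"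
    and shift_nz: "\<And>s k. s \<in> S \<Longrightarrow> c1 s \<Longrightarrow> k \<in> {2..m} \<Longrightarrow> 1 + inverse (a k) * v s \<noteq> 0"
begin

lemma charged_fields_at:
  assumes t: "values_at c1 v e S t r q" and i: "i \<le> m"
  shows "charged_fields (shifted a t i) y c1 v
    (twist c1 (\<lambda>s. r s * numer a v i s) e) (twist c1 (\<lambda>s. q s / denom a v i s) e) S"
proof
  fix s assume s: "s \<in> S"
  show "exp_values (if c1 s then shifted a t i else y) (v s)
      (twist c1 (\<lambda>s. r s * numer a v i s) e s) (twist c1 (\<lambda>s. q s / denom a v i s) e s)"
  proof (cases "c1 s")
    case True
    have "exp_values (shifted a t i) (v s) ((\<Prod>k=2..i. 1 - inverse (a k) * v s) * (r s * e s))
        ((q s * e s) / (\<Prod>k=2..i. 1 + inverse (a k) * v s))"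
      using t s True i shift_nz[OF s True] by (intro exp_values_shifted) (auto simp: values_at_def)
    then show ?thesis
      using True by (simp add: twist_def numer_def denom_def mult_ac)
  next
    case False
    then show ?thesis
      using exp_values_odd[OF odd_y value_y[OF s False]] by (simp add: twist_def)
  qed
qed (rule nz)

lemma F_vev_at:
  assumes "values_at c1 v e S t r q" "i \<le> m" "syms G \<subseteq> S"
  shows "F_vev y 1 1 0 (shifted a t i) (charged_gexp False c1 v G) =
    F11 G c1 v e (\<lambda>s. r s * numer a v i s) (\<lambda>s. q s / denom a v i s)"
  using charged_fields.F_vev_11[OF charged_fields_at[OF assms(1,2)] assms(3)] by (simp add: F11_def)

lemma F_vev_01_at:
  assumes t: "values_at c1 v e S t r (\<lambda>_. 1)" and m: "1 \<le> m" and G: "syms G \<subseteq> S"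
  shows "F_vev y 0 1 0 (shifted a t 1) (charged_gexp False c1 v G) + w * F_vev y 0 1 1 (shifted a t
      1) (charged_gexp False c1 v G) =
    F01 w G c1 v e r"
  unfolding charged_fields.F_vev_01[OF charged_fields_at[OF t m] G] F01_def
  by (rule arg_cong[where f = "det_sum G"]) (auto simp: fun_eq_iff kernel_00_def twist_def)

lemma F_vev_00_at:
  assumes t: "values_at c1 v e S t r (\<lambda>_. 1)" and i: "i \<le> m" and G: "syms G \<subseteq> S"
  shows "F_vev y 0 0 0 (shifted a t i) (charged_gexp True c1 v G) + \<rho> * F_vev y (- 1) 1 1 (shifted a
      t i) (charged_gexp True c1 v G) =
    F00 \<rho> G c1 v e (\<lambda>s. r s * numer a v i s) (\<lambda>s. 1 / denom a v i s)"
  unfolding charged_fields.F_vev_00_shifted[OF charged_fields_at[OF t i] G] F00_def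
  by (rule arg_cong[where f = "det_sum G"]) (auto simp: fun_eq_iff twist_def)

lemma neutral_fields_at:
  assumes "values_at c1 v e S t r r" "odd_time t"
  shows "neutral_fields t y c1 v (twist c1 r e) S"
proof
  fix s assume "s \<in> S"
  then show "has_value (exp_xi (if c1 s then t else y)) (v s) (twist c1 r e s)"
    using assms value_y by (auto simp: values_at_def twist_def exp_values_def)
qed (use assms odd_y nz in auto)

lemma f_vev_at:
  assumes "values_at c1 v e S t r r" "odd_time t" "syms G \<subseteq> S"
  shows "f_vev y 0 (shifted a t 1) (neutral_gexp c1 v G) = pf_sum G (pf_kernel c1 v \<i> (twist c1 r e))"
    and "f_vev y 1 (shifted a t 1) (neutral_gexp c1 v G) = pf_sum G (pf_kernel c1 v (- \<i>) (twist c1 r e))"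
  using neutral_fields.f_vev_0[OF neutral_fields_at[OF assms(1,2)] assms(3)]
    neutral_fields.f_vev_1[OF neutral_fields_at[OF assms(1,2)] assms(3)] by (simp_all add: shifted_1)

end

theorem theorem5p5:
  fixes n Nb Mc :: nat
    and L K :: complex and a :: "nat \<Rightarrow> complex"
    and x :: "nat \<Rightarrow> time" and xN xS xW xE y :: time
    and b c p q p' q' b' c' :: "nat \<Rightarrow> complex"
    and g' g h' :: gexp
    and S W N E :: "nat \<Rightarrow> complex" and \<tau> :: "nat \<Rightarrow> nat \<Rightarrow> complex"
    and A :: "complex \<Rightarrow> complex" and U V :: "complex set"
  assumes n: "n \<ge> 3"
    and A: "A = A_poly n a"
    and U: "U = p ` {1..Nb} \<union> q ` {1..Nb} \<union> p' ` {1..Mc}"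
    and V: "V = q' ` {1..Mc}"
    and nonzero: "L \<noteq> 0" "K \<noteq> 0" "\<And>k. k \<ge> 2 \<Longrightarrow> a k \<noteq> 0" and a1: "a 1 = 0"
    and odd: "odd_time (x 1)" "odd_time y"
    and times:
      "xW - x 3 = teps (inverse L)" "x 0 - xS = teps (inverse L)" "xE - x 4 = teps (inverse L)"
      "x 2 - xW = eps (inverse L)" "xN - x 0 = eps (inverse L)" "x 1 - xE = eps (inverse L)"
      "xN - x 2 = teps (inverse K)" "x 0 - xW = teps (inverse K)" "xS - x 3 = teps (inverse K)"
      "x 1 - xN = eps (inverse K)" "xE - x 0 = eps (inverse K)" "x 4 - xS = eps (inverse K)"
    \<comment> \<open>all expressions are defined\<close>
    and generic_U: "\<And>u v. u \<in> U \<Longrightarrow> v \<in> U \<Longrightarrow> u + v \<noteq> 0"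
    and generic_V: "\<And>u v. u \<in> V \<Longrightarrow> v \<in> V \<Longrightarrow> u + v \<noteq> 0"
    and generic_shifts: "\<And>u. u \<in> U \<Longrightarrow> u \<noteq> - L \<and> u \<noteq> - K \<and> (\<forall>k\<in>{2..n-2}. u \<noteq> - a k)"
    and generic_A: "\<And>j. j \<in> {1..Nb} \<Longrightarrow> A (- p j) \<noteq> 0"
    and generic_exp: "\<And>u. u \<in> U \<Longrightarrow> exp_xi_defined (x 1) u"
      "\<And>u. u \<in> V \<Longrightarrow> exp_xi_defined y u"
    \<comment> \<open>the reduction condition\<close>
    and reduction_pq: "\<And>j. j \<in> {1..Nb} \<Longrightarrow>
      (p j)\<^sup>2 * A (p j) * A (- p j) = (q j)\<^sup>2 * A (q j) * A (- q j)"
    and reduction_pq': "\<And>j. j \<in> {1..Mc} \<Longrightarrow> (p' j)\<^sup>2 * A (p' j) * A (- p' j) = (q' j)\<^sup>2"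
    and b': "\<And>j. b' j = - (q j * A (q j) / (p j * A (- p j))) * b j"
    and c': "\<And>j. c' j = - (p' j * A (p' j) / q' j) * c j"
    and g': "g' = g_neutral Nb Mc b c p q p' q'"
    and g: "g = g_charged Nb Mc b c p q p' q'"
    and h': "h' = g_neutral Nb Mc b' c' p q p' q'"
    and SWNE: "\<And>j. j \<in> {1..n-2} \<Longrightarrow> S j = F_vev y 1 1 0 (shifted a xS j) g"
      "\<And>j. j \<in> {1..n-2} \<Longrightarrow> W j = F_vev y 1 1 0 (shifted a xW j) g"
      "\<And>j. j \<in> {1..n-2} \<Longrightarrow> N j = F_vev y 1 1 0 (shifted a xN j) g"
      "\<And>j. j \<in> {1..n-2} \<Longrightarrow> E j = F_vev y 1 1 0 (shifted a xE j) g"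
    and \<tau>J: "\<And>J j. J \<in> {1..4} \<Longrightarrow> j \<in> {0, 1} \<Longrightarrow> \<tau> J j = f_vev y (int j) (shifted a (x J) 1) g'"
      "\<And>J j. J \<in> {1..4} \<Longrightarrow> j \<in> {2..n-2} \<Longrightarrow> \<tau> J j = F_vev y 1 1 0 (shifted a (x J) j) g"
      "\<And>J j. J \<in> {1..4} \<Longrightarrow> j \<in> {n-1, n} \<Longrightarrow>
         \<tau> J j = f_vev y (int (n - j)) (shifted a (x J) 1) h'"
    and \<tau>0: "\<And>j. j \<in> {0, 1} \<Longrightarrow>
         \<tau> 0 j = F_vev y 0 1 0 (shifted a (x 0) 1) g
               + (-1) ^ j * \<i> * F_vev y 0 1 1 (shifted a (x 0) 1) g"
      "\<And>j. j \<in> {2..n-2} \<Longrightarrow> \<tau> 0 j = F_vev y 1 1 0 (shifted a (x 0) (j - 1)) g"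
      "\<And>j. j \<in> {n-1, n} \<Longrightarrow>
         \<tau> 0 j = F_vev y 0 0 0 (shifted a (x 0) (n-2)) (omega g)
               + (-1) ^ (n - j) * \<i> * a (n-1) / (K * L)
                 * F_vev y (-1) 1 1 (shifted a (x 0) (n-2)) (omega g)"
  shows "D1_bilinear n
    (\<lambda>i. if i = n then 1 else L - a i) (\<lambda>i. L + a i)
    (\<lambda>i. if i = n then 1 else K - a i) (\<lambda>i. K + a i)
    (K - L) (K + L) S W N E \<tau>"
proof -
  define c1 where "c1 = on_first"
  define v where "v = location p q p' q'"
  define G where "G = insertions Nb Mc b c"
  define G' where "G' = insertions Nb Mc b' c'"
  define H where "H = double_exp G"
  define Z where "Z = (\<Union>h\<in>set (indices Nb Mc). {(h, True), (h, False)})"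
  define \<kappa> \<nu> where "\<kappa> = inverse K" "\<nu> = inverse L"
  have syms: "syms G = Z" "syms G' = Z" "syms H = Z"
    by (simp_all add: G_def G'_def H_def Z_def syms_insertions)
  have Z_cases: "(\<exists>j\<in>{1..Nb}. v s \<in> {p j, q j} \<and> c1 s) \<or> (\<exists>j\<in>{1..Mc}. v s = p' j \<and> c1 s) \<or>
      (\<exists>j\<in>{1..Mc}. v s = q' j \<and> \<not> c1 s)" if "s \<in> Z" for s
    using that by (auto simp: Z_def indices_def v_def c1_def)
  have vU: "v s \<in> U" if "s \<in> Z" "c1 s" for s
    using Z_cases[OF that(1)] that(2) by (auto simp: U)
  have vV: "v s \<in> V" if "s \<in> Z" "\<not> c1 s" for s
    using Z_cases[OF that(1)] that(2) by (auto simp: V)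
  have nz: "v s + v t \<noteq> 0" if "s \<in> Z" "t \<in> Z" "c1 s = c1 t" for s t
    using that generic_U generic_V vU vV by (cases "c1 s") blast+
  have shift_nz: "1 + inverse z * v s \<noteq> 0" if "v s \<noteq> - z" "z \<noteq> 0" for s z
    using that by (auto simp: field_simps add_eq_0_iff2)
  have uK: "1 + \<kappa> * v s \<noteq> 0" and uL: "1 + \<nu> * v s \<noteq> 0" if "s \<in> Z" "c1 s" for s
    using that generic_shifts vU nonzero shift_nz unfolding \<kappa>_\<nu>_def by blast+
  have "\<exists>r. has_value (exp_xi (if c1 s then x 1 else y)) (v s) r" if "s \<in> Z" for s
    using vU[OF that] vV[OF that] generic_exp by (cases "c1 s") (simp_all add: has_value_exists)
  then obtain e0 where e0: "\<And>s. s \<in> Z \<Longrightarrow> has_value (exp_xi (if c1 s then x 1 else y)) (v s) (e0 s)"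
    by metis
  define e where "e s = (if c1 s then e0 s / ((1 + \<kappa> * v s) * (1 + \<nu> * v s)) else e0 s)" for s
  define rE qE rN qN rW qW rS qS r0 where
    "rE s = (1 + \<kappa> * v s) * (1 + \<nu> * v s) * (1 - \<nu> * v s)" "qE s = 1 + \<kappa> * v s"
    "rN s = (1 + \<kappa> * v s) * (1 + \<nu> * v s) * (1 - \<kappa> * v s)" "qN s = 1 + \<nu> * v s"
    "rW s = (1 - \<kappa> * v s) * (1 + \<nu> * v s) * (1 - \<nu> * v s)" "qW s = 1 - \<kappa> * v s"
    "rS s = (1 + \<kappa> * v s) * (1 - \<nu> * v s) * (1 - \<kappa> * v s)" "qS s = 1 - \<nu> * v s"
    "r0 s = (1 + \<kappa> * v s) * (1 + \<nu> * v s) * (1 - \<kappa> * v s) * (1 - \<nu> * v s)" for s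
  define r where "r J s = (if J \<in> {1, 4} then 1 + \<kappa> * v s else 1 - \<kappa> * v s) *
    (if J \<in> {1, 2} then 1 + \<nu> * v s else 1 - \<nu> * v s)" for J :: nat and s
  have r: "r 1 s = (1 + \<kappa> * v s) * (1 + \<nu> * v s)" "r 2 s = (1 - \<kappa> * v s) * (1 + \<nu> * v s)"
    "r 3 s = (1 - \<kappa> * v s) * (1 - \<nu> * v s)" "r 4 s = (1 + \<kappa> * v s) * (1 - \<nu> * v s)" for s
    by (simp_all add: r_def)
  note r = r r(1)[unfolded One_nat_def]
  note edges = rE_qE_rN_qN_rW_qW_rS_qS_r0_def
  interpret corners c1 v e Z y a "n - 2"
  proof
    show "1 + inverse (a k) * v s \<noteq> 0" if "s \<in> Z" "c1 s" "k \<in> {2..n - 2}" for s k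
      using that generic_shifts vU nonzero(3) shift_nz by auto
    show "has_value (exp_xi y) (v s) (e s)" if "s \<in> Z" "\<not> c1 s" for s
      using e0[OF that(1)] that(2) by (simp add: e_def)
  qed (use nz odd in auto)
  let ?at = "values_at c1 v e Z"
  have at1: "?at (x 1) (r 1) (r 1)"
    unfolding values_at_def
  proof (intro ballI impI)
    fix s assume s: "s \<in> Z" "c1 s"
    have "has_value (exp_xi (x 1)) (v s) (r 1 s * e s)"
      using e0[OF s(1)] s uK[OF s] uL[OF s] by (simp add: r e_def)
    then show "exp_values (x 1) (v s) (r 1 s * e s) (r 1 s * e s)"
      by (rule exp_values_odd[OF odd(1)])
  qed
  have atE: "?at xE rE qE"
    by (rule values_at_eps[OF at1 times(6)]) (simp_all add: r edges uL flip: \<kappa>_\<nu>_def)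
  have atN: "?at xN rN qN"
    by (rule values_at_eps[OF at1 times(10)]) (simp_all add: r edges uK flip: \<kappa>_\<nu>_def)
  have at0: "?at (x 0) r0 (\<lambda>_. 1)"
    by (rule values_at_eps[OF atE times(11)]) (simp_all add: edges uK flip: \<kappa>_\<nu>_def)
  have atW: "?at xW rW qW"
    by (rule values_at_teps[OF at0 times(8)]) (simp_all add: edges uK flip: \<kappa>_\<nu>_def)
  have atS: "?at xS rS qS"
    by (rule values_at_teps[OF at0 times(2)]) (simp_all add: edges uL flip: \<kappa>_\<nu>_def)
  have at2: "?at (x 2) (r 2) (r 2)"
    by (rule values_at_teps[OF atN times(7)]) (simp_all add: r edges uK flip: \<kappa>_\<nu>_def)
  have at3: "?at (x 3) (r 3) (r 3)"
    by (rule values_at_teps[OF atW times(1)]) (simp_all add: r edges uL flip: \<kappa>_\<nu>_def)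
  have at4: "?at (x 4) (r 4) (r 4)"
    by (rule values_at_teps[OF atE times(3)]) (simp_all add: r edges uL flip: \<kappa>_\<nu>_def)
  have diff: "t' = t - d" if "t - t' = d" for t t' d :: time
    using that by auto
  have odd2: "odd_time (x 2)"
    unfolding diff[OF times(7)] diff[OF times(10)] by (rule odd_time_shift[OF odd(1)])
  have odd4: "odd_time (x 4)"
    unfolding diff[OF times(3)] diff[OF times(6)] by (rule odd_time_shift[OF odd(1)])
  have odd3: "odd_time (x 3)"
    unfolding diff[OF times(1)] diff[OF times(4)] by (rule odd_time_shift[OF odd2])
  have J_cases: "J = 1 \<or> J = 2 \<or> J = 3 \<or> J = 4" if "J \<in> {1..4}" for J :: nat
    using that by auto
  have atJ: "?at (x J) (r J) (r J)" and oddJ: "odd_time (x J)" if "J \<in> {1..4}" for J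
    using J_cases[OF that] at1 at2 at3 at4 odd(1) odd2 odd3 odd4 by auto
  have g_eq: "g = charged_gexp False c1 v H" and g'_eq: "g' = neutral_gexp c1 v G" and h'_eq: "h' =
      neutral_gexp c1 v G'"
    by (simp_all add: g g' h' g_charged_eq g_neutral_eq c1_def v_def H_def G_def G'_def)
  have omega_g: "omega g = charged_gexp True c1 v H"
    unfolding g_eq by (rule omega_charged_gexp)
  define Fn where "Fn r q i = F11 H c1 v e (\<lambda>s. r s * numer a v i s) (\<lambda>s. q s / denom a v i s)" for r q i
  have F: "F_vev y 1 1 0 (shifted a t i) g = Fn r q i" if "?at t r q" "i \<le> n - 2" for t r q i
    unfolding g_eq Fn_def using F_vev_at[OF that] syms by simp
  have edge: "S j = Fn rS qS j" "W j = Fn rW qW j" "N j = Fn rN qN j" "E j = Fn rE qE j"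
      if "j \<in> {1..n - 2}" for j
    using that SWNE[OF that] F[OF atS] F[OF atW] F[OF atN] F[OF atE] by auto
  let ?f = "\<lambda>G w J. pf_sum G (pf_kernel c1 v w (twist c1 (r J) e))"
  have f: "f_vev y 0 (shifted a (x J) 1) (neutral_gexp c1 v G'') = ?f G'' \<i> J"
    "f_vev y 1 (shifted a (x J) 1) (neutral_gexp c1 v G'') = ?f G'' (- \<i>) J" if "J \<in> {1..4}"
        "syms G'' = Z" for J G''
    using f_vev_at[OF atJ oddJ, OF that(1) that(1), of G''] that by auto
  have \<tau>_first: "\<tau> J 0 = ?f G \<i> J" "\<tau> J 1 = ?f G (- \<i>) J" if "J \<in> {1..4}" for J
    using \<tau>J(1)[OF that, of 0] \<tau>J(1)[OF that, of 1] f[OF that syms(1)] by (simp_all add: g'_eq)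
  have \<tau>_middle: "\<tau> J j = Fn (r J) (r J) j" if "J \<in> {1..4}" "j \<in> {2..n - 2}" for J j
    using \<tau>J(2)[OF that] F[OF atJ[OF that(1)]] that by simp
  have \<tau>_last: "\<tau> J n = ?f G' \<i> J" "\<tau> J (n - 1) = ?f G' (- \<i>) J" if "J \<in> {1..4}" for J
    using \<tau>J(3)[OF that, of n] \<tau>J(3)[OF that, of "n - 1"] f[OF that syms(2)] n by (simp_all add: h'_eq)
  have \<tau>0_first: "\<tau> 0 0 = F01 \<i> H c1 v e r0" "\<tau> 0 1 = F01 (- \<i>) H c1 v e r0"
    using \<tau>0(1)[of 0] \<tau>0(1)[of 1] F_vev_01_at[OF at0, where G = H and w = \<i>]
      F_vev_01_at[OF at0, where G = H and w = "- \<i>"] n syms by (simp_all add: g_eq)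
  have \<tau>0_middle: "\<tau> 0 j = Fn r0 (\<lambda>_. 1) (j - 1)" if "j \<in> {2..n - 2}" for j
  proof -
    have "j - 1 \<le> n - 2"
      using that by auto
    then show ?thesis
      using \<tau>0(2)[OF that] F[OF at0] by simp
  qed
  let ?F0 = "\<lambda>\<rho>. F00 \<rho> H c1 v e (\<lambda>s. r0 s * numer a v (n - 2) s) (\<lambda>s. 1 / denom a v (n - 2) s)"
  have \<tau>0_last: "\<tau> 0 n = ?F0 (\<i> * a (n - 1) / (K * L))" "\<tau> 0 (n - 1) = ?F0 (- \<i> * a (n - 1) / (K * L))"
    using \<tau>0(3)[of n] \<tau>0(3)[of "n - 1"] F_vev_00_at[OF at0, where i = "n - 2" and G = H and \<rho> =
        "\<i> * a (n - 1) / (K * L)"]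
      F_vev_00_at[OF at0, where i = "n - 2" and G = H and \<rho> = "- \<i> * a (n - 1) / (K * L)"] n syms
    by (simp_all add: omega_g)
  have nz_H: "v s + v t \<noteq> 0" if "s \<in> syms H" "t \<in> syms H" "c1 s = c1 t" for s t
    using that nz syms by simp
  have nz_G: "v s + v t \<noteq> 0" if "s \<in> syms G" "t \<in> syms G" "c1 s = c1 t" for s t
    using that nz syms by simp
  have minus: "- K \<noteq> 0" "- L \<noteq> 0"
    using nonzero by auto
  have first:
    "K * N 1 * ?f G (- w) 4 - L * E 1 * ?f G (- w) 2 = (K - L) * F01 w H c1 v e r0 * ?f G w 1"
    "K * N 1 * ?f G (- w) 3 + L * W 1 * ?f G (- w) 1 = (K + L) * F01 w H c1 v e r0 * ?f G w 2"
    "K * S 1 * ?f G (- w) 2 - L * W 1 * ?f G (- w) 4 = (K - L) * F01 w H c1 v e r0 * ?f G w 3"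
    "K * S 1 * ?f G (- w) 1 + L * E 1 * ?f G (- w) 3 = (K + L) * F01 w H c1 v e r0 * ?f G w 4"
    if w: "w * w = - 1" for w
  proof -
    have edge1: "S 1 = F11 H c1 v e rS qS" "W 1 = F11 H c1 v e rW qW" "N 1 = F11 H c1 v e rN qN"
        "E 1 = F11 H c1 v e rE qE"
      using edge[of 1] n by (simp_all add: Fn_def)
    show "K * N 1 * ?f G (- w) 4 - L * E 1 * ?f G (- w) 2 = (K - L) * F01 w H c1 v e r0 * ?f G w 1"
      unfolding edge1 H_def
      by (rule corner_first[OF nz_G nonzero(2,1) w]) (simp_all add: edges r flip: \<kappa>_\<nu>_def)
    show "K * N 1 * ?f G (- w) 3 + L * W 1 * ?f G (- w) 1 = (K + L) * F01 w H c1 v e r0 * ?f G w 2"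
      unfolding edge1 H_def
      by (rule bilinear_signs(1)[OF corner_first[OF nz_G minus(1) nonzero(1) w]])
        (simp_all add: edges r mult_ac flip: \<kappa>_\<nu>_def)
    show "K * S 1 * ?f G (- w) 2 - L * W 1 * ?f G (- w) 4 = (K - L) * F01 w H c1 v e r0 * ?f G w 3"
      unfolding edge1 H_def
      by (rule bilinear_signs(2)[OF corner_first[OF nz_G minus w]])
        (simp_all add: edges r mult_ac flip: \<kappa>_\<nu>_def)
    show "K * S 1 * ?f G (- w) 1 + L * E 1 * ?f G (- w) 3 = (K + L) * F01 w H c1 v e r0 * ?f G w 4"
      unfolding edge1 H_def
      by (rule bilinear_signs(3)[OF corner_first[OF nz_G nonzero(2) minus(2) w]])
        (simp_all add: edges r mult_ac flip: \<kappa>_\<nu>_def)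
  qed
  have middle:
    "(K - a i) * E (i - 1) * N i - (L - a i) * N (i - 1) * E i = (K - L) * \<tau> 0 i * \<tau> 1 i"
    "(K + a i) * W (i - 1) * N i + (L - a i) * N (i - 1) * W i = (K + L) * \<tau> 0 i * \<tau> 2 i"
    "(K + a i) * W (i - 1) * S i - (L + a i) * S (i - 1) * W i = (K - L) * \<tau> 0 i * \<tau> 3 i"
    "(K - a i) * E (i - 1) * S i + (L + a i) * S (i - 1) * E i = (K + L) * \<tau> 0 i * \<tau> 4 i"
    if i: "i \<in> {2..n - 2}" for i
  proof -
    have i1: "i - 1 \<in> {1..n - 2}" "i \<in> {1..n - 2}" "i = Suc (i - 1)" "2 \<le> Suc (i - 1)" and ai: "a i \<noteq> 0"
      using i nonzero(3) by auto
    have ua: "1 + inverse (a i) * v s \<noteq> 0" if "s \<in> syms H" "c1 s" for s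
      using that shift_nz[of s i] local.shift_nz i syms generic_shifts[OF vU[of s]] ai by auto
    have step: "numer a v i s = numer a v (i - 1) s * (1 - inverse (a i) * v s)"
      "denom a v i s = denom a v (i - 1) s * (1 + inverse (a i) * v s)" for s
      unfolding numer_def denom_def by (subst (1) i1(3), subst prod.cl_ivl_Suc, use i1(3,4) in simp)+
    have \<tau>i: "\<tau> 1 i = Fn (r 1) (r 1) i" "\<tau> 2 i = Fn (r 2) (r 2) i" "\<tau> 3 i = Fn (r 3) (r 3) i"
        "\<tau> 4 i = Fn (r 4) (r 4) i"
      using \<tau>_middle[OF _ i] by simp_all
    show "(K - a i) * E (i - 1) * N i - (L - a i) * N (i - 1) * E i = (K - L) * \<tau> 0 i * \<tau> 1 i"
      unfolding edge[OF i1(1)] edge[OF i1(2)] \<tau>i \<tau>0_middle[OF i] Fn_def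
      by (rule corner_middle[OF nz_H nonzero(2,1) ai ua]) (simp_all add: edges r step flip: \<kappa>_\<nu>_def)
    show "(K + a i) * W (i - 1) * N i + (L - a i) * N (i - 1) * W i = (K + L) * \<tau> 0 i * \<tau> 2 i"
      unfolding edge[OF i1(1)] edge[OF i1(2)] \<tau>i \<tau>0_middle[OF i] Fn_def
      by (rule bilinear_signs(1)[OF corner_middle[OF nz_H minus(1) nonzero(1) ai ua]])
        (simp_all add: edges r step mult_ac flip: \<kappa>_\<nu>_def)
    show "(K + a i) * W (i - 1) * S i - (L + a i) * S (i - 1) * W i = (K - L) * \<tau> 0 i * \<tau> 3 i"
      unfolding edge[OF i1(1)] edge[OF i1(2)] \<tau>i \<tau>0_middle[OF i] Fn_def
      by (rule bilinear_signs(2)[OF corner_middle[OF nz_H minus ai ua]])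
        (simp_all add: edges r step mult_ac flip: \<kappa>_\<nu>_def)
    show "(K - a i) * E (i - 1) * S i + (L + a i) * S (i - 1) * E i = (K + L) * \<tau> 0 i * \<tau> 4 i"
      unfolding edge[OF i1(1)] edge[OF i1(2)] \<tau>i \<tau>0_middle[OF i] Fn_def
      by (rule bilinear_signs(3)[OF corner_middle[OF nz_H nonzero(2) minus(2) ai ua]])
        (simp_all add: edges r step mult_ac flip: \<kappa>_\<nu>_def)
  qed
  have an: "a (n - 1) \<noteq> 0"
    using nonzero(3) n by simp
  have A_split: "A (v s) = numer a v (n - 2) s * (1 - inverse (a (n - 1)) * v s)"
    "A (- v s) = denom a v (n - 2) s * (1 + inverse (a (n - 1)) * v s)" for s
  proof -
    have "n - 1 = Suc (n - 2)" "2 \<le> Suc (n - 2)"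
      using n by auto
    then show "A (v s) = numer a v (n - 2) s * (1 - inverse (a (n - 1)) * v s)"
      "A (- v s) = denom a v (n - 2) s * (1 + inverse (a (n - 1)) * v s)"
      unfolding A A_poly_def numer_def denom_def by (simp_all add: prod.cl_ivl_Suc divide_inverse
          mult.commute)
  qed
  have denom_nz: "denom a v (n - 2) s \<noteq> 0" if "s \<in> Z" "c1 s" for s
    using local.shift_nz[OF that] by (simp add: denom_def)
  have v_nz: "v s \<noteq> 0" if "s \<in> Z" for s
    using nz[OF that that] by auto
  let ?\<alpha> = "\<lambda>s. v s * (if c1 s then numer a v (n - 2) s else 1)"
  let ?\<gamma> = "\<lambda>s. - 1 / (v s * (if c1 s then denom a v (n - 2) s else 1))"
  let ?D = "\<lambda>s. if c1 s then 1 - inverse (a (n - 1)) * v s else 1"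
  let ?U = "\<lambda>s. if c1 s then 1 + inverse (a (n - 1)) * v s else 1"
  have gauge: "case_sum b c h * (?\<alpha> (h, True) * ?\<gamma> (h, False)) * ?D (h, True) =
      case_sum b' c' h * ?U (h, False)"
    "case_sum b c h * (?\<alpha> (h, False) * ?\<gamma> (h, True)) * ?D (h, False) = case_sum b' c' h * ?U (h, True)"
    if h: "h \<in> set (indices Nb Mc)" for h
  proof -
    define s t where "s = (h, True)" and "t = (h, False)"
    have st: "s \<in> Z" "t \<in> Z"
      using h by (auto simp: Z_def s_def t_def)
    define Ps Ms Ds Us where "Ps = numer a v (n - 2) s" "Ms = denom a v (n - 2) s"
      "Ds = 1 - inverse (a (n - 1)) * v s" "Us = 1 + inverse (a (n - 1)) * v s"
    define Pt Mt Dt Ut where "Pt = numer a v (n - 2) t" "Mt = denom a v (n - 2) t"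
      "Dt = 1 - inverse (a (n - 1)) * v t" "Ut = 1 + inverse (a (n - 1)) * v t"
    note shorts = Ps_Ms_Ds_Us_def Pt_Mt_Dt_Ut_def
    have As: "A (v s) = Ps * Ds" "A (- v s) = Ms * Us" and At: "A (v t) = Pt * Dt" "A (- v t) = Mt * Ut"
      by (simp_all add: A_split shorts)
    have c1s: "c1 s"
      by (cases h) (simp_all add: c1_def s_def)
    have nz': "v s \<noteq> 0" "v t \<noteq> 0" "Ms \<noteq> 0"
      using v_nz st denom_nz[OF st(1) c1s] by (auto simp: shorts)
    have "case_sum b c h * (?\<alpha> s * ?\<gamma> t) * ?D s = case_sum b' c' h * ?U t \<and>
        case_sum b c h * (?\<alpha> t * ?\<gamma> s) * ?D t = case_sum b' c' h * ?U s"
    proof (cases h)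
      case (Inl j)
      then have j: "j \<in> {1..Nb}"
        using h by (auto simp: indices_def)
      have vs: "v s = p j" "v t = q j" and c1t: "c1 t"
        by (simp_all add: s_def t_def v_def c1_def Inl)
      have Us: "Us \<noteq> 0" and Mt: "Mt \<noteq> 0"
        using generic_A[OF j] As(2) denom_nz[OF st(2) c1t] by (auto simp: vs shorts)
      have red: "(v s)\<^sup>2 * (Ps * Ds) * (Ms * Us) = (v t)\<^sup>2 * (Pt * Dt) * (Mt * Ut)"
        using reduction_pq[OF j] by (simp only: As[symmetric] At[symmetric] vs)
      have b'j: "b' j = - (v t * (Pt * Dt) / (v s * (Ms * Us))) * b j"
        unfolding b' by (simp only: As[symmetric] At[symmetric] vs)
      have "b j * (v s * Ps * (- 1 / (v t * Mt))) * Ds = b' j * Ut"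
      proof -
        have "v s * Ps * Ds * (v s * (Ms * Us)) = v t * (Pt * Dt) * Ut * (v t * Mt)"
          using red by (simp add: power2_eq_square mult_ac)
        then have eq: "v s * Ps * Ds / (v t * Mt) = v t * (Pt * Dt) * Ut / (v s * (Ms * Us))"
          using nz' Us Mt by (simp add: frac_eq_eq)
        have "b j * (v s * Ps * (- 1 / (v t * Mt))) * Ds = - b j * (v s * Ps * Ds / (v t * Mt))"
          by simp
        also have "\<dots> = b' j * Ut"
          unfolding eq by (simp add: b'j)
        finally show ?thesis .
      qed
      moreover have "b j * (v t * Pt * (- 1 / (v s * Ms))) * Dt = b' j * Us"
        using nz' Us by (simp add: b'j mult_ac)
      ultimately show ?thesis
        using c1s c1t by (simp add: Inl shorts)
    next
      case (Inr j)
      then have j: "j \<in> {1..Mc}"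
        using h by (auto simp: indices_def)
      have vs: "v s = p' j" "v t = q' j" and c1t: "\<not> c1 t"
        by (simp_all add: s_def t_def v_def c1_def Inr)
      have red: "(v s)\<^sup>2 * (Ps * Ds) * (Ms * Us) = (v t)\<^sup>2"
        using reduction_pq'[OF j] by (simp only: As[symmetric] vs)
      have c'j: "c' j = - (v s * (Ps * Ds) / v t) * c j"
        unfolding c' by (simp only: As[symmetric] vs)
      have "c j * (v s * Ps * (- 1 / v t)) * Ds = c' j"
        by (simp add: c'j mult_ac)
      moreover have "c j * (v t * (- 1 / (v s * Ms))) = c' j * Us"
      proof -
        have "v t * v t = v s * (Ps * Ds) * Us * (v s * Ms)"
          using red by (simp add: power2_eq_square mult_ac)
        then have eq: "v t / (v s * Ms) = v s * (Ps * Ds) * Us / v t"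
          using nz' by (simp add: frac_eq_eq)
        have "c j * (v t * (- 1 / (v s * Ms))) = - c j * (v t / (v s * Ms))"
          by simp
        also have "\<dots> = c' j * Us"
          unfolding eq by (simp add: c'j)
        finally show ?thesis .
      qed
      ultimately show ?thesis
        using c1s c1t by (simp add: Inr shorts)
    qed
    then show "case_sum b c h * (?\<alpha> (h, True) * ?\<gamma> (h, False)) * ?D (h, True) =
        case_sum b' c' h * ?U (h, False)"
      "case_sum b c h * (?\<alpha> (h, False) * ?\<gamma> (h, True)) * ?D (h, False) = case_sum b' c' h * ?U (h, True)"
      unfolding s_def t_def by blast+
  qed
  have AB: "numer a v (n - 2) s = numer a v (n - 2) t \<and> denom a v (n - 2) s = denom a v (n - 2) t"
      if "v s = v t" for s t
    using that by (simp add: numer_def denom_def)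
  have nz_I: "v s + v t \<noteq> 0" if "s \<in> (\<Union>h\<in>set (indices Nb Mc). {(h, True), (h, False)})"
    "t \<in> (\<Union>h\<in>set (indices Nb Mc). {(h, True), (h, False)})" "c1 s = c1 t" for s t
    using that nz unfolding Z_def by blast
  have B_I: "denom a v (n - 2) s \<noteq> 0" if "s \<in> (\<Union>h\<in>set (indices Nb Mc). {(h, True), (h, False)})"
      "c1 s" for s
    using that denom_nz unfolding Z_def by blast
  note last_rule = corner_last[where i = "\<lambda>h. (h, True)" and j = "\<lambda>h. (h, False)" and z =
      "case_sum b c" and z' = "case_sum b' c'"
      and hs = "indices Nb Mc" and A = "numer a v (n - 2)" and B = "denom a v (n - 2)" and a = "a (n - 1)"
      and v = v and ?c1.0 = c1 and y = e, folded insertions_def G_def G'_def, folded H_def]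
  have n2: "n - 2 \<in> {1..n - 2}"
    using n by simp
  have last:
    "(K - a (n - 1)) * E (n - 2) * ?f G' w 2 - (L - a (n - 1)) * N (n - 2) * ?f G' w 4 =
      (K - L) * ?F0 (- w * a (n - 1) / (K * L)) * ?f G' w 1"
    "(K + a (n - 1)) * W (n - 2) * ?f G' w 1 + (L - a (n - 1)) * N (n - 2) * ?f G' w 3 =
      (K + L) * ?F0 (w * a (n - 1) / (K * L)) * ?f G' w 2"
    "(K + a (n - 1)) * W (n - 2) * ?f G' w 4 - (L + a (n - 1)) * S (n - 2) * ?f G' w 2 =
      (K - L) * ?F0 (- w * a (n - 1) / (K * L)) * ?f G' w 3"
    "(K - a (n - 1)) * E (n - 2) * ?f G' w 3 + (L + a (n - 1)) * S (n - 2) * ?f G' w 1 =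
      (K + L) * ?F0 (w * a (n - 1) / (K * L)) * ?f G' w 4"
    if w: "w * w = - 1" for w
  proof -
    have \<rho>: "w * a (n - 1) / (K * L) = - w * a (n - 1) / (- K * L)"
      "w * a (n - 1) / (K * L) = - w * a (n - 1) / (K * - L)"
      "- w * a (n - 1) / (K * L) = - w * a (n - 1) / (- K * - L)"
      by simp_all
    show "(K - a (n - 1)) * E (n - 2) * ?f G' w 2 - (L - a (n - 1)) * N (n - 2) * ?f G' w 4 =
      (K - L) * ?F0 (- w * a (n - 1) / (K * L)) * ?f G' w 1"
      unfolding edge[OF n2] Fn_def
      by (rule last_rule[OF nz_I nonzero(2,1) an w _ _ _ _ _ _ _ _ B_I AB gauge])
        (simp_all only: edges r \<kappa>_\<nu>_def)
    show "(K + a (n - 1)) * W (n - 2) * ?f G' w 1 + (L - a (n - 1)) * N (n - 2) * ?f G' w 3 =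
      (K + L) * ?F0 (w * a (n - 1) / (K * L)) * ?f G' w 2"
      unfolding edge[OF n2] Fn_def \<rho>(1)
      by (rule bilinear_signs(1)[OF last_rule[OF nz_I minus(1) nonzero(1) an w _ _ _ _ _ _ _ _ B_I
          AB gauge]])
        (simp_all add: edges r mult_ac flip: \<kappa>_\<nu>_def)
    show "(K + a (n - 1)) * W (n - 2) * ?f G' w 4 - (L + a (n - 1)) * S (n - 2) * ?f G' w 2 =
      (K - L) * ?F0 (- w * a (n - 1) / (K * L)) * ?f G' w 3"
      unfolding edge[OF n2] Fn_def \<rho>(3)
      by (rule bilinear_signs(2)[OF last_rule[OF nz_I minus an w _ _ _ _ _ _ _ _ B_I AB gauge]])
        (simp_all add: edges r mult_ac flip: \<kappa>_\<nu>_def)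
    show "(K - a (n - 1)) * E (n - 2) * ?f G' w 3 + (L + a (n - 1)) * S (n - 2) * ?f G' w 1 =
      (K + L) * ?F0 (w * a (n - 1) / (K * L)) * ?f G' w 4"
      unfolding edge[OF n2] Fn_def \<rho>(2)
      by (rule bilinear_signs(3)[OF last_rule[OF nz_I nonzero(2) minus(2) an w _ _ _ _ _ _ _ _ B_I
          AB gauge]])
        (simp_all add: edges r mult_ac flip: \<kappa>_\<nu>_def)
  qed
  have ii: "\<i> * \<i> = - 1" "- \<i> * - \<i> = - 1"
    by simp_all
  note first_i = first[OF ii(1), folded \<tau>0_first] and first_mi =
      first[OF ii(2), unfolded minus_minus, folded \<tau>0_first]
  note last_i = last[OF ii(1), folded \<tau>0_last] and last_mi = last[OF ii(2), unfolded minus_minus,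
      folded \<tau>0_last]
  have J: "1 \<in> {1..4 :: nat}" "2 \<in> {1..4 :: nat}" "3 \<in> {1..4 :: nat}" "4 \<in> {1..4 :: nat}"
    by simp_all
  note \<tau>_simps = \<tau>_first[OF J(1)] \<tau>_first[OF J(2)] \<tau>_first[OF J(3)] \<tau>_first[OF J(4)]
    \<tau>_last[OF J(1)] \<tau>_last[OF J(2)] \<tau>_last[OF J(3)] \<tau>_last[OF J(4)]
  have ne: "1 \<noteq> n" "n - 1 \<noteq> n"
    using n by auto
  show ?thesis
    unfolding D1_bilinear_def if_not_P[OF ne(1)] if_not_P[OF ne(2)] if_P[OF refl] mult_1_right mult_1_left
      a1 diff_0_right add_0_right \<tau>_simps
  proof (intro conjI ballI)
    fix i assume i: "i \<in> {2..n - 2}"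
    then have "i \<noteq> n"
      by auto
    with middle[OF i] show "(if i = n then 1 else K - a i) * E (i - 1) * N i - (if i =
        n then 1 else L - a i) * N (i - 1) * E i =
        (K - L) * \<tau> 0 i * \<tau> 1 i"
      "(K + a i) * W (i - 1) * N i + (if i = n then 1 else L - a i) * N (i - 1) * W i =
          (K + L) * \<tau> 0 i * \<tau> 2 i"
      "(K + a i) * W (i - 1) * S i - (L + a i) * S (i - 1) * W i = (K - L) * \<tau> 0 i * \<tau> 3 i"
      "(if i = n then 1 else K - a i) * E (i - 1) * S i + (L + a i) * S (i - 1) * E i =
          (K + L) * \<tau> 0 i * \<tau> 4 i"
      by simp_all
  qed (fact first_i first_mi last_i last_mi)+
qed

end
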